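(* Let $x\in\mathbb{R}^p_+$ with $F_X(x)>0$, let $\rho_x>0$, and let $k_n<n$ be a sequence of positive integers. Write $\hat q=\hat\varphi_{1-\frac{k_n}{n\hat F_X(x)}}(x)$. (i) Suppose that $F(\cdot|x)$ has a positive density $F'(\cdot|x)$ on $]0,\varphi(x)[$ such that $t\mapsto F'(\varphi(x)-\frac1t\mid x)$ belongs to $RV_{1-\rho_x}$. Then $$\sqrt{k_n}\;\frac{\hat q-\varphi_{1-\frac{p_n}{F_X(x)}}(x)}{M_n^{(1)}\,\hat q}\stackrel{d}{\longrightarrow}\mathcal{N}(0,V_4(\rho_x)),\qquad V_4(\rho_x)=(1+1/\rho_x)^2,$$ provided that $p_n\to0$, $np_n\to\infty$ and $k_n=[np_n]$ (integer part). (ii) Let $U(t)=\varphi_{1-\frac1{tF_X(x)}}(x)$, $t>1/F_X(x)$. Suppose that, for one choice of the sign, $\pm t^{1/\rho_x}\{\varphi(x)-U(t)\}\in\Pi(B)$ for some positive function $B$; that $k_n\to\infty$ with $k_n=o(n/g^{-1}(n))$, where $g^{-1}$ is the generalized inverse of $g(t)=t^{1+2/\rho_x}[\{\log\varphi(x)-\log U(t)\}/B(t)]^2$; and that $U$ has a regularly varying derivative $U'\in RV_{-1-1/\rho_x}$. Define the moment estimator $$\hat\varphi(x)=\hat q\,\bigl\{1+M_n^{(1)}(1+\tilde\rho_x)\bigr\}.$$ Then $$\sqrt{k_n}\;\frac{\hat\varphi(x)-\varphi(x)}{M_n^{(1)}(1+1/\tilde\rho_x)\,\hat q}\stackrel{d}{\longrightarrow}\mathcal{N}(0,V_5(\rho_x)),$$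 $$V_5(\rho_x)=\rho_x^2\left[\frac{\rho_x}{2+\rho_x}+\rho_x(2+\rho_x)\left\{4-8\frac{2+\rho_x}{3+\rho_x}+\frac{(11+5\rho_x)(2+\rho_x)}{(3+\rho_x)(4+\rho_x)}\right\}-\frac{4\rho_x}{3+\rho_x}\right].$$
   Context: $(X,Y)$ is a random vector in $\mathbb{R}^p_+\times\mathbb{R}_+$ with joint distribution function $F(x,y)=\mathbb{P}(X\le x,Y\le y)$ (inequalities between vectors are componentwise), and $(X_i,Y_i)$, $i=1,\dots,n$, are i.i.d. copies of $(X,Y)$. Put $F_X(x)=F(x,\infty)$ and, for $F_X(x)>0$, $F(y|x)=F(x,y)/F_X(x)$; $F'(\cdot|x)$ denotes the derivative of $y\mapsto F(y|x)$. The frontier function is $\varphi(x)=\sup\{y\ge0: F(y|x)<1\}$, assumed finite. For $\alpha\in(0,1]$, $\varphi_\alpha(x)=\inf\{y\ge0:F(y|x)\ge\alpha\}$. Empirical versions: $\hat F_n(x,y)=\frac1n\sum_{i=1}^n\mathbf{1}(X_i\le x,Y_i\le y)$, $\hat F_X(x)=\hat F_n(x,\infty)$, $\hat F(y|x)=\hat F_n(x,y)/\hat F_X(x)$, $\hat\varphi_\alpha(x)=\inf\{y\ge0:\hat F(y|x)\ge\alpha\}$. The orders of the empirical quantiles used are positive, with probability one, for $n$ large enough. With $k=k_n$ and $j=1,2$, $$M_n^{(j)}=\frac1k\sum_{i=0}^{k-1}\Bigl(\log\hat\varphi_{1-\frac{i}{n\hat F_X(x)}}(x)-\log\hat\varphi_{1-\frac{k}{n\hat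 F_X(x)}}(x)\Bigr)^j,\qquad \tilde\rho_x=-\Bigl\{M_n^{(1)}+1-\tfrac12\bigl[1-(M_n^{(1)})^2/M_n^{(2)}\bigr]^{-1}\Bigr\}^{-1}.$$ $f\in RV_a$ means $f(tz)/f(t)\to z^a$ as $t\to\infty$ for all $z>0$; $f\in\Pi(B)$, for a positive function $B$, means $\{f(tz)-f(t)\}/B(t)\to\log z$ as $t\to\infty$ for all $z>0$. The generalized inverse of $g$ is $g^{-1}(s)=\inf\{t:g(t)\ge s\}$.
   Formalization: In (i), F(·|x) is assumed to have no atom at φ(x) (else the statistic is 0/0). In (ii), the inverse of g is taken over t≥t0, for any t0>1/F_X(x) with g bounded on each [t0,T]; taken over all t>1/F_X(x), it makes (ii) false when g is unbounded near 1/F_X(x), e.g. U(t)→0 there. *)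

theory Defs
  imports "HOL-Probability.Probability" "HOL-Library.Landau_Symbols"
begin

text \<open>Vectors are ordered componentwise: this is the library order on \<^typ>\<open>real ^ 'p\<close>.\<close>

definition joint_df ::
    "'a measure \<Rightarrow> ('a \<Rightarrow> real ^ 'p) \<Rightarrow> ('a \<Rightarrow> real) \<Rightarrow> real ^ 'p \<Rightarrow> real \<Rightarrow> real" where
  "joint_df M X Y x y = measure M {\<omega> \<in> space M. X \<omega> \<le> x \<and> Y \<omega> \<le> y}"

text \<open>\<open>F\<^sub>X(x) = F(x,\<infinity>)\<close>: the constraint on \<open>Y\<close> is void.\<close>

definition marginal_df :: "'a measure \<Rightarrow> ('a \<Rightarrow> real ^ 'p) \<Rightarrow> real ^ 'p \<Rightarrow> real" where
  "marginal_df M X x = measure M {\<omega> \<in> space M. X \<omega> \<le> x}"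

definition cond_df ::
    "'a measure \<Rightarrow> ('a \<Rightarrow> real ^ 'p) \<Rightarrow> ('a \<Rightarrow> real) \<Rightarrow> real ^ 'p \<Rightarrow> real \<Rightarrow> real" where
  "cond_df M X Y x y = joint_df M X Y x y / marginal_df M X x"

text \<open>The frontier and the quantiles depend on \<open>x\<close> only through \<open>G = F(\<cdot>|x)\<close>
  (or its empirical version).\<close>

definition frontier_finite :: "(real \<Rightarrow> real) \<Rightarrow> bool" where
  "frontier_finite G \<longleftrightarrow> bdd_above {y. 0 \<le> y \<and> G y < 1}"

definition frontier_point :: "(real \<Rightarrow> real) \<Rightarrow> real" where
  "frontier_point G = Sup {y. 0 \<le> y \<and> G y < 1}"

definition quantile_of :: "(real \<Rightarrow> real) \<Rightarrow> real \<Rightarrow> real" where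
  "quantile_of G \<alpha> = Inf {y. 0 \<le> y \<and> G y \<ge> \<alpha>}"

definition emp_joint_df ::
    "(nat \<Rightarrow> 'a \<Rightarrow> real ^ 'p) \<Rightarrow> (nat \<Rightarrow> 'a \<Rightarrow> real) \<Rightarrow> nat \<Rightarrow> 'a \<Rightarrow> real ^ 'p \<Rightarrow> real \<Rightarrow> real" where
  "emp_joint_df Xs Ys n \<omega> x y =
     (1 / real n) * (\<Sum>i = 1..n. of_bool (Xs i \<omega> \<le> x \<and> Ys i \<omega> \<le> y))"

definition emp_marginal_df ::
    "(nat \<Rightarrow> 'a \<Rightarrow> real ^ 'p) \<Rightarrow> nat \<Rightarrow> 'a \<Rightarrow> real ^ 'p \<Rightarrow> real" where
  "emp_marginal_df Xs n \<omega> x = (1 / real n) * (\<Sum>i = 1..n. of_bool (Xs i \<omega> \<le> x))"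

definition emp_cond_df ::
    "(nat \<Rightarrow> 'a \<Rightarrow> real ^ 'p) \<Rightarrow> (nat \<Rightarrow> 'a \<Rightarrow> real) \<Rightarrow> nat \<Rightarrow> 'a \<Rightarrow> real ^ 'p \<Rightarrow> real \<Rightarrow> real" where
  "emp_cond_df Xs Ys n \<omega> x y = emp_joint_df Xs Ys n \<omega> x y / emp_marginal_df Xs n \<omega> x"

definition emp_level :: "(nat \<Rightarrow> 'a \<Rightarrow> real ^ 'p) \<Rightarrow> nat \<Rightarrow> 'a \<Rightarrow> real ^ 'p \<Rightarrow> nat \<Rightarrow> real" where
  "emp_level Xs n \<omega> x i = 1 - real i / (real n * emp_marginal_df Xs n \<omega> x)"

text \<open>\<open>upper_emp_quantile Xs Ys n \<omega> x i\<close> is the conditional empirical quantile of order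
  \<open>1 - i / (n F\<^sub>X\<^sub>,\<^sub>n(x))\<close>, where \<open>F\<^sub>X\<^sub>,\<^sub>n\<close> is the empirical marginal.\<close>

definition upper_emp_quantile ::
    "(nat \<Rightarrow> 'a \<Rightarrow> real ^ 'p) \<Rightarrow> (nat \<Rightarrow> 'a \<Rightarrow> real) \<Rightarrow> nat \<Rightarrow> 'a \<Rightarrow> real ^ 'p \<Rightarrow> nat \<Rightarrow> real" where
  "upper_emp_quantile Xs Ys n \<omega> x i =
     quantile_of (emp_cond_df Xs Ys n \<omega> x) (emp_level Xs n \<omega> x i)"

definition log_moment ::
    "(nat \<Rightarrow> 'a \<Rightarrow> real ^ 'p) \<Rightarrow> (nat \<Rightarrow> 'a \<Rightarrow> real) \<Rightarrow> nat \<Rightarrow> nat \<Rightarrow> 'a \<Rightarrow> real ^ 'p \<Rightarrow> nat \<Rightarrow> real" where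
  "log_moment Xs Ys n k \<omega> x j =
     (1 / real k) * (\<Sum>i = 0..<k.
       (ln (upper_emp_quantile Xs Ys n \<omega> x i) - ln (upper_emp_quantile Xs Ys n \<omega> x k)) ^ j)"

definition moment_rho ::
    "(nat \<Rightarrow> 'a \<Rightarrow> real ^ 'p) \<Rightarrow> (nat \<Rightarrow> 'a \<Rightarrow> real) \<Rightarrow> nat \<Rightarrow> nat \<Rightarrow> 'a \<Rightarrow> real ^ 'p \<Rightarrow> real" where
  "moment_rho Xs Ys n k \<omega> x =
     - inverse (log_moment Xs Ys n k \<omega> x 1 + 1
        - (1/2) * inverse (1 - (log_moment Xs Ys n k \<omega> x 1)\<^sup>2 / log_moment Xs Ys n k \<omega> x 2))"

definition moment_frontier ::
    "(nat \<Rightarrow> 'a \<Rightarrow> real ^ 'p) \<Rightarrow> (nat \<Rightarrow> 'a \<Rightarrow> real) \<Rightarrow> nat \<Rightarrow> nat \<Rightarrow> 'a \<Rightarrow> real ^ 'p \<Rightarrow> real" where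
  "moment_frontier Xs Ys n k \<omega> x =
     upper_emp_quantile Xs Ys n \<omega> x k
       * (1 + log_moment Xs Ys n k \<omega> x 1 * (1 + moment_rho Xs Ys n k \<omega> x))"

definition regularly_varying :: "real \<Rightarrow> (real \<Rightarrow> real) \<Rightarrow> bool" where
  "regularly_varying a f \<longleftrightarrow> (\<forall>z>0. ((\<lambda>t. f (t * z) / f t) \<longlongrightarrow> z powr a) at_top)"

definition Pi_varying :: "(real \<Rightarrow> real) \<Rightarrow> (real \<Rightarrow> real) \<Rightarrow> bool" where
  "Pi_varying B f \<longleftrightarrow> (\<forall>z>0. ((\<lambda>t. (f (t * z) - f t) / B t) \<longlongrightarrow> ln z) at_top)"

text \<open>\<open>D\<close> is the domain on which \<open>g\<close> is inverted. If \<open>g\<close> is unbounded near a finite point of its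
  domain (for instance \<open>U(t) \<rightarrow> 0\<close> and \<open>log U(t) \<rightarrow> -\<infinity>\<close> as \<open>t\<close> decreases to \<open>1/F\<^sub>X(x)\<close>), then
  \<open>inf {t. g t \<ge> s}\<close> over the whole domain says nothing about \<open>g\<close> at infinity. The inverse of a
  regularly varying \<open>g\<close> is therefore taken on a half-line \<open>[t\<^sub>0,\<infinity>[\<close> on which \<open>g\<close> is locally bounded;
  any two such \<open>t\<^sub>0\<close> give the same values for all large \<open>s\<close>.\<close>

definition gen_inverse :: "real set \<Rightarrow> (real \<Rightarrow> real) \<Rightarrow> real \<Rightarrow> real" where
  "gen_inverse D g s = Inf {t \<in> D. g t \<ge> s}"

text \<open>\<open>G\<close> has the positive density \<open>G'\<close> on \<open>]0,\<phi>[\<close>, where \<open>\<phi>\<close> is its frontier. The derivative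
  exists at every point of the open interval and increments of \<open>G\<close> are its integrals. Taking
  \<open>b = \<phi>\<close> rules out an atom at the frontier, which differentiability inside the interval does not;
  an atom at \<open>0\<close> is allowed.\<close>

definition has_positive_density :: "(real \<Rightarrow> real) \<Rightarrow> bool" where
  "has_positive_density G \<longleftrightarrow>
     (\<forall>y. 0 < y \<and> y < frontier_point G \<longrightarrow> G differentiable (at y) \<and> 0 < deriv G y) \<and>
     (\<forall>a b. 0 < a \<and> a \<le> b \<and> b \<le> frontier_point G \<longrightarrow> (deriv G has_integral (G b - G a)) {a..b})"

text \<open>\<open>tail_quantile M X Y x\<close> is \<open>U\<close> and \<open>bias_fun\<close> is \<open>g\<close>; both are meant for
  \<open>t > 1/F\<^sub>X(x)\<close>.\<close>

definition tail_quantile ::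
    "'a measure \<Rightarrow> ('a \<Rightarrow> real ^ 'p) \<Rightarrow> ('a \<Rightarrow> real) \<Rightarrow> real ^ 'p \<Rightarrow> real \<Rightarrow> real" where
  "tail_quantile M X Y x t = quantile_of (cond_df M X Y x) (1 - 1 / (t * marginal_df M X x))"

definition bias_fun ::
    "real \<Rightarrow> real \<Rightarrow> (real \<Rightarrow> real) \<Rightarrow> (real \<Rightarrow> real) \<Rightarrow> real \<Rightarrow> real" where
  "bias_fun \<rho> \<phi> U B t = t powr (1 + 2 / \<rho>) * ((ln \<phi> - ln (U t)) / B t)\<^sup>2"

definition V4 :: "real \<Rightarrow> real" where
  "V4 \<rho> = (1 + 1 / \<rho>)\<^sup>2"

definition V5 :: "real \<Rightarrow> real" where
  "V5 \<rho> = \<rho>\<^sup>2 *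
     (\<rho> / (2 + \<rho>)
      + \<rho> * (2 + \<rho>) *
          (4 - 8 * ((2 + \<rho>) / (3 + \<rho>)) + ((11 + 5 * \<rho>) * (2 + \<rho>)) / ((3 + \<rho>) * (4 + \<rho>)))
      - 4 * \<rho> / (3 + \<rho>))"

text \<open>The second argument is the variance.\<close>

definition normal_law :: "real \<Rightarrow> real \<Rightarrow> real measure" where
  "normal_law m v = density lborel (normal_density m (sqrt v))"

definition converges_in_law :: "'a measure \<Rightarrow> (nat \<Rightarrow> 'a \<Rightarrow> real) \<Rightarrow> real measure \<Rightarrow> bool" where
  "converges_in_law M T L \<longleftrightarrow> weak_conv_m (\<lambda>n. distr M borel (T n)) L"

end

theory Submission
  imports Defs "HOL-Combinatorics.Permutations"
begin

text \<open>
  Put \<open>Z\<^sub>j = Y\<^sub>j\<close> on \<open>{X\<^sub>j \<le> x}\<close> and \<open>Z\<^sub>j = 0\<close> elsewhere. The empirical conditional quantile of order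
  \<open>1 - i/(n F\<^sub>X\<^sub>,\<^sub>n(x))\<close> is the \<open>(i+1)\<close>-st largest of the \<open>Z\<^sub>j\<close>, and the \<open>Z\<^sub>j\<close> are i.i.d. with the law of
  \<open>Q(v)\<close>, \<open>v\<close> uniform on \<open>]0,1[\<close>, where \<open>Q(v)\<close> is the conditional quantile of order \<open>1 - v/F\<^sub>X(x)\<close>.
  Hence everything is a function of the \<open>k+1\<close> smallest of \<open>n\<close> uniform variables, which are
  distributed as \<open>(u w\<^sub>1, \<dots>, u w\<^sub>k, u)\<close> (up to order) with \<open>u\<close> the \<open>(k+1)\<close>-st smallest and
  \<open>w\<^sub>1, \<dots>, w\<^sub>k\<close> independent of it and uniform. Put \<open>D = \<phi> - Q\<close> and \<open>\<delta> = 1/\<rho>\<close>.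

  With \<open>\<gamma> = D(u)/Q(u) \<rightarrow> 0\<close>, regular variation of \<open>D\<close> gives
  \<open>log Q(u w) - log Q(u) \<approx> \<gamma> (1 - w\<^sup>\<delta>)\<close>, so the log-moments are, to first order, \<open>\<gamma>\<^sup>l\<close> times empirical
  means of \<open>(1 - w\<^sup>\<delta>)\<^sup>l\<close>. In (i), \<open>log D(u) - log D(p) \<approx> \<delta> (log u - log p)\<close>, and the fluctuation of \<open>log u\<close>,
  which comes from the binomial central limit theorem, is the only one of order \<open>k\<^sup>-\<^sup>1\<^sup>/\<^sup>2\<close>.
  In (ii), \<open>Q(u) - \<phi> = - \<gamma> Q(u)\<close> is compared with \<open>M\<^sup>(\<^sup>1\<^sup>)\<close> itself, so \<open>u\<close> drops out and the delta method
  for the empirical means of \<open>1 - w\<^sup>\<delta>\<close> and \<open>(1 - w\<^sup>\<delta>)\<^sup>2\<close> yields the limit; the class \<open>\<Pi>\<close> and the growth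
  condition on \<open>k\<close> make the approximation errors \<open>o(k\<^sup>-\<^sup>1\<^sup>/\<^sup>2)\<close>.
\<close>

section \<open>Convergence with high probability\<close>

text \<open>Ties among the \<open>Z\<close> values and an atom at 0 rule out the ranks of the sample
  itself; ranks are taken among the uniform variables behind \<open>Q\<close>, which are almost
  surely distinct. In law these are replaced by two independent sequences, v for u and w for the
  spacings, on one space that does not change with n. On it every approximation is a limit along
  \<open>whp\<close>: limits in probability obey the ordinary limit rules, and a property need not
  be measurable to hold along it.

  The growth condition acts through one slowly varying function. With H(x) = e^{\<delta>x}
  D(e^{-x}), \<beta> its unit increment up to sign and \<alpha> = \<beta>/H, both relative errors,
  \<gamma> and the mean of |w^\<delta> - D(uw)/D(u)|, are O(\<alpha>(-log u)), while g(t) lies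
  between constant multiples of t/\<alpha>(log t)^2. So k = o(n/g^{-1}(n)) forces k
  \<alpha>(log(n/k))^2 to 0. The linear term left in (ii) is governed by the gradient of m2 + m1 m2
  - 2 m1^2 at the limiting log-moments, a point where this polynomial vanishes.\<close>

text \<open>A property of \<open>(n, \<omega>)\<close> is eventual in this filter if for every \<open>\<epsilon>\<close> it fails with probability less
  than \<open>\<epsilon>\<close> for all large \<open>n\<close>; a limit along it is a limit in probability.\<close>

definition whp :: "'a measure \<Rightarrow> (nat \<times> 'a) filter" where
  "whp M = Abs_filter (\<lambda>P. \<forall>\<epsilon>>0. \<forall>\<^sub>F n in sequentially.
     \<exists>A\<in>sets M. measure M (space M - A) < \<epsilon> \<and> (\<forall>\<omega>\<in>A. P (n, \<omega>)))"

context prob_space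
begin

text \<open>Conjunction is the one filter law with content: half of \<epsilon> goes to each
  exceptional set. Asking for a measurable event inside the property, not for a measurable property,
  makes monotonicity immediate.\<close>

lemma eventually_whp:
  "eventually P (whp M) \<longleftrightarrow> (\<forall>\<epsilon>>0. \<forall>\<^sub>F n in sequentially.
     \<exists>A\<in>sets M. measure M (space M - A) < \<epsilon> \<and> (\<forall>\<omega>\<in>A. P (n, \<omega>)))"
  unfolding whp_def
proof (rule eventually_Abs_filter, unfold_locales, goal_cases)
  case 1
  show ?case by (auto intro!: always_eventually bexI[of _ "space M"])
next
  case (2 P Q)
  show ?case
  proof (intro allI impI)
    fix \<epsilon> :: real assume "\<epsilon> > 0"
    then have e: "\<epsilon> / 2 > 0" by simp
    show "\<forall>\<^sub>F n in sequentially. \<exists>A\<in>sets M. prob (space M - A) < \<epsilon> \<and> (\<forall>\<omega>\<in>A. P (n, \<omega>) \<and> Q (n, \<omega>))"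
      using 2(1)[rule_format, OF e] 2(2)[rule_format, OF e]
    proof eventually_elim
      case (elim n)
      then obtain A B where A: "A \<in> sets M" "prob (space M - A) < \<epsilon> / 2" "\<forall>\<omega>\<in>A. P (n, \<omega>)"
        and B: "B \<in> sets M" "prob (space M - B) < \<epsilon> / 2" "\<forall>\<omega>\<in>B. Q (n, \<omega>)" by blast
      have "prob (space M - A \<inter> B) \<le> prob ((space M - A) \<union> (space M - B))"
        using A B by (intro finite_measure_mono) auto
      also have "\<dots> \<le> prob (space M - A) + prob (space M - B)"
        using A B by (intro measure_subadditive) (auto simp: emeasure_eq_measure)
      finally show ?case using A B by (intro bexI[of _ "A \<inter> B"]) auto
    qed
  qed
next
  case (3 P Q)
  show ?case
  proof (intro allI impI)
    fix \<epsilon> :: real assume "\<epsilon> > 0"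
    show "\<forall>\<^sub>F n in sequentially. \<exists>A\<in>sets M. prob (space M - A) < \<epsilon> \<and> (\<forall>\<omega>\<in>A. Q (n, \<omega>))"
      using 3(2)[rule_format, OF \<open>\<epsilon> > 0\<close>] by eventually_elim (use 3(1) in blast)
  qed
qed

lemma eventually_whpI:
  assumes "\<And>n. {\<omega>\<in>space M. P (n, \<omega>)} \<in> sets M"
    and "(\<lambda>n. prob {\<omega>\<in>space M. \<not> P (n, \<omega>)}) \<longlonglongrightarrow> 0"
  shows "eventually P (whp M)"
  unfolding eventually_whp
proof (intro allI impI)
  fix \<epsilon> :: real assume "\<epsilon> > 0"
  show "\<forall>\<^sub>F n in sequentially. \<exists>A\<in>sets M. prob (space M - A) < \<epsilon> \<and> (\<forall>\<omega>\<in>A. P (n, \<omega>))"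
    using order_tendstoD(2)[OF assms(2) \<open>\<epsilon> > 0\<close>]
  proof eventually_elim
    case (elim n)
    have "space M - {\<omega>\<in>space M. P (n, \<omega>)} = {\<omega>\<in>space M. \<not> P (n, \<omega>)}" by auto
    then show ?case using assms(1)[of n] elim
      by (intro bexI[of _ "{\<omega>\<in>space M. P (n, \<omega>)}"]) auto
  qed
qed

lemma filterlim_fst_whp: "filterlim fst sequentially (whp M)"
  unfolding filterlim_iff eventually_whp
proof (intro allI impI)
  fix P :: "nat \<Rightarrow> bool" and \<epsilon> :: real assume P: "eventually P sequentially" "\<epsilon> > 0"
  show "\<forall>\<^sub>F n in sequentially. \<exists>A\<in>sets M. prob (space M - A) < \<epsilon> \<and> (\<forall>\<omega>\<in>A. P (fst (n, \<omega>)))"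
    using P(1) by eventually_elim (use P(2) in \<open>auto intro!: bexI[of _ "space M"]\<close>)
qed

lemma whp_seq: "filterlim f F sequentially \<Longrightarrow> filterlim (\<lambda>z. f (fst z)) F (whp M)"
  by (rule filterlim_compose[OF _ filterlim_fst_whp])

lemma eventually_whp_seq: "eventually P sequentially \<Longrightarrow> \<forall>\<^sub>F z in whp M. P (fst z)"
  using filterlim_fst_whp unfolding filterlim_iff by auto

lemma eventually_whp_AE:
  assumes "\<And>n. AE \<omega> in M. P (n, \<omega>)"
  shows "eventually P (whp M)"
  unfolding eventually_whp
proof (intro allI impI always_eventually)
  fix \<epsilon> :: real and n assume e: "\<epsilon> > 0"
  obtain N where N: "N \<in> null_sets M" "{\<omega>\<in>space M. \<not> P (n, \<omega>)} \<subseteq> N"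
    using assms[of n] by (auto elim!: AE_E)
  have "prob (space M - (space M - N)) = 0"
    using N(1) by (simp add: Diff_Diff_Int measure_eq_0_null_sets sets.Int_space_eq1)
  with N e show "\<exists>A\<in>sets M. prob (space M - A) < \<epsilon> \<and> (\<forall>\<omega>\<in>A. P (n, \<omega>))"
    by (intro bexI[of _ "space M - N"]) auto
qed

text \<open>The preimage of an event of high probability has the same probability. This is applied
  to the two projections of a product space, so that facts about one uniform sequence can be used on
  the pair.\<close>

lemma whp_measure_preserving:
  assumes N: "prob_space N" and f: "f \<in> measurable M N" "distr M N f = N"
    and ev: "eventually P (whp N)"
  shows "\<forall>\<^sub>F z in whp M. P (fst z, f (snd z))"
  unfolding eventually_whp
proof (intro allI impI)
  fix \<epsilon> :: real assume "\<epsilon> > 0"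
  interpret N: prob_space N by fact
  show "\<forall>\<^sub>F n in sequentially. \<exists>A\<in>sets M. prob (space M - A) < \<epsilon> \<and>
      (\<forall>\<omega>\<in>A. P (fst (n, \<omega>), f (snd (n, \<omega>))))"
    using ev[unfolded N.eventually_whp, rule_format, OF \<open>\<epsilon> > 0\<close>]
  proof eventually_elim
    case (elim n)
    then obtain A where A: "A \<in> sets N" "measure N (space N - A) < \<epsilon>" "\<forall>\<omega>\<in>A. P (n, \<omega>)" by blast
    have "measure N (space N - A) = measure (distr M N f) (space N - A)" using f by simp
    also have "\<dots> = prob (f -` (space N - A) \<inter> space M)"
      using A f(1) by (intro measure_distr) auto
    also have "f -` (space N - A) \<inter> space M = space M - (f -` A \<inter> space M)"
      using f(1) by (auto dest: measurable_space)
    finally show ?case using A f(1)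
      by (intro bexI[of _ "f -` A \<inter> space M"]) auto
  qed
qed

end

text \<open>Fubini: if, outside a v-set of small probability, the w-section of the bad set is small,
  then the bad set is small. Half of \<epsilon> pays for the exceptional v, where the section is
  bounded by 1 only.\<close>

lemma whp_pair:
  assumes M: "prob_space M" and N: "prob_space N"
    and meas: "\<And>n. {z \<in> space (M \<Otimes>\<^sub>M N). P n (fst z) (snd z)} \<in> sets (M \<Otimes>\<^sub>M N)"
    and ev: "\<And>\<epsilon>. \<epsilon> > 0 \<Longrightarrow> \<forall>\<^sub>F z in whp M. measure N {w \<in> space N. \<not> P (fst z) (snd z) w} < \<epsilon>"
  shows "\<forall>\<^sub>F z in whp (M \<Otimes>\<^sub>M N). P (fst z) (fst (snd z)) (snd (snd z))"
proof -
  interpret M: prob_space M by fact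
  interpret N: prob_space N by fact
  interpret P: pair_prob_space M N ..
  show ?thesis
    unfolding P.eventually_whp
  proof (intro allI impI)
    fix \<epsilon> :: real assume "\<epsilon> > 0"
    then have e: "\<epsilon> / 2 > 0" by simp
    show "\<forall>\<^sub>F n in sequentially. \<exists>A\<in>sets (M \<Otimes>\<^sub>M N). measure (M \<Otimes>\<^sub>M N) (space (M \<Otimes>\<^sub>M N) - A) < \<epsilon> \<and>
        (\<forall>\<omega>\<in>A. P (fst (n, \<omega>)) (fst (snd (n, \<omega>))) (snd (snd (n, \<omega>))))"
      using ev[OF e, unfolded M.eventually_whp, rule_format, OF e]
    proof eventually_elim
      case (elim n)
      then obtain A where A[measurable]: "A \<in> sets M" and Ae: "measure M (space M - A) < \<epsilon> / 2"
        and AP: "\<And>v. v \<in> A \<Longrightarrow> measure N {w \<in> space N. \<not> P n v w} < \<epsilon> / 2" by auto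
      have As: "A \<subseteq> space M" using A by (rule sets.sets_into_space)
      define G where "G = {z \<in> space (M \<Otimes>\<^sub>M N). P n (fst z) (snd z)}"
      define B where "B = space (M \<Otimes>\<^sub>M N) - G"
      have G: "G \<in> sets (M \<Otimes>\<^sub>M N)" unfolding G_def by (rule meas)
      then have B: "B \<in> sets (M \<Otimes>\<^sub>M N)" by (auto simp: B_def)
      have "emeasure (M \<Otimes>\<^sub>M N) B = (\<integral>\<^sup>+ v. emeasure N (Pair v -` B) \<partial>M)"
        by (rule N.emeasure_pair_measure_alt[OF B])
      also have "\<dots> \<le> (\<integral>\<^sup>+ v. ennreal (\<epsilon> / 2) + indicator (space M - A) v \<partial>M)"
      proof (rule nn_integral_mono)
        fix v assume v: "v \<in> space M"
        show "emeasure N (Pair v -` B) \<le> ennreal (\<epsilon> / 2) + indicator (space M - A) v"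
        proof (cases "v \<in> A")
          case True
          have "Pair v -` B = {w \<in> space N. \<not> P n v w}"
            using v by (auto simp: B_def G_def space_pair_measure)
          then show ?thesis using AP[OF True] True
            by (simp add: N.emeasure_eq_measure ennreal_leI)
        next
          case False
          have "emeasure N (Pair v -` B) \<le> 1" by (rule N.emeasure_le_1)
          also have "1 \<le> ennreal (\<epsilon> / 2) + indicator (space M - A) v"
            using False v by simp
          finally show ?thesis .
        qed
      qed
      also have "\<dots> = ennreal (\<epsilon> / 2) + measure M (space M - A)"
        by (subst nn_integral_add) (auto simp: M.prob_space M.emeasure_eq_measure)
      also have "\<dots> < ennreal \<epsilon>"
        using Ae e by (simp flip: ennreal_plus add: ennreal_less_iff)
      finally have "measure (M \<Otimes>\<^sub>M N) B < \<epsilon>"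
        by (simp add: P.emeasure_eq_measure ennreal_less_iff)
      then show ?case using G unfolding B_def
        by (intro bexI[of _ G]) (auto simp: G_def)
    qed
  qed
qed

section \<open>Slowly varying functions and the class Pi\<close>

text \<open>A Steinhaus type argument. For large x most w in [0,2] are good increments from x, and
  likewise from x + u. Some point is reached from both, and comparing H at x and at x + u with H
  there costs one error for each base point, hence b x + b (x + u).\<close>

lemma uniform_increment_bound:
  fixes H b :: "real \<Rightarrow> real"
  assumes [measurable]: "H \<in> borel_measurable borel"
    and ptw: "\<And>u. 0 \<le> u \<Longrightarrow> u \<le> 2 \<Longrightarrow> \<forall>\<^sub>F x in at_top. \<bar>H (x + u) - H x\<bar> \<le> \<epsilon> * b x"
  shows "\<forall>\<^sub>F x in at_top. \<forall>u\<in>{0..1}. \<bar>H (x + u) - H x\<bar> \<le> \<epsilon> * (b x + b (x + u))"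
proof -
  define V where "V x = {w\<in>{0..2}. \<bar>H (x + w) - H x\<bar> \<le> \<epsilon> * b x}" for x
  have V[measurable]: "V x \<in> sets borel" for x unfolding V_def by measurable
  have Vsub: "V x \<subseteq> {0..2}" for x by (auto simp: V_def)
  have Vfin: "V x \<in> fmeasurable lborel" for x
    by (rule fmeasurableI2[OF fmeasurable_compact[OF compact_Icc] Vsub]) simp
  have "((\<lambda>x. \<integral>w. indicator (V x) w \<partial>lborel) \<longlongrightarrow> (\<integral>w. indicator {0..2::real} w \<partial>lborel :: real)) at_top"
  proof (rule integral_dominated_convergence_at_top[where w="indicator {0..2}"])
    show "AE w in lborel. ((\<lambda>x. indicator (V x) w :: real) \<longlongrightarrow> indicator {0..2} w) at_top"
    proof (intro AE_I2 tendsto_eventually)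
      fix w :: real
      show "\<forall>\<^sub>F x in at_top. (indicator (V x) w :: real) = indicator {0..2} w"
        using ptw[of w] by (cases "0 \<le> w \<and> w \<le> 2") (auto simp: V_def indicator_def elim!: eventually_mono)
    qed
    show "\<forall>\<^sub>F x in at_top. AE w in lborel. norm (indicator (V x) w :: real) \<le> indicator {0..2} w"
      by (intro always_eventually allI AE_I2) (auto simp: V_def indicator_def)
  qed simp_all
  then have "((\<lambda>x. measure lborel (V x)) \<longlongrightarrow> 2) at_top"
    using Vfin by simp
  \<comment> \<open>The good sets from x and from x + u both lie in [0,3]; as each has measure above
    3/2, they must meet.\<close>
  then have "\<forall>\<^sub>F x in at_top. measure lborel (V x) > 3/2"
    by (rule order_tendstoD) simp
  then obtain x1 where x1: "\<And>x. x \<ge> x1 \<Longrightarrow> measure lborel (V x) > 3/2"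
    by (auto simp: eventually_at_top_linorder)
  show ?thesis
    unfolding eventually_at_top_linorder
  proof (intro exI[of _ x1] allI impI ballI)
    fix x u :: real assume x: "x1 \<le> x" and u: "u \<in> {0..1}"
    define V' where "V' = (+) u ` V (x + u)"
    have eV': "V' = (\<lambda>w. w - u) -` V (x + u)"
      unfolding V'_def by (auto simp: image_iff algebra_simps intro!: bexI[of _ "_ - u"])
    have V'm[measurable]: "V' \<in> sets borel"
      unfolding eV' by (rule measurable_sets_borel[OF _ V]) simp
    have mV': "measure lborel V' = measure lborel (V (x + u))"
      using measure_translation[of u "V (x+u)"] Vfin V'm
      by (simp add: V'_def measure_completion)
    have "V' \<subseteq> {0..3}" using Vsub[of "x+u"] u by (force simp: V'_def)
    then have V'fin: "V' \<in> fmeasurable lborel"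
      by (intro fmeasurableI2[OF fmeasurable_compact[OF compact_Icc]]) auto
    have "V x \<inter> V' \<noteq> {}"
    proof
      assume dis: "V x \<inter> V' = {}"
      have "measure lborel (V x) + measure lborel V' = measure lborel (V x \<union> V')"
        using measure_Un3[OF Vfin[of x] V'fin] dis by simp
      also have "\<dots> \<le> measure lborel {0..3::real}"
      proof (rule measure_mono_fmeasurable)
        show "V x \<union> V' \<subseteq> {0..3}" using \<open>V' \<subseteq> {0..3}\<close> Vsub[of x] by fastforce
      qed (simp_all add: fmeasurable_compact)
      finally show False using x1[of x] x1[of "x+u"] x u mV' by simp
    qed
    then obtain w where w: "w \<in> V x" "w - u \<in> V (x + u)" by (auto simp: eV')
    then have "\<bar>H (x + w) - H x\<bar> \<le> \<epsilon> * b x" "\<bar>H (x + w) - H (x + u)\<bar> \<le> \<epsilon> * b (x + u)"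
      by (auto simp: V_def)
    then show "\<bar>H (x + u) - H x\<bar> \<le> \<epsilon> * (b x + b (x + u))"
      by (simp add: distrib_left)
  qed
qed

text \<open>Slow variation of a function f in additive form, L(x) = log f(e^x). Measurability
  belongs to it because uniformity in u is deduced by a measure argument.\<close>

definition log_slow :: "(real \<Rightarrow> real) \<Rightarrow> bool" where
  "log_slow L \<longleftrightarrow> L \<in> borel_measurable borel \<and> (\<forall>u. ((\<lambda>x. L (x + u) - L x) \<longlongrightarrow> 0) at_top)"

text \<open>A Potter bound: increments over unit steps are small uniformly, and u is covered by
  floor(u) such steps and a remainder.\<close>

lemma log_slow_uniform:
  assumes "log_slow L" "\<eta> > 0"
  shows "\<forall>\<^sub>F x in at_top. \<forall>u\<ge>0. \<bar>L (x + u) - L x\<bar> \<le> \<eta> * (u + 1)"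
proof -
  have "\<forall>\<^sub>F x in at_top. \<forall>u\<in>{0..1}. \<bar>L (x + u) - L x\<bar> \<le> \<eta> / 2 * (1 + 1)"
  proof (rule uniform_increment_bound[where b="\<lambda>_. 1"])
    fix u
    have "((\<lambda>x. L (x + u) - L x) \<longlongrightarrow> 0) at_top" using assms by (auto simp: log_slow_def)
    then have "\<forall>\<^sub>F x in at_top. dist (L (x + u) - L x) 0 < \<eta> / 2"
      by (rule tendstoD) (use assms in simp)
    then show "\<forall>\<^sub>F x in at_top. \<bar>L (x + u) - L x\<bar> \<le> \<eta> / 2 * 1"
      by eventually_elim (simp add: dist_real_def)
  qed (use assms in \<open>auto simp: log_slow_def\<close>)
  then obtain x1 where x1: "\<forall>x\<ge>x1. \<forall>u\<in>{0..1}. \<bar>L (x + u) - L x\<bar> \<le> \<eta>"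
    unfolding eventually_at_top_linorder by auto
  show ?thesis unfolding eventually_at_top_linorder
  proof (intro exI[of _ x1] allI impI)
    fix x u :: real assume x: "x1 \<le> x" and u: "0 \<le> u"
    have nat: "\<bar>L (x + real n) - L x\<bar> \<le> \<eta> * real n" for n
    proof (induction n)
      case (Suc n)
      have "\<bar>L (x + real n + 1) - L (x + real n)\<bar> \<le> \<eta>" using x x1 by auto
      with Suc show ?case by (simp add: algebra_simps)
    qed simp
    define n where "n = nat \<lfloor>u\<rfloor>"
    have n: "real n \<le> u" "u < real n + 1" using u by (auto simp: n_def)
    have "\<bar>L (x + real n + (u - real n)) - L (x + real n)\<bar> \<le> \<eta>"
      using x n by (intro x1[rule_format]) auto
    with nat[of n] have "\<bar>L (x + u) - L x\<bar> \<le> \<eta> * (real n + 1)" by (simp add: algebra_simps)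
    also have "\<dots> \<le> \<eta> * (u + 1)" using n assms by (intro mult_left_mono) auto
    finally show "\<bar>L (x + u) - L x\<bar> \<le> \<eta> * (u + 1)" .
  qed
qed

text \<open>A shift to the left is a shift to the right from x + u, so the base point must exceed
  the threshold by 1.\<close>

lemma log_slow_two_sided:
  assumes "log_slow L" "\<eta> > 0"
  shows "\<forall>\<^sub>F x in at_top. \<forall>u\<in>{-1..1}. \<bar>L (x + u) - L x\<bar> \<le> \<eta>"
proof -
  from log_slow_uniform[OF assms(1), of "\<eta>/2"] assms(2) obtain x1 where
    x1: "\<And>x u. x \<ge> x1 \<Longrightarrow> u \<ge> 0 \<Longrightarrow> \<bar>L (x + u) - L x\<bar> \<le> \<eta> / 2 * (u + 1)"
    by (auto simp: eventually_at_top_linorder)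
  have x2: "\<bar>L (x + u) - L x\<bar> \<le> \<eta>" if "x \<ge> x1" "0 \<le> u" "u \<le> 1" for x u
  proof -
    have "\<bar>L (x + u) - L x\<bar> \<le> \<eta> / 2 * (u + 1)" using that by (intro x1)
    also have "\<dots> \<le> \<eta> / 2 * 2" using that assms by (intro mult_left_mono) auto
    finally show ?thesis by simp
  qed
  show ?thesis unfolding eventually_at_top_linorder
  proof (intro exI[of _ "x1+1"] allI impI ballI)
    fix x u :: real assume "x1 + 1 \<le> x" "u \<in> {-1..1}"
    then show "\<bar>L (x + u) - L x\<bar> \<le> \<eta>"
      using x2[of x u] x2[of "x+u" "-u"] by (cases "u \<ge> 0") (auto simp: abs_minus_commute)
  qed
qed

lemma log_slow_diff:
  assumes "log_slow L" "log_slow K"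
  shows "log_slow (\<lambda>x. L x - K x)"
  unfolding log_slow_def
proof (intro conjI allI)
  show "(\<lambda>x. L x - K x) \<in> borel_measurable borel"
    using assms by (auto simp: log_slow_def)
  fix u
  have "((\<lambda>x. (L (x + u) - L x) - (K (x + u) - K x)) \<longlongrightarrow> 0 - 0) at_top"
    using assms unfolding log_slow_def by (intro tendsto_diff) blast+
  then show "((\<lambda>x. (L (x + u) - K (x + u)) - (L x - K x)) \<longlongrightarrow> 0) at_top"
    by (simp add: algebra_simps)
qed

lemma log_slow_cmult:
  assumes "log_slow L"
  shows "log_slow (\<lambda>x. c * L x)"
  unfolding log_slow_def
proof (intro conjI allI)
  show "(\<lambda>x. c * L x) \<in> borel_measurable borel"
    using assms by (auto simp: log_slow_def)
  fix u
  have "((\<lambda>x. c * (L (x + u) - L x)) \<longlongrightarrow> c * 0) at_top"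
    using assms unfolding log_slow_def by (intro tendsto_mult_left) blast
  then show "((\<lambda>x. c * L (x + u) - c * L x) \<longlongrightarrow> 0) at_top"
    by (simp add: right_diff_distrib)
qed

text \<open>The class \<Pi> in additive form, with H(x) = h(e^x) and b(x) = B(e^x). Since b is not
  assumed measurable, it is replaced by \<beta>, a unit increment of H asymptotic to it. The last
  bound has rate 1/2 so that its form w^{-1/2}, for w = e^{-u}, is integrable on ]0,1[.\<close>

lemma Pi_class_bounds:
  fixes H b :: "real \<Rightarrow> real" and s :: real
  assumes s: "s = 1 \<or> s = -1"
    and H[measurable]: "H \<in> borel_measurable borel"
    and Hnn: "\<forall>\<^sub>F x in at_top. 0 \<le> H x" and bpos: "\<forall>\<^sub>F x in at_top. 0 < b x"
    and lim: "\<And>u. ((\<lambda>x. s * (H (x + u) - H x) / b x) \<longlongrightarrow> u) at_top"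
  defines "\<beta> \<equiv> (\<lambda>x. s * (H (x + 1) - H x))"
  shows "\<forall>\<^sub>F x in at_top. 0 < \<beta> x" and "((\<lambda>x. \<beta> x / b x) \<longlongrightarrow> 1) at_top"
    and "((\<lambda>x. \<beta> x / H x) \<longlongrightarrow> 0) at_top" and "\<forall>\<^sub>F x in at_top. 0 < H x"
    and "log_slow (\<lambda>x. ln (\<beta> x))" and "log_slow (\<lambda>x. ln (H x))"
    and "\<exists>C>0. \<forall>\<^sub>F x in at_top. \<forall>u\<ge>0. \<bar>H (x + u) - H x\<bar> \<le> C * \<beta> x * exp (u / 2)"
proof -
  have [measurable]: "\<beta> \<in> borel_measurable borel" unfolding \<beta>_def by measurable
  show \<beta>b: "((\<lambda>x. \<beta> x / b x) \<longlongrightarrow> 1) at_top" using lim[of 1] by (simp add: \<beta>_def)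
  then have "\<forall>\<^sub>F x in at_top. 1/2 < \<beta> x / b x" by (rule order_tendstoD) simp
  with bpos show \<beta>pos: "\<forall>\<^sub>F x in at_top. 0 < \<beta> x"
  proof eventually_elim
    case (elim x)
    then have "0 < \<beta> x / b x" by linarith
    with elim show ?case by (simp add: zero_less_divide_iff)
  qed
  have shift: "filterlim (\<lambda>x. x + u) at_top at_top" for u :: real
    using filterlim_tendsto_add_at_top[OF tendsto_const[of u] filterlim_ident] by (simp add: add.commute)
  have ev_shift: "\<forall>\<^sub>F x in at_top. P (x + u)" if "eventually P at_top" for P and u :: real
    using shift[of u] that unfolding filterlim_iff by blast
  have lim\<beta>: "((\<lambda>x. s * (H (x + u) - H x) / \<beta> x) \<longlongrightarrow> u) at_top" for u
  proof -
    have "((\<lambda>x. (s * (H (x + u) - H x) / b x) / (\<beta> x / b x)) \<longlongrightarrow> u / 1) at_top"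
      by (intro tendsto_divide lim \<beta>b) simp
    moreover have "\<forall>\<^sub>F x in at_top. (s * (H (x + u) - H x) / b x) / (\<beta> x / b x) = s * (H (x + u) - H x) / \<beta> x"
      using bpos by eventually_elim simp
    ultimately show ?thesis by (auto intro: Lim_transform_eventually)
  qed
  have \<beta>ratio: "((\<lambda>x. \<beta> (x + u) / \<beta> x) \<longlongrightarrow> 1) at_top" for u
  proof -
    have "((\<lambda>x. s * (H (x + (u + 1)) - H x) / \<beta> x - s * (H (x + u) - H x) / \<beta> x) \<longlongrightarrow> (u + 1) - u) at_top"
      by (intro tendsto_diff lim\<beta>)
    moreover have "s * (H (x + (u + 1)) - H x) / \<beta> x - s * (H (x + u) - H x) / \<beta> x = \<beta> (x + u) / \<beta> x" for x
    proof -
      have "s * (H (x + (u + 1)) - H x) - s * (H (x + u) - H x) = \<beta> (x + u)"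
        by (simp add: \<beta>_def algebra_simps)
      then show ?thesis by (simp only: diff_divide_distrib[symmetric])
    qed
    ultimately show ?thesis by simp
  qed
  show ls\<beta>: "log_slow (\<lambda>x. ln (\<beta> x))"
    unfolding log_slow_def
  proof (intro conjI allI)
    fix u
    have "((\<lambda>x. ln (\<beta> (x + u) / \<beta> x)) \<longlongrightarrow> ln 1) at_top"
      by (intro tendsto_ln \<beta>ratio) simp
    moreover have "\<forall>\<^sub>F x in at_top. ln (\<beta> (x + u) / \<beta> x) = ln (\<beta> (x + u)) - ln (\<beta> x)"
      using \<beta>pos ev_shift[OF \<beta>pos, of u]
      by eventually_elim (simp add: ln_div)
    ultimately show "((\<lambda>x. ln (\<beta> (x + u)) - ln (\<beta> x)) \<longlongrightarrow> 0) at_top"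
      by (auto intro: Lim_transform_eventually)
  qed measurable
  \<comment> \<open>Moving by -s(c+1) lowers H by about (c+1)\<beta>; as H is nonnegative there, H
    must have been at least c\<beta>.\<close>
  have big: "\<forall>\<^sub>F x in at_top. c * \<beta> x \<le> H x" if "c > 0" for c
  proof -
    have "((\<lambda>x. s * (H (x + (- s * (c+1))) - H x) / \<beta> x) \<longlongrightarrow> - s * (c+1)) at_top" by (rule lim\<beta>)
    then have "((\<lambda>x. s * (s * (H (x + (- s * (c+1))) - H x) / \<beta> x)) \<longlongrightarrow> s * (- s * (c+1))) at_top"
      by (intro tendsto_intros)
    moreover have "s * s = 1" using s by auto
    ultimately have "((\<lambda>x. (H (x + (- s * (c+1))) - H x) / \<beta> x) \<longlongrightarrow> - (c+1)) at_top"
      by (simp add: mult.assoc[symmetric])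
    then have "\<forall>\<^sub>F x in at_top. (H (x + (- s * (c+1))) - H x) / \<beta> x < - c"
      by (rule order_tendstoD) simp
    then show ?thesis
      using \<beta>pos ev_shift[OF Hnn, of "- s * (c+1)"]
    proof eventually_elim
      case (elim x)
      then have "H (x + (- s * (c+1))) - H x < - c * \<beta> x" by (simp add: divide_less_eq)
      with elim show ?case by simp
    qed
  qed
  show Hpos: "\<forall>\<^sub>F x in at_top. 0 < H x"
    using big[OF zero_less_one] \<beta>pos by eventually_elim auto
  show \<beta>H: "((\<lambda>x. \<beta> x / H x) \<longlongrightarrow> 0) at_top"
  proof (rule tendstoI)
    fix e :: real assume e: "e > 0"
    then have e': "2 / e > 0" by simp
    show "\<forall>\<^sub>F x in at_top. dist (\<beta> x / H x) 0 < e"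
      using big[OF e'] \<beta>pos Hpos
    proof eventually_elim
      case (elim x)
      then have "\<beta> x / H x \<le> e / 2" using e by (simp add: field_simps)
      also have "e / 2 < e" using e by simp
      finally show ?case using elim by (simp add: dist_real_def)
    qed
  qed
  show "log_slow (\<lambda>x. ln (H x))"
    unfolding log_slow_def
  proof (intro conjI allI)
    fix u
    have "((\<lambda>x. 1 + s * ((s * (H (x + u) - H x) / \<beta> x) * (\<beta> x / H x))) \<longlongrightarrow> 1 + s * (u * 0)) at_top"
      by (intro tendsto_intros lim\<beta> \<beta>H)
    moreover have "\<forall>\<^sub>F x in at_top. 1 + s * ((s * (H (x + u) - H x) / \<beta> x) * (\<beta> x / H x)) = H (x + u) / H x"
      using \<beta>pos Hpos
    proof eventually_elim
      case (elim x)
      have "s * s = 1" using s by auto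
      then have "s * ((s * (H (x + u) - H x) / \<beta> x) * (\<beta> x / H x)) = (H (x + u) - H x) / H x"
        using elim s by (elim disjE) (simp_all add: field_simps)
      then show ?case using elim by (simp add: field_simps)
    qed
    ultimately have "((\<lambda>x. H (x + u) / H x) \<longlongrightarrow> 1) at_top"
      by (auto intro: Lim_transform_eventually)
    then have "((\<lambda>x. ln (H (x + u) / H x)) \<longlongrightarrow> ln 1) at_top"
      by (intro tendsto_ln) simp_all
    moreover have "\<forall>\<^sub>F x in at_top. ln (H (x + u) / H x) = ln (H (x + u)) - ln (H x)"
      using Hpos ev_shift[OF Hpos, of u]
      by eventually_elim (simp add: ln_div)
    ultimately show "((\<lambda>x. ln (H (x + u)) - ln (H x)) \<longlongrightarrow> 0) at_top"
      by (auto intro: Lim_transform_eventually)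
  qed measurable
  show "\<exists>C>0. \<forall>\<^sub>F x in at_top. \<forall>u\<ge>0. \<bar>H (x + u) - H x\<bar> \<le> C * \<beta> x * exp (u / 2)"
  proof -
    \<comment> \<open>The normalised increment tends to s u with |u| \<le> 2, so 3 bounds it
      eventually in absolute value.\<close>
    have "\<forall>\<^sub>F x in at_top. \<forall>u\<in>{0..1}. \<bar>H (x + u) - H x\<bar> \<le> 3 * (\<beta> x + \<beta> (x + u))"
    proof (rule uniform_increment_bound)
      fix u :: real assume u: "0 \<le> u" "u \<le> 2"
      have "\<forall>\<^sub>F x in at_top. s * (H (x + u) - H x) / \<beta> x < 3"
        by (rule order_tendstoD[OF lim\<beta>]) (use u in simp)
      moreover have "\<forall>\<^sub>F x in at_top. s * (H (x + u) - H x) / \<beta> x > - 3"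
        by (rule order_tendstoD[OF lim\<beta>]) (use u in simp)
      ultimately show "\<forall>\<^sub>F x in at_top. \<bar>H (x + u) - H x\<bar> \<le> 3 * \<beta> x"
        using \<beta>pos by eventually_elim (use s in \<open>auto simp: field_simps abs_le_iff\<close>)
    qed measurable
    \<comment> \<open>Rate 1/4 for \<beta>; the other quarter of the final rate 1/2 absorbs the
      number of unit steps.\<close>
    moreover have "\<forall>\<^sub>F x in at_top. \<forall>u\<ge>0. \<bar>ln (\<beta> (x + u)) - ln (\<beta> x)\<bar> \<le> 1/4 * (u + 1)"
      by (rule log_slow_uniform[OF ls\<beta>]) simp
    ultimately have "\<forall>\<^sub>F x in at_top. (\<forall>u\<in>{0..1}. \<bar>H (x + u) - H x\<bar> \<le> 3 * (\<beta> x + \<beta> (x + u))) \<and>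
        (\<forall>u\<ge>0. \<bar>ln (\<beta> (x + u)) - ln (\<beta> x)\<bar> \<le> 1/4 * (u + 1)) \<and> 0 < \<beta> x"
      using \<beta>pos by (intro eventually_conj)
    then obtain x1 where *: "\<And>x. x \<ge> x1 \<Longrightarrow> (\<forall>u\<in>{0..1}. \<bar>H (x + u) - H x\<bar> \<le> 3 * (\<beta> x + \<beta> (x + u))) \<and>
        (\<forall>u\<ge>0. \<bar>ln (\<beta> (x + u)) - ln (\<beta> x)\<bar> \<le> 1/4 * (u + 1)) \<and> 0 < \<beta> x"
      by (auto simp: eventually_at_top_linorder)
    have \<beta>grow: "\<beta> (x + u) \<le> \<beta> x * exp (1/4 * (u + 1))" if "x \<ge> x1" "u \<ge> 0" for x u
    proof -
      have "ln (\<beta> (x + u)) \<le> ln (\<beta> x) + 1/4 * (u + 1)"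
        using *[OF that(1), THEN conjunct2, THEN conjunct1, rule_format, OF that(2)] by linarith
      then have "exp (ln (\<beta> (x + u))) \<le> exp (ln (\<beta> x) + 1/4 * (u + 1))" by simp
      then show ?thesis using *[of x] *[of "x+u"] that by (simp add: exp_add)
    qed
    define C where "C = 3 * (1 + exp (1/2 :: real))"
    have C: "C > 0" by (simp add: C_def add_pos_pos)
    have loc: "\<bar>H (x + u) - H x\<bar> \<le> C * \<beta> x" if "x \<ge> x1" "0 \<le> u" "u \<le> 1" for x u
    proof -
      have "\<beta> (x + u) \<le> \<beta> x * exp (1/4 * (u + 1))" using that by (intro \<beta>grow)
      also have "\<dots> \<le> \<beta> x * exp (1/2)" using that *[of x] by (intro mult_left_mono) auto
      finally have "\<beta> (x + u) \<le> \<beta> x * exp (1/2)" .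
      moreover have "\<bar>H (x + u) - H x\<bar> \<le> 3 * (\<beta> x + \<beta> (x + u))" using *[of x] that by auto
      ultimately show ?thesis by (simp add: C_def algebra_simps)
    qed
    have step: "\<bar>H (x + real n) - H x\<bar> \<le> real n * (C * \<beta> x * exp (1/4 * (real n + 1)))" if x: "x \<ge> x1" for x n
    proof (induction n)
      case (Suc n)
      have 1: "\<bar>H (x + real n + 1) - H (x + real n)\<bar> \<le> C * \<beta> (x + real n)" using x by (intro loc) auto
      also have "\<dots> \<le> C * (\<beta> x * exp (1/4 * (real n + 1)))" using C x by (intro mult_left_mono \<beta>grow) auto
      also have "\<dots> \<le> C * \<beta> x * exp (1/4 * (real (Suc n) + 1))" using C x *[of x] by simp
      finally have 1: "\<bar>H (x + real n + 1) - H (x + real n)\<bar> \<le> C * \<beta> x * exp (1/4 * (real (Suc n) + 1))" .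
      have "real n * (C * \<beta> x * exp (1/4 * (real n + 1))) \<le> real n * (C * \<beta> x * exp (1/4 * (real (Suc n) + 1)))"
        using C x *[of x] by (intro mult_left_mono) auto
      with Suc have "\<bar>H (x + real n) - H x\<bar> \<le> real n * (C * \<beta> x * exp (1/4 * (real (Suc n) + 1)))" by linarith
      with 1 show ?case by (simp add: algebra_simps)
    qed simp
    show ?thesis
    proof (intro exI[of _ "4 * C * exp (1/2)"] conjI)
      show "\<forall>\<^sub>F x in at_top. \<forall>u\<ge>0. \<bar>H (x + u) - H x\<bar> \<le> 4 * C * exp (1/2) * \<beta> x * exp (u / 2)"
        unfolding eventually_at_top_linorder
      proof (intro exI[of _ x1] allI impI)
        fix x u :: real assume x: "x1 \<le> x" and u: "0 \<le> u"
        define n where "n = nat \<lfloor>u\<rfloor>"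
        have n: "real n \<le> u" "u < real n + 1" using u by (auto simp: n_def)
        have B: "0 < \<beta> x" using *[OF x] by simp
        have "\<bar>H (x + real n + (u - real n)) - H (x + real n)\<bar> \<le> C * \<beta> (x + real n)"
          using x n by (intro loc) auto
        also have "\<dots> \<le> C * (\<beta> x * exp (1/4 * (real n + 1)))" using C x by (intro mult_left_mono \<beta>grow) auto
        finally have "\<bar>H (x + u) - H x\<bar> \<le> (real n + 1) * (C * \<beta> x * exp (1/4 * (real n + 1)))"
          using step[OF x, of n] by (simp add: algebra_simps)
        also have "\<dots> \<le> (u + 1) * (C * \<beta> x * exp (1/4 * (u + 1)))"
          using n C B u by (intro mult_mono) auto
        also have "u + 1 \<le> 4 * exp (1/4 * (u + 1))"
        proof -
          have "4 * t \<le> 4 * exp t" for t :: real using exp_ge_add_one_self[of t] by linarith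
          from this[of "1/4 * (u + 1)"] show ?thesis by simp
        qed
        then have "(u + 1) * (C * \<beta> x * exp (1/4 * (u + 1))) \<le> (4 * exp (1/4 * (u + 1))) * (C * \<beta> x * exp (1/4 * (u + 1)))"
          using C B by (intro mult_right_mono) auto
        also have "\<dots> = 4 * C * \<beta> x * (exp (1/4 * (u + 1)) * exp (1/4 * (u + 1)))" by simp
        also have "exp (1/4 * (u + 1)) * exp (1/4 * (u + 1)) = exp (1/2) * exp (u / 2)"
          by (simp add: exp_add[symmetric] field_simps)
        finally show "\<bar>H (x + u) - H x\<bar> \<le> 4 * C * exp (1/2) * \<beta> x * exp (u / 2)"
          by (simp add: mult_ac)
      qed
    qed (use C in simp)
  qed
qed

section \<open>Inverses of functions with regularly varying derivative\<close>

text \<open>The derivative is a pointwise limit of difference quotients of the measurable function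
  R.\<close>

lemma borel_measurable_derivative_on:
  fixes R f :: "real \<Rightarrow> real"
  assumes [measurable]: "R \<in> borel_measurable borel"
    and D: "\<And>w. w \<in> {a<..<b} \<Longrightarrow> (R has_real_derivative f w) (at w)"
  shows "(\<lambda>w. indicator {a<..<b} w * f w) \<in> borel_measurable borel"
proof (rule borel_measurable_LIMSEQ_real)
  fix w :: real
  show "(\<lambda>n. indicator {a<..<b} w * ((R (w + inverse (real (Suc n))) - R w) / inverse (real (Suc n))))
      \<longlonglongrightarrow> indicator {a<..<b} w * f w"
  proof (cases "w \<in> {a<..<b}")
    case True
    have "((\<lambda>h. (R (w + h) - R w) / h) \<longlongrightarrow> f w) (at 0)"
      using D[OF True] by (simp add: DERIV_def)
    moreover have "filterlim (\<lambda>n. inverse (real (Suc n))) (at 0) sequentially"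
      using LIMSEQ_inverse_real_of_nat by (auto simp: filterlim_at)
    ultimately show ?thesis using True by (auto dest: filterlim_compose)
  qed simp
qed measurable

text \<open>To be read with R(w) = 1 - G(\<phi> - w), the conditional tail in terms of the distance
  w to the frontier, and f(w) = G'(\<phi> - w). The index \<rho> - 1 of f at 0 is the index 1 -
  \<rho> of the density hypothesis after t = 1/w.\<close>

locale vanishing_RV_derivative =
  fixes R f :: "real \<Rightarrow> real" and b \<rho> :: real
  assumes R_meas[measurable]: "R \<in> borel_measurable borel"
    and b: "b > 0" and rho: "\<rho> > 0"
    and R_deriv: "\<And>w. 0 < w \<Longrightarrow> w < b \<Longrightarrow> (R has_real_derivative f w) (at w)"
    and f_pos: "\<And>w. 0 < w \<Longrightarrow> w < b \<Longrightarrow> 0 < f w"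
    and R_0: "(R \<longlongrightarrow> 0) (at_right 0)"
    and f_RV: "\<And>z. z > 0 \<Longrightarrow> ((\<lambda>w. f (w * z) / f w) \<longlongrightarrow> z powr (\<rho> - 1)) (at_right 0)"
begin

lemma eventually_in: "\<forall>\<^sub>F w in at_right 0. 0 < w \<and> w < (c::real)" if "c > 0" for c
  using that by (auto simp: eventually_at_right_field)

lemma R_strict_mono: "0 < w \<Longrightarrow> w < w' \<Longrightarrow> w' < b \<Longrightarrow> R w < R w'"
  by (rule DERIV_pos_imp_increasing_open)
     (auto intro!: exI[of _ "f _"] R_deriv f_pos continuous_at_imp_continuous_on DERIV_isCont[OF R_deriv])

lemma R_pos: assumes "0 < w" "w < b" shows "0 < R w"
proof -
  have "0 \<le> R (w / 2)"
  proof (rule tendsto_upperbound[OF R_0])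
    show "\<forall>\<^sub>F v in at_right 0. R v \<le> R (w / 2)"
      using eventually_in[of "w/2"] assms
      by (auto elim!: eventually_mono intro!: less_imp_le R_strict_mono)
  qed simp
  also have "R (w / 2) < R w" using assms by (intro R_strict_mono) auto
  finally show ?thesis .
qed

lemma scale_right: "filterlim (\<lambda>w. w * z) (at_right 0) (at_right (0::real))" if "z > 0"
  using filterlim_times_pos[of "\<lambda>w. w" 0 "at_right 0" z 0] that
  by (auto simp: filterlim_ident mult.commute)

text \<open>Both R(w) and R(wz) vanish at 0, so l'Hopital reduces the quotient to z
  f(wz)/f(w).\<close>

lemma R_RV: assumes z: "z > 0" shows "((\<lambda>w. R (w * z) / R w) \<longlongrightarrow> z powr \<rho>) (at_right 0)"
proof (rule lhopital_right_0[where f'="\<lambda>w. z * f (w * z)" and g'=f])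
  have ev: "\<forall>\<^sub>F w in at_right 0. 0 < w \<and> w < min b (b / z)"
    using b z by (intro eventually_in) auto
  show "((\<lambda>w. R (w * z)) \<longlongrightarrow> 0) (at_right 0)"
    by (rule filterlim_compose[OF R_0 scale_right[OF z]])
  show "\<forall>\<^sub>F w in at_right 0. R w \<noteq> 0"
    using ev by eventually_elim (metis R_pos less_irrefl min_less_iff_conj)
  show "\<forall>\<^sub>F w in at_right 0. f w \<noteq> 0"
    using ev by eventually_elim (metis f_pos less_irrefl min_less_iff_conj)
  show "\<forall>\<^sub>F w in at_right 0. ((\<lambda>w. R (w * z)) has_real_derivative z * f (w * z)) (at w)"
    using ev
  proof eventually_elim
    case (elim w)
    then have "0 < w * z" "w * z < b" using z by (auto simp: field_simps)
    then have "(R has_real_derivative f (w * z)) (at (w * z))" by (rule R_deriv)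
    moreover have "((\<lambda>w. w * z) has_real_derivative z) (at w)" by (auto intro!: derivative_eq_intros)
    ultimately show ?case
      by (subst mult.commute[of z]) (rule DERIV_chain2)
  qed
  show "\<forall>\<^sub>F w in at_right 0. (R has_real_derivative f w) (at w)"
    using ev by eventually_elim (auto intro!: R_deriv)
  have "((\<lambda>w. z * (f (w * z) / f w)) \<longlongrightarrow> z * z powr (\<rho> - 1)) (at_right 0)"
    by (intro tendsto_intros f_RV z)
  also have "z * z powr (\<rho> - 1) = z powr \<rho>" using z by (simp add: powr_diff)
  finally show "filterlim (\<lambda>w. z * f (w * z) / f w) (nhds (z powr \<rho>)) (at_right 0)" by simp
qed (rule R_0)

text \<open>The elasticity d log R / d log w.\<close>

definition elast :: "real \<Rightarrow> real" where "elast w = w * f w / R w"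

lemma elast_pos: "0 < w \<Longrightarrow> w < b \<Longrightarrow> 0 < elast w"
  by (simp add: elast_def f_pos R_pos)

text \<open>The mean value theorem for log R(e^t), whose derivative in t is \<open>elast\<close> at
  e^t.\<close>

lemma ln_R_MVT:
  assumes "0 < w" "w < w'" "w' < b"
  obtains \<xi> where "w < \<xi>" "\<xi> < w'" "ln (R w') - ln (R w) = (ln w' - ln w) * elast \<xi>"
proof -
  have "\<exists>t. ln w < t \<and> t < ln w' \<and> ln (R (exp (ln w'))) - ln (R (exp (ln w))) = (ln w' - ln w) * elast (exp t)"
  proof (rule MVT2)
    fix t assume "ln w \<le> t" "t \<le> ln w'"
    then have "exp (ln w) \<le> exp t" "exp t \<le> exp (ln w')" by simp_all
    then have t: "0 < exp t" "exp t < b" using assms by auto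
    show "((\<lambda>t. ln (R (exp t))) has_real_derivative elast (exp t)) (at t)"
      unfolding elast_def
      by (rule derivative_eq_intros DERIV_chain2[OF R_deriv] refl t R_pos)+ (use t R_pos[OF t] in \<open>simp add: field_simps\<close>)
  qed (use assms in auto)
  then obtain t where "ln w < t" "t < ln w'" "ln (R w') - ln (R w) = (ln w' - ln w) * elast (exp t)"
    using assms by auto
  then show thesis using assms
    using exp_less_mono[of "ln w" t] exp_less_mono[of t "ln w'"] by (intro that[of "exp t"]) auto
qed

text \<open>Here x = -log w. Passing from w to wz multiplies w, f and 1/R by factors tending to z,
  z^{\<rho>-1} and z^{-\<rho>}, which cancel. The value 0 for e^{-x} \<ge> b secures measurability
  on the whole line.\<close>

lemma log_slow_elast: "log_slow (\<lambda>x. if exp (- x) < b then ln (elast (exp (- x))) else 0)"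
  (is "log_slow ?K")
  unfolding log_slow_def
proof (intro conjI allI)
  have [measurable]: "(\<lambda>w. indicator {0<..<b} w * f w) \<in> borel_measurable borel"
    by (rule borel_measurable_derivative_on[of R]) (auto intro: R_deriv)
  have "?K = (\<lambda>x. if exp (- x) < b then ln (exp (- x) * (indicator {0<..<b} (exp (- x)) * f (exp (- x))) / R (exp (- x))) else 0)"
    by (auto simp: elast_def fun_eq_iff)
  also have "\<dots> \<in> borel_measurable borel" by measurable
  finally show "?K \<in> borel_measurable borel" .
  fix u :: real
  define z where "z = exp (- u)"
  have z: "z > 0" by (simp add: z_def)
  then have mz: "min b (b / z) > 0" using b by simp
  have exp_right: "filterlim (\<lambda>x. exp (- x)) (at_right (0::real)) at_top"
    by (auto simp: filterlim_at intro!: filterlim_compose[OF exp_at_bot filterlim_uminus_at_bot_at_top])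
  have "((\<lambda>w. z * (f (w * z) / f w) / (R (w * z) / R w)) \<longlongrightarrow> z * z powr (\<rho> - 1) / z powr \<rho>) (at_right 0)"
    using z by (intro tendsto_divide tendsto_mult_left f_RV R_RV) auto
  also have "z * z powr (\<rho> - 1) / z powr \<rho> = 1" using z by (simp add: powr_diff)
  finally have "((\<lambda>w. ln (z * (f (w * z) / f w) / (R (w * z) / R w))) \<longlongrightarrow> ln 1) (at_right 0)"
    by (intro tendsto_ln) auto
  moreover have "\<forall>\<^sub>F w in at_right 0. ln (z * (f (w * z) / f w) / (R (w * z) / R w)) = ln (elast (w * z)) - ln (elast w)"
    using eventually_in[OF mz]
  proof eventually_elim
    case (elim w)
    then have w: "0 < w" "w < b" "0 < w * z" "w * z < b" using z by (auto simp: field_simps)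
    have "z * (f (w * z) / f w) / (R (w * z) / R w) = elast (w * z) / elast w"
      using w by (simp add: elast_def mult_ac)
    then show ?case using elast_pos[OF w(1,2)] elast_pos[OF w(3,4)] by (simp add: ln_div)
  qed
  ultimately have "((\<lambda>w. ln (elast (w * z)) - ln (elast w)) \<longlongrightarrow> 0) (at_right 0)"
    by (auto intro: Lim_transform_eventually)
  then have "((\<lambda>x. ln (elast (exp (- x) * z)) - ln (elast (exp (- x)))) \<longlongrightarrow> 0) at_top"
    by (rule filterlim_compose[OF _ exp_right])
  moreover have "\<forall>\<^sub>F x in at_top. exp (- x) < b \<and> exp (- x) * z < b"
  proof -
    have "\<forall>\<^sub>F w in at_right 0. w < b \<and> w * z < b"
      using eventually_in[of "min b (b/z)"] b z by (auto elim!: eventually_mono simp: field_simps)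
    then show ?thesis using exp_right unfolding filterlim_iff by blast
  qed
  then have "\<forall>\<^sub>F x in at_top. ln (elast (exp (- x) * z)) - ln (elast (exp (- x))) = ?K (x + u) - ?K x"
    by eventually_elim (simp add: z_def exp_add[symmetric])
  ultimately show "((\<lambda>x. ?K (x + u) - ?K x) \<longlongrightarrow> 0) at_top"
    by (auto intro: Lim_transform_eventually)
qed

text \<open>A Karamata theorem for the derivative, without integration: log(R(ew)/R(w)) tends to
  \<rho> and equals the elasticity at some point of ]w, ew[, from which slow variation, uniform over
  unit windows of log w, leads back to w.\<close>

lemma elast_tendsto: "(elast \<longlongrightarrow> \<rho>) (at_right 0)"
proof -
  let ?K = "\<lambda>x. if exp (- x) < b then ln (elast (exp (- x))) else 0"
  have "((\<lambda>w. ln (elast w)) \<longlongrightarrow> ln \<rho>) (at_right 0)"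
  proof (rule tendstoI)
    fix e :: real assume e: "e > 0"
    from log_slow_two_sided[OF log_slow_elast, of "e/2"] e obtain x1
      where x1: "\<forall>x\<ge>x1. \<forall>u\<in>{-1..1}. \<bar>?K (x + u) - ?K x\<bar> \<le> e / 2"
      unfolding eventually_at_top_linorder by (metis half_gt_zero)
    have lim: "((\<lambda>w. ln (ln (R (w * exp 1) / R w))) \<longlongrightarrow> ln (ln (exp 1 powr \<rho>))) (at_right 0)"
      using rho by (intro tendsto_ln R_RV) auto
    have "\<forall>\<^sub>F w in at_right 0. dist (ln (ln (R (w * exp 1) / R w))) (ln \<rho>) < e / 2"
      using tendstoD[OF lim, of "e/2"] e by simp
    moreover have "\<forall>\<^sub>F w in at_right 0. 0 < w \<and> w < min (b / exp 1) (exp (- x1 - 1))"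
      using b by (intro eventually_in) auto
    ultimately show "\<forall>\<^sub>F w in at_right 0. dist (ln (elast w)) (ln \<rho>) < e"
    proof eventually_elim
      case (elim w)
      define w' where "w' = w * exp 1"
      have e1: "(1::real) < exp 1" by simp
      have w: "0 < w" "w < w'" "w' < b" "w' < exp (- x1)"
        using elim e1 by (auto simp: w'_def field_simps exp_diff exp_minus)
      have lnw': "ln w' = ln w + 1" using w by (simp add: w'_def ln_mult)
      obtain \<xi> where \<xi>: "w < \<xi>" "\<xi> < w'" "ln (R w') - ln (R w) = (ln w' - ln w) * elast \<xi>"
        by (rule ln_R_MVT[OF w(1-3)])
      have "ln (R w' / R w) = elast \<xi>"
        using \<xi> w R_pos[of w] R_pos[of w'] lnw' by (simp add: ln_div)
      then have 1: "\<bar>ln (elast \<xi>) - ln \<rho>\<bar> < e / 2" using elim by (simp add: w'_def dist_real_def)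
      define x where "x = - ln \<xi>"
      define u where "u = ln \<xi> - ln w"
      have "ln \<xi> < ln w'" using \<xi> w by (subst ln_less_cancel_iff) auto
      then have "ln \<xi> \<le> ln w + 1" using lnw' by simp
      moreover have "ln w \<le> ln \<xi>" using \<xi> w by (subst ln_le_cancel_iff) auto
      ultimately have u: "u \<in> {-1..1}" by (simp add: u_def)
      have "ln \<xi> \<le> ln (exp (- x1))" using \<xi> w by (subst ln_le_cancel_iff) auto
      then have "x \<ge> x1" by (simp add: x_def)
      from x1[rule_format, OF this u] have "\<bar>ln (elast w) - ln (elast \<xi>)\<bar> \<le> e / 2"
        using \<xi> w by (simp add: x_def u_def)
      with 1 have "\<bar>ln (elast w) - ln \<rho>\<bar> < e" by linarith
      then show ?case by (simp add: dist_real_def)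
    qed
  qed
  then have "((\<lambda>w. exp (ln (elast w))) \<longlongrightarrow> exp (ln \<rho>)) (at_right 0)" by (rule tendsto_exp)
  moreover have "\<forall>\<^sub>F w in at_right 0. exp (ln (elast w)) = elast w"
    using eventually_in[OF b] by eventually_elim (simp add: elast_pos)
  ultimately show ?thesis using rho by (auto intro: Lim_transform_eventually)
qed

text \<open>D inverts R up to the factor c, so a chord of log D against log v has slope
  1/\<open>elast\<close> at an intermediate point, and that point tends to 0. The value 1/\<rho> at
  a z = a' z is a convention that lets the two points coincide.\<close>

lemma log_inverse_slope:
  fixes D :: "real \<Rightarrow> real"
  assumes D: "filterlim D (at_right 0) (at_right 0)"
    and inv: "\<forall>\<^sub>F v in at_right 0. R (D v) = c * v" and c: "c > 0"
    and a: "filterlim a (at_right 0) F" and a': "filterlim a' (at_right 0) F"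
  shows "((\<lambda>z. if a z = a' z then 1 / \<rho> else (ln (D (a z)) - ln (D (a' z))) / (ln (a z) - ln (a' z)))
     \<longlongrightarrow> 1 / \<rho>) F"
proof -
  have lim: "((\<lambda>w. 1 / elast w) \<longlongrightarrow> 1 / \<rho>) (at_right 0)"
    using rho by (intro tendsto_intros elast_tendsto) auto
  show ?thesis
  proof (rule tendstoI)
    fix e :: real assume e: "e > 0"
    from tendstoD[OF lim e] obtain d where d: "d > 0" "\<And>w. 0 < w \<Longrightarrow> w < d \<Longrightarrow> dist (1 / elast w) (1 / \<rho>) < e"
      unfolding eventually_at_right_field by auto
    have "\<forall>\<^sub>F v in at_right 0. 0 < D v \<and> D v < min b d"
      using eventually_in[of "min b d"] b d D unfolding filterlim_iff by auto
    with inv have "\<forall>\<^sub>F v in at_right 0. R (D v) = c * v \<and> 0 < D v \<and> D v < min b d" by (rule eventually_conj)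
    then have "\<forall>\<^sub>F v in at_right 0. R (D v) = c * v \<and> 0 < D v \<and> D v < min b d \<and> 0 < v"
      using eventually_in[OF b] by eventually_elim auto
    note ev = this
    have "\<forall>\<^sub>F z in F. (R (D (a z)) = c * a z \<and> 0 < D (a z) \<and> D (a z) < min b d \<and> 0 < a z) \<and>
        (R (D (a' z)) = c * a' z \<and> 0 < D (a' z) \<and> D (a' z) < min b d \<and> 0 < a' z)"
      using filterlim_iff[THEN iffD1, OF a, rule_format, OF ev] filterlim_iff[THEN iffD1, OF a', rule_format, OF ev]
      by (rule eventually_conj)
    then show "\<forall>\<^sub>F z in F. dist (if a z = a' z then 1 / \<rho> else (ln (D (a z)) - ln (D (a' z))) / (ln (a z) - ln (a' z))) (1 / \<rho>) < e"
    proof eventually_elim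
      case (elim z)
      show ?case
      proof (cases "a z = a' z")
        case False
        \<comment> \<open>Stated for w' < w; the other order follows by changing both signs in the
          quotient.\<close>
        have *: "dist ((ln w - ln w') / (ln v - ln v')) (1 / \<rho>) < e"
          if h: "R w = c * v" "0 < w" "w < min b d" "R w' = c * v'" "0 < w'" "w' < min b d" "0 < v" "0 < v'" "w' < w" for w w' v v'
        proof -
          obtain \<xi> where \<xi>: "w' < \<xi>" "\<xi> < w" "ln (R w) - ln (R w') = (ln w - ln w') * elast \<xi>"
            by (rule ln_R_MVT[of w' w]) (use h in auto)
          have "ln v - ln v' = (ln w - ln w') * elast \<xi>" using \<xi>(3) h c by (simp add: ln_mult)
          moreover have "ln w - ln w' \<noteq> 0" using h by simp
          moreover have "elast \<xi> > 0" using \<xi> h by (intro elast_pos) auto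
          ultimately have "(ln w - ln w') / (ln v - ln v') = 1 / elast \<xi>" by simp
          then show ?thesis using d(2)[of \<xi>] \<xi> h by simp
        qed
        have ne: "D (a z) \<noteq> D (a' z)" using elim False c by auto
        show ?thesis
        proof (cases "D (a' z) < D (a z)")
          case True
          have "dist ((ln (D (a z)) - ln (D (a' z))) / (ln (a z) - ln (a' z))) (1 / \<rho>) < e"
            by (rule *) (use elim True in simp_all)
          with False show ?thesis by simp
        next
          case lt: False
          have "dist ((ln (D (a' z)) - ln (D (a z))) / (ln (a' z) - ln (a z))) (1 / \<rho>) < e"
            by (rule *) (use elim lt ne in simp_all)
          then show ?thesis
            using False minus_divide_divide[of "ln (D (a z)) - ln (D (a' z))" "ln (a z) - ln (a' z)"] by simp
        qed
      qed (use e in simp)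
    qed
  qed
qed

end

section \<open>Order statistics of uniform variables\<close>

text \<open>The \<open>(i+1)\<close>-st largest of \<open>z\<^sub>0, \<dots>, z\<^sub>n\<^sub>-\<^sub>1\<close> if this is nonnegative, and \<open>0\<close> otherwise or if \<open>i \<ge> n\<close>.\<close>

definition upper_os :: "nat \<Rightarrow> (nat \<Rightarrow> real) \<Rightarrow> nat \<Rightarrow> real" where
  "upper_os n z i = Inf {y. 0 \<le> y \<and> card {j\<in>{..<n}. y < z j} \<le> i}"

text \<open>The infimum is attained, since the count is constant between the candidate m and the
  next larger sample value. This equivalence makes order statistics measurable and comparable with
  counts.\<close>

lemma upper_os_le_iff:
  "upper_os n z i \<le> y \<longleftrightarrow> 0 \<le> y \<and> card {j\<in>{..<n}. y < z j} \<le> i"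
proof -
  define L where "L = {y. 0 \<le> y \<and> card {j\<in>{..<n}. y < z j} \<le> i}"
  define m where "m = Inf L"
  have lb: "bdd_below L" by (auto simp: L_def)
  have up: "y' \<in> L" if "y \<in> L" "y \<le> y'" for y y'
  proof -
    have "card {j\<in>{..<n}. y' < z j} \<le> card {j\<in>{..<n}. y < z j}"
      using that by (intro card_mono) auto
    then show ?thesis using that by (auto simp: L_def)
  qed
  have "(\<Sum>j<n. \<bar>z j\<bar>) \<in> L"
  proof -
    have "z j \<le> (\<Sum>j<n. \<bar>z j\<bar>)" if "j < n" for j
      using member_le_sum[of j "{..<n}" "\<lambda>j. \<bar>z j\<bar>"] that by auto
    then have e: "{j\<in>{..<n}. (\<Sum>j<n. \<bar>z j\<bar>) < z j} = {}" using leD by blast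
    show ?thesis unfolding L_def mem_Collect_eq e by (simp add: sum_nonneg)
  qed
  then have ne: "L \<noteq> {}" by auto
  have m0: "0 \<le> m" unfolding m_def using ne by (intro cInf_greatest) (auto simp: L_def)
  have "m \<in> L"
  proof (cases "{j\<in>{..<n}. m < z j} = {}")
    case False
    \<comment> \<open>The smallest sample value above m: a point of L in [m, \<mu>[ exists and has
      the same count as m.\<close>
    define \<mu> where "\<mu> = Min (z ` {j\<in>{..<n}. m < z j})"
    have "\<mu> \<in> z ` {j\<in>{..<n}. m < z j}" unfolding \<mu>_def using False by (intro Min_in) auto
    then have "m < \<mu>" by auto
    then obtain y where y: "y \<in> L" "y < \<mu>" using cInf_lessD[OF ne] by (auto simp: m_def)
    have "m \<le> y" unfolding m_def using y lb by (intro cInf_lower)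
    have "\<mu> \<le> z j" if "j < n" "m < z j" for j
      unfolding \<mu>_def using that by (intro Min_le) auto
    then have "{j\<in>{..<n}. m < z j} = {j\<in>{..<n}. y < z j}"
      using y(2) \<open>m \<le> y\<close> by force
    then show ?thesis using y(1) m0 by (simp add: L_def)
  next
    case True
    show ?thesis unfolding L_def mem_Collect_eq True by (simp add: m0)
  qed
  then have "m \<le> y \<longleftrightarrow> y \<in> L"
    using up lb by (auto simp: m_def intro: cInf_lower)
  then show ?thesis by (simp add: m_def L_def upper_os_def)
qed

lemma upper_os_nonneg: "0 \<le> upper_os n z i"
  using upper_os_le_iff[of n z i "upper_os n z i"] by simp

lemma upper_os_eqI:
  assumes "0 \<le> c" "card {j\<in>{..<n}. c < z j} \<le> i" "\<And>y. 0 \<le> y \<Longrightarrow> y < c \<Longrightarrow> i < card {j\<in>{..<n}. y < z j}"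
  shows "upper_os n z i = c"
proof (rule antisym)
  show "upper_os n z i \<le> c" using assms by (simp add: upper_os_le_iff)
  show "c \<le> upper_os n z i"
    using assms(3)[OF upper_os_nonneg, of n z i] upper_os_le_iff[of n z i "upper_os n z i"] by force
qed

lemma upper_os_sorted:
  assumes "\<And>j j'. j \<le> j' \<Longrightarrow> j' < n \<Longrightarrow> z j' \<le> z j" "i < n" "0 \<le> z i"
  shows "upper_os n z i = z i"
proof (rule upper_os_eqI)
  have "{j\<in>{..<n}. z i < z j} \<subseteq> {..<i}"
    using assms(1)[of i] by (force simp: not_less[symmetric])
  from card_mono[OF _ this] show "card {j\<in>{..<n}. z i < z j} \<le> i" by simp
  fix y assume "y < z i"
  then have "{..i} \<subseteq> {j\<in>{..<n}. y < z j}"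
    using assms(1)[of _ i] assms(2) by force
  from card_mono[OF _ this] show "i < card {j\<in>{..<n}. y < z j}" by simp
qed fact

lemma upper_os_cong: "(\<And>j. j < n \<Longrightarrow> z j = z' j) \<Longrightarrow> upper_os n z i = upper_os n z' i"
  unfolding upper_os_def by (intro arg_cong[where f=Inf] Collect_cong conj_cong refl arg_cong[where f="\<lambda>A. card A \<le> i"]) auto

lemma upper_os_permutes:
  assumes "\<pi> permutes {..<n}"
  shows "upper_os n (z \<circ> \<pi>) i = upper_os n z i"
proof -
  have "card {j\<in>{..<n}. y < (z \<circ> \<pi>) j} = card {j\<in>{..<n}. y < z j}" for y
  proof (rule bij_betw_same_card)
    show "bij_betw \<pi> {j\<in>{..<n}. y < (z \<circ> \<pi>) j} {j\<in>{..<n}. y < z j}"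
      unfolding bij_betw_def
    proof
      show "inj_on \<pi> {j\<in>{..<n}. y < (z \<circ> \<pi>) j}"
        using permutes_inj[OF assms] by (rule inj_on_subset) auto
      show "\<pi> ` {j\<in>{..<n}. y < (z \<circ> \<pi>) j} = {j\<in>{..<n}. y < z j}"
        using permutes_in_image[OF assms] permutes_surj[OF assms]
        by (auto simp: image_iff) (metis lessThan_iff surjD)
    qed
  qed
  then show ?thesis unfolding upper_os_def by simp
qed

lemma borel_measurable_upper_os[measurable (raw)]:
  assumes [measurable]: "\<And>j. j < n \<Longrightarrow> z j \<in> borel_measurable M"
  shows "(\<lambda>\<omega>. upper_os n (\<lambda>j. z j \<omega>) i) \<in> borel_measurable M"
  unfolding borel_measurable_iff_le
proof
  fix a
  have c: "real (card {j\<in>{..<n}. a < z j \<omega>}) = (\<Sum>j<n. of_bool (a < z j \<omega>))" for \<omega>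
    by (simp add: sum.If_cases of_bool_def Int_def)
  have "(\<lambda>\<omega>. \<Sum>j<n. of_bool (a < z j \<omega>) :: real) \<in> borel_measurable M"
    by (intro borel_measurable_sum) measurable
  then have "{\<omega> \<in> space M. 0 \<le> a \<and> (\<Sum>j<n. of_bool (a < z j \<omega>)) \<le> real i} \<in> sets M" by measurable
  then show "{\<omega> \<in> space M. upper_os n (\<lambda>j. z j \<omega>) i \<le> a} \<in> sets M"
    by (simp add: upper_os_le_iff c[symmetric])
qed

lemma obtain_sorting_permutation:
  fixes v :: "nat \<Rightarrow> 'a::linorder"
  assumes inj: "inj_on v {..<n}"
  obtains \<sigma> where "\<sigma> permutes {..<n}" "\<And>i j. i < n \<Longrightarrow> j < n \<Longrightarrow> v (\<sigma> i) < v (\<sigma> j) \<longleftrightarrow> i < j"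
proof -
  define xs where "xs = sorted_list_of_set (v ` {..<n})"
  have len: "length xs = n" using card_image[OF inj] by (simp add: xs_def)
  have sd: "sorted_wrt (<) xs" by (simp add: xs_def)
  have set: "set xs = v ` {..<n}" by (simp add: xs_def)
  define \<sigma> where "\<sigma> j = (if j < n then inv_into {..<n} v (xs ! j) else j)" for j
  have v\<sigma>: "v (\<sigma> j) = xs ! j" "\<sigma> j < n" if "j < n" for j
  proof -
    have "xs ! j \<in> v ` {..<n}" using that len set by (metis nth_mem)
    then show "v (\<sigma> j) = xs ! j" "\<sigma> j < n"
      using that f_inv_into_f[of "xs ! j" v "{..<n}"] inv_into_into[of "xs ! j" v "{..<n}"] by (auto simp: \<sigma>_def)
  qed
  have less: "xs ! i < xs ! j \<longleftrightarrow> i < j" if "i < n" "j < n" for i j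
    using that len sorted_wrt_nth_less[OF sd, of i j] sorted_wrt_nth_less[OF sd, of j i]
    by (cases i j rule: linorder_cases) auto
  have "inj_on \<sigma> {..<n}"
  proof (rule inj_onI)
    fix i j assume ij: "i \<in> {..<n}" "j \<in> {..<n}" "\<sigma> i = \<sigma> j"
    then have "xs ! i = xs ! j" using v\<sigma>[of i] v\<sigma>[of j] by simp
    then show "i = j" using less[of i j] less[of j i] ij by (cases i j rule: linorder_cases) auto
  qed
  then have "bij_betw \<sigma> {..<n} {..<n}"
    unfolding bij_betw_def using v\<sigma> by (intro conjI endo_inj_surj) auto
  then have "\<sigma> permutes {..<n}" by (rule bij_imp_permutes) (simp add: \<sigma>_def)
  then show thesis using v\<sigma> less by (intro that[of \<sigma>]) auto
qed

text \<open>Only the split at coordinate k is fixed. The order among the first k coordinates and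
  among the remaining ones stays free, which leaves the first k independent once the others are
  given.\<close>

definition pivot :: "nat \<Rightarrow> nat \<Rightarrow> (nat \<Rightarrow> 'a::linorder) \<Rightarrow> bool" where
  "pivot n k v \<longleftrightarrow> (\<forall>j<k. v j < v k) \<and> (\<forall>j\<in>{k<..<n}. v k < v j)"

text \<open>Composition with the permutation that sorts v is a bijection between the two sets, so
  the count, k!(n-k-1)!, is the same for all injective v.\<close>

lemma card_pivot_permutations:
  fixes v :: "nat \<Rightarrow> 'a::linorder"
  assumes "inj_on v {..<n}" "k < n"
  shows "card {\<pi>. \<pi> permutes {..<n} \<and> pivot n k (v \<circ> \<pi>)} = card {\<pi>. \<pi> permutes {..<n} \<and> pivot n k \<pi>}"
proof -
  obtain \<sigma> where \<sigma>: "\<sigma> permutes {..<n}" "\<And>i j. i < n \<Longrightarrow> j < n \<Longrightarrow> v (\<sigma> i) < v (\<sigma> j) \<longleftrightarrow> i < j"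
    by (rule obtain_sorting_permutation[OF assms(1)]) blast
  have piv: "pivot n k (v \<circ> (\<sigma> \<circ> \<tau>)) \<longleftrightarrow> pivot n k \<tau>" if "\<tau> permutes {..<n}" for \<tau>
  proof -
    have "\<tau> j < n" if "j < n" for j using permutes_in_image[OF \<open>\<tau> permutes _\<close>, of j] that by simp
    then show ?thesis using assms(2) \<sigma>(2) by (auto simp: pivot_def)
  qed
  have "bij_betw (\<lambda>\<tau>. \<sigma> \<circ> \<tau>) {\<pi>. \<pi> permutes {..<n} \<and> pivot n k \<pi>}
      {\<pi>. \<pi> permutes {..<n} \<and> pivot n k (v \<circ> \<pi>)}"
  proof (rule bij_betwI[where g="\<lambda>\<pi>. inv \<sigma> \<circ> \<pi>"])
    show "(\<lambda>\<pi>. inv \<sigma> \<circ> \<pi>) \<in> {\<pi>. \<pi> permutes {..<n} \<and> pivot n k (v \<circ> \<pi>)} \<rightarrow> {\<pi>. \<pi> permutes {..<n} \<and> pivot n k \<pi>}"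
    proof safe
      fix \<pi> assume "\<pi> permutes {..<n}" "pivot n k (v \<circ> \<pi>)"
      then show p: "inv \<sigma> \<circ> \<pi> permutes {..<n}" using \<sigma> by (intro permutes_compose permutes_inv)
      have "\<sigma> \<circ> (inv \<sigma> \<circ> \<pi>) = \<pi>" using permutes_surj[OF \<sigma>(1)] by (simp add: fun_eq_iff surj_f_inv_f)
      then show "pivot n k (inv \<sigma> \<circ> \<pi>)" using piv[OF p] \<open>pivot n k (v \<circ> \<pi>)\<close> by simp
    qed
  qed (use piv \<sigma> permutes_inj[OF \<sigma>(1)] permutes_surj[OF \<sigma>(1)] in
      \<open>auto intro!: permutes_compose simp: fun_eq_iff inv_f_f surj_f_inv_f\<close>)
  then show ?thesis by (rule bij_betw_same_card[symmetric])
qed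

lemma card_pivot_pos:
  assumes "k < n" shows "0 < card {\<pi>. \<pi> permutes {..<n} \<and> pivot n k (\<pi> :: nat \<Rightarrow> nat)}"
proof -
  have "id \<in> {\<pi>. \<pi> permutes {..<n} \<and> pivot n k \<pi>}" by (auto simp: permutes_id pivot_def)
  moreover have "finite {\<pi>. \<pi> permutes {..<n} \<and> pivot n k \<pi>}"
    by (rule finite_subset[OF _ finite_permutations[of "{..<n}"]]) auto
  ultimately show ?thesis unfolding card_gt_0_iff by blast
qed

text \<open>Counted from the top and from 0, the (k+1)-st smallest of n values has index n - Suc k,
  the number of values that exceed it.\<close>

lemma upper_os_pivot:
  fixes v :: "nat \<Rightarrow> real"
  assumes "pivot n k v" "k < n" "0 \<le> v k"
  shows "upper_os n v (n - Suc k) = v k"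
proof (rule upper_os_eqI)
  have "{j\<in>{..<n}. v k < v j} \<subseteq> {k<..<n}"
    using assms by (auto simp: pivot_def) (metis less_asym nat_neq_iff)
  from card_mono[OF _ this] show "card {j\<in>{..<n}. v k < v j} \<le> n - Suc k" by simp
  fix y assume "y < v k"
  have "y < v j" if "j \<in> {k..<n}" for j
    using assms(1) that \<open>y < v k\<close> less_trans[of y "v k" "v j"] by (cases "j = k") (auto simp: pivot_def)
  then have "{k..<n} \<subseteq> {j\<in>{..<n}. y < v j}" by auto
  from card_mono[OF _ this] show "n - Suc k < card {j\<in>{..<n}. y < v j}"
    using assms(2) by simp
qed fact

section \<open>Uniform variables and their finite products\<close>

definition unif :: "real measure" where "unif = uniform_measure lborel {0<..<1}"

lemma sets_unif[simp, measurable_cong]: "sets unif = sets borel" by (simp add: unif_def)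
lemma space_unif[simp]: "space unif = UNIV" by (simp add: unif_def)

lemma emeasure_unif: "A \<in> sets borel \<Longrightarrow> emeasure unif A = emeasure lborel (A \<inter> {0<..<1})"
  by (simp add: unif_def Int_commute divide_ennreal_def)

interpretation unif: prob_space unif
  unfolding unif_def by (intro prob_space_uniform_measure) auto

interpretation unifs: product_prob_space "\<lambda>_::nat. unif" I for I ..

lemma AE_unif: "AE v in unif. 0 < v \<and> v < 1"
  unfolding unif_def by (rule AE_uniform_measureI) auto

lemma unif_scale:
  assumes s: "0 < s" "s < 1" and A[measurable]: "A \<in> sets borel"
  shows "emeasure unif (A \<inter> {..<s}) = ennreal s * emeasure unif {v. s * v \<in> A}"
proof -
  have m: "(\<lambda>v. s * v) -` A \<in> sets borel" by (rule measurable_sets_borel[OF _ A]) simp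
  have "emeasure unif (A \<inter> {..<s}) = emeasure lborel (A \<inter> {0<..<s})"
    using s by (subst emeasure_unif) (auto intro!: arg_cong[where f="emeasure lborel"])
  also have "\<dots> = emeasure (density (distr lborel borel ((*) s)) (\<lambda>_. ennreal \<bar>s\<bar>)) (A \<inter> {0<..<s})"
    using lborel_distr_mult'[of s] s by simp
  also have "\<dots> = ennreal s * emeasure (distr lborel borel ((*) s)) (A \<inter> {0<..<s})"
    using s by (subst emeasure_density) (auto simp: nn_integral_cmult_indicator)
  also have "emeasure (distr lborel borel ((*) s)) (A \<inter> {0<..<s}) = emeasure lborel ((*) s -` (A \<inter> {0<..<s}))"
    by (subst emeasure_distr) auto
  also have "(*) s -` (A \<inter> {0<..<s}) = ((\<lambda>v. s * v) -` A) \<inter> {0<..<1}"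
    using s by (auto simp: zero_less_mult_iff)
  also have "emeasure lborel \<dots> = emeasure unif ((\<lambda>v. s * v) -` A)"
    using m by (simp add: emeasure_unif)
  finally show ?thesis by (simp add: vimage_def)
qed

text \<open>Both sides integrate h against one finite product measure, that of \<open>unif\<close>
  restricted below s. Its descriptions by a density and by a scaled image agree on rectangles, which
  determine it.\<close>

lemma PiM_unif_scale:
  assumes s: "0 < s" "s < 1" and fin: "finite I"
    and h[measurable]: "h \<in> borel_measurable (PiM I (\<lambda>_::nat. borel))"
  shows "(\<integral>\<^sup>+y. indicator {y. \<forall>j\<in>I. y j < s} y * h y \<partial>PiM I (\<lambda>_. unif)) =
    ennreal s ^ card I * (\<integral>\<^sup>+y. h (\<lambda>j\<in>I. s * y j) \<partial>PiM I (\<lambda>_. unif))"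
proof -
  let ?P = "PiM I (\<lambda>_::nat. unif)"
  define N where "N = density unif (indicator {..<s})"
  have N: "emeasure N A = emeasure unif (A \<inter> {..<s})" if "A \<in> sets borel" for A
    using that unfolding N_def by (subst emeasure_density) (auto simp: indicator_inter_arith[symmetric] Int_commute)
  have sN[simp, measurable_cong]: "sets N = sets borel" by (simp add: N_def)
  have spN[simp]: "space N = UNIV" by (simp add: N_def)
  interpret N: finite_measure N
    by standard (auto simp: N less_top[symmetric] intro!: unif.emeasure_finite)
  interpret PN: product_sigma_finite "\<lambda>_::nat. N" by standard
  have sP: "sets ?P = sets (PiM I (\<lambda>_. borel))" by (intro sets_PiM_cong) auto
  have spP: "space ?P = extensional I" by (simp add: space_PiM PiE_def)
  have ind: "{y\<in>space ?P. \<forall>j\<in>I. y j < s} \<in> sets ?P" using fin by measurable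
  have "density ?P (indicator {y\<in>space ?P. \<forall>j\<in>I. y j < s}) = PiM I (\<lambda>_. N)"
  proof (rule PN.PiM_eqI[OF fin])
    show "sets (density ?P (indicator {y \<in> space ?P. \<forall>j\<in>I. y j < s})) = sets (PiM I (\<lambda>_. N))"
      by (simp, intro sets_PiM_cong) auto
    fix A assume A: "\<And>i. i \<in> I \<Longrightarrow> A i \<in> sets N"
    then have [measurable]: "Pi\<^sub>E I A \<in> sets ?P" using fin by (intro sets_PiM_I_finite) auto
    have "emeasure (density ?P (indicator {y \<in> space ?P. \<forall>j\<in>I. y j < s})) (Pi\<^sub>E I A)
      = emeasure ?P (Pi\<^sub>E I A \<inter> {y \<in> space ?P. \<forall>j\<in>I. y j < s})"
      using ind by (subst emeasure_density) (auto simp: indicator_inter_arith[symmetric] Int_commute)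
    also have "Pi\<^sub>E I A \<inter> {y \<in> space ?P. \<forall>j\<in>I. y j < s} = Pi\<^sub>E I (\<lambda>i. A i \<inter> {..<s})"
      by (auto simp: spP PiE_def Pi_iff)
    also have "emeasure ?P \<dots> = (\<Prod>i\<in>I. emeasure N (A i))"
      using A fin by (subst unifs.emeasure_PiM) (auto simp: N intro!: prod.cong)
    finally show "emeasure (density ?P (indicator {y \<in> space ?P. \<forall>j\<in>I. y j < s})) (Pi\<^sub>E I A) = (\<Prod>i\<in>I. emeasure N (A i))" .
  qed
  moreover have "scale_measure (ennreal s ^ card I) (distr ?P ?P (\<lambda>y. \<lambda>j\<in>I. s * y j)) = PiM I (\<lambda>_. N)"
  proof (rule PN.PiM_eqI[OF fin])
    show "sets (scale_measure (ennreal s ^ card I) (distr ?P ?P (\<lambda>y. \<lambda>j\<in>I. s * y j))) = sets (PiM I (\<lambda>_. N))"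
      by (simp, intro sets_PiM_cong) auto
    fix A assume A: "\<And>i. i \<in> I \<Longrightarrow> A i \<in> sets N"
    then have PA[measurable]: "Pi\<^sub>E I A \<in> sets ?P" using fin by (intro sets_PiM_I_finite) auto
    have Am: "{v. s * v \<in> A i} \<in> sets borel" if "i \<in> I" for i
      using measurable_sets_borel[of "\<lambda>v. s * v" borel "A i"] A[OF that] by (simp add: vimage_def)
    have "emeasure (distr ?P ?P (\<lambda>y. \<lambda>j\<in>I. s * y j)) (Pi\<^sub>E I A) =
      emeasure ?P ((\<lambda>y. \<lambda>j\<in>I. s * y j) -` Pi\<^sub>E I A \<inter> space ?P)"
      by (rule emeasure_distr) auto
    also have "(\<lambda>y. \<lambda>j\<in>I. s * y j) -` Pi\<^sub>E I A \<inter> space ?P = Pi\<^sub>E I (\<lambda>i. {v. s * v \<in> A i})"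
      by (auto simp: spP PiE_def Pi_iff)
    also have "emeasure ?P \<dots> = (\<Prod>i\<in>I. emeasure unif {v. s * v \<in> A i})"
      using Am fin by (subst unifs.emeasure_PiM) auto
    finally have "emeasure (distr ?P ?P (\<lambda>y. \<lambda>j\<in>I. s * y j)) (Pi\<^sub>E I A) = (\<Prod>i\<in>I. emeasure unif {v. s * v \<in> A i})" .
    moreover have "(\<Prod>i\<in>I. emeasure N (A i)) = (\<Prod>i\<in>I. ennreal s * emeasure unif {v. s * v \<in> A i})"
      using A s by (intro prod.cong refl) (simp add: N unif_scale)
    ultimately show "emeasure (scale_measure (ennreal s ^ card I) (distr ?P ?P (\<lambda>y. \<lambda>j\<in>I. s * y j))) (Pi\<^sub>E I A) = (\<Prod>i\<in>I. emeasure N (A i))"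
      by (simp only: emeasure_scale_measure prod.distrib prod_constant)
  qed
  ultimately have eq: "density ?P (indicator {y\<in>space ?P. \<forall>j\<in>I. y j < s}) =
      scale_measure (ennreal s ^ card I) (distr ?P ?P (\<lambda>y. \<lambda>j\<in>I. s * y j))" by simp
  have h': "h \<in> borel_measurable ?P" using h sP measurable_cong_sets by blast
  have "(\<integral>\<^sup>+y. indicator {y. \<forall>j\<in>I. y j < s} y * h y \<partial>?P) = (\<integral>\<^sup>+y. indicator {y\<in>space ?P. \<forall>j\<in>I. y j < s} y * h y \<partial>?P)"
    by (intro nn_integral_cong) (auto simp: indicator_def)
  also have "\<dots> = (\<integral>\<^sup>+y. h y \<partial>density ?P (indicator {y\<in>space ?P. \<forall>j\<in>I. y j < s}))"
    using ind h' by (subst nn_integral_density) auto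
  also have "\<dots> = ennreal s ^ card I * (\<integral>\<^sup>+y. h y \<partial>distr ?P ?P (\<lambda>y. \<lambda>j\<in>I. s * y j))"
    unfolding eq using h' by (subst nn_integral_scale_measure) auto
  also have "(\<integral>\<^sup>+y. h y \<partial>distr ?P ?P (\<lambda>y. \<lambda>j\<in>I. s * y j)) = (\<integral>\<^sup>+y. h (\<lambda>j\<in>I. s * y j) \<partial>?P)"
    using h' by (subst nn_integral_distr) auto
  finally show ?thesis .
qed

lemma borel_measurable_coordinate:
  "i \<in> I \<Longrightarrow> (\<lambda>v. v i) \<in> borel_measurable (PiM I (\<lambda>_. unif))"
  using measurable_component_singleton[of i I "\<lambda>_. unif"] by (auto cong: measurable_cong_sets)

lemma pred_pivot: "k < n \<Longrightarrow> Measurable.pred (PiM {..<n} (\<lambda>_. unif)) (pivot n k)"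
  unfolding pivot_def[abs_def] Ball_def[symmetric] lessThan_iff[symmetric, of _ k]
  by (intro pred_intros_logic pred_intros_finite borel_measurable_pred_less borel_measurable_coordinate) auto

text \<open>Fubini in coordinate i: with the other coordinates fixed, the event lies in a single
  point.\<close>

lemma AE_unif_ne:
  fixes i j n :: nat
  assumes "i < n" "j < n" "i \<noteq> j"
  shows "AE v in PiM {..<n} (\<lambda>_. unif). v i \<noteq> v j"
proof -
  let ?J = "{..<n} - {i}"
  have ins: "insert i ?J = {..<n}" using assms by auto
  have [measurable]: "(\<lambda>v. v i) \<in> borel_measurable (PiM {..<n} (\<lambda>_. unif))"
      "(\<lambda>v. v j) \<in> borel_measurable (PiM {..<n} (\<lambda>_. unif))"
    using assms by (auto intro: borel_measurable_coordinate)
  let ?E = "{v \<in> space (PiM {..<n} (\<lambda>_. unif)). v i = v j}"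
  have E[measurable]: "?E \<in> sets (PiM {..<n} (\<lambda>_. unif))" using assms by measurable
  have pt: "emeasure unif {c} = 0" for c
    by (cases "0 < c \<and> c < 1") (auto simp: emeasure_unif)
  have "emeasure (PiM {..<n} (\<lambda>_. unif)) ?E = (\<integral>\<^sup>+v. indicator ?E v \<partial>PiM (insert i ?J) (\<lambda>_. unif))"
    unfolding ins by (rule nn_integral_indicator[symmetric]) (rule E)
  also have "\<dots> = (\<integral>\<^sup>+v. (\<integral>\<^sup>+y. indicator ?E (v(i := y)) \<partial>unif) \<partial>PiM ?J (\<lambda>_. unif))"
    by (rule unifs.product_nn_integral_insert) (use ins in auto)
  also have "\<dots> = (\<integral>\<^sup>+v. 0 \<partial>PiM ?J (\<lambda>_. unif))"
  proof (rule nn_integral_cong)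
    fix v
    have "(\<integral>\<^sup>+y. indicator ?E (v(i := y)) \<partial>unif) \<le> (\<integral>\<^sup>+y. indicator {v j} y \<partial>unif)"
      by (intro nn_integral_mono) (use assms in \<open>auto simp: indicator_def\<close>)
    then show "(\<integral>\<^sup>+y. indicator ?E (v(i := y)) \<partial>unif) = 0"
      using pt by (simp add: nn_integral_indicator_singleton)
  qed
  finally show ?thesis by (subst AE_iff_measurable[OF E]) auto
qed

lemma AE_unif_inj: fixes n :: nat shows "AE v in PiM {..<n} (\<lambda>_. unif). inj_on v {..<n}"
proof -
  have "AE v in PiM {..<n} (\<lambda>_. unif). \<forall>i\<in>{..<n}. \<forall>j\<in>{..<n}. i \<noteq> j \<longrightarrow> v i \<noteq> v j"
  proof (intro AE_finite_allI)
    fix i j assume "i \<in> {..<n}" "j \<in> {..<n}"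
    then show "AE v in PiM {..<n} (\<lambda>_. unif). i \<noteq> j \<longrightarrow> v i \<noteq> v j"
      using AE_unif_ne[of i n j] by (cases "i = j") auto
  qed auto
  then show ?thesis by eventually_elim (auto simp: inj_on_def)
qed

lemma AE_PiM_unif: fixes n :: nat shows "AE v in PiM {..<n} (\<lambda>_. unif). \<forall>j<n. 0 < v j \<and> v j < 1"
proof -
  have "AE v in PiM {..<n} (\<lambda>_. unif). \<forall>j\<in>{..<n}. 0 < v j \<and> v j < 1"
  proof (intro AE_finite_allI)
    fix j assume j: "j \<in> {..<n}"
    show "AE v in PiM {..<n} (\<lambda>_. unif). 0 < v j \<and> v j < 1"
      by (rule AE_PiM_component[OF _ j AE_unif]) (rule unif.prob_space_axioms)
  qed auto
  then show ?thesis by eventually_elim auto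
qed

text \<open>Averaging over all relabellings reduces a symmetric functional to the event that the first
  \<open>k\<close> coordinates lie below the coordinate \<open>k\<close> and the remaining ones above it.\<close>

lemma nn_integral_symmetric:
  fixes f :: "(nat \<Rightarrow> real) \<Rightarrow> ennreal"
  assumes k: "k < n"
  obtains c where "\<And>f :: (nat \<Rightarrow> real) \<Rightarrow> ennreal. f \<in> borel_measurable (PiM {..<n} (\<lambda>_. unif)) \<Longrightarrow>
    (\<And>\<pi> v. \<pi> permutes {..<n} \<Longrightarrow> f (v \<circ> \<pi>) = f v) \<Longrightarrow>
    (\<integral>\<^sup>+v. f v \<partial>PiM {..<n} (\<lambda>_. unif)) = c * (\<integral>\<^sup>+v. of_bool (pivot n k v) * f v \<partial>PiM {..<n} (\<lambda>_. unif))"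
proof -
  let ?P = "PiM {..<n} (\<lambda>_. unif)"
  define Per where "Per = {\<pi>. \<pi> permutes {..<n}}"
  define m where "m = card {\<pi>. \<pi> permutes {..<n} \<and> pivot n k (\<pi> :: nat \<Rightarrow> nat)}"
  have m: "m > 0" unfolding m_def by (rule card_pivot_pos[OF k])
  have fin: "finite Per" unfolding Per_def by (rule finite_permutations) simp
  have mp: "distr ?P ?P (\<lambda>v. v \<circ> \<pi>) = ?P" "(\<lambda>v. v \<circ> \<pi>) \<in> measurable ?P ?P" if \<pi>: "\<pi> permutes {..<n}" for \<pi>
  proof -
    have eq: "(\<lambda>n\<in>{..<n}. v (\<pi> n)) = v \<circ> \<pi>" if "v \<in> space ?P" for v
      using that \<pi> by (auto simp: space_PiM PiE_def extensional_def restrict_def fun_eq_iff permutes_not_in)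
    have "distr ?P ?P (\<lambda>v. \<lambda>n\<in>{..<n}. v (\<pi> n)) = ?P"
      by (rule distr_PiM_reindex)
         (use \<pi> permutes_in_image[OF \<pi>] in \<open>auto intro: inj_on_subset[OF permutes_inj[OF \<pi>]] unif.prob_space_axioms\<close>)
    also have "distr ?P ?P (\<lambda>v. \<lambda>n\<in>{..<n}. v (\<pi> n)) = distr ?P ?P (\<lambda>v. v \<circ> \<pi>)"
      by (rule distr_cong) (simp_all add: eq)
    finally show "distr ?P ?P (\<lambda>v. v \<circ> \<pi>) = ?P" .
    have "(\<lambda>v. \<lambda>n\<in>{..<n}. v (\<pi> n)) \<in> measurable ?P ?P"
      using permutes_in_image[OF \<pi>] by (intro measurable_restrict measurable_component_singleton) auto
    then show "(\<lambda>v. v \<circ> \<pi>) \<in> measurable ?P ?P"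
      using measurable_cong[of ?P "\<lambda>v. \<lambda>n\<in>{..<n}. v (\<pi> n)" "\<lambda>v. v \<circ> \<pi>" ?P, OF eq] by blast
  qed
  have piv[measurable]: "Measurable.pred ?P (pivot n k)"
    by (rule pred_pivot[OF k])
  show thesis
  \<comment> \<open>The constant is n!/m, the reciprocal of the probability of the pivot event. It
    is the same for all symmetric f and cancels when two symmetric functionals are compared.\<close>
  proof (rule that[of "ennreal (card Per / m)"])
    fix f :: "(nat \<Rightarrow> real) \<Rightarrow> ennreal"
    assume f[measurable]: "f \<in> borel_measurable ?P" and symf: "\<And>\<pi> v. \<pi> permutes {..<n} \<Longrightarrow> f (v \<circ> \<pi>) = f v"
    \<comment> \<open>For distinct coordinates exactly m relabellings satisfy \<open>pivot\<close>,
      and f does not see the relabelling.\<close>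
    have ae: "AE v in ?P. of_nat m * f v = (\<Sum>\<pi>\<in>Per. of_bool (pivot n k (v \<circ> \<pi>)) * f (v \<circ> \<pi>))"
      using AE_unif_inj
    proof eventually_elim
      case (elim v)
      have "(\<Sum>\<pi>\<in>Per. of_bool (pivot n k (v \<circ> \<pi>)) * f (v \<circ> \<pi>)) = (\<Sum>\<pi>\<in>Per. of_bool (pivot n k (v \<circ> \<pi>)) * f v)"
        by (intro sum.cong refl) (auto simp: Per_def symf)
      also have "\<dots> = (\<Sum>\<pi>\<in>Per. of_bool (pivot n k (v \<circ> \<pi>))) * f v"
        by (simp add: sum_distrib_right)
      also have "(\<Sum>\<pi>\<in>Per. of_bool (pivot n k (v \<circ> \<pi>)) :: ennreal) = of_nat (card {\<pi>\<in>Per. pivot n k (v \<circ> \<pi>)})"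
        using fin by (simp add: of_bool_def sum.If_cases Int_def)
      also have "card {\<pi>\<in>Per. pivot n k (v \<circ> \<pi>)} = m"
        using card_pivot_permutations[OF elim k] by (simp add: Per_def m_def)
      finally show ?case by (rule sym)
    qed
    have "of_nat m * (\<integral>\<^sup>+v. f v \<partial>?P) = (\<integral>\<^sup>+v. (\<Sum>\<pi>\<in>Per. of_bool (pivot n k (v \<circ> \<pi>)) * f (v \<circ> \<pi>)) \<partial>?P)"
      by (subst nn_integral_cmult[symmetric]) (simp, rule nn_integral_cong_AE[OF ae])
    also have "\<dots> = (\<Sum>\<pi>\<in>Per. \<integral>\<^sup>+v. of_bool (pivot n k (v \<circ> \<pi>)) * f (v \<circ> \<pi>) \<partial>?P)"
    proof (rule nn_integral_sum)
      fix \<pi> assume "\<pi> \<in> Per"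
      then have [measurable]: "(\<lambda>v. v \<circ> \<pi>) \<in> measurable ?P ?P" using mp by (auto simp: Per_def)
      show "(\<lambda>v. of_bool (pivot n k (v \<circ> \<pi>)) * f (v \<circ> \<pi>)) \<in> borel_measurable ?P"
        by measurable
    qed
    also have "\<dots> = (\<Sum>\<pi>\<in>Per. \<integral>\<^sup>+v. of_bool (pivot n k v) * f v \<partial>?P)"
    proof (rule sum.cong[OF refl])
      fix \<pi> assume "\<pi> \<in> Per"
      then have \<pi>: "\<pi> permutes {..<n}" by (simp add: Per_def)
      have "(\<integral>\<^sup>+v. of_bool (pivot n k v) * f v \<partial>?P) = (\<integral>\<^sup>+v. of_bool (pivot n k v) * f v \<partial>distr ?P ?P (\<lambda>v. v \<circ> \<pi>))"
        by (simp add: mp[OF \<pi>])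
      also have "\<dots> = (\<integral>\<^sup>+v. of_bool (pivot n k (v \<circ> \<pi>)) * f (v \<circ> \<pi>) \<partial>?P)"
        by (rule nn_integral_distr) (use mp[OF \<pi>] in measurable)
      finally show "(\<integral>\<^sup>+v. of_bool (pivot n k (v \<circ> \<pi>)) * f (v \<circ> \<pi>) \<partial>?P) = (\<integral>\<^sup>+v. of_bool (pivot n k v) * f v \<partial>?P)" by simp
    qed
    also have "\<dots> = of_nat (card Per) * (\<integral>\<^sup>+v. of_bool (pivot n k v) * f v \<partial>?P)" by simp
    finally have "of_nat m * (\<integral>\<^sup>+v. f v \<partial>?P) = of_nat (card Per) * (\<integral>\<^sup>+v. of_bool (pivot n k v) * f v \<partial>?P)" .
    then have "ennreal (1 / m) * (of_nat m * (\<integral>\<^sup>+v. f v \<partial>?P)) = ennreal (1 / m) * (of_nat (card Per) * (\<integral>\<^sup>+v. of_bool (pivot n k v) * f v \<partial>?P))"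
      by simp
    moreover have "ennreal (1 / m) * of_nat m = 1" "ennreal (1 / m) * of_nat (card Per) = ennreal (card Per / m)"
      using m by (simp_all add: ennreal_of_nat_eq_real_of_nat ennreal_mult[symmetric])
    ultimately show "(\<integral>\<^sup>+v. f v \<partial>?P) = ennreal (card Per / m) * (\<integral>\<^sup>+v. of_bool (pivot n k v) * f v \<partial>?P)"
      by (simp add: mult.assoc[symmetric])
  qed
qed

lemma borel_measurable_upper_os_unif:
  "(\<lambda>v. upper_os n v i) \<in> borel_measurable (PiM {..<n} (\<lambda>_. unif))"
  by (rule borel_measurable_upper_os) (auto intro: borel_measurable_coordinate)

text \<open>Given the \<open>(k+1)\<close>-st smallest of \<open>n\<close> uniform variables, the \<open>k\<close> smaller ones are,
  up to their order, independent and uniform below it.\<close>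

lemma unif_lower_os_representation:
  fixes g :: "real \<times> real \<Rightarrow> real \<times> real" and n k :: nat
  assumes k: "k < n" and g[measurable]: "g \<in> borel_measurable borel"
  defines "P \<equiv> PiM {..<n} (\<lambda>_. unif)" and "W \<equiv> PiM {..<k} (\<lambda>_. unif)"
    and "u \<equiv> (\<lambda>v. upper_os n v (n - Suc k))"
  assumes f[measurable]: "f \<in> borel_measurable borel"
  shows "(\<integral>\<^sup>+v. f (u v, \<Sum>j<n. if v j < u v then g (u v, v j) else 0) \<partial>P) =
    (\<integral>\<^sup>+v. (\<integral>\<^sup>+w. f (u v, \<Sum>j<k. g (u v, u v * w j)) \<partial>W) \<partial>P)"
proof -
  have comp[measurable]: "(\<lambda>v. v i) \<in> borel_measurable P" if "i < n" for i
    unfolding P_def using that by (auto intro: borel_measurable_coordinate)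
  have compW[measurable]: "(\<lambda>v. v i) \<in> borel_measurable W" if "i < k" for i
    unfolding W_def using that by (auto intro: borel_measurable_coordinate)
  have u[measurable]: "u \<in> borel_measurable P"
    unfolding u_def P_def by (rule borel_measurable_upper_os_unif)
  have sfW: "sigma_finite_measure W" unfolding W_def by (rule unifs.sigma_finite_measure)
  interpret W: sigma_finite_measure W by fact
  define \<psi> where "\<psi> s = (\<integral>\<^sup>+w. f (s, \<Sum>j<k. g (s, s * w j)) \<partial>W)" for s
  have \<psi>[measurable]: "\<psi> \<in> borel_measurable borel"
    unfolding \<psi>_def by measurable
  define \<Phi> where "\<Phi> v = f (u v, \<Sum>j<n. if v j < u v then g (u v, v j) else 0)" for v
  have \<Phi>[measurable]: "\<Phi> \<in> borel_measurable P" unfolding \<Phi>_def by measurable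
  obtain c where c: "\<And>f :: (nat \<Rightarrow> real) \<Rightarrow> ennreal. f \<in> borel_measurable P \<Longrightarrow>
    (\<And>\<pi> v. \<pi> permutes {..<n} \<Longrightarrow> f (v \<circ> \<pi>) = f v) \<Longrightarrow>
    (\<integral>\<^sup>+v. f v \<partial>P) = c * (\<integral>\<^sup>+v. of_bool (pivot n k v) * f v \<partial>P)"
    using nn_integral_symmetric[OF k] unfolding P_def by blast
  have pos: "AE v in P. \<forall>j<n. 0 < v j \<and> v j < 1" unfolding P_def by (rule AE_PiM_unif)
  have upiv: "u v = v k" if "pivot n k v" "\<forall>j<n. 0 < v j \<and> v j < 1" for v
    unfolding u_def using that k by (intro upper_os_pivot) (auto intro: less_imp_le)
  have usym: "u (v \<circ> \<pi>) = u v" if "\<pi> permutes {..<n}" for v \<pi>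
    unfolding u_def by (rule upper_os_permutes[OF that])
  \<comment> \<open>\<open>F\<close> is the functional on the pivot event, where u is the coordinate
    k; \<open>F'\<close> replaces its value by the average \<psi> over fresh uniform points below
    that coordinate.\<close>
  define F where "F v = of_bool (\<forall>j\<in>{k<..<n}. v k < v j) * (of_bool (\<forall>j\<in>{..<k}. v j < v k) * f (v k, \<Sum>j<k. g (v k, v j)))" for v :: "nat \<Rightarrow> real"
  define F' where "F' v = of_bool (\<forall>j\<in>{k<..<n}. v k < v j) * (of_bool (\<forall>j\<in>{..<k}. v j < v k) * \<psi> (v k))" for v :: "nat \<Rightarrow> real"
  have piv1: "Measurable.pred P (\<lambda>v. \<forall>j\<in>{k<..<n}. v k < v j)"
    using k by (intro pred_intros_finite borel_measurable_pred_less comp) auto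
  have piv2: "Measurable.pred P (\<lambda>v. \<forall>j\<in>{..<k}. v j < v k)"
    using k by (intro pred_intros_finite borel_measurable_pred_less comp) auto
  have [measurable]: "(\<lambda>v. v k) \<in> borel_measurable P" "\<And>j. j \<in> {..<k} \<Longrightarrow> (\<lambda>v. v j) \<in> borel_measurable P"
    using k by auto
  note [measurable] = piv1 piv2
  have F[measurable]: "F \<in> borel_measurable P" "F' \<in> borel_measurable P"
    unfolding F_def F'_def by measurable
  have 1: "(\<integral>\<^sup>+v. \<Phi> v \<partial>P) = c * (\<integral>\<^sup>+v. of_bool (pivot n k v) * \<Phi> v \<partial>P)"
  proof (rule c[OF \<Phi>])
    fix \<pi> and v :: "nat \<Rightarrow> real" assume \<pi>: "\<pi> permutes {..<n}"
    have "(\<Sum>j<n. if (v \<circ> \<pi>) j < u v then g (u v, (v \<circ> \<pi>) j) else 0) = (\<Sum>j<n. if v j < u v then g (u v, v j) else 0)"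
      using sum.permute[OF \<pi>, of "\<lambda>j. if v j < u v then g (u v, v j) else 0"] unfolding comp_def by (rule sym)
    then show "\<Phi> (v \<circ> \<pi>) = \<Phi> v" unfolding \<Phi>_def usym[OF \<pi>] by (simp only:)
  qed
  have 2: "(\<integral>\<^sup>+v. of_bool (pivot n k v) * \<Phi> v \<partial>P) = (\<integral>\<^sup>+v. F v \<partial>P)"
  proof (rule nn_integral_cong_AE)
    show "AE v in P. of_bool (pivot n k v) * \<Phi> v = F v"
      using pos
    proof eventually_elim
      case (elim v)
      show ?case
      proof (cases "pivot n k v")
        case True
        have lt: "v j < v k \<longleftrightarrow> j < k" if "j < n" for j
        proof (cases "k < j")
          case kj: True
          then have "v k < v j" using True that by (simp add: pivot_def)
          with kj show ?thesis by simp
        next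
          case False
          then show ?thesis using True by (cases "j = k") (simp_all add: pivot_def)
        qed
        have "(\<Sum>j<n. if v j < v k then g (v k, v j) else 0) = (\<Sum>j<n. if j < k then g (v k, v j) else 0)"
          by (intro sum.cong refl) (simp add: lt)
        also have "\<dots> = (\<Sum>j<k. g (v k, v j))"
          using k by (intro sum.mono_neutral_cong_right) auto
        finally have "\<Phi> v = f (v k, \<Sum>j<k. g (v k, v j))"
          unfolding \<Phi>_def upiv[OF True elim] by (simp only:)
        then show ?thesis using True by (simp add: F_def pivot_def)
      qed (auto simp: F_def pivot_def)
    qed
  qed
  have 3: "(\<integral>\<^sup>+v. F v \<partial>P) = (\<integral>\<^sup>+v. F' v \<partial>P)"
  proof -
    have un: "{k..<n} \<union> {..<k} = {..<n}" using k by auto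
    have dis: "{k..<n} \<inter> {..<k} = {}" by (auto simp: disjoint_iff)
    \<comment> \<open>Fubini with the first k coordinates innermost; the outer ones fix s = x k and
      decide the condition above it.\<close>
    have fold: "(\<integral>\<^sup>+v. h v \<partial>P) = (\<integral>\<^sup>+x. (\<integral>\<^sup>+y. h (merge {k..<n} {..<k} (x, y)) \<partial>W) \<partial>PiM {k..<n} (\<lambda>_. unif))"
      if "h \<in> borel_measurable P" for h
      using unifs.product_nn_integral_fold[OF dis, of h] that unfolding un P_def W_def by simp
    have pos': "AE x in PiM {k..<n} (\<lambda>_. unif). 0 < x k \<and> x k < 1"
      using k by (intro AE_PiM_component[where P="\<lambda>v. 0 < v \<and> v < 1"] AE_unif unif.prob_space_axioms) auto
    show ?thesis
      unfolding fold[OF F(1)] fold[OF F(2)]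
    proof (rule nn_integral_cong_AE, use pos' in eventually_elim)
      fix x :: "nat \<Rightarrow> real" assume x: "0 < x k \<and> x k < 1"
      define s where "s = x k"
      define b where "b = (of_bool (\<forall>j\<in>{k<..<n}. x k < x j) :: ennreal)"
      let ?I = "\<lambda>y. indicator {y. \<forall>j\<in>{..<k}. y j < s} y :: ennreal"
      have s: "0 < s" "s < 1" using x by (auto simp: s_def)
      have mg1: "merge {k..<n} {..<k} (x, y) j = y j" if "j < k" for j y
        using that by (simp add: merge_def)
      have mg2: "merge {k..<n} {..<k} (x, y) j = x j" if "k \<le> j" "j < n" for j y
        using that by (simp add: merge_def)
      have e: "merge {k..<n} {..<k} (x, y) k = x k"
          "(\<forall>j\<in>{..<k}. merge {k..<n} {..<k} (x, y) j < x k) \<longleftrightarrow> (\<forall>j\<in>{..<k}. y j < x k)"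
          "(\<forall>j\<in>{k<..<n}. x k < merge {k..<n} {..<k} (x, y) j) \<longleftrightarrow> (\<forall>j\<in>{k<..<n}. x k < x j)"
          "(\<Sum>j<k. g (x k, merge {k..<n} {..<k} (x, y) j)) = (\<Sum>j<k. g (x k, y j))" for y
        using k by (auto simp: mg1 mg2 intro!: sum.cong)
      have m: "F (merge {k..<n} {..<k} (x, y)) = b * (?I y * f (s, \<Sum>j<k. g (s, y j)))" for y
        unfolding F_def b_def s_def e by (simp add: indicator_def)
      have m': "F' (merge {k..<n} {..<k} (x, y)) = b * (?I y * \<psi> s)" for y
        unfolding F'_def b_def s_def e by (simp add: indicator_def)
      have Im: "?I \<in> borel_measurable W"
      proof -
        have "Measurable.pred W (\<lambda>y. \<forall>j\<in>{..<k}. y j < s)"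
          by (intro pred_intros_finite borel_measurable_pred_less compW) auto
        then have "(\<lambda>y. of_bool (\<forall>j\<in>{..<k}. y j < s) :: ennreal) \<in> borel_measurable W" by measurable
        then show ?thesis by (simp add: indicator_def of_bool_def)
      qed
      have hm: "(\<lambda>y. f (s, \<Sum>j<k. g (s, y j))) \<in> borel_measurable (PiM {..<k} (\<lambda>_::nat. borel))"
        by measurable
      \<comment> \<open>Restricting the k inner coordinates below s and rescaling them gives the
        factor s^k, here and for the constant \<psi> s.\<close>
      have "(\<integral>\<^sup>+y. ?I y * f (s, \<Sum>j<k. g (s, y j)) \<partial>W) = ennreal s ^ k * \<psi> s"
        using PiM_unif_scale[OF s _ hm] by (simp add: W_def \<psi>_def)
      moreover have "(\<integral>\<^sup>+y. ?I y * \<psi> s \<partial>W) = ennreal s ^ k * \<psi> s"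
      proof -
        have "(\<integral>\<^sup>+y. ?I y * \<psi> s \<partial>W) = ennreal s ^ k * (\<integral>\<^sup>+y. \<psi> s \<partial>W)"
          using PiM_unif_scale[OF s, of "{..<k}" "\<lambda>_. \<psi> s"] by (simp add: W_def)
        also have "(\<integral>\<^sup>+y. \<psi> s \<partial>W) = \<psi> s" by (simp add: W_def unifs.emeasure_space_1)
        finally show ?thesis .
      qed
      moreover have "(\<lambda>y. f (s, \<Sum>j<k. g (s, y j))) \<in> borel_measurable W"
        by measurable
      ultimately show "(\<integral>\<^sup>+y. F (merge {k..<n} {..<k} (x, y)) \<partial>W) = (\<integral>\<^sup>+y. F' (merge {k..<n} {..<k} (x, y)) \<partial>W)"
        unfolding m m' using Im by (simp add: nn_integral_cmult)
    qed
  qed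
  have 4: "(\<integral>\<^sup>+v. F' v \<partial>P) = (\<integral>\<^sup>+v. of_bool (pivot n k v) * \<psi> (u v) \<partial>P)"
  proof (rule nn_integral_cong_AE)
    show "AE v in P. F' v = of_bool (pivot n k v) * \<psi> (u v)"
      using pos by eventually_elim (auto simp: F'_def upiv, auto simp: pivot_def)
  qed
  \<comment> \<open>\<psi> (u v) is symmetric as well, so the same constant c leads back from the
    pivot event.\<close>
  have 5: "(\<integral>\<^sup>+v. \<psi> (u v) \<partial>P) = c * (\<integral>\<^sup>+v. of_bool (pivot n k v) * \<psi> (u v) \<partial>P)"
    by (rule c) (auto simp: usym)
  from 1 2 3 4 5 have "(\<integral>\<^sup>+v. \<Phi> v \<partial>P) = (\<integral>\<^sup>+v. \<psi> (u v) \<partial>P)" by simp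
  then show ?thesis unfolding \<Phi>_def \<psi>_def .
qed

section \<open>Order statistics of a decreasing image of uniform variables\<close>

abbreviation unif_seq :: "(nat \<Rightarrow> real) measure" where "unif_seq \<equiv> PiM UNIV (\<lambda>_. unif)"

text \<open>Q is only weakly decreasing, so the transformed values may have ties. The order of the
  distinct v settles which of them are taken as the k largest: those with v j < u.\<close>

lemma upper_os_decreasing_image:
  fixes v :: "nat \<Rightarrow> real" and Q :: "real \<Rightarrow> real" and G :: "real \<times> real \<Rightarrow> 'b::comm_monoid_add"
  assumes k: "k < n" and inj: "inj_on v {..<n}" and v: "\<forall>j<n. 0 < v j \<and> v j < 1"
    and Q: "antimono_on {0<..<1} Q" "\<And>s. 0 < s \<Longrightarrow> s < 1 \<Longrightarrow> 0 \<le> Q s"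
  defines "u \<equiv> upper_os n v (n - Suc k)"
  shows "upper_os n (\<lambda>j. Q (v j)) k = Q u"
    and "(\<Sum>i<k. G (Q u, upper_os n (\<lambda>j. Q (v j)) i)) = (\<Sum>j<n. if v j < u then G (Q u, Q (v j)) else 0)"
proof -
  obtain \<sigma> where \<sigma>: "\<sigma> permutes {..<n}" "\<And>i j. i < n \<Longrightarrow> j < n \<Longrightarrow> v (\<sigma> i) < v (\<sigma> j) \<longleftrightarrow> i < j"
    by (rule obtain_sorting_permutation[OF inj]) blast
  define v' where "v' = v \<circ> \<sigma>"
  have v': "0 < v' j" "v' j < 1" if "j < n" for j
    using v permutes_in_image[OF \<sigma>(1), of j] that by (auto simp: v'_def)
  have v'_less: "v' i < v' j \<longleftrightarrow> i < j" if "i < n" "j < n" for i j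
    using \<sigma>(2)[OF that] by (simp add: v'_def)
  have piv: "pivot n k v'" using v'_less k by (auto simp: pivot_def)
  have "u = upper_os n v' (n - Suc k)"
    unfolding u_def v'_def by (rule upper_os_permutes[OF \<sigma>(1), symmetric])
  also have "\<dots> = v' k"
    using piv k v'(1)[OF k] by (intro upper_os_pivot) auto
  finally have u: "u = v' k" .
  have os: "upper_os n (\<lambda>j. Q (v j)) i = Q (v' i)" if "i < n" for i
  proof -
    have "upper_os n (\<lambda>j. Q (v j)) i = upper_os n ((\<lambda>j. Q (v j)) \<circ> \<sigma>) i"
      by (rule upper_os_permutes[OF \<sigma>(1), symmetric])
    also have "\<dots> = upper_os n (\<lambda>j. Q (v' j)) i" by (simp add: v'_def comp_def)
    also have "\<dots> = Q (v' i)"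
    proof (rule upper_os_sorted[OF _ that])
      fix j j' assume j: "j \<le> j'" "j' < n"
      then have "v' j \<le> v' j'" using v'_less[of j j'] by (cases "j = j'") auto
      then show "Q (v' j') \<le> Q (v' j)"
        using v' j by (intro monotone_onD[OF Q(1)]) auto
    qed (use Q v' that in auto)
    finally show ?thesis .
  qed
  show "upper_os n (\<lambda>j. Q (v j)) k = Q u" using os[OF k] u by simp
  have "(\<Sum>j<n. if v j < u then G (Q u, Q (v j)) else 0) = (\<Sum>j<n. if v' j < u then G (Q u, Q (v' j)) else 0)"
    using sum.permute[OF \<sigma>(1), of "\<lambda>j. if v j < u then G (Q u, Q (v j)) else 0"]
    unfolding v'_def comp_def .
  also have "\<dots> = (\<Sum>j<n. if j < k then G (Q u, Q (v' j)) else 0)"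
    by (intro sum.cong refl) (simp add: u v'_less k)
  also have "\<dots> = (\<Sum>j<k. G (Q u, Q (v' j)))"
    using k by (intro sum.mono_neutral_cong_right) auto
  also have "\<dots> = (\<Sum>i<k. G (Q u, upper_os n (\<lambda>j. Q (v j)) i))"
    using k by (intro sum.cong refl) (simp add: os)
  finally show "(\<Sum>i<k. G (Q u, upper_os n (\<lambda>j. Q (v j)) i)) = (\<Sum>j<n. if v j < u then G (Q u, Q (v j)) else 0)"
    by (rule sym)
qed

text \<open>The vector of the Z j has the law of Q applied to uniform variables; conditioning on u
  then makes the k largest values independent. G is pair valued because the first two log-moments
  are needed jointly.\<close>

lemma distr_upper_os_eq:
  fixes Z :: "nat \<Rightarrow> 'a \<Rightarrow> real" and Q :: "real \<Rightarrow> real" and G :: "real \<times> real \<Rightarrow> real \<times> real"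
  assumes M: "prob_space M" and k: "k < n"
    and ind: "prob_space.indep_vars M (\<lambda>_. borel) Z {..<n}"
    and law: "\<And>j. j < n \<Longrightarrow> distr M borel (Z j) = distr unif borel Q"
    and Q: "antimono_on {0<..<1} Q" "\<And>s. 0 < s \<Longrightarrow> s < 1 \<Longrightarrow> 0 \<le> Q s"
    and Qm[measurable]: "Q \<in> borel_measurable borel" and G[measurable]: "G \<in> borel_measurable borel"
  defines "u \<equiv> (\<lambda>v. upper_os n v (n - Suc k))"
  shows "distr M borel (\<lambda>\<omega>. (upper_os n (\<lambda>j. Z j \<omega>) k,
      \<Sum>i<k. G (upper_os n (\<lambda>j. Z j \<omega>) k, upper_os n (\<lambda>j. Z j \<omega>) i))) =
    distr (unif_seq \<Otimes>\<^sub>M unif_seq) borel (\<lambda>(v, w). (Q (u v), \<Sum>j<k. G (Q (u v), Q (u v * w j))))"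
proof -
  interpret prob_space M by fact
  have Qu: "Q \<in> borel_measurable unif"
    using Qm by (subst measurable_cong_sets[OF sets_unif refl])
  define P where "P = PiM {..<n} (\<lambda>_::nat. unif)"
  define W where "W = PiM {..<k} (\<lambda>_::nat. unif)"
  define B where "B = PiM {..<n} (\<lambda>_::nat. borel :: real measure)"
  define T where "T z = (upper_os n z k, \<Sum>i<k. G (upper_os n z k, upper_os n z i))" for z
  have Tm[measurable]: "T \<in> borel_measurable B" unfolding T_def B_def by measurable
  have T_cong: "T z = T z'" if "\<And>j. j < n \<Longrightarrow> z j = z' j" for z z'
    unfolding T_def using upper_os_cong[of n z z'] that by simp
  have Zm[measurable]: "Z j \<in> borel_measurable M" if "j < n" for j
    using ind that by (auto simp: indep_vars_def)
  have comp[measurable]: "(\<lambda>v. v i) \<in> borel_measurable P" if "i < n" for i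
    unfolding P_def using that by (auto intro: borel_measurable_coordinate)
  have um[measurable]: "u \<in> borel_measurable P"
    unfolding u_def P_def by (rule borel_measurable_upper_os_unif)
  have ne: "{..<n} \<noteq> {}" using k by auto
  have Zvec: "(\<lambda>\<omega>. \<lambda>j\<in>{..<n}. Z j \<omega>) \<in> measurable M B"
    unfolding B_def by (intro measurable_restrict) auto
  have Qvec: "(\<lambda>v. \<lambda>j\<in>{..<n}. Q (v j)) \<in> measurable P B"
    unfolding B_def by (intro measurable_restrict) auto
  have "distr M B (\<lambda>\<omega>. \<lambda>j\<in>{..<n}. Z j \<omega>) = PiM {..<n} (\<lambda>j. distr M borel (Z j))"
    unfolding B_def using indep_vars_iff_distr_eq_PiM'[where I="{..<n}" and X=Z and M'="\<lambda>_. borel", OF ne] ind Zm by auto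
  also have "\<dots> = PiM {..<n} (\<lambda>j. distr unif borel Q)"
    using law by (intro PiM_cong) auto
  also have "\<dots> = distr P B (\<lambda>v. \<lambda>j\<in>{..<n}. Q (v j))"
  proof -
    define N where "N = distr unif borel Q"
    have N: "prob_space N" unfolding N_def by (rule unif.prob_space_distr) (rule Qu)
    have sN[measurable_cong]: "sets N = sets borel" by (simp add: N_def)
    have "distr (PiM {..<n} (\<lambda>_. unif)) (PiM {..<n} (\<lambda>_. N)) (compose {..<n} Q) =
        PiM {..<n} (\<lambda>_. distr unif N Q)"
      by (rule distr_PiM_finite_prob_space') (auto intro: unif.prob_space_axioms N simp: measurable_cong_sets[OF refl sN] Qu)
    moreover have "distr unif N Q = distr unif borel Q" by (rule distr_cong) (simp_all add: sN)
    moreover have "distr (PiM {..<n} (\<lambda>_. unif)) (PiM {..<n} (\<lambda>_. N)) (compose {..<n} Q) =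
        distr (PiM {..<n} (\<lambda>_. unif)) (PiM {..<n} (\<lambda>_. borel)) (compose {..<n} Q)"
      by (intro distr_cong sets_PiM_cong) (simp_all add: sN)
    moreover have "compose {..<n} Q = (\<lambda>v. \<lambda>j\<in>{..<n}. Q (v j))"
      by (auto simp: compose_def fun_eq_iff)
    ultimately show ?thesis by (simp add: P_def B_def)
  qed
  finally have vec: "distr M B (\<lambda>\<omega>. \<lambda>j\<in>{..<n}. Z j \<omega>) = distr P B (\<lambda>v. \<lambda>j\<in>{..<n}. Q (v j))" .
  have "distr M borel (\<lambda>\<omega>. T (\<lambda>j. Z j \<omega>)) = distr M borel (T \<circ> (\<lambda>\<omega>. \<lambda>j\<in>{..<n}. Z j \<omega>))"
    by (rule arg_cong[where f="distr M borel"]) (auto simp: fun_eq_iff intro!: T_cong)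
  also have "\<dots> = distr (distr M B (\<lambda>\<omega>. \<lambda>j\<in>{..<n}. Z j \<omega>)) borel T"
    by (rule distr_distr[symmetric, OF Tm Zvec])
  also have "\<dots> = distr P borel (T \<circ> (\<lambda>v. \<lambda>j\<in>{..<n}. Q (v j)))"
    unfolding vec by (rule distr_distr[OF Tm Qvec])
  also have "T \<circ> (\<lambda>v. \<lambda>j\<in>{..<n}. Q (v j)) = (\<lambda>v. T (\<lambda>j. Q (v j)))"
    by (auto simp: fun_eq_iff intro!: T_cong)
  finally have L: "distr M borel (\<lambda>\<omega>. T (\<lambda>j. Z j \<omega>)) = distr P borel (\<lambda>v. T (\<lambda>j. Q (v j)))" .
  define h where "h = (\<lambda>(s, m :: real \<times> real). (Q s, m))"
  define g where "g = (\<lambda>(s, t). G (Q s, Q t))"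
  have "h \<in> borel_measurable (borel \<Otimes>\<^sub>M borel)" "g \<in> borel_measurable (borel \<Otimes>\<^sub>M borel)"
    unfolding h_def g_def by measurable
  then have [measurable]: "h \<in> borel_measurable borel" "g \<in> borel_measurable borel"
    by (simp_all add: borel_prod)
  define R where "R v = h (u v, \<Sum>j<n. if v j < u v then g (u v, v j) else 0)" for v
  have Rm[measurable]: "R \<in> borel_measurable P" unfolding R_def by measurable
  have "distr P borel (\<lambda>v. T (\<lambda>j. Q (v j))) = distr P borel R"
  proof (rule distr_cong_AE)
    have "AE v in P. inj_on v {..<n} \<and> (\<forall>j<n. 0 < v j \<and> v j < 1)"
      unfolding P_def using AE_unif_inj AE_PiM_unif by (rule AE_conjI)
    then show "AE v in P. T (\<lambda>j. Q (v j)) = R v"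
    proof eventually_elim
      case (elim v)
      have "T (\<lambda>j. Q (v j)) = (Q (u v), \<Sum>j<n. if v j < u v then G (Q (u v), Q (v j)) else 0)"
        using upper_os_decreasing_image(1)[OF k elim[THEN conjunct1] elim[THEN conjunct2] Q]
          upper_os_decreasing_image(2)[OF k elim[THEN conjunct1] elim[THEN conjunct2] Q, of G]
        unfolding T_def u_def by (simp only:)
      then show ?case by (simp only: R_def h_def g_def case_prod_conv)
    qed
    show "(\<lambda>v. T (\<lambda>j. Q (v j))) \<in> borel_measurable P"
      unfolding T_def by measurable
  qed (use Rm in auto)
  also have "distr P borel R = distr (unif_seq \<Otimes>\<^sub>M unif_seq) borel (\<lambda>(v, w). (Q (u v), \<Sum>j<k. G (Q (u v), Q (u v * w j))))"
    (is "_ = distr _ borel ?R'")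
  proof (rule measure_eqI)
    \<comment> \<open>Finite blocks are restrictions of infinite sequences, so that the space on the
      right does not depend on n and k.\<close>
    have PS: "distr unif_seq P (\<lambda>x. restrict x {..<n}) = P"
      unfolding P_def by (rule unifs.distr_PiM_restrict_finite) auto
    have WS: "distr unif_seq W (\<lambda>x. restrict x {..<k}) = W"
      unfolding W_def by (rule unifs.distr_PiM_restrict_finite) auto
    have rP[measurable]: "(\<lambda>x. restrict x {..<n}) \<in> measurable unif_seq P"
      unfolding P_def by (rule measurable_restrict_subset) auto
    have rW[measurable]: "(\<lambda>x. restrict x {..<k}) \<in> measurable unif_seq W"
      unfolding W_def by (rule measurable_restrict_subset) auto
    have uS: "u (restrict v {..<n}) = u v" for v
      unfolding u_def by (rule upper_os_cong) auto
    have [measurable]: "(\<lambda>v. v i) \<in> borel_measurable unif_seq" for i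
      by (rule borel_measurable_coordinate) auto
    have [measurable]: "(\<lambda>v. v i) \<in> borel_measurable W" if "i < k" for i
      unfolding W_def using that by (auto intro: borel_measurable_coordinate)
    have [measurable]: "u \<in> borel_measurable unif_seq"
      unfolding u_def by (rule borel_measurable_upper_os) auto
    have R'm[measurable]: "?R' \<in> borel_measurable (unif_seq \<Otimes>\<^sub>M unif_seq)" by measurable
    fix E assume "E \<in> sets (distr P borel R)"
    then have E[measurable]: "E \<in> sets borel" by simp
    define f where "f = (\<lambda>z. indicator E (h z) :: ennreal)"
    have fm[measurable]: "f \<in> borel_measurable borel" unfolding f_def by measurable
    have sfW: "sigma_finite_measure W" unfolding W_def by (rule unifs.sigma_finite_measure)
    interpret W: sigma_finite_measure W by fact
    have "emeasure (distr P borel R) E = (\<integral>\<^sup>+x. indicator E x \<partial>distr P borel R)" by simp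
    also have "\<dots> = (\<integral>\<^sup>+v. indicator E (R v) \<partial>P)"
      by (rule nn_integral_distr) measurable
    also have "\<dots> = (\<integral>\<^sup>+v. f (u v, \<Sum>j<n. if v j < u v then g (u v, v j) else 0) \<partial>P)"
      by (simp only: f_def R_def)
    also have "\<dots> = (\<integral>\<^sup>+v. (\<integral>\<^sup>+w. f (u v, \<Sum>j<k. g (u v, u v * w j)) \<partial>W) \<partial>P)"
      unfolding u_def P_def W_def by (rule unif_lower_os_representation[OF k]) measurable
    also have "\<dots> = (\<integral>\<^sup>+v. (\<integral>\<^sup>+w. f (u v, \<Sum>j<k. g (u v, u v * w j)) \<partial>W) \<partial>distr unif_seq P (\<lambda>x. restrict x {..<n}))"
      by (simp only: PS)
    also have "\<dots> = (\<integral>\<^sup>+v. (\<integral>\<^sup>+w. f (u v, \<Sum>j<k. g (u v, u v * w j)) \<partial>W) \<partial>unif_seq)"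
      by (subst nn_integral_distr) (simp_all only: uS, measurable)
    also have "\<dots> = (\<integral>\<^sup>+v. (\<integral>\<^sup>+w. f (u v, \<Sum>j<k. g (u v, u v * w j)) \<partial>unif_seq) \<partial>unif_seq)"
    proof (rule nn_integral_cong)
      fix v
      have "(\<integral>\<^sup>+w. f (u v, \<Sum>j<k. g (u v, u v * w j)) \<partial>W) =
          (\<integral>\<^sup>+w. f (u v, \<Sum>j<k. g (u v, u v * w j)) \<partial>distr unif_seq W (\<lambda>x. restrict x {..<k}))"
        by (simp only: WS)
      also have "\<dots> = (\<integral>\<^sup>+w. f (u v, \<Sum>j<k. g (u v, u v * restrict w {..<k} j)) \<partial>unif_seq)"
        by (rule nn_integral_distr) measurable
      finally show "(\<integral>\<^sup>+w. f (u v, \<Sum>j<k. g (u v, u v * w j)) \<partial>W) =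
          (\<integral>\<^sup>+w. f (u v, \<Sum>j<k. g (u v, u v * w j)) \<partial>unif_seq)" by simp
    qed
    also have "\<dots> = (\<integral>\<^sup>+v. (\<integral>\<^sup>+w. indicator E (?R' (v, w)) \<partial>unif_seq) \<partial>unif_seq)"
      by (simp add: f_def h_def g_def)
    also have "\<dots> = (\<integral>\<^sup>+z. indicator E (?R' z) \<partial>(unif_seq \<Otimes>\<^sub>M unif_seq))"
      by (rule unifs.nn_integral_fst) measurable
    also have "\<dots> = (\<integral>\<^sup>+x. indicator E x \<partial>distr (unif_seq \<Otimes>\<^sub>M unif_seq) borel ?R')"
      by (rule nn_integral_distr[symmetric]) measurable
    also have "\<dots> = emeasure (distr (unif_seq \<Otimes>\<^sub>M unif_seq) borel ?R') E" by simp
    finally show "emeasure (distr P borel R) E = emeasure (distr (unif_seq \<Otimes>\<^sub>M unif_seq) borel ?R') E" .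
  qed simp
  finally have R: "distr P borel (\<lambda>v. T (\<lambda>j. Q (v j))) = distr (unif_seq \<Otimes>\<^sub>M unif_seq) borel ?R'" .
  show ?thesis using trans[OF L R] unfolding T_def .
qed

section \<open>Weak convergence\<close>

lemma norm_iexp_diff: "cmod (iexp x - iexp y) \<le> \<bar>x - y\<bar>" "cmod (iexp x - iexp y) \<le> 2"
proof -
  have "cmod (iexp x - iexp y) = cmod (iexp y * (iexp (x - y) - 1))"
    by (simp add: algebra_simps exp_add[symmetric])
  also have "\<dots> = cmod (iexp (x - y) - 1)" by (simp add: norm_mult)
  also have "\<dots> \<le> \<bar>x - y\<bar>" using iexp_approx1[of "x - y" 0] by simp
  finally show "cmod (iexp x - iexp y) \<le> \<bar>x - y\<bar>" .
  show "cmod (iexp x - iexp y) \<le> 2"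
    using norm_triangle_ineq4[of "iexp x" "iexp y"] by simp
qed

context prob_space
begin

text \<open>Characteristic functions: |e^{itT} - e^{itS}| is at most |t| |T - S| where T and S are
  close, and at most 2 on the small remaining event.\<close>

lemma weak_conv_Slutsky:
  fixes S T :: "nat \<Rightarrow> 'a \<Rightarrow> real"
  assumes L: "real_distribution L"
    and [measurable]: "\<And>n. S n \<in> borel_measurable M" "\<And>n. T n \<in> borel_measurable M"
    and S: "weak_conv_m (\<lambda>n. distr M borel (S n)) L"
    and diff: "((\<lambda>z. T (fst z) (snd z) - S (fst z) (snd z)) \<longlongrightarrow> 0) (whp M)"
  shows "weak_conv_m (\<lambda>n. distr M borel (T n)) L"
proof (rule levy_continuity)
  show "real_distribution (distr M borel (T n))" for n by simp
  show "real_distribution L" by fact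
  fix t :: real
  have "(\<lambda>n. char (distr M borel (S n)) t) \<longlonglongrightarrow> char L t"
    by (rule levy_continuity1[OF _ L S]) simp
  moreover have "(\<lambda>n. char (distr M borel (T n)) t - char (distr M borel (S n)) t) \<longlonglongrightarrow> 0"
  proof (rule tendstoI)
    fix e :: real assume e: "e > 0"
    \<comment> \<open>With this d the first bound contributes at most e/4; the exceptional event, of
      probability below e/8, contributes less than e/4.\<close>
    define d where "d = e / (4 * (\<bar>t\<bar> + 1))"
    have d: "d > 0" using e by (simp add: d_def)
    have td: "\<bar>t\<bar> * d \<le> e / 4" using e by (simp add: d_def field_simps)
    have "\<forall>\<^sub>F z in whp M. dist (T (fst z) (snd z) - S (fst z) (snd z)) 0 < d"
      using tendstoD[OF diff d] .
    from this[unfolded eventually_whp, rule_format, of "e/8"] e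
    have "\<forall>\<^sub>F n in sequentially. \<exists>A\<in>events. prob (space M - A) < e / 8 \<and>
          (\<forall>\<omega>\<in>A. dist (T (fst (n, \<omega>)) (snd (n, \<omega>)) - S (fst (n, \<omega>)) (snd (n, \<omega>))) 0 < d)" by simp
    then show "\<forall>\<^sub>F n in sequentially. dist (char (distr M borel (T n)) t - char (distr M borel (S n)) t) 0 < e"
    proof eventually_elim
      case (elim n)
      then obtain A where A[measurable]: "A \<in> events" and pA: "prob (space M - A) < e / 8"
        and d': "\<And>\<omega>. \<omega> \<in> A \<Longrightarrow> \<bar>T n \<omega> - S n \<omega>\<bar> < d" by (auto simp: dist_real_def)
      have int: "integrable M (\<lambda>\<omega>. iexp (t * T n \<omega>))" "integrable M (\<lambda>\<omega>. iexp (t * S n \<omega>))"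
        by (intro integrable_iexp; measurable)+
      have intI: "integrable M (\<lambda>\<omega>. \<bar>t\<bar> * d + 2 * indicat_real (space M - A) \<omega>)"
        by (intro Bochner_Integration.integrable_add integrable_const integrable_mult_right integrable_real_indicator)
          (auto simp: emeasure_eq_measure)
      have "char (distr M borel (T n)) t - char (distr M borel (S n)) t = (CLINT \<omega>|M. iexp (t * T n \<omega>) - iexp (t * S n \<omega>))"
        using int by (simp add: char_def integral_distr)
      also have "cmod \<dots> \<le> (\<integral>\<omega>. \<bar>t\<bar> * d + 2 * indicator (space M - A) \<omega> \<partial>M)"
      proof (rule order_trans[OF integral_norm_bound integral_mono])
        fix \<omega> assume \<omega>: "\<omega> \<in> space M"
        show "cmod (iexp (t * T n \<omega>) - iexp (t * S n \<omega>)) \<le> \<bar>t\<bar> * d + 2 * indicator (space M - A) \<omega>"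
        proof (cases "\<omega> \<in> A")
          case True
          have "cmod (iexp (t * T n \<omega>) - iexp (t * S n \<omega>)) \<le> \<bar>t * T n \<omega> - t * S n \<omega>\<bar>" by (rule norm_iexp_diff)
          also have "\<dots> = \<bar>t\<bar> * \<bar>T n \<omega> - S n \<omega>\<bar>" by (simp add: abs_mult[symmetric] algebra_simps)
          also have "\<dots> \<le> \<bar>t\<bar> * d" using d'[OF True] by (intro mult_left_mono) auto
          finally show ?thesis using True by simp
        next
          case False
          have "cmod (iexp (t * T n \<omega>) - iexp (t * S n \<omega>)) \<le> 2" by (rule norm_iexp_diff)
          moreover have "0 \<le> \<bar>t\<bar> * d" using d by simp
          moreover have "(indicator (space M - A) \<omega> :: real) = 1" using False \<omega> by simp
          ultimately show ?thesis by linarith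
        qed
      qed (use int intI in auto)
      also have "\<dots> = \<bar>t\<bar> * d + 2 * prob (space M - A)"
      proof -
        have "expectation (\<lambda>\<omega>. \<bar>t\<bar> * d + 2 * indicat_real (space M - A) \<omega>) =
            expectation (\<lambda>\<omega>. \<bar>t\<bar> * d) + expectation (\<lambda>\<omega>. 2 * indicat_real (space M - A) \<omega>)"
          by (intro Bochner_Integration.integral_add integrable_const integrable_mult_right integrable_real_indicator)
            (auto simp: emeasure_eq_measure)
        also have "expectation (\<lambda>\<omega>. 2 * indicat_real (space M - A) \<omega>) = 2 * prob (space M - A)"
          using A by (simp add: sets.Int_space_eq2 Int_absorb1 sets.sets_into_space)
        finally show ?thesis by (simp add: prob_space)
      qed
      also have "\<dots> < e" using td pA e by linarith
      finally show ?case by simp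
    qed
  qed
  ultimately have "(\<lambda>n. char (distr M borel (S n)) t + (char (distr M borel (T n)) t - char (distr M borel (S n)) t)) \<longlonglongrightarrow> char L t + 0"
    by (rule tendsto_add)
  then show "(\<lambda>n. char (distr M borel (T n)) t) \<longlonglongrightarrow> char L t" by simp
qed

text \<open>Tightness of S. The limit has no atoms, so the distribution functions converge at every
  point, in particular at K and -K, and S lies in ]-K,K] with probability above 1 - \<epsilon>/2 for
  large n.\<close>

lemma weak_conv_times_null:
  fixes S :: "nat \<Rightarrow> 'a \<Rightarrow> real"
  assumes L: "real_distribution L" and cont: "\<And>x. measure L {x} = 0"
    and [measurable]: "\<And>n. S n \<in> borel_measurable M"
    and S: "weak_conv_m (\<lambda>n. distr M borel (S n)) L"
    and a: "((\<lambda>z. a z) \<longlongrightarrow> 0) (whp M)"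
  shows "((\<lambda>z. a z * S (fst z) (snd z)) \<longlongrightarrow> 0) (whp M)"
proof (rule tendstoI)
  fix e :: real assume e: "e > 0"
  interpret L: real_distribution L by fact
  show "\<forall>\<^sub>F z in whp M. dist (a z * S (fst z) (snd z)) 0 < e"
    unfolding eventually_whp
  proof (intro allI impI)
    fix \<epsilon> :: real assume \<epsilon>: "\<epsilon> > 0"
    have "\<forall>\<^sub>F K in at_top. cdf L K > 1 - \<epsilon> / 4"
      using order_tendstoD(1)[OF L.cdf_lim_at_top_prob] \<epsilon> by simp
    moreover have "\<forall>\<^sub>F K in at_top. cdf L (- K) < \<epsilon> / 4"
      using order_tendstoD(2)[OF filterlim_compose[OF L.cdf_lim_at_bot filterlim_uminus_at_bot_at_top], of "\<epsilon> / 4"] \<epsilon>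
      by simp
    ultimately have "\<forall>\<^sub>F K in at_top. cdf L K > 1 - \<epsilon> / 4 \<and> cdf L (- K) < \<epsilon> / 4 \<and> K > 0"
      using eventually_gt_at_top[of 0] by eventually_elim auto
    then obtain K where K: "cdf L K > 1 - \<epsilon> / 4" "cdf L (- K) < \<epsilon> / 4" "K > 0"
      using eventually_happens[of _ "at_top :: real filter"] by auto
    have conv: "(\<lambda>n. cdf (distr M borel (S n)) x) \<longlonglongrightarrow> cdf L x" for x
      using S cont[of x] unfolding weak_conv_m_def weak_conv_def by (simp add: L.isCont_cdf)
    have "\<forall>\<^sub>F z in whp M. dist (a z) 0 < e / K" using tendstoD[OF a] e K by simp
    from this[unfolded eventually_whp, rule_format, of "\<epsilon>/2"] \<epsilon>
    have "\<forall>\<^sub>F n in sequentially. \<exists>A\<in>events. prob (space M - A) < \<epsilon> / 2 \<and> (\<forall>\<omega>\<in>A. dist (a (n, \<omega>)) 0 < e / K)" by simp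
    then show "\<forall>\<^sub>F n in sequentially. \<exists>A\<in>events. prob (space M - A) < \<epsilon> \<and>
        (\<forall>\<omega>\<in>A. dist (a (n, \<omega>) * S (fst (n, \<omega>)) (snd (n, \<omega>))) 0 < e)"
      using order_tendstoD(1)[OF conv K(1)] order_tendstoD(2)[OF conv K(2)]
    proof eventually_elim
      case (elim n)
      then obtain A where A: "A \<in> events" "prob (space M - A) < \<epsilon> / 2" "\<forall>\<omega>\<in>A. dist (a (n, \<omega>)) 0 < e / K" by blast
      define B where "B = {\<omega>\<in>space M. - K < S n \<omega> \<and> S n \<omega> \<le> K}"
      have B: "B \<in> events" unfolding B_def by measurable
      have c1: "prob {\<omega>\<in>space M. S n \<omega> \<le> K} > 1 - \<epsilon> / 4"
        using elim(2) by (simp add: cdf_def measure_distr vimage_def Int_def conj_commute)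
      have c2: "prob {\<omega>\<in>space M. S n \<omega> \<le> - K} < \<epsilon> / 4"
        using elim(3) by (simp add: cdf_def measure_distr vimage_def Int_def conj_commute)
      have c1': "prob {\<omega>\<in>space M. \<not> S n \<omega> \<le> K} = 1 - prob {\<omega>\<in>space M. S n \<omega> \<le> K}"
        by (rule prob_neg) measurable
      have "space M - A \<inter> B \<subseteq> (space M - A) \<union> ({\<omega>\<in>space M. \<not> S n \<omega> \<le> K} \<union> {\<omega>\<in>space M. S n \<omega> \<le> - K})"
        by (auto simp: B_def)
      then have "prob (space M - A \<inter> B) \<le> prob ((space M - A) \<union> ({\<omega>\<in>space M. \<not> S n \<omega> \<le> K} \<union> {\<omega>\<in>space M. S n \<omega> \<le> - K}))"
        using A(1) by (intro finite_measure_mono) auto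
      also have "\<dots> \<le> prob (space M - A) + prob ({\<omega>\<in>space M. \<not> S n \<omega> \<le> K} \<union> {\<omega>\<in>space M. S n \<omega> \<le> - K})"
        using A(1) by (intro measure_subadditive) (auto simp: emeasure_eq_measure)
      also have "prob ({\<omega>\<in>space M. \<not> S n \<omega> \<le> K} \<union> {\<omega>\<in>space M. S n \<omega> \<le> - K}) \<le> prob {\<omega>\<in>space M. \<not> S n \<omega> \<le> K} + prob {\<omega>\<in>space M. S n \<omega> \<le> - K}"
        by (intro measure_subadditive) (auto simp: emeasure_eq_measure)
      finally have "prob (space M - A \<inter> B) < \<epsilon>" using c1 c2 c1' A(2) by linarith
      moreover have "dist (a (n, \<omega>) * S n \<omega>) 0 < e" if "\<omega> \<in> A \<inter> B" for \<omega>
      proof -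
        have "\<bar>S n \<omega>\<bar> \<le> K" using that by (auto simp: B_def)
        moreover have "\<bar>a (n, \<omega>)\<bar> < e / K" using A(3) that by (auto simp: dist_real_def)
        ultimately have "\<bar>a (n, \<omega>)\<bar> * \<bar>S n \<omega>\<bar> \<le> \<bar>a (n, \<omega>)\<bar> * K" by (intro mult_left_mono) auto
        also have "\<dots> < e / K * K" using \<open>\<bar>a (n, \<omega>)\<bar> < e / K\<close> K by (intro mult_strict_right_mono) auto
        finally show ?thesis using K by (simp add: dist_real_def abs_mult)
      qed
      ultimately show ?case using A(1) B by (intro bexI[of _ "A \<inter> B"]) auto
    qed
  qed
qed

end

section \<open>Normal laws\<close>

lemma measure_std_normal_singleton: "measure std_normal_distribution {x} = 0"
proof -
  have "emeasure std_normal_distribution {x} = 0"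
    by (subst emeasure_density) (auto simp: nn_integral_0_iff_AE indicator_def intro!: AE_I[of _ _ "{x}"])
  then show ?thesis by (simp add: measure_def)
qed

lemma normal_law_eq_distr:
  assumes "\<sigma> > 0"
  shows "normal_law 0 (\<sigma>\<^sup>2) = distr std_normal_distribution borel (\<lambda>x. \<sigma> * x)"
proof -
  interpret prob_space std_normal_distribution
    using real_dist_normal_dist by (simp add: real_distribution_def)
  have "distributed std_normal_distribution lborel (\<lambda>x. x) std_normal_density"
    by (auto simp: distributed_def distr_id2 intro!: distr_cong)
  from normal_density_affine[OF this, of \<sigma> 0] assms
  have "distributed std_normal_distribution lborel (\<lambda>x. \<sigma> * x) (normal_density 0 \<sigma>)" by simp
  then have "distr std_normal_distribution lborel (\<lambda>x. \<sigma> * x) = density lborel (normal_density 0 \<sigma>)"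
    by (simp add: distributed_def)
  moreover have "distr std_normal_distribution lborel (\<lambda>x. \<sigma> * x) = distr std_normal_distribution borel (\<lambda>x. \<sigma> * x)"
    by (rule distr_cong) auto
  ultimately show ?thesis using assms by (simp add: normal_law_def)
qed

text \<open>The sign of c disappears because the standard normal characteristic function is even. In
  (i) the factor is negative.\<close>

lemma (in prob_space) weak_conv_scale_normal:
  fixes S :: "nat \<Rightarrow> 'a \<Rightarrow> real"
  assumes "c \<noteq> 0" and [measurable]: "\<And>n. S n \<in> borel_measurable M"
    and S: "weak_conv_m (\<lambda>n. distr M borel (S n)) std_normal_distribution"
  shows "weak_conv_m (\<lambda>n. distr M borel (\<lambda>\<omega>. c * S n \<omega>)) (normal_law 0 (c\<^sup>2))"
    and "real_distribution (normal_law 0 (c\<^sup>2))"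
proof -
  have rd: "real_distribution std_normal_distribution" by (rule real_dist_normal_dist)
  interpret N: real_distribution std_normal_distribution by (rule rd)
  have N: "normal_law 0 (c\<^sup>2) = distr std_normal_distribution borel (\<lambda>x. \<bar>c\<bar> * x)"
    using normal_law_eq_distr[of "\<bar>c\<bar>"] assms by simp
  show rn: "real_distribution (normal_law 0 (c\<^sup>2))" unfolding N by simp
  show "weak_conv_m (\<lambda>n. distr M borel (\<lambda>\<omega>. c * S n \<omega>)) (normal_law 0 (c\<^sup>2))"
  proof (rule levy_continuity[OF _ rn])
    fix t
    have "(\<lambda>n. char (distr M borel (S n)) (c * t)) \<longlonglongrightarrow> char std_normal_distribution (c * t)"
      by (rule levy_continuity1[OF _ rd S]) simp
    moreover have "char (distr M borel (S n)) (c * t) = char (distr M borel (\<lambda>\<omega>. c * S n \<omega>)) t" for n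
      by (simp add: char_def integral_distr mult_ac)
    moreover have "char std_normal_distribution (c * t) = char (normal_law 0 (c\<^sup>2)) t"
    proof -
      have "char (normal_law 0 (c\<^sup>2)) t = char std_normal_distribution (\<bar>c\<bar> * t)"
        unfolding N char_def by (subst integral_distr) (auto simp: mult_ac)
      then show ?thesis by (simp add: char_std_normal_distribution power_mult_distrib)
    qed
    ultimately show "(\<lambda>n. char (distr M borel (\<lambda>\<omega>. c * S n \<omega>)) t) \<longlonglongrightarrow> char (normal_law 0 (c\<^sup>2)) t" by simp
  qed simp
qed

section \<open>Central limit theorem for intermediate order statistics\<close>

lemma prob_unif_seq: "prob_space unif_seq"
  by (intro prob_space_PiM unif.prob_space_axioms)

lemma indep_vars_unif_seq:
  assumes [measurable]: "\<And>i. f i \<in> borel_measurable borel"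
  shows "unifs.indep_vars UNIV (\<lambda>_. borel) (\<lambda>i v. f i (v i) :: real) UNIV"
proof -
  have "unifs.indep_vars UNIV (\<lambda>_. unif) (\<lambda>i v. v i) UNIV"
  proof (subst unifs.indep_vars_iff_distr_eq_PiM)
    have "PiM UNIV (\<lambda>i. distr unif_seq unif (\<lambda>v. v i)) = unif_seq"
      by (intro PiM_cong refl unifs.PiM_component) auto
    then show "distr unif_seq (PiM UNIV (\<lambda>i. unif)) (\<lambda>x. \<lambda>i\<in>UNIV. x i) = PiM UNIV (\<lambda>i. distr unif_seq unif (\<lambda>x. x i))"
      by (simp add: distr_id2 restrict_UNIV)
  qed (auto intro: measurable_component_singleton)
  then show ?thesis
    by (rule unifs.indep_vars_compose2) (use assms in \<open>simp cong: measurable_cong_sets\<close>)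
qed

lemma distr_unif_seq_coordinate: "distr unif_seq unif (\<lambda>v. v i) = unif"
  by (rule unifs.PiM_component) auto

lemma measurable_unif: "measurable unif = measurable borel"
  by (intro ext measurable_cong_sets) auto

lemma measure_unif_atMost: "0 \<le> s \<Longrightarrow> s \<le> 1 \<Longrightarrow> measure unif {..s} = s"
proof -
  assume s: "0 \<le> s" "s \<le> 1"
  have "emeasure unif {..s} = emeasure lborel ({..s} \<inter> {0<..<1})" by (simp add: emeasure_unif)
  also have "\<dots> = emeasure lborel {0<..s}"
  proof (cases "s = 1")
    case True
    then have "{..s} \<inter> {0<..<1} = {0<..<1}" by auto
    then show ?thesis using True by simp
  next
    case False
    then have "{..s} \<inter> {0<..<1} = {0<..s}" using s by auto
    then show ?thesis by simp
  qed
  finally show ?thesis using s by (simp add: measure_def)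
qed

definition ucount :: "nat \<Rightarrow> real \<Rightarrow> (nat \<Rightarrow> real) \<Rightarrow> real" where
  "ucount n s v = (\<Sum>j<n. of_bool (v j \<le> s))"

lemma borel_measurable_coord_seq[measurable]: "(\<lambda>v. v i) \<in> borel_measurable unif_seq"
  by (rule borel_measurable_coordinate) simp

lemma borel_measurable_ucount[measurable]: "ucount n s \<in> borel_measurable unif_seq"
  unfolding ucount_def by measurable

text \<open>The success probability s n varies with n, so this is a triangular array. The
  characteristic function of one centred indicator is expanded to second order, and its n-th power
  is compared with (1 - t^2/(2n))^n.\<close>

lemma ucount_CLT:
  fixes s :: "nat \<Rightarrow> real"
  assumes s01: "\<forall>\<^sub>F n in sequentially. 0 < s n \<and> s n < 1"
    and ns: "filterlim (\<lambda>n. real n * s n) at_top sequentially" and s0: "s \<longlonglongrightarrow> 0"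
  shows "weak_conv_m (\<lambda>n. distr unif_seq borel (\<lambda>v. (ucount n (s n) v - n * s n) / sqrt (n * s n)))
    std_normal_distribution"
proof (rule levy_continuity)
  show "real_distribution std_normal_distribution" by (rule real_dist_normal_dist)
  show "real_distribution (distr unif_seq borel (\<lambda>v. (ucount n (s n) v - n * s n) / sqrt (n * s n)))" for n
    by (rule unifs.real_distribution_distr) measurable
  fix t :: real
  define Y where "Y n v = (ucount n (s n) v - n * s n) / sqrt (n * s n)" for n v
  have Ym[measurable]: "Y n \<in> borel_measurable unif_seq" for n unfolding Y_def by measurable
  define c where "c n = char (distr unif_seq borel (\<lambda>v. of_bool (v 0 \<le> s n) - s n)) (t / sqrt (n * s n))" for n
  have char_eq: "char (distr unif_seq borel (Y n)) t = c n ^ n" for n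
  proof -
    define X where "X i v = of_bool (v i \<le> s n) - s n" for i :: nat and v :: "nat \<Rightarrow> real"
    have X: "unifs.indep_vars UNIV (\<lambda>_. borel) X {..<n}"
      by (rule unifs.indep_vars_subset[OF _ subset_UNIV])
        (use indep_vars_unif_seq[of "\<lambda>i x. of_bool (x \<le> s n) - s n"] in \<open>simp add: X_def[abs_def]\<close>)
    have Xm[measurable]: "X i \<in> borel_measurable unif_seq" for i unfolding X_def by measurable
    have same: "distr unif_seq borel (X i) = distr unif_seq borel (X 0)" for i
    proof -
      have "distr unif_seq borel (X i) = distr (distr unif_seq unif (\<lambda>v. v i)) borel (\<lambda>x. of_bool (x \<le> s n) - s n)" for i
        by (subst distr_distr) (auto simp: measurable_unif comp_def X_def[abs_def] intro!: measurable_component_singleton)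
      then show ?thesis by (simp add: distr_unif_seq_coordinate)
    qed
    have "Y n v = (\<Sum>i<n. X i v) / sqrt (n * s n)" for v
      by (simp add: Y_def X_def ucount_def sum_subtractf)
    then have "char (distr unif_seq borel (Y n)) t = char (distr unif_seq borel (\<lambda>v. \<Sum>i<n. X i v)) (t / sqrt (n * s n))"
      by (simp add: char_def integral_distr)
    also have "\<dots> = (\<Prod>i<n. char (distr unif_seq borel (X i)) (t / sqrt (n * s n)))"
      by (rule unifs.char_distr_sum[OF X])
    also have "\<dots> = (\<Prod>i<n. c n)" 
    proof (rule prod.cong[OF refl])
      fix i
      have "char (distr unif_seq borel (X i)) \<tau> = char (distr unif_seq borel (X 0)) \<tau>" for \<tau>
        by (rule arg_cong[OF same, of "\<lambda>D. char D \<tau>"])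
      then show "char (distr unif_seq borel (X i)) (t / sqrt (n * s n)) = c n"
        by (simp add: c_def X_def[abs_def])
    qed
    finally show ?thesis by simp
  qed
  \<comment> \<open>The centred indicator is bounded by 1, so its third absolute moment is at most
    its variance s(1-s), hence at most s.\<close>
  have c_bound: "cmod (c n - (1 - (t / sqrt (n * s n))\<^sup>2 * (s n * (1 - s n)) / 2)) \<le> (t / sqrt (n * s n))\<^sup>2 / 6 * (\<bar>t / sqrt (n * s n)\<bar> * s n)"
    if s: "0 < s n" "s n < 1" for n
  proof -
    define \<tau> where "\<tau> = t / sqrt (n * s n)"
    define X where "X v = of_bool (v 0 \<le> s n) - s n" for v :: "nat \<Rightarrow> real"
    have Xm[measurable]: "X \<in> borel_measurable unif_seq" unfolding X_def by measurable
    have bd: "\<bar>X v\<bar> \<le> 1" for v using s by (auto simp: X_def)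
    have int: "integrable unif_seq (\<lambda>v. h (X v))" if "\<And>x. \<bar>x\<bar> \<le> 1 \<Longrightarrow> \<bar>h x\<bar> \<le> C" "h \<in> borel_measurable borel" for h :: "real \<Rightarrow> real" and C
      by (rule unifs.integrable_const_bound[of _ C]) (use that bd in auto)
    have p: "unifs.prob UNIV {v\<in>space unif_seq. v 0 \<le> s n} = s n"
    proof -
      have "unifs.prob UNIV {v\<in>space unif_seq. v 0 \<le> s n} = measure (distr unif_seq unif (\<lambda>v. v 0)) {..s n}"
        by (subst measure_distr) (auto simp: vimage_def Int_def conj_commute intro!: measurable_component_singleton)
      also have "\<dots> = s n" using s by (simp add: distr_unif_seq_coordinate measure_unif_atMost)
      finally show ?thesis .
    qed
    have E: "unifs.expectation UNIV (\<lambda>v. a + b * of_bool (v 0 \<le> s n)) = a + b * s n" for a b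
    proof -
      have ob: "(of_bool (v 0 \<le> s n) :: real) = indicator {v\<in>space unif_seq. v 0 \<le> s n} v" for v
        by (auto simp: space_PiM)
      show ?thesis unfolding ob using p
        by (subst Bochner_Integration.integral_add) (auto simp: prob_space.prob_space[OF prob_unif_seq] unifs.emeasure_eq_measure)
    qed
    have "unifs.expectation UNIV X = 0"
      using E[of "- s n" 1] by (simp add: X_def[abs_def])
    moreover have "X v ^ 2 = (s n)\<^sup>2 + (1 - 2 * s n) * of_bool (v 0 \<le> s n)" for v
      by (simp add: X_def power2_eq_square algebra_simps)
    then have E2: "unifs.expectation UNIV (\<lambda>v. (X v)\<^sup>2) = s n * (1 - s n)"
      by (simp only: E) (simp add: power2_eq_square algebra_simps)
    ultimately have "cmod (char (distr unif_seq borel X) \<tau> - (1 - \<tau>\<^sup>2 * (s n * (1 - s n)) / 2)) \<le> (\<tau>\<^sup>2 / 6) * unifs.expectation UNIV (\<lambda>v. min (6 * (X v)\<^sup>2) (\<bar>\<tau>\<bar> * \<bar>X v\<bar> ^ 3))"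
      using int[of "\<lambda>x. x" 1] int[of "\<lambda>x. x\<^sup>2" 1]
      by (intro unifs.char_approx3') (auto simp: abs_square_le_1)
    also have "unifs.expectation UNIV (\<lambda>v. min (6 * (X v)\<^sup>2) (\<bar>\<tau>\<bar> * \<bar>X v\<bar> ^ 3)) \<le> unifs.expectation UNIV (\<lambda>v. \<bar>\<tau>\<bar> * (X v)\<^sup>2)"
    proof (rule integral_mono_AE')
      show "integrable unif_seq (\<lambda>v. \<bar>\<tau>\<bar> * (X v)\<^sup>2)" using int[of "\<lambda>x. x\<^sup>2" 1] by (auto simp: abs_square_le_1)
      show "AE v in unif_seq. min (6 * (X v)\<^sup>2) (\<bar>\<tau>\<bar> * \<bar>X v\<bar> ^ 3) \<le> \<bar>\<tau>\<bar> * (X v)\<^sup>2"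
      proof (rule AE_I2)
        fix v
        have "\<bar>X v\<bar> ^ 3 = \<bar>X v\<bar> * (X v)\<^sup>2" by (simp add: power3_eq_cube power2_eq_square)
        also have "\<dots> \<le> 1 * (X v)\<^sup>2" using bd by (intro mult_right_mono) auto
        finally have "\<bar>\<tau>\<bar> * \<bar>X v\<bar> ^ 3 \<le> \<bar>\<tau>\<bar> * (X v)\<^sup>2" by (intro mult_left_mono) auto
        then show "min (6 * (X v)\<^sup>2) (\<bar>\<tau>\<bar> * \<bar>X v\<bar> ^ 3) \<le> \<bar>\<tau>\<bar> * (X v)\<^sup>2" by linarith
      qed
    qed simp
    also have "unifs.expectation UNIV (\<lambda>v. \<bar>\<tau>\<bar> * (X v)\<^sup>2) = \<bar>\<tau>\<bar> * (s n * (1 - s n))"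
      by (simp add: E2)
    also have "\<dots> \<le> \<bar>\<tau>\<bar> * s n" using s by (intro mult_left_mono) (auto simp: mult_le_cancel_left1)
    finally show ?thesis
      by (simp add: c_def \<tau>_def X_def[abs_def] mult_left_mono)
  qed
  have lim1: "(\<lambda>n. (1 + (- (t\<^sup>2) / 2) / real n) ^ n) \<longlonglongrightarrow> exp (- (t\<^sup>2) / 2)"
    by (rule tendsto_exp_limit_sequentially)
  have lim: "(\<lambda>n. complex_of_real ((1 + (- (t\<^sup>2) / 2) / real n) ^ n)) \<longlonglongrightarrow> complex_of_real (exp (- (t\<^sup>2) / 2))"
    using lim1 by (rule tendsto_of_real)
  \<comment> \<open>This is n times the two one-step errors: the third-order term, and the
    difference between the variance s(1-s) and the normalisation by s.\<close>
  define err where "err n = \<bar>t\<bar> ^ 3 / 6 * inverse (sqrt (n * s n)) + t\<^sup>2 / 2 * s n" for n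
  have err0: "err \<longlonglongrightarrow> 0"
  proof -
    have "filterlim (\<lambda>n. sqrt (real n * s n)) at_top sequentially"
      by (rule filterlim_compose[OF sqrt_at_top ns])
    then have "(\<lambda>n. inverse (sqrt (real n * s n))) \<longlonglongrightarrow> 0"
      by (rule tendsto_inverse_0_at_top)
    then have "(\<lambda>n. \<bar>t\<bar> ^ 3 / 6 * inverse (sqrt (n * s n)) + t\<^sup>2 / 2 * s n) \<longlonglongrightarrow> \<bar>t\<bar> ^ 3 / 6 * 0 + t\<^sup>2 / 2 * 0"
      using s0 by (intro tendsto_intros)
    then show ?thesis by (simp add: err_def[abs_def])
  qed
  have "(\<lambda>n. char (distr unif_seq borel (Y n)) t - complex_of_real ((1 + (- (t\<^sup>2) / 2) / real n) ^ n)) \<longlonglongrightarrow> 0"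
  proof (rule Lim_null_comparison[OF _ err0])
    have "\<forall>\<^sub>F n in sequentially. t\<^sup>2 / 2 \<le> real n"
      using filterlim_real_sequentially unfolding filterlim_at_top by blast
    then show "\<forall>\<^sub>F n in sequentially. cmod (char (distr unif_seq borel (Y n)) t - complex_of_real ((1 + (- (t\<^sup>2) / 2) / real n) ^ n)) \<le> err n"
      using s01 eventually_gt_at_top[of 0]
    proof eventually_elim
      case (elim n)
      define r where "r = sqrt (n * s n)"
      have r: "r > 0" "r\<^sup>2 = n * s n" using elim by (auto simp: r_def)
      have "cmod (c n) \<le> 1"
      proof -
        interpret R: real_distribution "distr unif_seq borel (\<lambda>v. of_bool (v 0 \<le> s n) - s n)"
          by (rule unifs.real_distribution_distr) measurable
        show ?thesis unfolding c_def by (rule R.cmod_char_le_1)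
      qed
      moreover have "cmod (complex_of_real (1 + (- (t\<^sup>2) / 2) / real n)) \<le> 1"
        unfolding norm_of_real using elim by (auto simp: abs_le_iff field_simps)
      ultimately have "cmod (c n ^ n - complex_of_real (1 + (- (t\<^sup>2) / 2) / real n) ^ n) \<le>
          n * cmod (c n - complex_of_real (1 + (- (t\<^sup>2) / 2) / real n))"
        by (rule norm_power_diff)
      also have "cmod (c n - complex_of_real (1 + (- (t\<^sup>2) / 2) / real n)) \<le>
          cmod (c n - (1 - (t / r)\<^sup>2 * (s n * (1 - s n)) / 2)) + cmod (complex_of_real ((1 - (t / r)\<^sup>2 * (s n * (1 - s n)) / 2) - (1 + (- (t\<^sup>2) / 2) / real n)))"
        using dist_triangle[of "c n" "complex_of_real (1 + (- (t\<^sup>2) / 2) / real n)" "complex_of_real (1 - (t / r)\<^sup>2 * (s n * (1 - s n)) / 2)"]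
        unfolding dist_norm of_real_diff by simp
      also have "(1 - (t / r)\<^sup>2 * (s n * (1 - s n)) / 2) - (1 + (- (t\<^sup>2) / 2) / real n) = t\<^sup>2 / 2 * s n / n"
        using elim r by (simp add: power_divide field_simps)
      also have "cmod (complex_of_real (t\<^sup>2 / 2 * s n / n)) = t\<^sup>2 / 2 * s n / n"
        unfolding norm_of_real using elim by simp
      also have "cmod (c n - (1 - (t / r)\<^sup>2 * (s n * (1 - s n)) / 2)) \<le> (t / r)\<^sup>2 / 6 * (\<bar>t / r\<bar> * s n)"
        using c_bound[of n] elim by (simp add: r_def)
      also have "(t / r)\<^sup>2 / 6 * (\<bar>t / r\<bar> * s n) = \<bar>t\<bar> ^ 3 / 6 * inverse r / n"
        using elim r by (simp add: power_divide power3_eq_cube power2_eq_square field_simps)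
      finally have "cmod (c n ^ n - complex_of_real (1 + (- (t\<^sup>2) / 2) / real n) ^ n) \<le>
          n * (\<bar>t\<bar> ^ 3 / 6 * inverse r / n + t\<^sup>2 / 2 * s n / n)" by (simp add: mult_left_mono)
      also have "\<dots> = err n" using elim by (simp add: err_def r_def distrib_left)
      finally show ?case by (simp add: char_eq)
    qed
  qed
  from tendsto_add[OF this lim]
  show "(\<lambda>n. char (distr unif_seq borel (\<lambda>v. (ucount n (s n) v - n * s n) / sqrt (n * s n))) t) \<longlonglongrightarrow> char std_normal_distribution t"
    by (simp add: Y_def[abs_def] char_std_normal_distribution)
qed

text \<open>The \<open>(k+1)\<close>-st smallest of nonnegative \<open>v\<^sub>0, \<dots>, v\<^sub>n\<^sub>-\<^sub>1\<close>, for \<open>k < n\<close>.\<close>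

definition lower_os :: "nat \<Rightarrow> nat \<Rightarrow> (nat \<Rightarrow> real) \<Rightarrow> real" where
  "lower_os n k v = upper_os n v (n - Suc k)"

lemma borel_measurable_lower_os[measurable]: "lower_os n k \<in> borel_measurable unif_seq"
  unfolding lower_os_def[abs_def] by (rule borel_measurable_upper_os) measurable

text \<open>At most n - k - 1 values lie above s exactly when more than k lie at or below it.
  Through this duality the binomial central limit theorem passes to u.\<close>

lemma lower_os_le_iff:
  assumes "k < n"
  shows "lower_os n k v \<le> s \<longleftrightarrow> 0 \<le> s \<and> real k < ucount n s v"
proof -
  have "{..<n} = {j\<in>{..<n}. v j \<le> s} \<union> {j\<in>{..<n}. s < v j}" by auto
  then have "card {..<n} = card ({j\<in>{..<n}. v j \<le> s} \<union> {j\<in>{..<n}. s < v j})" by (rule arg_cong)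
  also have "\<dots> = card {j\<in>{..<n}. v j \<le> s} + card {j\<in>{..<n}. s < v j}"
    by (rule card_Un_disjoint) auto
  finally have "n = card {j\<in>{..<n}. v j \<le> s} + card {j\<in>{..<n}. s < v j}" by simp
  moreover have "ucount n s v = real (card {j\<in>{..<n}. v j \<le> s})"
    by (simp add: ucount_def of_bool_def sum.If_cases Int_def)
  ultimately show ?thesis using assms by (auto simp: lower_os_def upper_os_le_iff)
qed

lemma AE_lower_os_pos:
  assumes "k < n" shows "AE v in unif_seq. 0 < lower_os n k v"
proof -
  have "AE v in unif_seq. \<forall>j\<in>{..<n}. 0 < v j"
  proof (intro AE_finite_allI)
    fix j
    have "AE x in unif. 0 < x" using AE_unif by eventually_elim auto
    then show "AE v in unif_seq. 0 < v j"
      by (intro AE_PiM_component[where P="\<lambda>x. 0 < x"]) (auto intro: unif.prob_space_axioms)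
  qed auto
  then show ?thesis
  proof eventually_elim
    case (elim v)
    have "ucount n 0 v = 0" unfolding ucount_def using elim by (intro sum.neutral ballI) (simp add: not_le)
    then have "\<not> lower_os n k v \<le> 0" by (simp add: lower_os_le_iff[OF assms])
    then show ?case by simp
  qed
qed

lemma std_normal_uminus: "distr std_normal_distribution borel uminus = std_normal_distribution"
proof -
  have rd: "real_distribution std_normal_distribution" by (rule real_dist_normal_dist)
  interpret N: real_distribution std_normal_distribution by (rule rd)
  have "char (distr std_normal_distribution borel uminus) t = char std_normal_distribution t" for t
  proof -
    have "char (distr std_normal_distribution borel uminus) t = char std_normal_distribution (- t)"
      by (simp add: char_def integral_distr)
    then show ?thesis by (simp add: char_std_normal_distribution)
  qed
  then show ?thesis by (intro Levy_uniqueness rd N.real_distribution_distr) auto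
qed

lemma cdf_std_normal_uminus: "cdf std_normal_distribution (- x) = 1 - cdf std_normal_distribution x"
proof -
  interpret N: real_distribution std_normal_distribution by (rule real_dist_normal_dist)
  have "cdf std_normal_distribution (- x) = measure (distr std_normal_distribution borel uminus) {.. - x}"
    by (simp add: cdf_def std_normal_uminus)
  also have "\<dots> = measure std_normal_distribution {x..}"
    by (subst measure_distr) (auto simp: vimage_def atLeast_def)
  also have "{x..} = {x} \<union> {x<..}" by auto
  also have "measure std_normal_distribution \<dots> = measure std_normal_distribution {x} + measure std_normal_distribution {x<..}"
    by (rule N.finite_measure_Union) auto
  also have "measure std_normal_distribution {x<..} = 1 - measure std_normal_distribution {..x}"
    using N.prob_compl[of "{..x}"] by (simp add: Compl_eq_Diff_UNIV[symmetric] Compl_atMost)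
  finally show ?thesis by (simp add: measure_std_normal_singleton cdf_def)
qed

text \<open>The derivative of exp at 0, taken along the increments x/\<kappa>.\<close>

lemma exp_increment_tendsto:
  fixes x :: real
  assumes "filterlim \<kappa> at_top F"
  shows "((\<lambda>n. \<kappa> n * (1 - exp (x / \<kappa> n))) \<longlongrightarrow> - x) F"
proof (cases "x = 0")
  case False
  have "((\<lambda>h. (exp (0 + h) - exp 0) / h) \<longlongrightarrow> (exp 0 :: real)) (at 0)"
    using DERIV_exp[of "0::real"] unfolding DERIV_def .
  moreover have "filterlim (\<lambda>n. x / \<kappa> n) (at 0) F"
  proof -
    have "((\<lambda>n. x / \<kappa> n) \<longlongrightarrow> 0) F"
      by (rule real_tendsto_divide_at_top[OF tendsto_const assms])
    moreover have "\<forall>\<^sub>F n in F. x / \<kappa> n \<noteq> 0"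
      using assms[unfolded filterlim_at_top_dense, rule_format, of 0] by eventually_elim (use False in auto)
    ultimately show ?thesis by (simp add: filterlim_at)
  qed
  ultimately have "((\<lambda>n. (exp (0 + x / \<kappa> n) - exp 0) / (x / \<kappa> n)) \<longlongrightarrow> exp 0) F"
    by (rule filterlim_compose)
  then have "((\<lambda>n. - x * ((exp (0 + x / \<kappa> n) - exp 0) / (x / \<kappa> n))) \<longlongrightarrow> - x * exp 0) F"
    by (intro tendsto_intros)
  moreover have "\<forall>\<^sub>F n in F. - x * ((exp (0 + x / \<kappa> n) - exp 0) / (x / \<kappa> n)) = \<kappa> n * (1 - exp (x / \<kappa> n))"
    using assms[unfolded filterlim_at_top_dense, rule_format, of 0]
    by eventually_elim (use False in \<open>simp add: field_simps\<close>)
  ultimately show ?thesis by (auto intro: Lim_transform_eventually)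
qed simp

text \<open>The event sqrt(k) log(u/p) \<le> x says that more than k of the uniform variables are at
  most s = p e^{x/sqrt(k)}, and the standardised threshold for this count tends to -x. A deviation
  of np from k by at most 1 vanishes after division by sqrt(k), which admits integer parts.\<close>

lemma lower_os_CLT:
  fixes k :: "nat \<Rightarrow> nat" and p :: "nat \<Rightarrow> real"
  assumes k: "filterlim k at_top sequentially" and kn: "\<forall>\<^sub>F n in sequentially. k n < n"
    and p0: "p \<longlonglongrightarrow> 0" and np: "\<forall>\<^sub>F n in sequentially. \<bar>real n * p n - real (k n)\<bar> \<le> 1"
  shows "weak_conv_m (\<lambda>n. distr unif_seq borel (\<lambda>v. sqrt (k n) * ln (lower_os n (k n) v / p n))) std_normal_distribution"
  unfolding weak_conv_m_def weak_conv_def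
proof (intro allI impI)
  fix x :: real
  have rN: "real_distribution std_normal_distribution" by (rule real_dist_normal_dist)
  interpret N: real_distribution std_normal_distribution by (rule rN)
  define \<kappa> where "\<kappa> n = sqrt (real (k n))" for n
  define s where "s n = p n * exp (x / \<kappa> n)" for n
  define c where "c n = (real (k n) - n * s n) / sqrt (n * s n)" for n
  have rk: "filterlim (\<lambda>n. real (k n)) at_top sequentially"
    by (rule filterlim_compose[OF filterlim_real_sequentially k])
  have \<kappa>: "filterlim \<kappa> at_top sequentially"
    unfolding \<kappa>_def by (rule filterlim_compose[OF sqrt_at_top rk])
  have k2: "\<forall>\<^sub>F n in sequentially. 2 \<le> real (k n)"
    using rk unfolding filterlim_at_top by blast
  have i\<kappa>: "(\<lambda>n. inverse (\<kappa> n)) \<longlonglongrightarrow> 0" by (rule tendsto_inverse_0_at_top[OF \<kappa>])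
  have e1: "(\<lambda>n. exp (x / \<kappa> n)) \<longlonglongrightarrow> 1"
    using tendsto_exp[OF tendsto_mult[OF tendsto_const[of x] i\<kappa>]] by (simp add: divide_inverse)
  define r where "r n = real n * p n / real (k n)" for n
  have rb: "\<forall>\<^sub>F n in sequentially. \<bar>\<kappa> n * (1 - r n)\<bar> \<le> inverse (\<kappa> n)"
    using np k2
  proof eventually_elim
    case (elim n)
    have \<kappa>n: "\<kappa> n > 0" "\<kappa> n * \<kappa> n = real (k n)" using elim by (auto simp: \<kappa>_def)
    have "\<kappa> n * (1 - r n) = inverse (\<kappa> n) * (real (k n) - real n * p n)"
      unfolding r_def \<kappa>n(2)[symmetric] using \<kappa>n(1) by (simp add: field_simps)
    also have "\<bar>\<dots>\<bar> \<le> inverse (\<kappa> n) * 1"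
      unfolding abs_mult using \<kappa>n elim by (intro mult_mono) (auto simp: abs_minus_commute)
    finally show ?case by simp
  qed
  have rb0: "(\<lambda>n. \<kappa> n * (1 - r n)) \<longlonglongrightarrow> 0"
    by (rule Lim_null_comparison[OF _ i\<kappa>]) (use rb in simp)
  have r1: "r \<longlonglongrightarrow> 1"
  proof -
    have "(\<lambda>n. 1 - inverse (\<kappa> n) * (\<kappa> n * (1 - r n))) \<longlonglongrightarrow> 1 - 0 * 0"
      by (intro tendsto_intros i\<kappa> rb0)
    moreover have "\<forall>\<^sub>F n in sequentially. 1 - inverse (\<kappa> n) * (\<kappa> n * (1 - r n)) = r n"
      using k2 by eventually_elim (simp add: \<kappa>_def field_simps)
    ultimately show ?thesis by (auto intro: Lim_transform_eventually)
  qed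
  have nsk: "n * s n = real (k n) * (r n * exp (x / \<kappa> n))" if "2 \<le> real (k n)" for n
    using that by (simp add: s_def r_def)
  have re1: "(\<lambda>n. r n * exp (x / \<kappa> n)) \<longlonglongrightarrow> 1"
    using tendsto_mult[OF r1 e1] by simp
  have ns: "filterlim (\<lambda>n. real n * s n) at_top sequentially"
  proof -
    have "filterlim (\<lambda>n. (r n * exp (x / \<kappa> n)) * real (k n)) at_top sequentially"
      by (rule filterlim_tendsto_pos_mult_at_top[OF re1 _ rk]) simp
    then show ?thesis
      by (rule filterlim_mono_eventually[OF _ order_refl order_refl])
        (use k2 in eventually_elim, use nsk in \<open>simp add: mult_ac\<close>)
  qed
  have s0: "s \<longlonglongrightarrow> 0" using tendsto_mult[OF p0 e1] by (simp add: s_def[abs_def])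
  have p_pos: "\<forall>\<^sub>F n in sequentially. 0 < p n"
    using np k2 eventually_gt_at_top[of 0]
  proof eventually_elim
    case (elim n)
    then have "0 < real n * p n" by linarith
    then show ?case using elim by (simp add: zero_less_mult_iff)
  qed
  have s01: "\<forall>\<^sub>F n in sequentially. 0 < s n \<and> s n < 1"
    using p_pos order_tendstoD(2)[OF s0 zero_less_one] by eventually_elim (simp add: s_def)
  \<comment> \<open>Up to a factor tending to 1 the threshold is sqrt(k) (1 - r e^{x/sqrt(k)}).
    Replacing r by 1 costs nothing at this order, and the derivative of exp gives -x.\<close>
  have c: "c \<longlonglongrightarrow> - x"
  proof -
    have "(\<lambda>n. ((\<kappa> n * (1 - r n)) * exp (x / \<kappa> n) + \<kappa> n * (1 - exp (x / \<kappa> n))) / sqrt (r n * exp (x / \<kappa> n))) \<longlonglongrightarrow> (0 * 1 + (- x)) / sqrt 1"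
      by (intro tendsto_divide tendsto_add tendsto_mult tendsto_real_sqrt rb0 e1 re1 exp_increment_tendsto[OF \<kappa>]) simp
    moreover have "\<forall>\<^sub>F n in sequentially. ((\<kappa> n * (1 - r n)) * exp (x / \<kappa> n) + \<kappa> n * (1 - exp (x / \<kappa> n))) / sqrt (r n * exp (x / \<kappa> n)) = c n"
      using k2
    proof eventually_elim
      case (elim n)
      have \<kappa>n: "\<kappa> n > 0" "\<kappa> n * \<kappa> n = real (k n)" using elim by (auto simp: \<kappa>_def)
      have "c n = (\<kappa> n * \<kappa> n * (1 - r n * exp (x / \<kappa> n))) / (\<kappa> n * sqrt (r n * exp (x / \<kappa> n)))"
        unfolding c_def nsk[OF elim] by (simp add: \<kappa>n(2) right_diff_distrib real_sqrt_mult flip: \<kappa>_def)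
      also have "\<dots> = \<kappa> n * (1 - r n * exp (x / \<kappa> n)) / sqrt (r n * exp (x / \<kappa> n))"
        using \<kappa>n(1) by (simp add: mult.assoc)
      finally show ?case by (simp add: algebra_simps)
    qed
    ultimately show ?thesis by (auto intro: Lim_transform_eventually)
  qed
  define Y where "Y n v = (ucount n (s n) v - n * s n) / sqrt (n * s n)" for n v
  have Ym[measurable]: "Y n \<in> borel_measurable unif_seq" for n unfolding Y_def by measurable
  have "weak_conv_m (\<lambda>n. distr unif_seq borel (Y n)) std_normal_distribution"
    unfolding Y_def by (rule ucount_CLT[OF s01 ns s0])
  \<comment> \<open>The moving threshold c n becomes the fixed point -x by a shift of Y: Y \<le> c n
    means Y - (c n + x) \<le> -x.\<close>
  then have "weak_conv_m (\<lambda>n. distr unif_seq borel (\<lambda>v. Y n v - (c n + x))) std_normal_distribution"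
  proof (rule prob_space.weak_conv_Slutsky[OF prob_unif_seq rN, rotated 2])
    have "((\<lambda>n. - (c n + x)) \<longlongrightarrow> - (- x + x)) sequentially"
      by (intro tendsto_intros c)
    then have "((\<lambda>z. - (c (fst z) + x)) \<longlongrightarrow> 0) (whp unif_seq)"
      by (intro prob_space.whp_seq[OF prob_unif_seq]) simp
    then show "((\<lambda>z. Y (fst z) (snd z) - (c (fst z) + x) - Y (fst z) (snd z)) \<longlongrightarrow> 0) (whp unif_seq)"
      by simp
  qed measurable
  then have lim: "(\<lambda>n. cdf (distr unif_seq borel (\<lambda>v. Y n v - (c n + x))) (- x)) \<longlonglongrightarrow> cdf std_normal_distribution (- x)"
    unfolding weak_conv_m_def weak_conv_def by (auto simp: N.isCont_cdf measure_std_normal_singleton)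
  \<comment> \<open>The count must exceed k, hence the complement; symmetry of the normal law turns
    1 - \<Phi>(-x) into \<Phi>(x).\<close>
  have "(\<lambda>n. 1 - cdf (distr unif_seq borel (\<lambda>v. Y n v - (c n + x))) (- x)) \<longlonglongrightarrow> cdf std_normal_distribution x"
    using tendsto_diff[OF tendsto_const[of 1] lim] by (simp add: cdf_std_normal_uminus)
  moreover have "\<forall>\<^sub>F n in sequentially. 1 - cdf (distr unif_seq borel (\<lambda>v. Y n v - (c n + x))) (- x) =
      cdf (distr unif_seq borel (\<lambda>v. sqrt (k n) * ln (lower_os n (k n) v / p n))) x"
    using k2 kn p_pos s01 eventually_gt_at_top[of 0]
  proof eventually_elim
    case (elim n)
    have \<kappa>n: "\<kappa> n > 0" using elim by (auto simp: \<kappa>_def)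
    have ns_pos: "0 < sqrt (n * s n)" using elim by simp
    have "cdf (distr unif_seq borel (\<lambda>v. Y n v - (c n + x))) (- x) = measure unif_seq {v\<in>space unif_seq. Y n v - (c n + x) \<le> - x}"
      by (simp add: cdf_def measure_distr vimage_def Int_def conj_commute)
    also have "{v\<in>space unif_seq. Y n v - (c n + x) \<le> - x} = {v\<in>space unif_seq. ucount n (s n) v \<le> real (k n)}"
    proof -
      have "Y n v - (c n + x) \<le> - x \<longleftrightarrow> ucount n (s n) v \<le> real (k n)" for v
      proof -
        have "Y n v - (c n + x) \<le> - x \<longleftrightarrow> Y n v \<le> c n" by linarith
        also have "\<dots> \<longleftrightarrow> ucount n (s n) v - n * s n \<le> real (k n) - n * s n"
          unfolding Y_def c_def using ns_pos by (simp add: divide_le_cancel)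
        finally show ?thesis by simp
      qed
      then show ?thesis by simp
    qed
    finally have 1: "cdf (distr unif_seq borel (\<lambda>v. Y n v - (c n + x))) (- x) = measure unif_seq {v\<in>space unif_seq. ucount n (s n) v \<le> real (k n)}" .
    have "cdf (distr unif_seq borel (\<lambda>v. sqrt (k n) * ln (lower_os n (k n) v / p n))) x =
        measure unif_seq {v\<in>space unif_seq. \<kappa> n * ln (lower_os n (k n) v / p n) \<le> x}"
      by (simp add: cdf_def measure_distr vimage_def Int_def conj_commute \<kappa>_def)
    also have "\<dots> = measure unif_seq {v\<in>space unif_seq. \<not> ucount n (s n) v \<le> real (k n)}"
    proof (rule measure_eq_AE)
      show "AE v in unif_seq. v \<in> {v\<in>space unif_seq. \<kappa> n * ln (lower_os n (k n) v / p n) \<le> x} \<longleftrightarrow>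
          v \<in> {v\<in>space unif_seq. \<not> ucount n (s n) v \<le> real (k n)}"
        using AE_lower_os_pos[OF elim(2)]
      proof eventually_elim
        case (elim v)
        have "\<kappa> n * ln (lower_os n (k n) v / p n) \<le> x \<longleftrightarrow> ln (lower_os n (k n) v / p n) \<le> x / \<kappa> n"
          using \<kappa>n by (simp add: pos_le_divide_eq mult.commute)
        also have "\<dots> \<longleftrightarrow> lower_os n (k n) v / p n \<le> exp (x / \<kappa> n)"
          using elim \<open>0 < p n\<close> by (metis divide_pos_pos exp_gt_zero exp_ln ln_exp ln_le_cancel_iff)
        also have "\<dots> \<longleftrightarrow> lower_os n (k n) v \<le> s n"
          using \<open>0 < p n\<close> by (simp add: s_def pos_divide_le_eq mult.commute)
        also have "\<dots> \<longleftrightarrow> \<not> ucount n (s n) v \<le> real (k n)"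
          using \<open>0 < s n \<and> s n < 1\<close> by (simp add: lower_os_le_iff[OF \<open>k n < n\<close>] not_le)
        finally show ?case by simp
      qed
    qed measurable
    also have "\<dots> = 1 - measure unif_seq {v\<in>space unif_seq. ucount n (s n) v \<le> real (k n)}"
      by (rule prob_space.prob_neg[OF prob_unif_seq]) measurable
    finally show ?case using 1 by simp
  qed
  ultimately show "(\<lambda>n. cdf (distr unif_seq borel (\<lambda>v. sqrt (k n) * ln (lower_os n (k n) v / p n))) x) \<longlonglongrightarrow> cdf std_normal_distribution x"
    by (auto intro: Lim_transform_eventually)
qed

text \<open>The central limit theorem multiplied by 1/sqrt(k): u/p tends to 1 in
  probability.\<close>

lemma lower_os_ln_ratio:
  fixes k :: "nat \<Rightarrow> nat" and p :: "nat \<Rightarrow> real"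
  assumes k: "filterlim k at_top sequentially" and kn: "\<forall>\<^sub>F n in sequentially. k n < n"
    and p0: "p \<longlonglongrightarrow> 0" and np: "\<forall>\<^sub>F n in sequentially. \<bar>real n * p n - real (k n)\<bar> \<le> 1"
  shows "((\<lambda>z. ln (lower_os (fst z) (k (fst z)) (snd z) / p (fst z))) \<longlongrightarrow> 0) (whp unif_seq)"
    and "\<forall>\<^sub>F z in whp unif_seq. 0 < lower_os (fst z) (k (fst z)) (snd z)"
proof -
  have rk: "filterlim (\<lambda>n. sqrt (real (k n))) at_top sequentially"
    by (rule filterlim_compose[OF sqrt_at_top filterlim_compose[OF filterlim_real_sequentially k]])
  have "((\<lambda>z. inverse (sqrt (real (k (fst z)))) * (sqrt (k (fst z)) * ln (lower_os (fst z) (k (fst z)) (snd z) / p (fst z)))) \<longlongrightarrow> 0) (whp unif_seq)"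
    by (rule prob_space.weak_conv_times_null[OF prob_unif_seq real_dist_normal_dist measure_std_normal_singleton _ lower_os_CLT[OF assms]
          prob_space.whp_seq[OF prob_unif_seq tendsto_inverse_0_at_top[OF rk]]]) measurable
  moreover have "\<forall>\<^sub>F z in whp unif_seq. k (fst z) > 0"
    using k[unfolded filterlim_at_top, rule_format, of 1]
    by (intro prob_space.eventually_whp_seq[OF prob_unif_seq]) (auto elim: eventually_mono)
  then have "\<forall>\<^sub>F z in whp unif_seq. inverse (sqrt (real (k (fst z)))) * (sqrt (k (fst z)) * ln (lower_os (fst z) (k (fst z)) (snd z) / p (fst z))) =
      ln (lower_os (fst z) (k (fst z)) (snd z) / p (fst z))"
    by eventually_elim simp
  ultimately show "((\<lambda>z. ln (lower_os (fst z) (k (fst z)) (snd z) / p (fst z))) \<longlongrightarrow> 0) (whp unif_seq)"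
    by (auto intro: Lim_transform_eventually)
  have "\<forall>\<^sub>F z in whp unif_seq. k (fst z) < fst z \<longrightarrow> 0 < lower_os (fst z) (k (fst z)) (snd z)"
  proof (rule prob_space.eventually_whp_AE[OF prob_unif_seq])
    fix n
    show "AE v in unif_seq. k (fst (n, v)) < fst (n, v) \<longrightarrow> 0 < lower_os (fst (n, v)) (k (fst (n, v))) (snd (n, v))"
      using AE_lower_os_pos[of "k n" n] by (cases "k n < n") auto
  qed
  moreover have "\<forall>\<^sub>F z in whp unif_seq. k (fst z) < fst z" by (rule prob_space.eventually_whp_seq[OF prob_unif_seq kn])
  ultimately show "\<forall>\<^sub>F z in whp unif_seq. 0 < lower_os (fst z) (k (fst z)) (snd z)"
    by eventually_elim auto
qed

section \<open>Empirical means below a uniform order statistic\<close>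

lemma unif_powr:
  assumes "a > -1"
  shows "integrable unif (\<lambda>w. w powr a)" "(\<integral>w. w powr a \<partial>unif) = 1 / (a + 1)"
proof -
  have "((\<lambda>x. x powr a) has_integral (1 powr (a+1) / (a+1))) {0..1::real}"
    using assms by (intro has_integral_powr_from_0) auto
  then have "((\<lambda>x. x powr a) has_integral (1 / (a+1))) {0..1::real}" by simp
  then have hi: "((\<lambda>x. x powr a) has_integral (1 / (a+1))) {0<..<1::real}"
    by (simp add: has_integral_Icc_iff_Ioo)
  have "(\<integral>\<^sup>+w. ennreal (w powr a) \<partial>unif) = (\<integral>\<^sup>+w. ennreal (indicator {0<..<1} w * w powr a) \<partial>lborel)"
    unfolding unif_def by (subst nn_integral_uniform_measure)
      (auto simp: divide_ennreal_def indicator_def intro!: nn_integral_cong)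
  also have "\<dots> = ennreal (1 / (a+1))"
    by (rule nn_integral_has_integral_lebesgue[OF _ hi]) simp
  finally have nn: "(\<integral>\<^sup>+w. ennreal (w powr a) \<partial>unif) = ennreal (1 / (a+1))" .
  show int: "integrable unif (\<lambda>w. w powr a)"
    by (rule integrableI_nonneg) (auto simp: nn measurable_unif)
  show "(\<integral>w. w powr a \<partial>unif) = 1 / (a + 1)"
    using nn assms by (subst integral_eq_nn_integral) (auto simp: measurable_unif)
qed

definition emp_mean :: "nat \<Rightarrow> (real \<Rightarrow> real) \<Rightarrow> (nat \<Rightarrow> real) \<Rightarrow> real" where
  "emp_mean k f w = (1 / real k) * (\<Sum>j<k. f (w j))"

lemma borel_measurable_emp_mean[measurable]:
  assumes [measurable]: "f \<in> borel_measurable borel"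
  shows "emp_mean k f \<in> borel_measurable unif_seq"
  unfolding emp_mean_def[abs_def] by measurable

lemma expectation_unif_seq_coordinate:
  fixes f :: "real \<Rightarrow> real"
  assumes "f \<in> borel_measurable borel"
  shows "(\<integral>w. f (w j) \<partial>unif_seq) = (\<integral>x. f x \<partial>unif)"
proof -
  have "(\<integral>x. f x \<partial>distr unif_seq unif (\<lambda>w. w j)) = (\<integral>w. f (w j) \<partial>unif_seq)"
    by (rule integral_distr) (use assms in \<open>auto simp: measurable_unif intro: measurable_component_singleton\<close>)
  then show ?thesis by (simp add: distr_unif_seq_coordinate)
qed

text \<open>The f (w j) form one i.i.d. sequence, so the classical theorem for sample size N
  applies; it is then read along N = k n.\<close>

lemma emp_mean_CLT:
  fixes f :: "real \<Rightarrow> real" and k :: "nat \<Rightarrow> nat"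
  assumes f[measurable]: "f \<in> borel_measurable borel" and bd: "\<And>x. \<bar>f x\<bar> \<le> C"
    and \<sigma>: "\<sigma> > 0" and var: "(\<integral>x. (f x)\<^sup>2 \<partial>unif) - (\<integral>x. f x \<partial>unif)\<^sup>2 = \<sigma>\<^sup>2"
    and k: "filterlim k at_top sequentially"
  shows "weak_conv_m (\<lambda>n. distr unif_seq borel (\<lambda>w. sqrt (k n) * (emp_mean (k n) f w - (\<integral>x. f x \<partial>unif)) / \<sigma>)) std_normal_distribution"
proof -
  define m where "m = (\<integral>x. f x \<partial>unif)"
  have [measurable]: "f \<in> borel_measurable unif" by (simp add: measurable_unif)
  define X where "X j w = f (w j)" for j :: nat and w :: "nat \<Rightarrow> real"
  have Xm[measurable]: "X j \<in> borel_measurable unif_seq" for j unfolding X_def by measurable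
  have intX: "integrable unif_seq (X j)" "integrable unif_seq (\<lambda>w. (X j w)\<^sup>2)" for j
  proof -
    show "integrable unif_seq (X j)"
      by (rule finite_measure.integrable_const_bound[OF prob_space.finite_measure[OF prob_unif_seq], of _ C]) (auto simp: X_def bd)
    have "C \<ge> 0" using bd[of 0] by linarith
    then have "(f x)\<^sup>2 \<le> C\<^sup>2" for x using bd[of x] by (simp add: abs_le_square_iff[symmetric])
    then show "integrable unif_seq (\<lambda>w. (X j w)\<^sup>2)"
      by (intro finite_measure.integrable_const_bound[OF prob_space.finite_measure[OF prob_unif_seq], of _ "C\<^sup>2"]) (auto simp: X_def)
  qed
  have mean: "(\<integral>w. X j w \<partial>unif_seq) = m" for j
    unfolding X_def m_def by (rule expectation_unif_seq_coordinate[OF f])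
  have mean2: "(\<integral>w. (X j w)\<^sup>2 \<partial>unif_seq) = (\<integral>x. (f x)\<^sup>2 \<partial>unif)" for j
    unfolding X_def by (rule expectation_unif_seq_coordinate) simp
  have "weak_conv_m (\<lambda>n. distr unif_seq borel (\<lambda>w. (\<Sum>i<n. X i w - m) / sqrt (n * \<sigma>\<^sup>2))) std_normal_distribution"
  proof (rule prob_space.central_limit_theorem[OF prob_unif_seq, where \<mu>="distr unif borel f"])
    show "prob_space.indep_vars unif_seq (\<lambda>i. borel) X UNIV"
      using indep_vars_unif_seq[of "\<lambda>_. f"] by (simp add: X_def[abs_def])
    show "distr unif_seq borel (X n) = distr unif borel f" for n
    proof -
      have "distr unif_seq borel (X n) = distr (distr unif_seq unif (\<lambda>w. w n)) borel f"
        by (subst distr_distr) (auto simp: comp_def X_def[abs_def] intro!: measurable_component_singleton)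
      then show ?thesis by (simp add: distr_unif_seq_coordinate)
    qed
    show "(\<integral>x. (X n x - integral\<^sup>L unif_seq (X n))\<^sup>2 \<partial>unif_seq) = \<sigma>\<^sup>2" for n
      by (subst prob_space.variance_eq[OF prob_unif_seq intX]) (simp add: mean mean2 var m_def)
  qed (use \<sigma> intX mean in auto)
  then have "weak_conv_m (\<lambda>n. distr unif_seq borel (\<lambda>w. (\<Sum>i<k n. X i w - m) / sqrt (k n * \<sigma>\<^sup>2))) std_normal_distribution"
    unfolding weak_conv_m_def weak_conv_def using filterlim_compose[OF _ k] by auto
  moreover have "(\<Sum>i<k n. X i w - m) / sqrt (k n * \<sigma>\<^sup>2) = sqrt (k n) * (emp_mean (k n) f w - m) / \<sigma>" for n w
  proof (cases "k n = 0")
    case False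
    have "sqrt (k n) * (emp_mean (k n) f w - m) = sqrt (k n) * ((\<Sum>i<k n. X i w - m) / k n)"
      using False by (simp add: emp_mean_def X_def sum_subtractf field_simps)
    also have "\<dots> = (\<Sum>i<k n. X i w - m) / sqrt (k n)"
    proof -
      have "q * (S / (q * q)) = S / q" for q S :: real by simp
      from this[of "sqrt (k n)"] show ?thesis by simp
    qed
    finally show ?thesis using \<sigma> by (simp add: real_sqrt_mult)
  qed (simp add: emp_mean_def)
  ultimately show ?thesis by (simp add: m_def)
qed

lemma prob_unif_seq_pair: "prob_space (unif_seq \<Otimes>\<^sub>M unif_seq)"
  by (intro prob_space_pair prob_unif_seq)

text \<open>Given the first sequence, the w j are i.i.d., and the empirical average has the integral
  of r (u, x) over x as its mean (or 0 if k = 0). Markov's inequality under this conditional law and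
  Fubini give convergence in probability.\<close>

lemma emp_mean_conditional_null:
  fixes r :: "real \<times> real \<Rightarrow> real" and u :: "nat \<Rightarrow> (nat \<Rightarrow> real) \<Rightarrow> real" and a :: "nat \<Rightarrow> real"
  assumes r[measurable]: "r \<in> borel_measurable borel" and r0: "\<And>z. 0 \<le> r z" and rC: "\<And>z. r z \<le> C"
    and u[measurable]: "\<And>n. u n \<in> borel_measurable unif_seq" and a: "\<And>n. 0 \<le> a n"
    and lim: "((\<lambda>z. a (fst z) * (\<integral>x. r (u (fst z) (snd z), x) \<partial>unif)) \<longlongrightarrow> 0) (whp unif_seq)"
  shows "((\<lambda>z. a (fst z) * emp_mean (k (fst z)) (\<lambda>x. r (u (fst z) (fst (snd z)), x)) (snd (snd z))) \<longlongrightarrow> 0)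
    (whp (unif_seq \<Otimes>\<^sub>M unif_seq))"
proof (rule tendstoI)
  fix e :: real assume e: "e > 0"
  have meas: "(\<lambda>z. emp_mean (k n) (\<lambda>x. r (u n (fst z), x)) (snd z)) \<in> borel_measurable (unif_seq \<Otimes>\<^sub>M unif_seq)" for n
    unfolding emp_mean_def by measurable
  have rm[measurable]: "(\<lambda>x. r (s, x)) \<in> borel_measurable borel" for s by measurable
  have nn: "0 \<le> a n * emp_mean (k n) (\<lambda>x. r (s, x)) w" for n s w
    unfolding emp_mean_def by (intro mult_nonneg_nonneg sum_nonneg a r0) simp
  have E: "(\<integral>w. a n * emp_mean (k n) (\<lambda>x. r (s, x)) w \<partial>unif_seq) \<le> a n * (\<integral>x. r (s, x) \<partial>unif)"
    and int: "integrable unif_seq (\<lambda>w. a n * emp_mean (k n) (\<lambda>x. r (s, x)) w)" for n s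
  proof -
    have i: "integrable unif_seq (\<lambda>w. r (s, w j))" for j
      by (rule finite_measure.integrable_const_bound[OF prob_space.finite_measure[OF prob_unif_seq], of _ C])
         (use r0 rC in auto)
    then show "integrable unif_seq (\<lambda>w. a n * emp_mean (k n) (\<lambda>x. r (s, x)) w)"
      unfolding emp_mean_def by auto
    have "(\<integral>w. a n * emp_mean (k n) (\<lambda>x. r (s, x)) w \<partial>unif_seq) = a n * ((1 / real (k n)) * (\<Sum>j<k n. (\<integral>w. r (s, w j) \<partial>unif_seq)))"
      unfolding emp_mean_def using i by (simp add: Bochner_Integration.integral_sum)
    also have "(\<Sum>j<k n. (\<integral>w. r (s, w j) \<partial>unif_seq)) = real (k n) * (\<integral>x. r (s, x) \<partial>unif)"
      using expectation_unif_seq_coordinate[of "\<lambda>x. r (s, x)"] by simp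
    also have "a n * ((1 / real (k n)) * (real (k n) * (\<integral>x. r (s, x) \<partial>unif))) \<le> a n * (\<integral>x. r (s, x) \<partial>unif)"
      using a[of n] r0 by (intro mult_left_mono) (auto intro!: integral_nonneg)
    finally show "(\<integral>w. a n * emp_mean (k n) (\<lambda>x. r (s, x)) w \<partial>unif_seq) \<le> a n * (\<integral>x. r (s, x) \<partial>unif)" .
  qed
  have "\<forall>\<^sub>F z in whp (unif_seq \<Otimes>\<^sub>M unif_seq). a (fst z) * emp_mean (k (fst z)) (\<lambda>x. r (u (fst z) (fst (snd z)), x)) (snd (snd z)) < e"
  proof (rule whp_pair[OF prob_unif_seq prob_unif_seq])
    show "{z \<in> space (unif_seq \<Otimes>\<^sub>M unif_seq). a n * emp_mean (k n) (\<lambda>x. r (u n (fst z), x)) (snd z) < e} \<in> sets (unif_seq \<Otimes>\<^sub>M unif_seq)" for n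
      using meas by measurable
    fix \<epsilon> :: real assume \<epsilon>: "\<epsilon> > 0"
    have "\<forall>\<^sub>F z in whp unif_seq. dist (a (fst z) * (\<integral>x. r (u (fst z) (snd z), x) \<partial>unif)) 0 < e * \<epsilon>"
      using tendstoD[OF lim, of "e * \<epsilon>"] e \<epsilon> by simp
    then show "\<forall>\<^sub>F z in whp unif_seq. measure unif_seq {w \<in> space unif_seq. \<not> a (fst z) * emp_mean (k (fst z)) (\<lambda>x. r (u (fst z) (snd z), x)) w < e} < \<epsilon>"
    proof eventually_elim
      case (elim z)
      have "measure unif_seq {w \<in> space unif_seq. \<not> a (fst z) * emp_mean (k (fst z)) (\<lambda>x. r (u (fst z) (snd z), x)) w < e}
        = measure unif_seq {w \<in> space unif_seq. e \<le> a (fst z) * emp_mean (k (fst z)) (\<lambda>x. r (u (fst z) (snd z), x)) w}"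
        by (simp add: not_less)
      also have "\<dots> \<le> (\<integral>w. a (fst z) * emp_mean (k (fst z)) (\<lambda>x. r (u (fst z) (snd z), x)) w \<partial>unif_seq) / e"
        by (rule integral_Markov_inequality_measure[where A="{}"]) (use int e nn in auto)
      also have "\<dots> \<le> (a (fst z) * (\<integral>x. r (u (fst z) (snd z), x) \<partial>unif)) / e"
        using E e by (intro divide_right_mono) auto
      also have "\<dots> < (e * \<epsilon>) / e"
        using elim e by (intro divide_strict_right_mono) (auto simp: dist_real_def)
      finally show ?case using e by simp
    qed
  qed
  then show "\<forall>\<^sub>F z in whp (unif_seq \<Otimes>\<^sub>M unif_seq). dist (a (fst z) * emp_mean (k (fst z)) (\<lambda>x. r (u (fst z) (fst (snd z)), x)) (snd (snd z))) 0 < e"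
    by eventually_elim (use nn in \<open>simp add: dist_real_def\<close>)
qed

lemma (in prob_space) distr_pair_snd:
  assumes "sigma_finite_measure N"
  shows "distr (M \<Otimes>\<^sub>M N) N snd = N"
proof (rule measure_eqI)
  fix A assume "A \<in> sets (distr (M \<Otimes>\<^sub>M N) N snd)"
  then have A: "A \<in> sets N" by simp
  have "snd -` A \<inter> space (M \<Otimes>\<^sub>M N) = space M \<times> A"
    using sets.sets_into_space[OF A] by (auto simp: space_pair_measure)
  then show "emeasure (distr (M \<Otimes>\<^sub>M N) N snd) A = emeasure N A"
    using A by (simp add: emeasure_distr sigma_finite_measure.emeasure_pair_measure_Times[OF assms] emeasure_space_1)
qed simp

lemma distr_pair_projections:
  assumes "f \<in> borel_measurable unif_seq"
  shows "distr (unif_seq \<Otimes>\<^sub>M unif_seq) borel (\<lambda>z. f (fst z) :: real) = distr unif_seq borel f"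
    and "distr (unif_seq \<Otimes>\<^sub>M unif_seq) borel (\<lambda>z. f (snd z) :: real) = distr unif_seq borel f"
proof -
  have 1: "distr (unif_seq \<Otimes>\<^sub>M unif_seq) unif_seq fst = unif_seq" "distr (unif_seq \<Otimes>\<^sub>M unif_seq) unif_seq snd = unif_seq"
    by (simp_all add: prob_space.distr_pair_fst[OF prob_unif_seq] prob_space.distr_pair_snd[OF prob_unif_seq] prob_space_imp_sigma_finite[OF prob_unif_seq])
  have "distr (unif_seq \<Otimes>\<^sub>M unif_seq) borel (\<lambda>z. f (fst z)) = distr (distr (unif_seq \<Otimes>\<^sub>M unif_seq) unif_seq fst) borel f"
    using assms by (subst distr_distr) (auto simp: comp_def)
  then show "distr (unif_seq \<Otimes>\<^sub>M unif_seq) borel (\<lambda>z. f (fst z)) = distr unif_seq borel f" by (simp add: 1)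
  have "distr (unif_seq \<Otimes>\<^sub>M unif_seq) borel (\<lambda>z. f (snd z)) = distr (distr (unif_seq \<Otimes>\<^sub>M unif_seq) unif_seq snd) borel f"
    using assms by (subst distr_distr) (auto simp: comp_def)
  then show "distr (unif_seq \<Otimes>\<^sub>M unif_seq) borel (\<lambda>z. f (snd z)) = distr unif_seq borel f" by (simp add: 1)
qed

lemma whp_pair_fst:
  assumes "eventually P (whp unif_seq)"
  shows "\<forall>\<^sub>F z in whp (unif_seq \<Otimes>\<^sub>M unif_seq). P (fst z, fst (snd z))"
  by (rule prob_space.whp_measure_preserving[OF prob_unif_seq_pair prob_unif_seq measurable_fst _ assms])
     (rule prob_space.distr_pair_fst[OF prob_unif_seq])

lemma filterlim_whp_pair_fst:
  "filterlim (\<lambda>z. (fst z, fst (snd z))) (whp unif_seq) (whp (unif_seq \<Otimes>\<^sub>M unif_seq))"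
  unfolding filterlim_iff using whp_pair_fst by auto

section \<open>Log-spacings of quantiles near the frontier\<close>

lemma whp_pair_snd:
  assumes "eventually P (whp unif_seq)"
  shows "\<forall>\<^sub>F z in whp (unif_seq \<Otimes>\<^sub>M unif_seq). P (fst z, snd (snd z))"
  by (rule prob_space.whp_measure_preserving[OF prob_unif_seq_pair prob_unif_seq measurable_snd _ assms])
     (rule prob_space.distr_pair_snd[OF prob_unif_seq prob_space_imp_sigma_finite[OF prob_unif_seq]])

lemma filterlim_whp_pair_snd:
  "filterlim (\<lambda>z. (fst z, snd (snd z))) (whp unif_seq) (whp (unif_seq \<Otimes>\<^sub>M unif_seq))"
  unfolding filterlim_iff using whp_pair_snd by auto

text \<open>Both claims come from the central limit theorem, the first with a = 1/sqrt(k). The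
  strict inequality \<open>var\<close> makes the limiting variance positive, so that division by
  \<sigma> is possible.\<close>

lemma emp_mean_LLN:
  fixes f :: "real \<Rightarrow> real" and k :: "nat \<Rightarrow> nat"
  assumes f[measurable]: "f \<in> borel_measurable borel" and bd: "\<And>x. \<bar>f x\<bar> \<le> C"
    and var: "(\<integral>x. f x \<partial>unif)\<^sup>2 < (\<integral>x. (f x)\<^sup>2 \<partial>unif)"
    and k: "filterlim k at_top sequentially"
  shows "((\<lambda>z. emp_mean (k (fst z)) f (snd z)) \<longlongrightarrow> (\<integral>x. f x \<partial>unif)) (whp unif_seq)"
    and "(a \<longlongrightarrow> 0) (whp unif_seq) \<Longrightarrow>
      ((\<lambda>z. a z * (sqrt (k (fst z)) * (emp_mean (k (fst z)) f (snd z) - (\<integral>x. f x \<partial>unif)))) \<longlongrightarrow> 0) (whp unif_seq)"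
proof -
  let ?m = "\<integral>x. f x \<partial>unif"
  define \<sigma> where "\<sigma> = sqrt ((\<integral>x. (f x)\<^sup>2 \<partial>unif) - ?m\<^sup>2)"
  have \<sigma>: "\<sigma> > 0" "(\<integral>x. (f x)\<^sup>2 \<partial>unif) - ?m\<^sup>2 = \<sigma>\<^sup>2" using var by (auto simp: \<sigma>_def)
  have clt: "weak_conv_m (\<lambda>n. distr unif_seq borel (\<lambda>w. sqrt (k n) * (emp_mean (k n) f w - ?m) / \<sigma>)) std_normal_distribution"
    by (rule emp_mean_CLT[OF f bd \<sigma> k])
  have *: "((\<lambda>z. a z * (sqrt (k (fst z)) * (emp_mean (k (fst z)) f (snd z) - ?m))) \<longlongrightarrow> 0) (whp unif_seq)"
    if "(a \<longlongrightarrow> 0) (whp unif_seq)" for a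
  proof -
    have "((\<lambda>z. a z * (sqrt (k (fst z)) * (emp_mean (k (fst z)) f (snd z) - ?m) / \<sigma>)) \<longlongrightarrow> 0) (whp unif_seq)"
      by (rule prob_space.weak_conv_times_null[OF prob_unif_seq real_dist_normal_dist measure_std_normal_singleton _ clt that]) measurable
    from tendsto_mult_left[OF this, of \<sigma>] show ?thesis using \<sigma>(1) by simp
  qed
  then show "(a \<longlongrightarrow> 0) (whp unif_seq) \<Longrightarrow>
      ((\<lambda>z. a z * (sqrt (k (fst z)) * (emp_mean (k (fst z)) f (snd z) - ?m))) \<longlongrightarrow> 0) (whp unif_seq)" .
  have rk: "filterlim (\<lambda>n. sqrt (real (k n))) at_top sequentially"
    by (rule filterlim_compose[OF sqrt_at_top filterlim_compose[OF filterlim_real_sequentially k]])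
  have "((\<lambda>z. inverse (sqrt (k (fst z))) * (sqrt (k (fst z)) * (emp_mean (k (fst z)) f (snd z) - ?m))) \<longlongrightarrow> 0) (whp unif_seq)"
    by (rule *[OF prob_space.whp_seq[OF prob_unif_seq tendsto_inverse_0_at_top[OF rk]]])
  moreover have "\<forall>\<^sub>F z in whp unif_seq. k (fst z) > 0"
    using k[unfolded filterlim_at_top, rule_format, of 1]
    by (intro prob_space.eventually_whp_seq[OF prob_unif_seq]) (auto elim: eventually_mono)
  then have "\<forall>\<^sub>F z in whp unif_seq. inverse (sqrt (k (fst z))) * (sqrt (k (fst z)) * (emp_mean (k (fst z)) f (snd z) - ?m)) = emp_mean (k (fst z)) f (snd z) - ?m"
    by eventually_elim simp
  ultimately have "((\<lambda>z. emp_mean (k (fst z)) f (snd z) - ?m) \<longlongrightarrow> 0) (whp unif_seq)"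
    by (auto intro: Lim_transform_eventually)
  then show "((\<lambda>z. emp_mean (k (fst z)) f (snd z)) \<longlongrightarrow> ?m) (whp unif_seq)"
    by (simp add: LIM_zero_iff)
qed

text \<open>The argument of Q is an upper level, so the frontier is its limit at 0. Staying strictly
  below \<phi> makes the distance to the frontier positive, as its logarithm and the quotients by it
  require. The role of \<delta> is that of 1/\<rho>.\<close>

locale quantile_end =
  fixes Q :: "real \<Rightarrow> real" and \<phi> \<delta> :: real
  assumes Qm[measurable]: "Q \<in> borel_measurable borel"
    and phi: "\<phi> > 0" and delta: "\<delta> > 0"
    and Q_anti: "antimono_on {0<..<1} Q" and Q_nonneg: "\<And>v. 0 < v \<Longrightarrow> v < 1 \<Longrightarrow> 0 \<le> Q v"
    and Q_less: "\<And>v. 0 < v \<Longrightarrow> v < 1 \<Longrightarrow> Q v < \<phi>"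
    and Q_lim: "(Q \<longlongrightarrow> \<phi>) (at_right 0)"
begin

definition D :: "real \<Rightarrow> real" where "D v = \<phi> - Q v"
definition gap :: "real \<Rightarrow> real" where "gap v = D v / Q v"
definition spacing :: "real \<Rightarrow> real \<Rightarrow> real" where "spacing s w = (ln (Q (s * w)) - ln (Q s)) / gap s"
text \<open>The limit in law of a normalised spacing, cut to 0 off ]0,1[ so that it is bounded on
  the whole line, as the limit theorems for \<open>emp_mean\<close> require.\<close>

definition \<xi> :: "real \<Rightarrow> real" where "\<xi> w = (if 0 < w \<and> w < 1 then 1 - w powr \<delta> else 0)"
text \<open>The error of the power law for D is measured in mean over w, because it enters only
  through averages over the uniform w j.\<close>

definition ratio_error :: "real \<Rightarrow> real" where
  "ratio_error s = (\<integral>w. \<bar>w powr \<delta> - D (s * w) / D s\<bar> \<partial>unif)"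
definition good :: "real \<Rightarrow> bool" where "good s \<longleftrightarrow> 0 < s \<and> s < 1 \<and> 0 < Q s"

lemma D_pos: "0 < v \<Longrightarrow> v < 1 \<Longrightarrow> 0 < D v" by (simp add: D_def Q_less)

lemma D_lim: "(D \<longlongrightarrow> 0) (at_right 0)"
  using tendsto_diff[OF tendsto_const Q_lim, of \<phi>] by (simp add: D_def[abs_def])

lemma gap_lim: "(gap \<longlongrightarrow> 0) (at_right 0)"
  using tendsto_divide[OF D_lim Q_lim] phi by (simp add: gap_def[abs_def])

lemma D_meas[measurable]: "D \<in> borel_measurable borel" unfolding D_def[abs_def] by measurable

lemma gap_meas[measurable]: "gap \<in> borel_measurable borel" unfolding gap_def[abs_def] by measurable

lemma eventually_good: "eventually good (at_right 0)"
proof -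
  have "\<forall>\<^sub>F s in at_right 0. 0 < Q s" using order_tendstoD(1)[OF Q_lim phi] .
  moreover have "\<forall>\<^sub>F s in at_right 0. 0 < s \<and> s < (1::real)"
    by (auto simp: eventually_at_right_field intro!: exI[of _ 1])
  ultimately show ?thesis by eventually_elim (simp add: good_def)
qed

lemma \<xi>_bounds: "0 \<le> \<xi> w" "\<xi> w \<le> 1"
  using delta powr_le1[of \<delta> w] by (auto simp: \<xi>_def)

lemma \<xi>_meas[measurable]: "\<xi> \<in> borel_measurable borel" unfolding \<xi>_def[abs_def] by measurable

text \<open>Put e = gap s and r = 1 - D(sw)/D(s). Then Q(sw)/Q(s) = 1 + er, and y - y^2 \<le>
  log(1+y) \<le> y at y = er puts the spacing within e of r; the distance from r to \<xi> w is the
  error of the power law.\<close>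

lemma spacing_bounds:
  assumes s: "good s" and w: "0 < w" "w < 1"
  shows "0 \<le> spacing s w" "spacing s w \<le> 1"
    and "\<bar>spacing s w - \<xi> w\<bar> \<le> gap s + \<bar>w powr \<delta> - D (s * w) / D s\<bar>"
proof -
  have s': "0 < s" "s < 1" "0 < Q s" using s by (auto simp: good_def)
  have lt: "s * w < s" using s' w by simp
  note sw = mult_pos_pos[OF s'(1) w(1)] less_trans[OF lt s'(2)] less_imp_le[OF lt]
  have mem: "s \<in> {0<..<1}" "s * w \<in> {0<..<1}"
    using s' sw(1,2) unfolding greaterThanLessThan_iff by blast+
  have Ds: "0 < D s" "0 < D (s * w)" using D_pos[OF s'(1,2)] D_pos[OF sw(1,2)] .
  have Qle: "Q s \<le> Q (s * w)" using monotone_onD[OF Q_anti mem(2,1) sw(3)] by simp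
  define e where "e = gap s"
  have e: "e > 0" using Ds s' by (simp add: e_def gap_def)
  define r where "r = (D s - D (s * w)) / D s"
  have r: "0 \<le> r" "r \<le> 1" using Ds Qle by (auto simp: r_def D_def)
  have "Q (s * w) / Q s = 1 + e * r" using s' Ds by (simp add: e_def gap_def r_def) (simp add: D_def field_simps)
  moreover have "ln (Q (s * w) / Q s) = ln (Q (s * w)) - ln (Q s)"
    using s'(3) Qle by (simp add: ln_div)
  ultimately have lnq: "ln (Q (s * w)) - ln (Q s) = ln (1 + e * r)" by simp
  then have sp: "spacing s w = ln (1 + e * r) / e" by (simp add: spacing_def e_def)
  have er: "0 \<le> e * r" using e r by simp
  have up: "ln (1 + e * r) \<le> e * r" using ln_add_one_self_le_self[OF er] .
  have lo: "e * r - (e * r)\<^sup>2 \<le> ln (1 + e * r)"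
  proof -
    have "e * r / (1 + e * r) \<le> ln (1 + e * r)"
    proof -
      have "y / (1 + y) \<le> ln (1 + y)" if "0 \<le> y" for y :: real
      proof -
        have "- ln (1 + y) \<le> inverse (1 + y) - 1"
          using ln_le_minus_one[of "inverse (1 + y)"] that by (simp add: ln_inverse)
        also have "inverse (1 + y) - 1 = - (y / (1 + y))" using that by (simp add: field_simps)
        finally show ?thesis by simp
      qed
      from this[OF er] show ?thesis .
    qed
    moreover have "e * r - (e * r)\<^sup>2 \<le> e * r / (1 + e * r)"
    proof -
      have "(y - y\<^sup>2) * (1 + y) \<le> y" if "0 \<le> y" for y :: real
      proof -
        have "(y - y\<^sup>2) * (1 + y) = y - y * y\<^sup>2" by (simp add: algebra_simps power2_eq_square)
        then show ?thesis using that by simp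
      qed
      from this[OF er] er show ?thesis by (simp add: pos_le_divide_eq)
    qed
    ultimately show ?thesis by linarith
  qed
  show "0 \<le> spacing s w" unfolding sp using e er by simp
  have "spacing s w \<le> r" unfolding sp using up e by (simp add: pos_divide_le_eq mult.commute)
  then show "spacing s w \<le> 1" using r by simp
  have "(r - e * r\<^sup>2) * e = e * r - (e * r)\<^sup>2" by (simp add: power2_eq_square algebra_simps)
  then have "(r - e * r\<^sup>2) * e \<le> ln (1 + e * r)" using lo by (simp only:)
  then have "r - e * r\<^sup>2 \<le> spacing s w" unfolding sp pos_le_divide_eq[OF e] .
  moreover have "e * r\<^sup>2 \<le> e" using e r power_le_one[of r 2] by (simp add: mult_le_cancel_left1)
  ultimately have "\<bar>spacing s w - r\<bar> \<le> e" using \<open>spacing s w \<le> r\<close> by linarith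
  moreover have "r - \<xi> w = w powr \<delta> - D (s * w) / D s" using w Ds by (simp add: r_def \<xi>_def diff_divide_distrib)
  ultimately show "\<bar>spacing s w - \<xi> w\<bar> \<le> gap s + \<bar>w powr \<delta> - D (s * w) / D s\<bar>"
    unfolding e_def[symmetric] by linarith
qed

lemma ratio_integrand:
  assumes s: "good s" and w: "0 < w" "w < 1"
  shows "\<bar>w powr \<delta> - D (s * w) / D s\<bar> \<le> 1"
proof -
  have s': "0 < s" "s < 1" using s by (auto simp: good_def)
  have lt: "s * w < s" using s' w by simp
  note sw = mult_pos_pos[OF s'(1) w(1)] less_trans[OF lt s'(2)] less_imp_le[OF lt]
  have mem: "s \<in> {0<..<1}" "s * w \<in> {0<..<1}"
    using s' sw(1,2) unfolding greaterThanLessThan_iff by blast+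
  have "0 < D s" "0 < D (s * w)" "D (s * w) \<le> D s"
    using D_pos[OF s'(1,2)] D_pos[OF sw(1,2)] monotone_onD[OF Q_anti mem(2,1) sw(3)] by (simp_all add: D_def)
  then have "0 \<le> D (s * w) / D s" "D (s * w) / D s \<le> 1" by auto
  moreover have "0 \<le> w powr \<delta>" "w powr \<delta> \<le> 1" using w delta powr_le1[of \<delta> w] by auto
  ultimately show ?thesis by linarith
qed

text \<open>Set to 0 where the quantities are not meaningful, so that it is measurable on the plane
  with values in [0,1] everywhere, as the conditional Markov bound requires.\<close>

definition spacing_error :: "real \<times> real \<Rightarrow> real" where
  "spacing_error = (\<lambda>(s, w). if good s \<and> 0 < w \<and> w < 1 then \<bar>spacing s w - \<xi> w\<bar> else 0)"

lemma spacing_meas[measurable]: "(\<lambda>z. spacing (fst z) (snd z)) \<in> borel_measurable (borel \<Otimes>\<^sub>M borel)"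
  unfolding spacing_def gap_def by measurable

lemma spacing_error_meas[measurable]: "spacing_error \<in> borel_measurable borel"
proof -
  have "spacing_error = (\<lambda>z. if good (fst z) \<and> 0 < snd z \<and> snd z < 1 then \<bar>spacing (fst z) (snd z) - \<xi> (snd z)\<bar> else 0)"
    by (auto simp: spacing_error_def)
  also have "\<dots> \<in> borel_measurable (borel \<Otimes>\<^sub>M borel)" unfolding good_def by measurable
  finally show ?thesis by (simp add: borel_prod)
qed

lemma spacing_error_bounds: "0 \<le> spacing_error z" "spacing_error z \<le> 1"
proof -
  show "0 \<le> spacing_error z" by (simp add: spacing_error_def split: prod.split)
  show "spacing_error z \<le> 1"
    using spacing_bounds(1,2)[of "fst z" "snd z"] \<xi>_bounds[of "snd z"]
    by (auto simp: spacing_error_def split: prod.split)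
qed

lemma spacing_error_integral:
  assumes "good s"
  shows "(\<integral>w. spacing_error (s, w) \<partial>unif) \<le> gap s + ratio_error s"
proof -
  have m: "(\<lambda>w. \<bar>w powr \<delta> - D (s * w) / D s\<bar>) \<in> borel_measurable unif"
    by (subst measurable_unif) measurable
  have i1: "integrable unif (\<lambda>w. \<bar>w powr \<delta> - D (s * w) / D s\<bar>)"
    by (rule unif.integrable_const_bound[of _ 1, OF _ m]) (use AE_unif in eventually_elim, use ratio_integrand[OF assms] in auto)
  have i2: "integrable unif (\<lambda>w. spacing_error (s, w))"
    by (rule unif.integrable_const_bound[of _ 1]) (use spacing_error_bounds in \<open>auto simp: measurable_unif\<close>)
  have "(\<integral>w. spacing_error (s, w) \<partial>unif) \<le> (\<integral>w. gap s + \<bar>w powr \<delta> - D (s * w) / D s\<bar> \<partial>unif)"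
  proof (rule integral_mono_AE[OF i2])
    show "integrable unif (\<lambda>w. gap s + \<bar>w powr \<delta> - D (s * w) / D s\<bar>)"
      using i1 by (intro Bochner_Integration.integrable_add) auto
    show "AE w in unif. spacing_error (s, w) \<le> gap s + \<bar>w powr \<delta> - D (s * w) / D s\<bar>"
      using AE_unif by eventually_elim (use spacing_bounds(3)[OF assms] assms in \<open>auto simp: spacing_error_def\<close>)
  qed
  also have "\<dots> = gap s + ratio_error s"
    using i1 by (subst Bochner_Integration.integral_add) (auto simp: ratio_error_def unif.prob_space[unfolded space_unif])
  finally show ?thesis .
qed

lemma ratio_error_nonneg: "0 \<le> ratio_error s"
  unfolding ratio_error_def by (rule integral_nonneg_AE) simp

text \<open>Dominated convergence; the integrand is at most 1 because D increases.\<close>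

lemma ratio_error_tendsto:
  assumes "\<And>w. 0 < w \<Longrightarrow> w < 1 \<Longrightarrow> ((\<lambda>s. D (s * w) / D s) \<longlongrightarrow> w powr \<delta>) (at_right 0)"
  shows "(ratio_error \<longlongrightarrow> 0) (at_right 0)"
  unfolding filterlim_at_right_to_top ratio_error_def
proof -
  have inv: "filterlim inverse (at_right (0::real)) at_top"
    by (rule filterlim_inverse_at_right_top)
  have m: "(\<lambda>w. \<bar>w powr \<delta> - D (s * w) / D s\<bar>) \<in> borel_measurable unif" for s
    by (subst measurable_unif) measurable
  have "((\<lambda>x. \<integral>w. \<bar>w powr \<delta> - D (inverse x * w) / D (inverse x)\<bar> \<partial>unif) \<longlongrightarrow> (\<integral>w. 0 \<partial>unif)) at_top"
  proof (rule integral_dominated_convergence_at_top[where w="\<lambda>_. 1"])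
    show "\<forall>\<^sub>F x in at_top. AE w in unif. norm \<bar>w powr \<delta> - D (inverse x * w) / D (inverse x)\<bar> \<le> 1"
    proof -
      have "\<forall>\<^sub>F x in at_top. good (inverse x)" using inv eventually_good unfolding filterlim_iff by blast
      then show ?thesis
      proof eventually_elim
        case (elim x)
        show ?case using AE_unif by eventually_elim (use ratio_integrand[OF elim] in auto)
      qed
    qed
    show "AE w in unif. ((\<lambda>x. \<bar>w powr \<delta> - D (inverse x * w) / D (inverse x)\<bar>) \<longlongrightarrow> 0) at_top"
      using AE_unif
    proof eventually_elim
      case (elim w)
      have "((\<lambda>x. D (inverse x * w) / D (inverse x)) \<longlongrightarrow> w powr \<delta>) at_top"
        by (rule filterlim_compose[OF assms inv]) (use elim in auto)
      from tendsto_rabs[OF tendsto_diff[OF tendsto_const[of "w powr \<delta>"] this]] show ?case by simp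
    qed
  qed (use m in auto)
  then show "((\<lambda>x. \<integral>w. \<bar>w powr \<delta> - D (inverse x * w) / D (inverse x)\<bar> \<partial>unif) \<longlongrightarrow> 0) at_top" by simp
qed

text \<open>The weight a is 1 for laws of large numbers and sqrt(k) for the delta method. Given u,
  the average of |spacing - \<xi>| is controlled by its mean; for squares, spacing and \<xi> both
  lie in [0,1], which costs a factor 2.\<close>

lemma spacing_mean_approx:
  fixes u :: "nat \<Rightarrow> (nat \<Rightarrow> real) \<Rightarrow> real" and a :: "nat \<Rightarrow> real" and k :: "nat \<Rightarrow> nat"
  assumes u[measurable]: "\<And>n. u n \<in> borel_measurable unif_seq" and a: "\<And>n. 0 \<le> a n"
    and u0: "filterlim (\<lambda>z. u (fst z) (snd z)) (at_right 0) (whp unif_seq)"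
    and lim1: "((\<lambda>z. a (fst z) * gap (u (fst z) (snd z))) \<longlongrightarrow> 0) (whp unif_seq)"
    and lim2: "((\<lambda>z. a (fst z) * ratio_error (u (fst z) (snd z))) \<longlongrightarrow> 0) (whp unif_seq)"
  shows "((\<lambda>z. a (fst z) * (emp_mean (k (fst z)) (spacing (u (fst z) (fst (snd z)))) (snd (snd z))
      - emp_mean (k (fst z)) \<xi> (snd (snd z)))) \<longlongrightarrow> 0) (whp (unif_seq \<Otimes>\<^sub>M unif_seq))" (is ?A)
    and "((\<lambda>z. a (fst z) * (emp_mean (k (fst z)) (\<lambda>x. (spacing (u (fst z) (fst (snd z))) x)\<^sup>2) (snd (snd z))
      - emp_mean (k (fst z)) (\<lambda>x. (\<xi> x)\<^sup>2) (snd (snd z)))) \<longlongrightarrow> 0) (whp (unif_seq \<Otimes>\<^sub>M unif_seq))" (is ?B)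
proof -
  have goodu: "\<forall>\<^sub>F z in whp unif_seq. good (u (fst z) (snd z))"
    using u0 eventually_good unfolding filterlim_iff by blast
  have "((\<lambda>z. a (fst z) * (\<integral>x. spacing_error (u (fst z) (snd z), x) \<partial>unif)) \<longlongrightarrow> 0) (whp unif_seq)"
  proof (rule Lim_null_comparison)
    show "((\<lambda>z. a (fst z) * gap (u (fst z) (snd z)) + a (fst z) * ratio_error (u (fst z) (snd z))) \<longlongrightarrow> 0) (whp unif_seq)"
      using tendsto_add[OF lim1 lim2] by simp
    show "\<forall>\<^sub>F z in whp unif_seq. norm (a (fst z) * (\<integral>x. spacing_error (u (fst z) (snd z), x) \<partial>unif)) \<le>
        a (fst z) * gap (u (fst z) (snd z)) + a (fst z) * ratio_error (u (fst z) (snd z))"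
      using goodu
    proof eventually_elim
      case (elim z)
      have "0 \<le> (\<integral>x. spacing_error (u (fst z) (snd z), x) \<partial>unif)"
        by (rule integral_nonneg_AE) (simp add: spacing_error_bounds)
      then show ?case
        using mult_left_mono[OF spacing_error_integral[OF elim] a[of "fst z"]] a[of "fst z"] by (simp add: distrib_left)
    qed
  qed
  from emp_mean_conditional_null[OF spacing_error_meas spacing_error_bounds u a this, where k=k]
  have R: "((\<lambda>z. a (fst z) * emp_mean (k (fst z)) (\<lambda>x. spacing_error (u (fst z) (fst (snd z)), x)) (snd (snd z))) \<longlongrightarrow> 0) (whp (unif_seq \<Otimes>\<^sub>M unif_seq))" .
  have w01: "\<forall>\<^sub>F z in whp (unif_seq \<Otimes>\<^sub>M unif_seq). \<forall>j. 0 < snd (snd z) j \<and> snd (snd z) j < 1"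
  proof -
    have "AE w in unif_seq. \<forall>j. 0 < w j \<and> w j < 1"
      unfolding AE_all_countable
      by (intro allI AE_PiM_component[where P="\<lambda>x. 0 < x \<and> x < 1"] AE_unif unif.prob_space_axioms) auto
    then have "\<forall>\<^sub>F z in whp unif_seq. \<forall>j. 0 < snd z j \<and> snd z j < (1::real)"
      by (intro prob_space.eventually_whp_AE[OF prob_unif_seq]) simp
    from whp_pair_snd[OF this] show ?thesis by simp
  qed
  have ev: "\<forall>\<^sub>F z in whp (unif_seq \<Otimes>\<^sub>M unif_seq). good (u (fst z) (fst (snd z))) \<and> (\<forall>j. 0 < snd (snd z) j \<and> snd (snd z) j < 1)"
    using whp_pair_fst[OF goodu] w01 by eventually_elim auto
  have emp_diff: "\<bar>emp_mean n f w - emp_mean n g w\<bar> \<le> c * emp_mean n h w"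
    if "\<And>j. \<bar>f (w j) - g (w j)\<bar> \<le> c * h (w j)" for n f g h c w
  proof -
    have "emp_mean n f w - emp_mean n g w = (1 / real n) * (\<Sum>j<n. f (w j) - g (w j))"
      by (simp add: emp_mean_def sum_subtractf right_diff_distrib)
    also have "\<bar>\<dots>\<bar> \<le> (1 / real n) * (\<Sum>j<n. \<bar>f (w j) - g (w j)\<bar>)"
      by (simp add: abs_mult divide_right_mono)
    also have "\<dots> \<le> (1 / real n) * (\<Sum>j<n. c * h (w j))"
      by (intro mult_left_mono sum_mono that) auto
    also have "\<dots> = c * emp_mean n h w" by (simp add: emp_mean_def sum_distrib_left[symmetric])
    finally show ?thesis .
  qed
  show ?A
  proof (rule Lim_null_comparison[OF _ R])
    show "\<forall>\<^sub>F z in whp (unif_seq \<Otimes>\<^sub>M unif_seq). norm (a (fst z) * (emp_mean (k (fst z)) (spacing (u (fst z) (fst (snd z)))) (snd (snd z))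
      - emp_mean (k (fst z)) \<xi> (snd (snd z)))) \<le> a (fst z) * emp_mean (k (fst z)) (\<lambda>x. spacing_error (u (fst z) (fst (snd z)), x)) (snd (snd z))"
      using ev
    proof eventually_elim
      case (elim z)
      have "\<bar>emp_mean (k (fst z)) (spacing (u (fst z) (fst (snd z)))) (snd (snd z)) - emp_mean (k (fst z)) \<xi> (snd (snd z))\<bar>
        \<le> 1 * emp_mean (k (fst z)) (\<lambda>x. spacing_error (u (fst z) (fst (snd z)), x)) (snd (snd z))"
        by (rule emp_diff) (use elim in \<open>simp add: spacing_error_def\<close>)
      then show ?case using a[of "fst z"] by (simp add: abs_mult mult_left_mono)
    qed
  qed
  have R2: "((\<lambda>z. 2 * (a (fst z) * emp_mean (k (fst z)) (\<lambda>x. spacing_error (u (fst z) (fst (snd z)), x)) (snd (snd z)))) \<longlongrightarrow> 0) (whp (unif_seq \<Otimes>\<^sub>M unif_seq))"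
    using tendsto_mult_left[OF R, of 2] by simp
  show ?B
  proof (rule Lim_null_comparison[OF _ R2])
    show "\<forall>\<^sub>F z in whp (unif_seq \<Otimes>\<^sub>M unif_seq). norm (a (fst z) * (emp_mean (k (fst z)) (\<lambda>x. (spacing (u (fst z) (fst (snd z))) x)\<^sup>2) (snd (snd z))
      - emp_mean (k (fst z)) (\<lambda>x. (\<xi> x)\<^sup>2) (snd (snd z)))) \<le> 2 * (a (fst z) * emp_mean (k (fst z)) (\<lambda>x. spacing_error (u (fst z) (fst (snd z)), x)) (snd (snd z)))"
      using ev
    proof eventually_elim
      case (elim z)
      let ?s = "u (fst z) (fst (snd z))"
      have "\<bar>emp_mean (k (fst z)) (\<lambda>x. (spacing ?s x)\<^sup>2) (snd (snd z)) - emp_mean (k (fst z)) (\<lambda>x. (\<xi> x)\<^sup>2) (snd (snd z))\<bar>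
        \<le> 2 * emp_mean (k (fst z)) (\<lambda>x. spacing_error (?s, x)) (snd (snd z))"
      proof (rule emp_diff)
        fix j
        let ?w = "snd (snd z) j"
        have "(spacing ?s ?w)\<^sup>2 - (\<xi> ?w)\<^sup>2 = (spacing ?s ?w + \<xi> ?w) * (spacing ?s ?w - \<xi> ?w)"
          by (simp add: power2_eq_square algebra_simps)
        also have "\<bar>\<dots>\<bar> \<le> 2 * \<bar>spacing ?s ?w - \<xi> ?w\<bar>"
          unfolding abs_mult using spacing_bounds(1,2)[of ?s ?w] elim \<xi>_bounds[of ?w]
          by (intro mult_right_mono) auto
        finally show "\<bar>(spacing ?s ?w)\<^sup>2 - (\<xi> ?w)\<^sup>2\<bar> \<le> 2 * spacing_error (?s, ?w)"
          using elim by (simp add: spacing_error_def)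
      qed
      from mult_left_mono[OF this a[of "fst z"]] a[of "fst z"] show ?case by (simp add: abs_mult mult_ac)
    qed
  qed
qed

end

section \<open>Moments of the limiting spacing and the variance \<open>V5\<close>\<close>

lemma V5_closed_form:
  assumes "\<rho> > 0"
  shows "V5 \<rho> = \<rho> ^ 3 * (1 + \<rho>)\<^sup>2 * (\<rho>\<^sup>2 + 3 * \<rho> + 4) / ((2 + \<rho>) * (3 + \<rho>) * (4 + \<rho>))"
proof -
  have nz: "2 + \<rho> \<noteq> 0" "3 + \<rho> \<noteq> 0" "4 + \<rho> \<noteq> 0" using assms by auto
  show ?thesis unfolding V5_def using nz
    by (simp add: divide_simps) (simp add: algebra_simps power2_eq_square power3_eq_cube)
qed

text \<open>The bracket that defines \<open>V5\<close> has terms of both signs; its sign becomes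
  visible once it is a single fraction.\<close>

lemma V5_pos: "\<rho> > 0 \<Longrightarrow> V5 \<rho> > 0"
  by (subst V5_closed_form) (auto intro!: divide_pos_pos mult_pos_pos add_pos_pos)

context quantile_end
begin

abbreviation \<rho> :: real where "\<rho> \<equiv> 1 / \<delta>"

lemma rho_pos: "\<rho> > 0" using delta by simp

lemma \<xi>_moment_poly:
  "has_bochner_integral unif (\<lambda>w. a0 + a1 * w powr \<delta> + a2 * w powr (2 * \<delta>) + a3 * w powr (3 * \<delta>) + a4 * w powr (4 * \<delta>))
    (a0 + a1 * (1 / (\<delta> + 1)) + a2 * (1 / (2 * \<delta> + 1)) + a3 * (1 / (3 * \<delta> + 1)) + a4 * (1 / (4 * \<delta> + 1)))"
proof -
  have p: "has_bochner_integral unif (\<lambda>w. w powr (c * \<delta>)) (1 / (c * \<delta> + 1))" if "c > 0" for c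
  proof -
    have "c * \<delta> > -1" using that delta mult_pos_pos[of c \<delta>] by linarith
    from unif_powr[OF this] show ?thesis by (simp add: has_bochner_integral_iff)
  qed
  have "has_bochner_integral unif (\<lambda>w. a0) a0"
    by (simp add: has_bochner_integral_iff unif.prob_space[unfolded space_unif])
  then show ?thesis
    using p[of 1] p[of 2] p[of 3] p[of 4]
    by (intro has_bochner_integral_add has_bochner_integral_mult_right) auto
qed

text \<open>The substitution w = t^\<rho> turns the m-th moment into \<rho> times the Beta integral
  of \<rho> and m + 1, that is m!/((1+\<rho>)...(m+\<rho>)). Here it is computed by expanding in
  powers of w^\<delta>.\<close>

lemma \<xi>_moments:
  "(\<integral>w. \<xi> w \<partial>unif) = 1 / (1 + \<rho>)"
  "(\<integral>w. (\<xi> w)\<^sup>2 \<partial>unif) = 2 / ((1 + \<rho>) * (2 + \<rho>))"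
  "(\<integral>w. (\<xi> w) ^ 3 \<partial>unif) = 6 / ((1 + \<rho>) * (2 + \<rho>) * (3 + \<rho>))"
  "(\<integral>w. (\<xi> w) ^ 4 \<partial>unif) = 24 / ((1 + \<rho>) * (2 + \<rho>) * (3 + \<rho>) * (4 + \<rho>))"
proof -
  have pw: "w powr (2 * \<delta>) = (w powr \<delta>)\<^sup>2" "w powr (3 * \<delta>) = (w powr \<delta>) ^ 3" "w powr (4 * \<delta>) = (w powr \<delta>) ^ 4" if "0 < w" for w :: real
    using that by (simp_all add: powr_power mult.commute)
  have I: "(\<integral>w. f w \<partial>unif) = a0 + a1 * (1 / (\<delta> + 1)) + a2 * (1 / (2 * \<delta> + 1)) + a3 * (1 / (3 * \<delta> + 1)) + a4 * (1 / (4 * \<delta> + 1))"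
    if "f \<in> borel_measurable borel"
      and "\<And>w. 0 < w \<Longrightarrow> w < 1 \<Longrightarrow> f w = a0 + a1 * w powr \<delta> + a2 * w powr (2 * \<delta>) + a3 * w powr (3 * \<delta>) + a4 * w powr (4 * \<delta>)"
    for f :: "real \<Rightarrow> real" and a0 a1 a2 a3 a4
  proof -
    have "(\<integral>w. f w \<partial>unif) = (\<integral>w. a0 + a1 * w powr \<delta> + a2 * w powr (2 * \<delta>) + a3 * w powr (3 * \<delta>) + a4 * w powr (4 * \<delta>) \<partial>unif)"
      by (rule integral_cong_AE) (use that AE_unif in \<open>auto simp: measurable_unif\<close>)
    then show ?thesis using has_bochner_integral_integral_eq[OF \<xi>_moment_poly] by simp
  qed
  have d: "\<delta> + 1 \<noteq> 0" "2 * \<delta> + 1 \<noteq> 0" "3 * \<delta> + 1 \<noteq> 0" "4 * \<delta> + 1 \<noteq> 0" "\<delta> \<noteq> 0" using delta by auto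
  have "(\<integral>w. \<xi> w \<partial>unif) = 1 + (-1) * (1 / (\<delta> + 1)) + 0 * (1 / (2 * \<delta> + 1)) + 0 * (1 / (3 * \<delta> + 1)) + 0 * (1 / (4 * \<delta> + 1))"
    by (rule I) (auto simp: \<xi>_def)
  then show "(\<integral>w. \<xi> w \<partial>unif) = 1 / (1 + \<rho>)" using d by (simp add: field_simps)
  have "(\<integral>w. (\<xi> w)\<^sup>2 \<partial>unif) = 1 + (-2) * (1 / (\<delta> + 1)) + 1 * (1 / (2 * \<delta> + 1)) + 0 * (1 / (3 * \<delta> + 1)) + 0 * (1 / (4 * \<delta> + 1))"
  proof (rule I)
    fix w :: real assume w: "0 < w" "w < 1"
    show "(\<xi> w) ^ 2 = 1 + (-2) * w powr \<delta> + 1 * w powr (2 * \<delta>) + 0 * w powr (3 * \<delta>) + 0 * w powr (4 * \<delta>)"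
      unfolding pw[OF w(1)] using w by (simp add: \<xi>_def power2_eq_square algebra_simps)
  qed measurable
  also have "\<dots> = 2 * \<delta>\<^sup>2 / ((\<delta> + 1) * (2 * \<delta> + 1))"
    using d by (simp add: divide_simps) (simp add: algebra_simps power2_eq_square)
  also have "\<dots> = 2 / ((1 + \<rho>) * (2 + \<rho>))"
    using d by (simp add: divide_simps) (simp add: algebra_simps power2_eq_square)
  finally show "(\<integral>w. (\<xi> w)\<^sup>2 \<partial>unif) = 2 / ((1 + \<rho>) * (2 + \<rho>))" .
  have "(\<integral>w. (\<xi> w) ^ 3 \<partial>unif) = 1 + (-3) * (1 / (\<delta> + 1)) + 3 * (1 / (2 * \<delta> + 1)) + (-1) * (1 / (3 * \<delta> + 1)) + 0 * (1 / (4 * \<delta> + 1))"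
  proof (rule I)
    fix w :: real assume w: "0 < w" "w < 1"
    show "(\<xi> w) ^ 3 = 1 + (-3) * w powr \<delta> + 3 * w powr (2 * \<delta>) + (-1) * w powr (3 * \<delta>) + 0 * w powr (4 * \<delta>)"
      unfolding pw[OF w(1)] using w by (simp add: \<xi>_def power2_eq_square power3_eq_cube algebra_simps)
  qed measurable
  also have "\<dots> = 6 * \<delta> ^ 3 / ((\<delta> + 1) * (2 * \<delta> + 1) * (3 * \<delta> + 1))"
    using d by (simp add: divide_simps) (simp add: algebra_simps power3_eq_cube)
  also have "\<dots> = 6 / ((1 + \<rho>) * (2 + \<rho>) * (3 + \<rho>))"
    using d by (simp add: divide_simps) (simp add: algebra_simps power3_eq_cube)
  finally show "(\<integral>w. (\<xi> w) ^ 3 \<partial>unif) = 6 / ((1 + \<rho>) * (2 + \<rho>) * (3 + \<rho>))" .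
  have "(\<integral>w. (\<xi> w) ^ 4 \<partial>unif) = 1 + (-4) * (1 / (\<delta> + 1)) + 6 * (1 / (2 * \<delta> + 1)) + (-4) * (1 / (3 * \<delta> + 1)) + 1 * (1 / (4 * \<delta> + 1))"
  proof (rule I)
    fix w :: real assume w: "0 < w" "w < 1"
    show "(\<xi> w) ^ 4 = 1 + (-4) * w powr \<delta> + 6 * w powr (2 * \<delta>) + (-4) * w powr (3 * \<delta>) + 1 * w powr (4 * \<delta>)"
      unfolding pw[OF w(1)] using w by (simp add: \<xi>_def power4_eq_xxxx power2_eq_square power3_eq_cube algebra_simps)
  qed measurable
  also have "\<dots> = 24 * \<delta> ^ 4 / ((\<delta> + 1) * (2 * \<delta> + 1) * (3 * \<delta> + 1) * (4 * \<delta> + 1))"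
    using d by (simp add: divide_simps) (simp add: algebra_simps power4_eq_xxxx)
  also have "\<dots> = 24 / ((1 + \<rho>) * (2 + \<rho>) * (3 + \<rho>) * (4 + \<rho>))"
    using d by (simp add: divide_simps) (simp add: algebra_simps power4_eq_xxxx)
  finally show "(\<integral>w. (\<xi> w) ^ 4 \<partial>unif) = 24 / ((1 + \<rho>) * (2 + \<rho>) * (3 + \<rho>) * (4 + \<rho>))" .
qed

text \<open>For \<rho> = r the left sides are the variance of \<xi>, the covariance of \<xi> and
  \<xi>^2, and the variance of \<xi>^2.\<close>

lemma \<xi>_covariances:
  "2 / ((1 + r) * (2 + r)) - (1 / (1 + r))\<^sup>2 = r / ((1 + r)\<^sup>2 * (2 + r))"
  "6 / ((1 + r) * (2 + r) * (3 + r)) - 1 / (1 + r) * (2 / ((1 + r) * (2 + r))) = 4 * r / ((1 + r)\<^sup>2 * (2 + r) * (3 + r))"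
  "24 / ((1 + r) * (2 + r) * (3 + r) * (4 + r)) - (2 / ((1 + r) * (2 + r)))\<^sup>2 = 4 * r * (11 + 5 * r) / ((1 + r)\<^sup>2 * (2 + r)\<^sup>2 * (3 + r) * (4 + r))"
  if "r > 0" for r :: real
proof -
  have nz: "1 + r \<noteq> 0" "2 + r \<noteq> 0" "3 + r \<noteq> 0" "4 + r \<noteq> 0" using that by auto
  show "2 / ((1 + r) * (2 + r)) - (1 / (1 + r))\<^sup>2 = r / ((1 + r)\<^sup>2 * (2 + r))"
    using nz by (simp add: divide_simps power2_eq_square, (simp add: algebra_simps)?)
  show "6 / ((1 + r) * (2 + r) * (3 + r)) - 1 / (1 + r) * (2 / ((1 + r) * (2 + r))) = 4 * r / ((1 + r)\<^sup>2 * (2 + r) * (3 + r))"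
    using nz by (simp add: divide_simps power2_eq_square, (simp add: algebra_simps)?)
  show "24 / ((1 + r) * (2 + r) * (3 + r) * (4 + r)) - (2 / ((1 + r) * (2 + r)))\<^sup>2 = 4 * r * (11 + 5 * r) / ((1 + r)\<^sup>2 * (2 + r)\<^sup>2 * (3 + r) * (4 + r))"
    using nz by (simp add: divide_simps power2_eq_square, (simp add: algebra_simps)?)
qed

text \<open>The linear part, at the limiting moments, of the delta method for the moment estimator.\<close>

definition influence :: "real \<Rightarrow> real" where
  "influence w = \<rho> * (1 + \<rho>) * ((2 + \<rho>)\<^sup>2 / 2 * (\<xi> w)\<^sup>2 - (3 + 2 * \<rho>) * \<xi> w)"

lemma \<xi>_power_integrable: "integrable unif (\<lambda>w. (\<xi> w) ^ i)"
  by (rule unif.integrable_const_bound[of _ 1])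
     (use \<xi>_bounds in \<open>auto simp: measurable_unif power_le_one\<close>)

text \<open>With \<open>influence\<close> = A \<xi> + B \<xi>^2 the variance is A^2 Var(\<xi>) + 2AB
  Cov(\<xi>, \<xi>^2) + B^2 Var(\<xi>^2), which the covariance formulas make rational in
  \<rho>.\<close>

lemma influence_variance:
  "(\<integral>w. (influence w)\<^sup>2 \<partial>unif) - (\<integral>w. influence w \<partial>unif)\<^sup>2 = V5 \<rho>"
proof -
  define r where "r = \<rho>"
  have r: "r > 0" using rho_pos by (simp add: r_def)
  define A where "A = - (r * (1 + r) * (3 + 2 * r))"
  define B where "B = r * (1 + r) * (2 + r)\<^sup>2 / 2"
  have infl: "influence w = A * \<xi> w + B * (\<xi> w)\<^sup>2" for w
    by (simp add: influence_def A_def B_def r_def[symmetric] algebra_simps)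
  have i: "integrable unif \<xi>" "integrable unif (\<lambda>w. (\<xi> w)\<^sup>2)" "integrable unif (\<lambda>w. (\<xi> w) ^ 3)" "integrable unif (\<lambda>w. (\<xi> w) ^ 4)"
    using \<xi>_power_integrable[of 1] \<xi>_power_integrable by auto
  define e1 e2 e3 e4 where "e1 = 1 / (1 + r)" and "e2 = 2 / ((1 + r) * (2 + r))"
    and "e3 = 6 / ((1 + r) * (2 + r) * (3 + r))" and "e4 = 24 / ((1 + r) * (2 + r) * (3 + r) * (4 + r))"
  have m1: "(\<integral>w. influence w \<partial>unif) = A * e1 + B * e2"
    unfolding infl using i by (simp add: \<xi>_moments e1_def e2_def r_def)
  have sq: "(influence w)\<^sup>2 = A\<^sup>2 * (\<xi> w)\<^sup>2 + 2 * A * B * (\<xi> w) ^ 3 + B\<^sup>2 * (\<xi> w) ^ 4" for w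
    unfolding infl by (simp add: power2_eq_square power3_eq_cube power4_eq_xxxx algebra_simps)
  have m2: "(\<integral>w. (influence w)\<^sup>2 \<partial>unif) = A\<^sup>2 * e2 + 2 * A * B * e3 + B\<^sup>2 * e4"
    unfolding sq using i by (simp add: \<xi>_moments e2_def e3_def e4_def r_def)
  have "(\<integral>w. (influence w)\<^sup>2 \<partial>unif) - (\<integral>w. influence w \<partial>unif)\<^sup>2 =
      A\<^sup>2 * (e2 - e1\<^sup>2) + 2 * A * B * (e3 - e1 * e2) + B\<^sup>2 * (e4 - e2\<^sup>2)"
    unfolding m1 m2 by (simp add: power2_eq_square algebra_simps)
  also have "\<dots> = A\<^sup>2 * (r / ((1 + r)\<^sup>2 * (2 + r))) + 2 * A * B * (4 * r / ((1 + r)\<^sup>2 * (2 + r) * (3 + r)))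
      + B\<^sup>2 * (4 * r * (11 + 5 * r) / ((1 + r)\<^sup>2 * (2 + r)\<^sup>2 * (3 + r) * (4 + r)))"
    unfolding e1_def e2_def e3_def e4_def \<xi>_covariances[OF r] ..
  also have "\<dots> = r ^ 3 * ((3 + 2 * r)\<^sup>2 / (2 + r)) - r ^ 3 * (4 * (3 + 2 * r) * (2 + r) / (3 + r))
      + r ^ 3 * ((2 + r)\<^sup>2 * (11 + 5 * r) / ((3 + r) * (4 + r)))"
  proof -
    have nz: "1 + r \<noteq> 0" "2 + r \<noteq> 0" "3 + r \<noteq> 0" "4 + r \<noteq> 0" using r by auto
    have "A\<^sup>2 * (r / ((1 + r)\<^sup>2 * (2 + r))) = r ^ 3 * ((3 + 2 * r)\<^sup>2 / (2 + r))"
      using nz by (simp add: A_def divide_simps power2_eq_square power3_eq_cube)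
    moreover have "2 * A * B * (4 * r / ((1 + r)\<^sup>2 * (2 + r) * (3 + r))) = - (r ^ 3 * (4 * (3 + 2 * r) * (2 + r) / (3 + r)))"
      using nz by (simp add: A_def B_def divide_simps power2_eq_square power3_eq_cube)
    moreover have "B\<^sup>2 * (4 * r * (11 + 5 * r) / ((1 + r)\<^sup>2 * (2 + r)\<^sup>2 * (3 + r) * (4 + r))) = r ^ 3 * ((2 + r)\<^sup>2 * (11 + 5 * r) / ((3 + r) * (4 + r)))"
      using nz by (simp add: B_def divide_simps power2_eq_square power3_eq_cube)
    ultimately show ?thesis by simp
  qed
  also have "\<dots> = V5 r"
  proof -
    have nz: "2 + r \<noteq> 0" "3 + r \<noteq> 0" "4 + r \<noteq> 0" using r by auto
    then show ?thesis unfolding V5_closed_form[OF r]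
      by (simp add: divide_simps) (simp add: algebra_simps power2_eq_square power3_eq_cube)
  qed
  finally show ?thesis by (simp add: r_def)
qed

lemma \<xi>_variance_pos:
  "(\<integral>w. \<xi> w \<partial>unif)\<^sup>2 < (\<integral>w. (\<xi> w)\<^sup>2 \<partial>unif)"
  "(\<integral>w. (\<xi> w)\<^sup>2 \<partial>unif)\<^sup>2 < (\<integral>w. ((\<xi> w)\<^sup>2)\<^sup>2 \<partial>unif)"
proof -
  define r where "r = \<rho>"
  have r: "r > 0" using rho_pos by (simp add: r_def)
  have "0 < 2 / ((1 + r) * (2 + r)) - (1 / (1 + r))\<^sup>2"
    unfolding \<xi>_covariances[OF r] using r by (intro divide_pos_pos mult_pos_pos) auto
  then show "(\<integral>w. \<xi> w \<partial>unif)\<^sup>2 < (\<integral>w. (\<xi> w)\<^sup>2 \<partial>unif)" by (simp add: \<xi>_moments r_def)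
  have "0 < 24 / ((1 + r) * (2 + r) * (3 + r) * (4 + r)) - (2 / ((1 + r) * (2 + r)))\<^sup>2"
    unfolding \<xi>_covariances[OF r] using r by (intro divide_pos_pos mult_pos_pos) auto
  moreover have "((\<xi> w)\<^sup>2)\<^sup>2 = (\<xi> w) ^ 4" for w by (simp flip: power_mult)
  ultimately show "(\<integral>w. (\<xi> w)\<^sup>2 \<partial>unif)\<^sup>2 < (\<integral>w. ((\<xi> w)\<^sup>2)\<^sup>2 \<partial>unif)" by (simp add: \<xi>_moments r_def)
qed

end

section \<open>Limits of the quantile and moment statistics\<close>

text \<open>The factor \<open>a\<close> may depend on both coordinates, so the second claim is not a
  mere transfer from one sequence; the tightness argument is carried out on the product.\<close>

lemma emp_mean_LLN_pair:
  fixes f :: "real \<Rightarrow> real" and k :: "nat \<Rightarrow> nat"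
  assumes f[measurable]: "f \<in> borel_measurable borel" and bd: "\<And>x. \<bar>f x\<bar> \<le> C"
    and var: "(\<integral>x. f x \<partial>unif)\<^sup>2 < (\<integral>x. (f x)\<^sup>2 \<partial>unif)"
    and k: "filterlim k at_top sequentially"
  shows "((\<lambda>z. emp_mean (k (fst z)) f (snd (snd z))) \<longlongrightarrow> (\<integral>x. f x \<partial>unif)) (whp (unif_seq \<Otimes>\<^sub>M unif_seq))"
    and "(a \<longlongrightarrow> 0) (whp (unif_seq \<Otimes>\<^sub>M unif_seq)) \<Longrightarrow>
      ((\<lambda>z. a z * (sqrt (k (fst z)) * (emp_mean (k (fst z)) f (snd (snd z)) - (\<integral>x. f x \<partial>unif)))) \<longlongrightarrow> 0) (whp (unif_seq \<Otimes>\<^sub>M unif_seq))"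
proof -
  show "((\<lambda>z. emp_mean (k (fst z)) f (snd (snd z))) \<longlongrightarrow> (\<integral>x. f x \<partial>unif)) (whp (unif_seq \<Otimes>\<^sub>M unif_seq))"
    using filterlim_compose[OF emp_mean_LLN(1)[OF assms] filterlim_whp_pair_snd] by simp
  assume a: "(a \<longlongrightarrow> 0) (whp (unif_seq \<Otimes>\<^sub>M unif_seq))"
  let ?m = "\<integral>x. f x \<partial>unif"
  define \<sigma> where "\<sigma> = sqrt ((\<integral>x. (f x)\<^sup>2 \<partial>unif) - ?m\<^sup>2)"
  have \<sigma>: "\<sigma> > 0" "(\<integral>x. (f x)\<^sup>2 \<partial>unif) - ?m\<^sup>2 = \<sigma>\<^sup>2" using var by (auto simp: \<sigma>_def)
  define S where "S n w = sqrt (k n) * (emp_mean (k n) f w - ?m) / \<sigma>" for n w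
  have Sm[measurable]: "S n \<in> borel_measurable unif_seq" for n unfolding S_def by measurable
  have "weak_conv_m (\<lambda>n. distr unif_seq borel (S n)) std_normal_distribution"
    unfolding S_def by (rule emp_mean_CLT[OF f bd \<sigma> k])
  then have clt: "weak_conv_m (\<lambda>n. distr (unif_seq \<Otimes>\<^sub>M unif_seq) borel (\<lambda>z. S n (snd z))) std_normal_distribution"
    by (simp only: distr_pair_projections(2)[OF Sm])
  have "((\<lambda>z. a z * S (fst z) (snd (snd z))) \<longlongrightarrow> 0) (whp (unif_seq \<Otimes>\<^sub>M unif_seq))"
    by (rule prob_space.weak_conv_times_null[OF prob_unif_seq_pair real_dist_normal_dist measure_std_normal_singleton _ clt a]) measurable
  from tendsto_mult_left[OF this, of \<sigma>]
  show "((\<lambda>z. a z * (sqrt (k (fst z)) * (emp_mean (k (fst z)) f (snd (snd z)) - ?m))) \<longlongrightarrow> 0) (whp (unif_seq \<Otimes>\<^sub>M unif_seq))"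
    using \<sigma>(1) by (simp add: S_def)
qed

text \<open>The value at 0 fills the removable singularity, so the limit can be composed with a null
  quantity that may vanish.\<close>

lemma exp_quotient_tendsto:
  "((\<lambda>y::real. if y = 0 then -1 else (exp (- y) - 1) / y) \<longlongrightarrow> -1) (nhds 0)"
proof -
  have "((\<lambda>y. exp (- y)) has_real_derivative (- 1)) (at (0::real))"
    by (auto intro!: derivative_eq_intros)
  then have "((\<lambda>y::real. (exp (- y) - 1) / y) \<longlongrightarrow> - 1) (at 0)" unfolding DERIV_def by simp
  then have "((\<lambda>y::real. if y = 0 then -1 else (exp (- y) - 1) / y) \<longlongrightarrow> - 1) (at 0)"
    by (rule Lim_transform_eventually) (auto simp: eventually_at_filter)
  then show ?thesis by (simp add: tendsto_nhds_iff)
qed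

text \<open>An exact identity for \<phi> = q (1 + \<eta>) with \<eta> the gap. Here
  \<open>\<gamma>\<close> is the moment estimator of the extreme value index -1/\<rho>. Outside
  \<open>\<gamma>\<close>, the gap survives only in (1 - m1) M1, and the numerator m2 + m1 m2 - 2
  m1^2 of the other term vanishes at the limits 1/(1+\<rho>) and 2/((1+\<rho>)(2+\<rho>)) of m1 and
  m2.\<close>

lemma moment_frontier_identity:
  fixes q \<eta> m1 m2 sk :: real
  defines "M1 \<equiv> m1 * \<eta>" and "M2 \<equiv> m2 * \<eta>\<^sup>2"
  defines "\<gamma> \<equiv> M1 + 1 - 1/2 * (m2 / (m2 - m1\<^sup>2))"
  assumes nz: "q \<noteq> 0" "\<eta> \<noteq> 0" "m1 \<noteq> 0" "m2 \<noteq> 0" "m2 - m1\<^sup>2 \<noteq> 0" "\<gamma> \<noteq> 0" "1 - \<gamma> \<noteq> 0"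
  defines "\<rho>t \<equiv> - inverse (M1 + 1 - (1/2) * inverse (1 - M1\<^sup>2 / M2))"
  shows "sk * ((q * (1 + M1 * (1 + \<rho>t)) - q * (1 + \<eta>)) / (M1 * (1 + 1 / \<rho>t) * q)) =
    1 / ((1 - \<gamma>) * m1 * (- \<gamma>)) * (sk * ((1 - m1) * M1) + sk * (m2 + m1 * m2 - 2 * m1\<^sup>2) / (2 * (m2 - m1\<^sup>2)))"
proof -
  have "inverse (1 - M1\<^sup>2 / M2) = m2 / (m2 - m1\<^sup>2)"
  proof -
    have "1 - M1\<^sup>2 / M2 = (m2 - m1\<^sup>2) / m2" using nz by (simp add: M1_def M2_def power_mult_distrib diff_divide_distrib)
    then show ?thesis by (simp add: inverse_eq_divide)
  qed
  then have \<rho>t: "\<rho>t = - inverse \<gamma>" by (simp add: \<rho>t_def \<gamma>_def)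
  have "(q * (1 + M1 * (1 + \<rho>t)) - q * (1 + \<eta>)) = q * \<eta> * (m1 * (1 - 1 / \<gamma>) - 1)"
    by (simp add: \<rho>t M1_def algebra_simps inverse_eq_divide)
  moreover have "M1 * (1 + 1 / \<rho>t) * q = q * \<eta> * (m1 * (1 - \<gamma>))"
    using nz by (simp add: \<rho>t M1_def inverse_eq_divide)
  ultimately have "(q * (1 + M1 * (1 + \<rho>t)) - q * (1 + \<eta>)) / (M1 * (1 + 1 / \<rho>t) * q) = (m1 * (1 - 1 / \<gamma>) - 1) / (m1 * (1 - \<gamma>))"
    using nz by simp
  also have "\<dots> = 1 / ((1 - \<gamma>) * m1 * (- \<gamma>)) * (m1 * (1 - \<gamma>) + \<gamma>)"
  proof -
    have "m1 * (1 - 1 / \<gamma>) - 1 = (m1 * (1 - \<gamma>) + \<gamma>) / (- \<gamma>)" using nz by (simp add: field_simps)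
    then show ?thesis by (simp add: mult_ac)
  qed
  also have "m1 * (1 - \<gamma>) + \<gamma> = (1 - m1) * M1 + (m2 + m1 * m2 - 2 * m1\<^sup>2) / (2 * (m2 - m1\<^sup>2))"
  proof -
    define V where "V = m2 - m1\<^sup>2"
    have V: "V \<noteq> 0" using nz by (simp add: V_def)
    have "m1 * (1 - \<gamma>) + \<gamma> = (1 - m1) * M1 + (1 - (1 - m1) * (m2 / (2 * V)))"
    proof -
      define h where "h = m2 / (2 * V)"
      have \<gamma>h: "\<gamma> = M1 + 1 - h" by (simp add: \<gamma>_def V_def[symmetric] h_def)
      show ?thesis unfolding \<gamma>h h_def[symmetric] by (simp add: algebra_simps)
    qed
    also have "1 - (1 - m1) * (m2 / (2 * V)) = (2 * V - (1 - m1) * m2) / (2 * V)"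
      using V by (simp add: diff_divide_distrib)
    also have "2 * V - (1 - m1) * m2 = m2 + m1 * m2 - 2 * m1\<^sup>2" by (simp add: V_def algebra_simps)
    finally show ?thesis by (simp add: V_def)
  qed
  finally have e: "(q * (1 + M1 * (1 + \<rho>t)) - q * (1 + \<eta>)) / (M1 * (1 + 1 / \<rho>t) * q) =
      1 / ((1 - \<gamma>) * m1 * (- \<gamma>)) * ((1 - m1) * M1 + (m2 + m1 * m2 - 2 * m1\<^sup>2) / (2 * (m2 - m1\<^sup>2)))" .
  have "sk * (c * (a + w / d)) = c * (sk * a + sk * w / d)" for c a w d :: real
    by (simp add: distrib_left mult_ac)
  then show ?thesis unfolding e .
qed

section \<open>The statistics on a pair of uniform sequences\<close>

locale intermediate_quantile_end = quantile_end +
  fixes k :: "nat \<Rightarrow> nat"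
  assumes k_top: "filterlim k at_top sequentially" and k_less: "\<forall>\<^sub>F n in sequentially. k n < n"
begin

abbreviation F where "F \<equiv> whp (unif_seq \<Otimes>\<^sub>M unif_seq)"

definition U where "U z = lower_os (fst z) (k (fst z)) (snd z)"
text \<open>The l-th log-moment in the representation: the first sequence supplies u, the second the
  points u w j below it.\<close>

definition L where "L l n z = (1 / real (k n)) * (\<Sum>j<k n. (ln (Q (lower_os n (k n) (fst z) * snd z j)) - ln (Q (lower_os n (k n) (fst z)))) ^ l)"
definition U' :: "nat \<times> (nat \<Rightarrow> real) \<times> (nat \<Rightarrow> real) \<Rightarrow> real" where "U' z = U (fst z, fst (snd z))"
definition m1 where "m1 z = emp_mean (k (fst z)) (spacing (U' z)) (snd (snd z))"
definition m2 where "m2 z = emp_mean (k (fst z)) (\<lambda>x. (spacing (U' z) x)\<^sup>2) (snd (snd z))"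

lemma L_meas[measurable]: "L l n \<in> borel_measurable (unif_seq \<Otimes>\<^sub>M unif_seq)"
  unfolding L_def by measurable

lemma L_eq:
  assumes "good (U' z)"
  shows "L 1 (fst z) (snd z) = m1 z * gap (U' z)" "L 2 (fst z) (snd z) = m2 z * (gap (U' z))\<^sup>2"
proof -
  have "gap (U' z) \<noteq> 0" using assms D_pos by (auto simp: gap_def good_def less_le)
  then have sp: "ln (Q (U' z * x)) - ln (Q (U' z)) = spacing (U' z) x * gap (U' z)" for x
    by (simp add: spacing_def)
  have u: "lower_os (fst z) (k (fst z)) (fst (snd z)) = U' z" by (simp add: U'_def U_def)
  show "L 1 (fst z) (snd z) = m1 z * gap (U' z)"
    by (simp add: L_def u sp m1_def emp_mean_def sum_distrib_right)
  show "L 2 (fst z) (snd z) = m2 z * (gap (U' z))\<^sup>2"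
    by (simp add: L_def u sp m2_def emp_mean_def sum_distrib_right power_mult_distrib)
qed

lemma U_tendsto:
  assumes p0: "p \<longlonglongrightarrow> 0" and np: "\<forall>\<^sub>F n in sequentially. \<bar>real n * p n - real (k n)\<bar> \<le> 1"
  shows "filterlim U (at_right 0) (whp unif_seq)" "filterlim p (at_right 0) sequentially"
proof -
  have "\<forall>\<^sub>F n in sequentially. 2 \<le> k n" using k_top unfolding filterlim_at_top by blast
  then have pp: "\<forall>\<^sub>F n in sequentially. 0 < p n"
    using np eventually_gt_at_top[of 0]
  proof eventually_elim
    case (elim n)
    then have "0 < real n * p n" by linarith
    then show ?case using elim by (simp add: zero_less_mult_iff)
  qed
  then show "filterlim p (at_right 0) sequentially" using p0 by (simp add: filterlim_at eventually_conj_iff)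
      (auto elim: eventually_mono)
  note lr = lower_os_ln_ratio[OF k_top k_less p0 np]
  have "((\<lambda>z. p (fst z) * exp (ln (lower_os (fst z) (k (fst z)) (snd z) / p (fst z)))) \<longlongrightarrow> 0 * exp 0) (whp unif_seq)"
    by (intro tendsto_mult tendsto_exp lr(1) prob_space.whp_seq[OF prob_unif_seq p0])
  moreover have "\<forall>\<^sub>F z in whp unif_seq. p (fst z) * exp (ln (lower_os (fst z) (k (fst z)) (snd z) / p (fst z))) = U z"
    using lr(2) prob_space.eventually_whp_seq[OF prob_unif_seq pp]
    by eventually_elim (simp add: U_def)
  ultimately have "(U \<longlongrightarrow> 0) (whp unif_seq)" by (auto intro: Lim_transform_eventually)
  then show "filterlim U (at_right 0) (whp unif_seq)"
    using lr(2) by (auto simp: filterlim_at U_def elim!: eventually_mono)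
qed

lemma U_meas[measurable]: "(\<lambda>v. U (n, v)) \<in> borel_measurable unif_seq"
  unfolding U_def by simp

lemma
  assumes U0: "filterlim U (at_right 0) (whp unif_seq)" and a: "\<And>n. 0 \<le> a n"
    and lim1: "((\<lambda>z. a (fst z) * gap (U z)) \<longlongrightarrow> 0) (whp unif_seq)"
    and lim2: "((\<lambda>z. a (fst z) * ratio_error (U z)) \<longlongrightarrow> 0) (whp unif_seq)"
  shows m1_approx: "((\<lambda>z. a (fst z) * (m1 z - emp_mean (k (fst z)) \<xi> (snd (snd z)))) \<longlongrightarrow> 0) F"
    and m2_approx: "((\<lambda>z. a (fst z) * (m2 z - emp_mean (k (fst z)) (\<lambda>x. (\<xi> x)\<^sup>2) (snd (snd z)))) \<longlongrightarrow> 0) F"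
  using spacing_mean_approx[of "\<lambda>n v. U (n, v)" a k] assms
  by (simp_all add: m1_def m2_def U'_def)

lemma \<xi>_abs: "\<bar>\<xi> x\<bar> \<le> 1" "\<bar>(\<xi> x)\<^sup>2\<bar> \<le> 1"
  using \<xi>_bounds[of x] by (auto intro: power_le_one)

lemma U'_lim: "filterlim U (at_right 0) (whp unif_seq) \<Longrightarrow> filterlim U' (at_right 0) F"
  unfolding U'_def using filterlim_compose[OF _ filterlim_whp_pair_fst] by blast

lemma moments_LLN:
  assumes U0: "filterlim U (at_right 0) (whp unif_seq)"
    and re: "((\<lambda>z. ratio_error (U z)) \<longlongrightarrow> 0) (whp unif_seq)"
  shows "(m1 \<longlongrightarrow> 1 / (1 + \<rho>)) F" "(m2 \<longlongrightarrow> 2 / ((1 + \<rho>) * (2 + \<rho>))) F"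
proof -
  have g: "((\<lambda>z. gap (U z)) \<longlongrightarrow> 0) (whp unif_seq)" by (rule filterlim_compose[OF gap_lim U0])
  from m1_approx[OF U0, of "\<lambda>_. 1"] g re
  have 1: "((\<lambda>z. m1 z - emp_mean (k (fst z)) \<xi> (snd (snd z))) \<longlongrightarrow> 0) F" by simp
  from m2_approx[OF U0, of "\<lambda>_. 1"] g re
  have 2: "((\<lambda>z. m2 z - emp_mean (k (fst z)) (\<lambda>x. (\<xi> x)\<^sup>2) (snd (snd z))) \<longlongrightarrow> 0) F" by simp
  have "((\<lambda>z. emp_mean (k (fst z)) \<xi> (snd (snd z))) \<longlongrightarrow> 1 / (1 + \<rho>)) F"
    using emp_mean_LLN_pair(1)[OF \<xi>_meas \<xi>_abs(1) \<xi>_variance_pos(1) k_top] by (simp add: \<xi>_moments)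
  from tendsto_add[OF 1 this] show "(m1 \<longlongrightarrow> 1 / (1 + \<rho>)) F" by simp
  have "((\<lambda>z. emp_mean (k (fst z)) (\<lambda>x. (\<xi> x)\<^sup>2) (snd (snd z))) \<longlongrightarrow> 2 / ((1 + \<rho>) * (2 + \<rho>))) F"
    using emp_mean_LLN_pair(1)[OF _ \<xi>_abs(2) \<xi>_variance_pos(2) k_top] by (simp add: \<xi>_moments)
  from tendsto_add[OF 2 this] show "(m2 \<longlongrightarrow> 2 / ((1 + \<rho>) * (2 + \<rho>))) F" by simp
qed

text \<open>With high probability the statistic is exactly c sqrt(k) log(u/p): (D(p) - D(u))/D(u) =
  e^{-y} - 1 for y = log D(u) - log D(p) = \<theta> log(u/p), and c = g(y) \<theta>/m1 tends to
  -\<delta>(1+\<rho>) = -(1+\<delta>).\<close>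

theorem quantile_limit:
  assumes p0: "p \<longlonglongrightarrow> 0" and np: "\<forall>\<^sub>F n in sequentially. \<bar>real n * p n - real (k n)\<bar> \<le> 1"
    and ratio: "\<And>w. 0 < w \<Longrightarrow> w < 1 \<Longrightarrow> ((\<lambda>s. D (s * w) / D s) \<longlongrightarrow> w powr \<delta>) (at_right 0)"
    and slope: "\<And>a b :: nat \<times> (nat \<Rightarrow> real) \<times> (nat \<Rightarrow> real) \<Rightarrow> real. filterlim a (at_right 0) F \<Longrightarrow> filterlim b (at_right 0) F \<Longrightarrow>
      ((\<lambda>z. if a z = b z then \<delta> else (ln (D (a z)) - ln (D (b z))) / (ln (a z) - ln (b z))) \<longlongrightarrow> \<delta>) F"
  shows "weak_conv_m (\<lambda>n. distr (unif_seq \<Otimes>\<^sub>M unif_seq) borel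
      (\<lambda>z. sqrt (k n) * ((Q (lower_os n (k n) (fst z)) - Q (p n)) / (L 1 n z * Q (lower_os n (k n) (fst z))))))
    (normal_law 0 ((1 + \<delta>)\<^sup>2))"
proof -
  note U0 = U_tendsto(1)[OF p0 np] and pr = U_tendsto(2)[OF p0 np]
  note U'0 = U'_lim[OF U0]
  have pF: "filterlim (\<lambda>z. p (fst z)) (at_right 0) F"
    by (rule prob_space.whp_seq[OF prob_unif_seq_pair pr])
  have re: "((\<lambda>z. ratio_error (U z)) \<longlongrightarrow> 0) (whp unif_seq)"
    by (rule filterlim_compose[OF ratio_error_tendsto[OF ratio] U0])
  note m1 = moments_LLN(1)[OF U0 re]
  \<comment> \<open>The chord slope of log D between the random u and the deterministic p. As u/p
    tends to 1, regular variation at fixed ratios would say nothing about this slope.\<close>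
  define \<theta> where "\<theta> z = (if U' z = p (fst z) then \<delta> else (ln (D (U' z)) - ln (D (p (fst z)))) / (ln (U' z) - ln (p (fst z))))" for z
  have \<theta>: "(\<theta> \<longlongrightarrow> \<delta>) F" unfolding \<theta>_def by (rule slope[OF U'0 pF])
  define S where "S n v = sqrt (k n) * ln (lower_os n (k n) v / p n)" for n v
  have Sm[measurable]: "S n \<in> borel_measurable unif_seq" for n unfolding S_def by measurable
  have clt: "weak_conv_m (\<lambda>n. distr (unif_seq \<Otimes>\<^sub>M unif_seq) borel (\<lambda>z. S n (fst z))) std_normal_distribution"
    unfolding distr_pair_projections(1)[OF Sm] unfolding S_def by (rule lower_os_CLT[OF k_top k_less p0 np])
  define lr where "lr z = ln (U' z / p (fst z))" for z
  have lr0: "(lr \<longlongrightarrow> 0) F"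
    using filterlim_compose[OF lower_os_ln_ratio(1)[OF k_top k_less p0 np] filterlim_whp_pair_fst]
    by (simp add: lr_def[abs_def] U'_def U_def)
  define y where "y z = \<theta> z * lr z" for z
  have y0: "(y \<longlongrightarrow> 0) F" using tendsto_mult[OF \<theta> lr0] by (simp add: y_def[abs_def])
  define g where "g y = (if y = 0 then -1 else (exp (- y) - 1) / y)" for y :: real
  have gy: "((\<lambda>z. g (y z)) \<longlongrightarrow> -1) F"
    unfolding g_def by (rule filterlim_compose[OF exp_quotient_tendsto y0])
  define c where "c z = g (y z) * \<theta> z / m1 z" for z
  have mu_pos: "0 < 1 / (1 + \<rho>)" by (rule divide_pos_pos[OF zero_less_one add_pos_pos[OF zero_less_one rho_pos]])
  note mu1 = less_imp_neq[OF mu_pos, symmetric]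
  have "(c \<longlongrightarrow> (-1) * \<delta> / (1 / (1 + \<rho>))) F"
    unfolding c_def by (intro tendsto_divide tendsto_mult gy \<theta> m1 mu1)
  moreover have "(-1) * \<delta> / (1 / (1 + \<rho>)) = - (1 + \<delta>)" using delta by (simp add: field_simps)
  ultimately have c: "((\<lambda>z. c z - (- (1 + \<delta>))) \<longlongrightarrow> 0) F" by (simp add: LIM_zero_iff)
  define T where "T n z = sqrt (k n) * ((Q (lower_os n (k n) (fst z)) - Q (p n)) / (L 1 n z * Q (lower_os n (k n) (fst z))))" for n z
  have Tm[measurable]: "T n \<in> borel_measurable (unif_seq \<Otimes>\<^sub>M unif_seq)" for n unfolding T_def by measurable
  have ev: "\<forall>\<^sub>F z in F. T (fst z) (snd z) = c z * S (fst z) (fst (snd z))"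
  proof -
    have "\<forall>\<^sub>F z in F. good (U' z)" "\<forall>\<^sub>F z in F. good (p (fst z))"
      using eventually_good U'0 pF unfolding filterlim_iff by auto
    moreover have "\<forall>\<^sub>F z in F. m1 z > 0"
      by (rule order_tendstoD(1)[OF m1 mu_pos])
    ultimately show ?thesis
    proof eventually_elim
      case (elim z)
      let ?u = "U' z" and ?p = "p (fst z)"
      have u: "lower_os (fst z) (k (fst z)) (fst (snd z)) = ?u" by (simp add: U'_def U_def)
      have pos: "0 < ?u" "?u < 1" "0 < Q ?u" "0 < ?p" "?p < 1" using elim by (auto simp: good_def)
      have D: "0 < D ?u" "0 < D ?p" using pos by (auto intro: D_pos)
      have lnr: "lr z = ln ?u - ln ?p" using pos by (simp add: lr_def ln_div)
      have "y z = ln (D ?u) - ln (D ?p)"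
        using pos by (auto simp: y_def \<theta>_def lnr)
      then have "exp (- y z) = D ?p / D ?u" using D by (simp add: exp_diff)
      moreover have "g t * t = exp (- t) - 1" for t by (simp add: g_def)
      ultimately have gyz: "g (y z) * y z = D ?p / D ?u - 1" by (simp only:)
      have "T (fst z) (snd z) = sqrt (k (fst z)) * ((D ?p - D ?u) / (m1 z * gap ?u * Q ?u))"
        by (simp only: T_def u L_eq[OF elim(1)]) (simp add: D_def)
      also have "m1 z * gap ?u * Q ?u = m1 z * D ?u" using pos by (simp add: gap_def)
      also have "(D ?p - D ?u) / (m1 z * D ?u) = (D ?p / D ?u - 1) / m1 z"
        using D elim by (simp add: field_simps)
      also have "\<dots> = c z * lr z" unfolding gyz[symmetric] by (simp add: c_def y_def)
      finally show ?case by (simp add: S_def u lr_def)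
    qed
  qed
  have "((\<lambda>z. (c z - (- (1 + \<delta>))) * S (fst z) (fst (snd z))) \<longlongrightarrow> 0) F"
    by (rule prob_space.weak_conv_times_null[OF prob_unif_seq_pair real_dist_normal_dist measure_std_normal_singleton _ clt c]) measurable
  moreover have "\<forall>\<^sub>F z in F. (c z - (- (1 + \<delta>))) * S (fst z) (fst (snd z)) = T (fst z) (snd z) - (- (1 + \<delta>)) * S (fst z) (fst (snd z))"
    using ev by eventually_elim (simp add: algebra_simps)
  ultimately have diff: "((\<lambda>z. T (fst z) (snd z) - (- (1 + \<delta>)) * S (fst z) (fst (snd z))) \<longlongrightarrow> 0) F"
    by (rule Lim_transform_eventually)
  have nz: "- (1 + \<delta>) \<noteq> 0" using delta by linarith
  have Sp: "(\<lambda>z. S n (fst z)) \<in> borel_measurable (unif_seq \<Otimes>\<^sub>M unif_seq)" for n by measurable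
  note sc = prob_space.weak_conv_scale_normal[OF prob_unif_seq_pair nz Sp clt]
  have sq: "(- (1 + \<delta>))\<^sup>2 = (1 + \<delta>)\<^sup>2" by (simp only: power2_minus)
  have "weak_conv_m (\<lambda>n. distr (unif_seq \<Otimes>\<^sub>M unif_seq) borel (T n)) (normal_law 0 ((1 + \<delta>)\<^sup>2))"
    by (rule prob_space.weak_conv_Slutsky[OF prob_unif_seq_pair sc(2)[unfolded sq] _ _ sc(1)[unfolded sq] diff]) measurable
  then show ?thesis by (simp only: T_def[abs_def])
qed

text \<open>The delta method in exact form: with high probability the statistic is a linear form in
  the centred averages A and B plus \<open>Er\<close>, whose terms all contain a factor tending to
  0.\<close>

theorem moment_limit:
  assumes U0: "filterlim U (at_right 0) (whp unif_seq)"
    and lim1: "((\<lambda>z. sqrt (k (fst z)) * gap (U z)) \<longlongrightarrow> 0) (whp unif_seq)"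
    and lim2: "((\<lambda>z. sqrt (k (fst z)) * ratio_error (U z)) \<longlongrightarrow> 0) (whp unif_seq)"
  defines "rt n z \<equiv> - inverse (L 1 n z + 1 - (1/2) * inverse (1 - (L 1 n z)\<^sup>2 / L 2 n z))"
  shows "weak_conv_m (\<lambda>n. distr (unif_seq \<Otimes>\<^sub>M unif_seq) borel
      (\<lambda>z. sqrt (k n) * ((Q (lower_os n (k n) (fst z)) * (1 + L 1 n z * (1 + rt n z)) - \<phi>) /
        (L 1 n z * (1 + 1 / rt n z) * Q (lower_os n (k n) (fst z))))))
    (normal_law 0 (V5 \<rho>))"
proof -
  define r where "r = \<rho>"
  have r: "r > 0" using rho_pos by (simp add: r_def)
  have nz: "1 + r \<noteq> 0" "2 + r \<noteq> 0" "r \<noteq> 0" using r by auto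
  note U'0 = U'_lim[OF U0]
  define sk where "sk z = sqrt (real (k (fst z)))" for z :: "nat \<times> (nat \<Rightarrow> real) \<times> (nat \<Rightarrow> real)"
  define e1 where "e1 = 1 / (1 + r)"
  define e2 where "e2 = 2 / ((1 + r) * (2 + r))"
  have "\<forall>\<^sub>F n in sequentially. 1 \<le> k n" using k_top unfolding filterlim_at_top by blast
  then have sk1: "\<forall>\<^sub>F z in whp unif_seq. 1 \<le> sqrt (real (k (fst z)))"
    by (intro prob_space.eventually_whp_seq[OF prob_unif_seq]) (auto elim: eventually_mono)
  have re: "((\<lambda>z. ratio_error (U z)) \<longlongrightarrow> 0) (whp unif_seq)"
  proof (rule Lim_null_comparison[OF _ lim2])
    show "\<forall>\<^sub>F z in whp unif_seq. norm (ratio_error (U z)) \<le> sqrt (k (fst z)) * ratio_error (U z)"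
      using sk1
    proof eventually_elim
      case (elim z)
      from mult_right_mono[OF elim ratio_error_nonneg[of "U z"]] show ?case
        using ratio_error_nonneg[of "U z"] by simp
    qed
  qed
  note m = moments_LLN[OF U0 re, folded r_def, folded e1_def e2_def]
  define \<eta> where "\<eta> z = gap (U' z)" for z
  have \<eta>0: "(\<eta> \<longlongrightarrow> 0) F" unfolding \<eta>_def by (rule filterlim_compose[OF gap_lim U'0])
  have sk\<eta>: "((\<lambda>z. sk z * \<eta> z) \<longlongrightarrow> 0) F"
    using filterlim_compose[OF lim1 filterlim_whp_pair_fst] by (simp add: sk_def \<eta>_def U'_def)
  define A where "A z = sk z * (emp_mean (k (fst z)) \<xi> (snd (snd z)) - e1)" for z
  define B where "B z = sk z * (emp_mean (k (fst z)) (\<lambda>x. (\<xi> x)\<^sup>2) (snd (snd z)) - e2)" for z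
  define R1 where "R1 z = sk z * (m1 z - emp_mean (k (fst z)) \<xi> (snd (snd z)))" for z
  define R2 where "R2 z = sk z * (m2 z - emp_mean (k (fst z)) (\<lambda>x. (\<xi> x)\<^sup>2) (snd (snd z)))" for z
  have R1: "(R1 \<longlongrightarrow> 0) F" and R2: "(R2 \<longlongrightarrow> 0) F"
    unfolding R1_def R2_def sk_def using m1_approx[OF U0 _ lim1 lim2] m2_approx[OF U0 _ lim1 lim2] by simp_all
  have nA: "((\<lambda>z. a z * A z) \<longlongrightarrow> 0) F" if "(a \<longlongrightarrow> 0) F" for a
    using emp_mean_LLN_pair(2)[OF \<xi>_meas \<xi>_abs(1) \<xi>_variance_pos(1) k_top that]
    by (simp add: A_def sk_def e1_def r_def \<xi>_moments)
  have nB: "((\<lambda>z. a z * B z) \<longlongrightarrow> 0) F" if "(a \<longlongrightarrow> 0) F" for a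
    using emp_mean_LLN_pair(2)[OF _ \<xi>_abs(2) \<xi>_variance_pos(2) k_top that]
    by (simp add: B_def sk_def e2_def r_def \<xi>_moments)
  define V where "V z = m2 z - (m1 z)\<^sup>2" for z
  have v0: "e2 - e1\<^sup>2 = r / ((1 + r)\<^sup>2 * (2 + r))"
    unfolding e1_def e2_def by (rule \<xi>_covariances(1)[OF r])
  have V: "(V \<longlongrightarrow> r / ((1 + r)\<^sup>2 * (2 + r))) F"
    unfolding V_def v0[symmetric] by (intro tendsto_intros m)
  have vpos: "r / ((1 + r)\<^sup>2 * (2 + r)) > 0" using r by (intro divide_pos_pos mult_pos_pos) auto
  note vnz = less_imp_neq[OF vpos, symmetric]
  define \<gamma> where "\<gamma> z = m1 z * \<eta> z + 1 - 1/2 * (m2 z / V z)" for z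
  have "(\<gamma> \<longlongrightarrow> e1 * 0 + 1 - 1/2 * (e2 / (r / ((1 + r)\<^sup>2 * (2 + r))))) F"
    unfolding \<gamma>_def by (intro tendsto_intros m V \<eta>0 vnz)
  moreover have "e1 * 0 + 1 - 1/2 * (e2 / (r / ((1 + r)\<^sup>2 * (2 + r)))) = - (1 / r)"
  proof -
    have "e2 / (r / ((1 + r)\<^sup>2 * (2 + r))) = 2 * (1 + r) / r"
      using nz unfolding e2_def by (simp add: power2_eq_square)
    then show ?thesis using nz by (simp add: add_divide_distrib)
  qed
  ultimately have \<gamma>: "(\<gamma> \<longlongrightarrow> - (1 / r)) F" by simp
  define G where "G z = 1 / ((1 - \<gamma> z) * m1 z * (- \<gamma> z)) / (2 * V z)" for z
  define g0 where "g0 = 1 / ((1 - (- (1 / r))) * e1 * (- (- (1 / r)))) / (2 * (r / ((1 + r)\<^sup>2 * (2 + r))))"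
  have dnz: "(1 - (- (1 / r))) * e1 * (- (- (1 / r))) \<noteq> 0" using r by (simp add: e1_def add_pos_pos less_imp_neq[symmetric])
  have G: "(G \<longlongrightarrow> g0) F"
    unfolding G_def g0_def using dnz vpos by (intro tendsto_intros \<gamma> m V) auto
  \<comment> \<open>The limit g0 of the prefactor, times the gradient (e2 - 4 e1, 1 + e1) of m2 + m1
    m2 - 2 m1^2 in (m1, m2), is (-ca, cb), the coefficients in \<open>influence\<close>.\<close>
  define ca where "ca = r * (1 + r) * (3 + 2 * r)"
  define cb where "cb = r * (1 + r) * ((2 + r)\<^sup>2 / 2)"
  have g0: "g0 = r * (1 + r)\<^sup>2 * (2 + r) / 2"
  proof -
    have "(1 - (- (1 / r))) * e1 * (- (- (1 / r))) = 1 / r\<^sup>2" using nz by (simp add: e1_def field_simps power2_eq_square)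
    then show ?thesis unfolding g0_def using nz by (simp add: field_simps power2_eq_square)
  qed
  have gb: "g0 * (1 + e1 + 0) = cb" unfolding g0 cb_def e1_def using nz by (simp add: field_simps power2_eq_square)
  have ga: "g0 * (e2 - 4 * e1 - 2 * 0) = - ca"
  proof -
    have E: "e2 - 4 * e1 = - (2 * (3 + 2 * r) / ((1 + r) * (2 + r)))" unfolding e1_def e2_def using nz by (simp add: divide_simps, (simp add: algebra_simps)?)
    show ?thesis unfolding g0 ca_def E using nz
      by (simp add: divide_simps power2_eq_square) (simp add: algebra_simps)
  qed
  have a0: "((\<lambda>z. m1 z - e1) \<longlongrightarrow> 0) F" using m(1) by (simp add: LIM_zero_iff)
  define Er where "Er z = (2 * V z) * G z * ((1 - m1 z) * m1 z * (sk z * \<eta> z))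
      + G z * ((1 + e1) * R2 z + (e2 - 4 * e1) * R1 z + (m1 z - e1) * R2 z - 2 * (m1 z - e1) * R1 z)
      + (G z * (1 + e1 + (m1 z - e1)) - cb) * B z + (G z * (e2 - 4 * e1 - 2 * (m1 z - e1)) - (- ca)) * A z" for z
  have "(Er \<longlongrightarrow> (2 * (r / ((1 + r)\<^sup>2 * (2 + r)))) * g0 * ((1 - e1) * e1 * 0)
      + g0 * ((1 + e1) * 0 + (e2 - 4 * e1) * 0 + 0 * 0 - 2 * 0 * 0) + 0 + 0) F"
    unfolding Er_def
  proof (intro tendsto_add)
    have "((\<lambda>z. G z * (1 + e1 + (m1 z - e1)) - cb) \<longlongrightarrow> g0 * (1 + e1 + 0) - cb) F"
      by (intro tendsto_intros G a0)
    then show "((\<lambda>z. (G z * (1 + e1 + (m1 z - e1)) - cb) * B z) \<longlongrightarrow> 0) F" by (intro nB) (simp only: gb diff_self)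
    have "((\<lambda>z. G z * (e2 - 4 * e1 - 2 * (m1 z - e1)) - (- ca)) \<longlongrightarrow> g0 * (e2 - 4 * e1 - 2 * 0) - (- ca)) F"
      by (intro tendsto_intros G a0)
    then show "((\<lambda>z. (G z * (e2 - 4 * e1 - 2 * (m1 z - e1)) - (- ca)) * A z) \<longlongrightarrow> 0) F" by (intro nA) (simp only: ga diff_self)
  qed (intro tendsto_intros V G m sk\<eta> R1 R2 a0)+
  then have Er: "(Er \<longlongrightarrow> 0) F" by simp
  define T where "T n z = sqrt (k n) * ((Q (lower_os n (k n) (fst z)) * (1 + L 1 n z * (1 + rt n z)) - \<phi>) /
        (L 1 n z * (1 + 1 / rt n z) * Q (lower_os n (k n) (fst z))))" for n z
  have Tm[measurable]: "T n \<in> borel_measurable (unif_seq \<Otimes>\<^sub>M unif_seq)" for n unfolding T_def rt_def by measurable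
  have inf_m[measurable]: "influence \<in> borel_measurable borel" unfolding influence_def[abs_def] by measurable
  define S where "S n w = sqrt (k n) * (emp_mean (k n) influence w - (\<integral>x. influence x \<partial>unif))" for n w
  have Sm[measurable]: "S n \<in> borel_measurable unif_seq" for n unfolding S_def by measurable
  have SAB: "S (fst z) (snd (snd z)) = cb * B z - ca * A z" for z
  proof -
    have "(\<integral>x. influence x \<partial>unif) = cb * e2 - ca * e1"
    proof -
      have "influence x = cb * (\<xi> x)\<^sup>2 - ca * \<xi> x" for x
        by (simp add: influence_def cb_def ca_def r_def[symmetric] algebra_simps)
      then show ?thesis using \<xi>_power_integrable[of 1] \<xi>_power_integrable[of 2]
        by (simp add: \<xi>_moments e1_def e2_def r_def)
    qed
    moreover have "emp_mean n influence w = cb * emp_mean n (\<lambda>x. (\<xi> x)\<^sup>2) w - ca * emp_mean n \<xi> w" for n w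
    proof -
      have "influence x = cb * (\<xi> x)\<^sup>2 - ca * \<xi> x" for x
        by (simp add: influence_def cb_def ca_def r_def[symmetric] algebra_simps)
      then show ?thesis
        unfolding emp_mean_def by (simp only: sum_subtractf sum_distrib_left[symmetric] right_diff_distrib mult.left_commute)
    qed
    moreover have "cb * (t * (b - e2)) - ca * (t * (a - e1)) = t * ((cb * b - ca * a) - (cb * e2 - ca * e1))" for t a b :: real
      by (simp add: algebra_simps)
    ultimately show ?thesis by (simp only: S_def A_def B_def sk_def)
  qed
  have ev: "\<forall>\<^sub>F z in F. Er z = T (fst z) (snd z) - S (fst z) (snd (snd z))"
  proof -
    have "\<forall>\<^sub>F z in F. good (U' z)" using eventually_good U'0 unfolding filterlim_iff by auto
    moreover have "\<forall>\<^sub>F z in F. m1 z > 0" by (rule order_tendstoD[OF m(1)]) (use r in \<open>simp add: e1_def\<close>)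
    moreover have "\<forall>\<^sub>F z in F. m2 z > 0" by (rule order_tendstoD[OF m(2)]) (use r in \<open>simp add: e2_def\<close>)
    moreover have "\<forall>\<^sub>F z in F. V z > 0" by (rule order_tendstoD(1)[OF V vpos])
    moreover have "\<forall>\<^sub>F z in F. \<gamma> z < 0" by (rule order_tendstoD[OF \<gamma>]) (use r in simp)
    ultimately show ?thesis
    proof eventually_elim
      case (elim z)
      let ?u = "U' z"
      have u: "lower_os (fst z) (k (fst z)) (fst (snd z)) = ?u" by (simp add: U'_def U_def)
      have pos: "0 < ?u" "?u < 1" "0 < Q ?u" using elim by (auto simp: good_def)
      have \<eta>: "\<eta> z > 0" using D_pos[OF pos(1,2)] pos(3) by (simp add: \<eta>_def gap_def)
      have phi_eq: "\<phi> = Q ?u * (1 + \<eta> z)" using pos by (simp add: \<eta>_def gap_def D_def field_simps)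
      have "T (fst z) (snd z) = sk z * ((Q ?u * (1 + (m1 z * \<eta> z) * (1 + (- inverse ((m1 z * \<eta> z) + 1 - (1/2) * inverse (1 - (m1 z * \<eta> z)\<^sup>2 / (m2 z * (\<eta> z)\<^sup>2)))))) - Q ?u * (1 + \<eta> z)) /
          ((m1 z * \<eta> z) * (1 + 1 / (- inverse ((m1 z * \<eta> z) + 1 - (1/2) * inverse (1 - (m1 z * \<eta> z)\<^sup>2 / (m2 z * (\<eta> z)\<^sup>2))))) * Q ?u))"
        unfolding T_def rt_def u L_eq[OF elim(1)] \<eta>_def[symmetric] sk_def phi_eq[symmetric] ..
      also have "\<dots> = 1 / ((1 - \<gamma> z) * m1 z * (- \<gamma> z)) * (sk z * ((1 - m1 z) * (m1 z * \<eta> z)) + sk z * (m2 z + m1 z * m2 z - 2 * (m1 z)\<^sup>2) / (2 * V z))"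
        unfolding \<gamma>_def V_def
        by (rule moment_frontier_identity) (use pos \<eta> elim in \<open>auto simp: \<gamma>_def V_def\<close>)
      also have "\<dots> = (2 * V z) * G z * ((1 - m1 z) * m1 z * (sk z * \<eta> z)) + G z * (sk z * (m2 z + m1 z * m2 z - 2 * (m1 z)\<^sup>2))"
        using elim(4) by (simp add: G_def distrib_left)
      also have "sk z * (m2 z + m1 z * m2 z - 2 * (m1 z)\<^sup>2) = (1 + e1) * (R2 z + B z) + (e2 - 4 * e1) * (R1 z + A z) + (m1 z - e1) * (R2 z + B z) - 2 * (m1 z - e1) * (R1 z + A z)"
      proof -
        have RB: "R2 z + B z = sk z * (m2 z - e2)" "R1 z + A z = sk z * (m1 z - e1)"
          by (simp_all add: R1_def R2_def A_def B_def algebra_simps)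
        have P0: "e2 + e1 * e2 - 2 * e1\<^sup>2 = 0" unfolding e1_def e2_def using nz
          by (simp add: divide_simps power2_eq_square, (simp add: algebra_simps)?)
        \<comment> \<open>The polynomial is quadratic, so its Taylor expansion at (e1, e2) is exact;
          the constant term is 0 by \<open>P0\<close>.\<close>
        have "m2 z + m1 z * m2 z - 2 * (m1 z)\<^sup>2 = (e2 + e1 * e2 - 2 * e1\<^sup>2) + (1 + e1) * (m2 z - e2) + (e2 - 4 * e1) * (m1 z - e1)
            + (m1 z - e1) * (m2 z - e2) - 2 * (m1 z - e1) * (m1 z - e1)"
          by (simp add: algebra_simps power2_eq_square)
        moreover have "t * ((1 + e1) * b + d * a + a * b - 2 * a * a) = (1 + e1) * (t * b) + d * (t * a) + a * (t * b) - 2 * a * (t * a)"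
          for t a b d :: real by (simp add: algebra_simps)
        ultimately show ?thesis unfolding RB P0 by (simp only: add_0_left)
      qed
      finally show ?case unfolding SAB Er_def by (simp add: algebra_simps)
    qed
  qed
  have diff: "((\<lambda>z. T (fst z) (snd z) - S (fst z) (snd (snd z))) \<longlongrightarrow> 0) F"
    by (rule Lim_transform_eventually[OF Er ev])
  define \<sigma> where "\<sigma> = sqrt (V5 \<rho>)"
  have \<sigma>: "\<sigma> > 0" "\<sigma>\<^sup>2 = V5 \<rho>" using V5_pos[OF rho_pos] by (auto simp: \<sigma>_def)
  have inf_bd: "\<bar>influence x\<bar> \<le> cb + ca" for x
  proof -
    have "influence x = cb * (\<xi> x)\<^sup>2 - ca * \<xi> x"
      by (simp add: influence_def cb_def ca_def r_def[symmetric] algebra_simps)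
    moreover have "0 \<le> cb" "0 \<le> ca" using r by (auto simp: cb_def ca_def)
    then have "\<bar>cb * (\<xi> x)\<^sup>2\<bar> \<le> cb * 1" "\<bar>ca * \<xi> x\<bar> \<le> ca * 1"
      using \<xi>_abs[of x] by (auto simp: abs_mult intro!: mult_left_le)
    ultimately show ?thesis by linarith
  qed
  have clt: "weak_conv_m (\<lambda>n. distr unif_seq borel (\<lambda>w. S n w / \<sigma>)) std_normal_distribution"
    unfolding S_def by (rule emp_mean_CLT[OF inf_m inf_bd \<sigma>(1) _ k_top]) (simp add: influence_variance \<sigma>)
  have S\<sigma>: "(\<lambda>w. S n w / \<sigma>) \<in> borel_measurable unif_seq" for n by measurable
  have clt2: "weak_conv_m (\<lambda>n. distr (unif_seq \<Otimes>\<^sub>M unif_seq) borel (\<lambda>z. S n (snd z) / \<sigma>)) std_normal_distribution"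
    using clt by (simp only: distr_pair_projections(2)[OF S\<sigma>])
  have Sp: "(\<lambda>z. S n (snd z) / \<sigma>) \<in> borel_measurable (unif_seq \<Otimes>\<^sub>M unif_seq)" for n by measurable
  have \<sigma>0: "\<sigma> \<noteq> 0" using \<sigma>(1) by simp
  note sc = prob_space.weak_conv_scale_normal[OF prob_unif_seq_pair \<sigma>0 Sp clt2, unfolded \<sigma>(2)]
  have sc1: "weak_conv_m (\<lambda>n. distr (unif_seq \<Otimes>\<^sub>M unif_seq) borel (\<lambda>z. S n (snd z))) (normal_law 0 (V5 \<rho>))"
    using sc(1) \<sigma>0 by simp
  have "weak_conv_m (\<lambda>n. distr (unif_seq \<Otimes>\<^sub>M unif_seq) borel (T n)) (normal_law 0 (V5 \<rho>))"
    by (rule prob_space.weak_conv_Slutsky[OF prob_unif_seq_pair sc(2) _ _ sc1 diff]) measurable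
  then show ?thesis by (simp only: T_def[abs_def])
qed

end

section \<open>Rates from the class Pi\<close>

lemma Pi_varying_exp:
  fixes h B :: "real \<Rightarrow> real"
  assumes "Pi_varying B (\<lambda>t. s * h t)"
  shows "((\<lambda>x. s * (h (exp (x + u)) - h (exp x)) / B (exp x)) \<longlongrightarrow> u) at_top"
proof -
  have "((\<lambda>t. (s * h (t * exp u) - s * h t) / B t) \<longlongrightarrow> ln (exp u)) at_top"
    using assms unfolding Pi_varying_def by (elim allE[of _ "exp u"]) (simp del: ln_exp)
  from filterlim_compose[OF this exp_at_top] show ?thesis
    by (simp add: exp_add right_diff_distrib)
qed

context intermediate_quantile_end
begin

text \<open>The errors are bounded by \<alpha> as functions of x = -log v, and the growth condition
  is evaluated at the deterministic point x = log(n/k). Since un/k tends to 1 in probability, slow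
  variation carries the bound over to the random x = -log u.\<close>

lemma Pi_rates:
  fixes B :: "real \<Rightarrow> real" and s t0 :: real
  assumes s: "s = 1 \<or> s = - 1" and Bpos: "\<forall>\<^sub>F t in at_top. 0 < B t"
    and PI: "Pi_varying B (\<lambda>t. s * (t powr \<delta> * (\<phi> - Q (1 / t))))"
    and t0: "1 \<le> t0"
    and bdd: "\<And>T. bdd_above (bias_fun \<rho> \<phi> (\<lambda>t. Q (1 / t)) B ` {t0..T})"
    and ko: "(\<lambda>n. real (k n)) \<in> o(\<lambda>n. real n / gen_inverse {t0..} (bias_fun \<rho> \<phi> (\<lambda>t. Q (1 / t)) B) (real n))"
  shows "(\<lambda>n. real (k n) / real n) \<longlonglongrightarrow> 0"
    and "((\<lambda>z. sqrt (k (fst z)) * gap (U z)) \<longlongrightarrow> 0) (whp unif_seq)"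
    and "((\<lambda>z. sqrt (k (fst z)) * ratio_error (U z)) \<longlongrightarrow> 0) (whp unif_seq)"
    and "filterlim U (at_right 0) (whp unif_seq)"
proof -
  define H where "H x = exp x powr \<delta> * D (1 / exp x)" for x
  define b where "b x = B (exp x)" for x
  define \<beta> where "\<beta> x = s * (H (x + 1) - H x)" for x
  have Hm[measurable]: "H \<in> borel_measurable borel" unfolding H_def[abs_def] by measurable
  have lim: "((\<lambda>x. s * (H (x + u) - H x) / b x) \<longlongrightarrow> u) at_top" for u
    using Pi_varying_exp[of B s "\<lambda>t. t powr \<delta> * (\<phi> - Q (1 / t))" u] PI by (simp add: H_def b_def D_def)
  have bpos: "\<forall>\<^sub>F x in at_top. 0 < b x"
    using filterlim_iff[THEN iffD1, OF exp_at_top, rule_format, OF Bpos] by (simp add: b_def)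
  have H_pos: "0 < H x" if "0 < x" for x
    using D_pos[of "1 / exp x"] that by (simp add: H_def)
  have Hnn: "\<forall>\<^sub>F x in at_top. 0 \<le> H x"
    using eventually_gt_at_top[of 0] by eventually_elim (auto intro: less_imp_le H_pos)
  note pi = Pi_class_bounds[OF s Hm Hnn bpos lim, folded \<beta>_def]
  obtain C where C: "C > 0" and Cb: "\<forall>\<^sub>F x in at_top. \<forall>u\<ge>0. \<bar>H (x + u) - H x\<bar> \<le> C * \<beta> x * exp (u / 2)"
    using pi(7) by blast
  define \<alpha> where "\<alpha> x = \<beta> x / H x" for x
  have \<alpha>pos: "\<forall>\<^sub>F x in at_top. 0 < \<alpha> x"
    using pi(1) pi(4) by eventually_elim (simp add: \<alpha>_def)
  define l where "l x = ln (\<beta> x) - ln (H x)" for x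
  have l: "log_slow l" unfolding l_def[abs_def] by (rule log_slow_diff[OF pi(5,6)])
  have l\<alpha>: "\<forall>\<^sub>F x in at_top. \<alpha> x = exp (l x)"
    using pi(1) pi(4) by eventually_elim (simp add: \<alpha>_def l_def exp_diff)
  have mln: "filterlim (\<lambda>s. - ln s) at_top (at_right (0::real))"
    using filterlim_compose[OF filterlim_uminus_at_top_at_bot ln_at_0] by simp
  have DH: "D (exp (- x)) = exp (- \<delta> * x) * H x" for x
    by (simp add: H_def exp_minus inverse_eq_divide powr_def exp_diff mult.assoc[symmetric] exp_add[symmetric])
  \<comment> \<open>The gap is of order e^{-\<delta>x} H(x), while H^2/\<beta> = e^q with q
    increasing at most at rate \<delta>/2; so the gap is eventually below \<beta>/H.\<close>
  have gap_bound: "\<forall>\<^sub>F x in at_top. gap (exp (- x)) \<le> \<alpha> x"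
  proof -
    define q where "q x = 2 * ln (H x) - ln (\<beta> x)" for x
    have q: "log_slow q" unfolding q_def[abs_def] by (rule log_slow_diff[OF log_slow_cmult[OF pi(6)] pi(5)])
    from log_slow_uniform[OF q, of "\<delta> / 2"] delta obtain x1 where
      x1: "\<forall>x\<ge>x1. \<forall>u\<ge>0. \<bar>q (x + u) - q x\<bar> \<le> \<delta> / 2 * (u + 1)"
      unfolding eventually_at_top_linorder by auto
    have "filterlim (\<lambda>x. \<delta> / 2 * x + (ln (\<phi> / 2) - q x1 - \<delta> / 2 + \<delta> / 2 * x1)) at_top at_top"
      using filterlim_tendsto_add_at_top[OF tendsto_const[of "ln (\<phi> / 2) - q x1 - \<delta> / 2 + \<delta> / 2 * x1"]
        filterlim_tendsto_pos_mult_at_top[OF tendsto_const[of "\<delta> / 2"] _ filterlim_ident]] delta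
      by (simp only: add.commute half_gt_zero)
    then have "\<forall>\<^sub>F x in at_top. 0 \<le> \<delta> / 2 * x + (ln (\<phi> / 2) - q x1 - \<delta> / 2 + \<delta> / 2 * x1)"
      unfolding filterlim_at_top by blast
    moreover have "\<forall>\<^sub>F x in at_top. \<phi> / 2 < Q (exp (- x))"
    proof -
      have "\<forall>\<^sub>F v in at_right 0. \<phi> / 2 < Q v" by (rule order_tendstoD(1)[OF Q_lim]) (use phi in simp)
      moreover have "filterlim (\<lambda>x. exp (- x)) (at_right (0::real)) at_top"
        by (auto simp: filterlim_at intro!: filterlim_compose[OF exp_at_bot filterlim_uminus_at_bot_at_top])
      ultimately show ?thesis unfolding filterlim_iff by blast
    qed
    ultimately show ?thesis
      using pi(1) pi(4) eventually_ge_at_top[of x1]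
    proof eventually_elim
      case (elim x)
      have "\<bar>q (x1 + (x - x1)) - q x1\<bar> \<le> \<delta> / 2 * ((x - x1) + 1)"
        by (rule x1[rule_format]) (use elim(5) in auto)
      moreover have "x1 + (x - x1) = x" by simp
      ultimately have "\<bar>q x - q x1\<bar> \<le> \<delta> / 2 * ((x - x1) + 1)" by (simp only:)
      then have "q x \<le> q x1 + \<delta> / 2 * ((x - x1) + 1)" by linarith
      also have "\<dots> = q x1 + \<delta> / 2 * x - \<delta> / 2 * x1 + \<delta> / 2" by (simp add: field_simps)
      also have "\<dots> \<le> \<delta> * x + ln (\<phi> / 2)" using elim(1) by simp
      finally have qx: "exp (q x) \<le> exp (\<delta> * x + ln (\<phi> / 2))" by simp
      have "exp (q x) = (H x)\<^sup>2 / \<beta> x" by (simp only: q_def exp_diff exp_double exp_ln[OF elim(3)] exp_ln[OF elim(4)])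
      with qx have "(H x)\<^sup>2 / \<beta> x \<le> exp (\<delta> * x) * (\<phi> / 2)" using phi by (simp add: exp_add)
      then have hb: "H x * H x \<le> exp (\<delta> * x) * (\<phi> / 2) * \<beta> x" using elim(3) by (simp add: pos_divide_le_eq power2_eq_square)
      have "gap (exp (- x)) \<le> D (exp (- x)) / (\<phi> / 2)"
        unfolding gap_def using elim(2,4) phi DH[of x] by (intro divide_left_mono) auto
      also have "\<dots> = exp (- \<delta> * x) * H x / (\<phi> / 2)" by (simp only: DH)
      also have "\<dots> \<le> \<beta> x / H x"
      proof -
        have "exp (- \<delta> * x) * H x * H x \<le> exp (- \<delta> * x) * (exp (\<delta> * x) * (\<phi> / 2) * \<beta> x)"
          using hb by (simp add: mult.assoc)
        also have "\<dots> = \<beta> x * (\<phi> / 2)" by (simp add: exp_minus field_simps)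
        finally show ?thesis using elim(4) phi by (simp add: pos_divide_le_eq pos_le_divide_eq mult_ac)
      qed
      finally show ?case by (simp add: \<alpha>_def)
    qed
  qed
  \<comment> \<open>With u = -log w the integrand is w^\<delta> |H(x+u) - H(x)|/H(x), at most C
    \<alpha>(x) e^{u/2}; the constant 2 is the integral of w^{-1/2} over ]0,1[.\<close>
  have re_bound: "\<forall>\<^sub>F x in at_top. ratio_error (exp (- x)) \<le> 2 * C * \<alpha> x"
    using Cb pi(1) pi(4) eventually_gt_at_top[of 0]
  proof eventually_elim
    case (elim x)
    have i: "integrable unif (\<lambda>w. C * \<alpha> x * w powr (- 1/2))"
      using unif_powr(1)[of "- 1/2"] by (intro integrable_mult_right) simp
    have "ratio_error (exp (- x)) \<le> (\<integral>w. C * \<alpha> x * w powr (- 1/2) \<partial>unif)"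
      unfolding ratio_error_def
    proof (rule integral_mono_AE'[OF i])
      show "AE w in unif. \<bar>w powr \<delta> - D (exp (- x) * w) / D (exp (- x))\<bar> \<le> C * \<alpha> x * w powr (- 1/2)"
        using AE_unif
      proof eventually_elim
        case w: (elim w)
        define u where "u = - ln w"
        have u: "u \<ge> 0" "exp (- u) = w" using w by (auto simp: u_def)
        have Dw: "D (exp (- x) * w) = exp (- \<delta> * x) * (w powr \<delta> * H (x + u))"
        proof -
          have "D (exp (- x) * w) = D (exp (- (x + u)))" using u by (simp add: exp_add[symmetric] flip: u(2))
          also have "\<dots> = exp (- \<delta> * (x + u)) * H (x + u)" by (rule DH)
          also have "exp (- \<delta> * (x + u)) = exp (- \<delta> * x) * w powr \<delta>"
            using w by (simp add: u_def powr_def exp_add[symmetric] algebra_simps)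
          finally show ?thesis by simp
        qed
        have "w powr \<delta> - D (exp (- x) * w) / D (exp (- x)) = w powr \<delta> * (- (H (x + u) - H x) / H x)"
          unfolding Dw DH using elim(3) by (simp add: field_simps)
        also have "\<bar>\<dots>\<bar> = w powr \<delta> * (\<bar>H (x + u) - H x\<bar> / H x)"
          using elim(3) by (simp add: abs_mult abs_divide abs_minus_commute)
        also have "\<dots> \<le> 1 * (C * \<beta> x * exp (u / 2) / H x)"
          using elim w u delta powr_le1[of \<delta> w]
          by (intro mult_mono divide_right_mono) (auto intro!: divide_nonneg_pos)
        also have "exp (u / 2) = w powr (- 1/2)" using w by (simp add: u_def powr_def)
        finally show "\<bar>w powr \<delta> - D (exp (- x) * w) / D (exp (- x))\<bar> \<le> C * \<alpha> x * w powr (- 1/2)"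
          by (simp add: \<alpha>_def)
      qed
    qed (use C elim in \<open>auto simp: \<alpha>_def intro!: AE_I2 divide_nonneg_pos mult_nonneg_nonneg less_imp_le\<close>)
    also have "\<dots> = 2 * C * \<alpha> x" using unif_powr(2)[of "- 1/2"] by simp
    finally show ?case .
  qed
  define g where "g = bias_fun \<rho> \<phi> (\<lambda>t. Q (1 / t)) B"
  \<comment> \<open>D/\<phi> \<le> log \<phi> - log Q \<le> 2D/\<phi> and \<beta>/2 \<le> b \<le>
    2\<beta> place e^{\<delta>x} (log \<phi> - log Q)/b between 1/(2\<phi>\<alpha>) and
    4/(\<phi>\<alpha>); the constants are the squares.\<close>
  have gB: "\<forall>\<^sub>F x in at_top. 1 / (4 * \<phi>\<^sup>2) * (exp x / (\<alpha> x)\<^sup>2) \<le> g (exp x) \<and> g (exp x) \<le> 16 / \<phi>\<^sup>2 * (exp x / (\<alpha> x)\<^sup>2)"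
  proof -
    have "\<forall>\<^sub>F x in at_top. \<phi> / 2 < Q (exp (- x))"
    proof -
      have "\<forall>\<^sub>F v in at_right 0. \<phi> / 2 < Q v" by (rule order_tendstoD(1)[OF Q_lim]) (use phi in simp)
      moreover have "filterlim (\<lambda>x. exp (- x)) (at_right (0::real)) at_top"
        by (auto simp: filterlim_at intro!: filterlim_compose[OF exp_at_bot filterlim_uminus_at_bot_at_top])
      ultimately show ?thesis unfolding filterlim_iff by blast
    qed
    moreover have "\<forall>\<^sub>F x in at_top. 1/2 < \<beta> x / b x" by (rule order_tendstoD(1)[OF pi(2)]) simp
    moreover have "\<forall>\<^sub>F x in at_top. \<beta> x / b x < 2" by (rule order_tendstoD(2)[OF pi(2)]) simp
    ultimately show ?thesis
      using bpos pi(1) pi(4) eventually_gt_at_top[of 0]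
    proof eventually_elim
      case (elim x)
      define y where "y = exp (- x)"
      have y: "0 < y" "y < 1" "1 / exp x = y" using elim by (auto simp: y_def exp_minus inverse_eq_divide)
      define ll where "ll = ln \<phi> - ln (Q y)"
      have Qy: "\<phi> / 2 < Q y" "Q y < \<phi>" using elim(1) Q_less[OF y(1,2)] by (auto simp: y_def)
      have Dy: "D y = \<phi> - Q y" by (simp add: D_def)
      have ll1: "D y / \<phi> \<le> ll"
      proof -
        have "ln (Q y / \<phi>) \<le> Q y / \<phi> - 1" using Qy phi by (intro ln_le_minus_one) auto
        then show ?thesis using Qy phi by (simp add: ll_def Dy ln_div diff_divide_distrib)
      qed
      have ll2: "ll \<le> 2 * D y / \<phi>"
      proof -
        have "ln (\<phi> / Q y) \<le> \<phi> / Q y - 1" using Qy phi by (intro ln_le_minus_one) auto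
        then have "ll \<le> (\<phi> - Q y) / Q y" using Qy phi by (simp add: ll_def ln_div diff_divide_distrib)
        also have "\<dots> \<le> (\<phi> - Q y) / (\<phi> / 2)" using Qy phi by (intro divide_left_mono) auto
        finally show ?thesis by (simp add: Dy mult.commute)
      qed
      have He: "exp (\<delta> * x) * D y = H x" using DH[of x] by (simp add: y_def exp_minus field_simps)
      have gx: "g (exp x) = exp x * (exp (\<delta> * x) * ll / b x)\<^sup>2"
      proof -
        have "exp x powr (1 + 2 / \<rho>) = exp x * (exp (\<delta> * x))\<^sup>2"
          by (simp add: powr_def power2_eq_square exp_add[symmetric] algebra_simps)
        then show ?thesis unfolding g_def bias_fun_def y(3) b_def[symmetric] ll_def[symmetric]
          by (simp add: power_mult_distrib power_divide)
      qed
      have bb: "b x \<le> 2 * \<beta> x" "\<beta> x / 2 \<le> b x" using elim(2,3,4) by (auto simp: field_simps)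
      have \<alpha>x: "1 / \<alpha> x = H x / \<beta> x" by (simp add: \<alpha>_def)
      have lo: "1 / (2 * \<phi>) * (1 / \<alpha> x) \<le> exp (\<delta> * x) * ll / b x"
      proof -
        have "1 / (2 * \<phi>) * (1 / \<alpha> x) = (H x / \<phi>) / (2 * \<beta> x)" by (simp add: \<alpha>x)
        also have "\<dots> \<le> (H x / \<phi>) / b x" using bb elim phi by (intro divide_left_mono) auto
        also have "H x / \<phi> = exp (\<delta> * x) * (D y / \<phi>)" by (simp add: He[symmetric])
        also have "exp (\<delta> * x) * (D y / \<phi>) / b x \<le> exp (\<delta> * x) * ll / b x"
          using ll1 elim by (intro divide_right_mono mult_left_mono) auto
        finally show ?thesis .
      qed
      have up: "exp (\<delta> * x) * ll / b x \<le> 4 / \<phi> * (1 / \<alpha> x)"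
      proof -
        have "exp (\<delta> * x) * ll / b x \<le> exp (\<delta> * x) * (2 * D y / \<phi>) / b x"
          using ll2 elim by (intro divide_right_mono mult_left_mono) auto
        also have "exp (\<delta> * x) * (2 * D y / \<phi>) = 2 * H x / \<phi>" by (simp add: He[symmetric])
        also have "2 * H x / \<phi> / b x \<le> 2 * H x / \<phi> / (\<beta> x / 2)" using bb elim phi by (intro divide_left_mono) auto
        also have "\<dots> = 4 / \<phi> * (1 / \<alpha> x)" by (simp add: \<alpha>x)
        finally show ?thesis .
      qed
      have a0: "0 < 1 / \<alpha> x" using elim by (simp add: \<alpha>_def)
      have "0 \<le> 1 / (2 * \<phi>) * (1 / \<alpha> x)" using a0 phi by (intro mult_nonneg_nonneg) auto
      from power_mono[OF lo this, of 2] power_mono[OF up order_trans[OF this lo], of 2]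
      have "(1 / (2 * \<phi>) * (1 / \<alpha> x))\<^sup>2 \<le> (exp (\<delta> * x) * ll / b x)\<^sup>2" "(exp (\<delta> * x) * ll / b x)\<^sup>2 \<le> (4 / \<phi> * (1 / \<alpha> x))\<^sup>2" .
      from mult_left_mono[OF this(1), of "exp x"] mult_left_mono[OF this(2), of "exp x"]
      show ?case unfolding gx by (simp add: power_mult_distrib power_divide mult_ac)
    qed
  qed
  \<comment> \<open>The logarithm of e^x/\<alpha>(x)^2. It grows at rate at least 1/2, up to a
    constant, because l moves at most at rate 1/4.\<close>
  define \<psi> where "\<psi> x = x - 2 * l x" for x
  have exp\<psi>: "\<forall>\<^sub>F x in at_top. exp x / (\<alpha> x)\<^sup>2 = exp (\<psi> x)"
    using l\<alpha> by eventually_elim (simp add: \<psi>_def exp_diff exp_double)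
  define c1 where "c1 = 1 / (4 * \<phi>\<^sup>2)"
  define c2 where "c2 = 16 / \<phi>\<^sup>2"
  have c12: "c1 > 0" "c2 > 0" using phi by (auto simp: c1_def c2_def)
  have "\<forall>\<^sub>F x in at_top. \<forall>u\<ge>0. \<bar>l (x + u) - l x\<bar> \<le> 1/4 * (u + 1)" by (rule log_slow_uniform[OF l]) simp
  with gB exp\<psi> have "\<forall>\<^sub>F x in at_top. c1 * exp (\<psi> x) \<le> g (exp x) \<and> g (exp x) \<le> c2 * exp (\<psi> x) \<and>
      (\<forall>u\<ge>0. \<psi> x + u / 2 - 1/2 \<le> \<psi> (x + u))"
  proof eventually_elim
    case (elim x)
    have "\<psi> x + u / 2 - 1/2 \<le> \<psi> (x + u)" if "u \<ge> 0" for u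
    proof -
      have "l (x + u) - l x \<le> 1/4 * (u + 1)" by (rule abs_le_D1[OF elim(3)[rule_format, OF that]])
      then show ?thesis unfolding \<psi>_def by argo
    qed
    then show ?case using elim(1) unfolding elim(2) by (simp add: c1_def c2_def)
  qed
  then obtain X where X: "\<And>x. x \<ge> X \<Longrightarrow> c1 * exp (\<psi> x) \<le> g (exp x)" "\<And>x. x \<ge> X \<Longrightarrow> g (exp x) \<le> c2 * exp (\<psi> x)"
      "\<And>x u. x \<ge> X \<Longrightarrow> u \<ge> 0 \<Longrightarrow> \<psi> x + u / 2 - 1/2 \<le> \<psi> (x + u)"
    unfolding eventually_at_top_linorder by blast
  \<comment> \<open>g is unbounded on [t0, \<infinity>[, so the generalized inverse is the infimum
    of a nonempty set.\<close>
  have ne: "\<exists>t\<ge>t0. y \<le> g t" for y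
  proof -
    define u where "u = max 0 (max (ln t0 - X) (2 * (ln (max 1 y / c1) - \<psi> X + 1/2)))"
    have u: "u \<ge> 0" "ln t0 \<le> X + u" "ln (max 1 y / c1) \<le> \<psi> X + u / 2 - 1/2"
    proof -
      have "2 * (ln (max 1 y / c1) - \<psi> X + 1/2) \<le> u" "ln t0 - X \<le> u" "0 \<le> u"
        unfolding u_def le_max_iff_disj by simp_all
      then show "u \<ge> 0" "ln t0 \<le> X + u" "ln (max 1 y / c1) \<le> \<psi> X + u / 2 - 1/2" by argo+
    qed
    have "max 1 y / c1 > 0" using c12 by simp
    then have "max 1 y / c1 = exp (ln (max 1 y / c1))" by simp
    also have "\<dots> \<le> exp (\<psi> (X + u))" using u(3) X(3)[of X u] u(1) by simp
    finally have "max 1 y \<le> c1 * exp (\<psi> (X + u))" using c12 by (simp add: pos_divide_le_eq mult.commute)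
    also have "\<dots> \<le> g (exp (X + u))" using u by (intro X) auto
    finally have "y \<le> g (exp (X + u))" by simp
    moreover have "t0 \<le> exp (X + u)"
    proof -
      have "exp (ln t0) \<le> exp (X + u)" using u(2) by simp
      then show ?thesis using t0 by simp
    qed
    ultimately show ?thesis by blast
  qed
  define gi where "gi n = gen_inverse {t0..} g (real n)" for n :: nat
  have gi_t0: "t0 \<le> gi n" for n
    unfolding gi_def gen_inverse_def using ne[of "real n"] by (intro cInf_greatest) auto
  \<comment> \<open>The infimum need not be attained, but a point below twice its value exists,
    since gi n \<ge> t0 > 0.\<close>
  have gi_ex: "\<exists>t\<ge>t0. real n \<le> g t \<and> t < 2 * gi n" for n
  proof -
    have "Inf {t \<in> {t0..}. real n \<le> g t} < 2 * gi n"
      using gi_t0[of n] t0 unfolding gi_def gen_inverse_def by linarith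
    from cInf_lessD[OF _ this] ne[of "real n"] show ?thesis by auto
  qed
  have kc: "\<forall>\<^sub>F n in sequentially. real (k n) * gi n \<le> c * real n" if "c > 0" for c
  proof -
    from landau_o.smallD[OF ko that]
    have "\<forall>\<^sub>F n in sequentially. norm (real (k n)) \<le> c * norm (real n / gi n)"
      by (simp only: g_def[symmetric] gi_def[symmetric])
    then show ?thesis
    proof eventually_elim
      case (elim n)
      have "0 < gi n" using gi_t0[of n] t0 by linarith
      with elim show ?case by (simp add: pos_le_divide_eq)
    qed
  qed
  show kn0: "(\<lambda>n. real (k n) / real n) \<longlonglongrightarrow> 0"
  proof (rule tendstoI)
    fix e :: real assume e: "e > 0"
    show "\<forall>\<^sub>F n in sequentially. dist (real (k n) / real n) 0 < e"
      using kc[OF half_gt_zero[OF e]] eventually_gt_at_top[of 0]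
    proof eventually_elim
      case (elim n)
      have "real (k n) * 1 \<le> real (k n) * gi n" using gi_t0[of n] t0 by (intro mult_left_mono) auto
      also have "\<dots> \<le> e / 2 * real n" using elim by simp
      finally have "real (k n) / real n \<le> e / 2" using elim by (simp add: pos_divide_le_eq)
      also have "e / 2 < e" using e by simp
      finally show ?case by (simp add: dist_real_def)
    qed
  qed
  have k1: "\<forall>\<^sub>F n in sequentially. 1 \<le> k n" using k_top unfolding filterlim_at_top by blast
  define p where "p n = real (k n) / real n" for n
  have p0: "p \<longlonglongrightarrow> 0" using kn0 by (simp add: p_def[abs_def])
  have np: "\<forall>\<^sub>F n in sequentially. \<bar>real n * p n - real (k n)\<bar> \<le> 1"
    using eventually_gt_at_top[of 0] by eventually_elim (simp add: p_def)
  note Ut = U_tendsto[OF p0 np]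
  show "filterlim U (at_right 0) (whp unif_seq)" by (rule Ut(1))
  define xn where "xn n = - ln (p n)" for n
  have xn: "filterlim xn at_top sequentially"
    unfolding xn_def by (rule filterlim_compose[OF mln Ut(2)])
  have det: "filterlim (\<lambda>n. \<psi> (xn n) - ln (real n)) at_top sequentially"
    unfolding filterlim_at_top
  proof
    fix Mx :: real
    \<comment> \<open>If k gi \<le> c n, a witness t < 2 gi has t \<le> 2c n/k, so log(n/k) exceeds
      log t by at least -log(2c). The guaranteed gain of \<psi>, half of that less 1/2, then covers
      |Mx| + |log c2|.\<close>
    define c where "c = exp (- 2 * (\<bar>Mx\<bar> + \<bar>ln c2\<bar> + 1)) / 2"
    have c: "c > 0" "2 * c \<le> 1" "ln (2 * c) = - 2 * (\<bar>Mx\<bar> + \<bar>ln c2\<bar> + 1)" by (auto simp: c_def)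
    \<comment> \<open>Boundedness of g on [t0, e^X] excludes small witnesses once n > K, so that t
      lies where the estimates hold.\<close>
    obtain K where "\<forall>x\<in>{t0..exp X}. g x \<le> K"
      using bdd[of "exp X"] unfolding g_def[symmetric] bdd_above_def by auto
    then have K: "g t \<le> K" if "t0 \<le> t" "t \<le> exp X" for t using that by simp
    show "\<forall>\<^sub>F n in sequentially. Mx \<le> \<psi> (xn n) - ln (real n)"
      using kc[OF c(1)] eventually_gt_at_top[of 0] eventually_gt_at_top[of "nat \<lceil>\<bar>K\<bar>\<rceil>"] k1
    proof eventually_elim
      case (elim n)
      obtain t where t: "t0 \<le> t" "real n \<le> g t" "t < 2 * gi n" using gi_ex by blast
      have "K < real n" using elim(3) by linarith
      then have tX: "exp X < t" using K[OF t(1)] t(2) by (force simp: not_le[symmetric])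
      define y where "y = ln t"
      have tpos: "0 < t" using tX exp_gt_zero[of X] by linarith
      have y: "exp y = t" "X \<le> y" using tpos tX by (auto simp: y_def ln_ge_iff)
      have "t * real (k n) \<le> 2 * gi n * real (k n)" using t by (intro mult_right_mono) auto
      also have "\<dots> \<le> 2 * c * real n" using elim(1) by (simp add: mult_ac)
      finally have "t \<le> 2 * c * (1 / p n)" using elim by (simp add: p_def pos_le_divide_eq)
      moreover have "1 / p n = exp (xn n)" using elim by (simp add: xn_def p_def exp_minus inverse_eq_divide)
      ultimately have "ln t \<le> ln (2 * c * exp (xn n))" using tpos by (subst ln_le_cancel_iff) auto
      then have yx: "y \<le> ln (2 * c) + xn n" using c by (simp add: y_def ln_mult)
      define u where "u = xn n - y"
      have u: "u \<ge> 2 * (\<bar>Mx\<bar> + \<bar>ln c2\<bar> + 1)" using yx unfolding u_def c(3) by linarith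
      have "ln (real n) \<le> ln (c2 * exp (\<psi> y))"
        using t(2) X(2)[OF y(2)] y(1) elim(2) by (subst ln_le_cancel_iff) (auto intro: less_le_trans)
      also have "\<dots> = ln c2 + \<psi> y" using c12 by (simp add: ln_mult)
      finally have "ln (real n) - ln c2 \<le> \<psi> y" by simp
      moreover have "\<psi> y + u / 2 - 1/2 \<le> \<psi> (xn n)" using X(3)[OF y(2), of u] u by (simp add: u_def)
      ultimately show ?case using u abs_ge_self[of Mx] abs_ge_self[of "ln c2"] by argo
    qed
  qed
  \<comment> \<open>At x = log(n/k) the difference \<psi>(x) - log n is -log k - 2 l(x), so its
    divergence means that sqrt(k) e^{l(x)} tends to 0.\<close>
  have det2: "(\<lambda>n. sqrt (real (k n)) * exp (l (xn n))) \<longlonglongrightarrow> 0"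
  proof -
    have "filterlim (\<lambda>n. 1/2 * (\<psi> (xn n) - ln (real n))) at_top sequentially"
      by (rule filterlim_tendsto_pos_mult_at_top[OF tendsto_const _ det]) simp
    then have "(\<lambda>n. exp (- (1/2 * (\<psi> (xn n) - ln (real n))))) \<longlonglongrightarrow> 0"
      by (intro filterlim_compose[OF exp_at_bot] filterlim_compose[OF filterlim_uminus_at_bot_at_top])
    moreover have "\<forall>\<^sub>F n in sequentially. exp (- (1/2 * (\<psi> (xn n) - ln (real n)))) = sqrt (real (k n)) * exp (l (xn n))"
      using k1 eventually_gt_at_top[of 0]
    proof eventually_elim
      case (elim n)
      have "xn n = ln (real n) - ln (real (k n))" using elim by (simp add: xn_def p_def ln_div)
      then have "- (1/2 * (\<psi> (xn n) - ln (real n))) = ln (real (k n)) / 2 + l (xn n)" by (simp add: \<psi>_def field_simps)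
      moreover have "exp (ln (real (k n)) / 2) = sqrt (real (k n))"
        using elim by (simp add: powr_half_sqrt[symmetric] powr_def)
      ultimately show ?case by (simp add: exp_add)
    qed
    ultimately show ?thesis by (rule Lim_transform_eventually)
  qed
  \<comment> \<open>With high probability |log(u/p)| < 1, and l changes by at most 1 over such a
    shift, hence the factor e.\<close>
  have stoch: "\<forall>\<^sub>F z in whp unif_seq. \<alpha> (- ln (U z)) \<le> exp 1 * exp (l (xn (fst z)))"
  proof -
    have "\<forall>\<^sub>F x in at_top. \<forall>u\<in>{-1..1}. \<bar>l (x + u) - l x\<bar> \<le> 1" by (rule log_slow_two_sided[OF l]) simp
    then have "\<forall>\<^sub>F n in sequentially. \<forall>u\<in>{-1..1}. \<bar>l (xn n + u) - l (xn n)\<bar> \<le> 1"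
      using xn unfolding filterlim_iff by blast
    from prob_space.eventually_whp_seq[OF prob_unif_seq this]
    have 1: "\<forall>\<^sub>F z in whp unif_seq. \<forall>u\<in>{-1..1}. \<bar>l (xn (fst z) + u) - l (xn (fst z))\<bar> \<le> 1" .
    have 2: "\<forall>\<^sub>F z in whp unif_seq. dist (ln (lower_os (fst z) (k (fst z)) (snd z) / p (fst z))) 0 < 1"
      by (rule tendstoD[OF lower_os_ln_ratio(1)[OF k_top k_less p0 np]]) simp
    have 3: "\<forall>\<^sub>F z in whp unif_seq. 0 < U z" using lower_os_ln_ratio(2)[OF k_top k_less p0 np] by (simp add: U_def)
    have "\<forall>\<^sub>F v in at_right (0::real). 0 < v" by (auto simp: eventually_at_right_field intro!: exI[of _ 1])
    then have "\<forall>\<^sub>F n in sequentially. 0 < p n" using Ut(2) unfolding filterlim_iff by blast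
    from prob_space.eventually_whp_seq[OF prob_unif_seq this] have 4: "\<forall>\<^sub>F z in whp unif_seq. 0 < p (fst z)" .
    have 5: "\<forall>\<^sub>F z in whp unif_seq. \<alpha> (- ln (U z)) = exp (l (- ln (U z)))"
      using l\<alpha> filterlim_compose[OF mln Ut(1)] unfolding filterlim_iff by blast
    show ?thesis using 1 2 3 4 5
    proof eventually_elim
      case (elim z)
      define u where "u = - ln (U z / p (fst z))"
      have "u \<in> {-1..1}" using elim(2) by (auto simp: u_def U_def dist_real_def)
      moreover have "- ln (U z) = xn (fst z) + u" using elim(3,4) by (simp add: u_def xn_def ln_div)
      ultimately have "l (- ln (U z)) \<le> l (xn (fst z)) + 1" using elim(1) by force
      then have "exp (l (- ln (U z))) \<le> exp (l (xn (fst z)) + 1)" by simp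
      then show ?case unfolding elim(5) by (simp add: exp_add mult.commute)
    qed
  qed
  have main: "((\<lambda>z. sqrt (k (fst z)) * e (U z)) \<longlongrightarrow> 0) (whp unif_seq)"
    if e: "\<forall>\<^sub>F x in at_top. e (exp (- x)) \<le> c * \<alpha> x" and e0: "\<forall>\<^sub>F v in at_right 0. 0 \<le> e v" and c: "c > 0" for e :: "real \<Rightarrow> real" and c
  proof (rule Lim_null_comparison)
    have "((\<lambda>n. c * exp 1 * (sqrt (real (k n)) * exp (l (xn n)))) \<longlongrightarrow> c * exp 1 * 0) sequentially"
      by (intro tendsto_mult_left det2)
    then show "((\<lambda>z. c * exp 1 * (sqrt (real (k (fst z))) * exp (l (xn (fst z))))) \<longlongrightarrow> 0) (whp unif_seq)"
      using prob_space.whp_seq[OF prob_unif_seq] by simp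
    have "\<forall>\<^sub>F z in whp unif_seq. e (exp (- (- ln (U z)))) \<le> c * \<alpha> (- ln (U z))"
      using e filterlim_compose[OF mln Ut(1)] unfolding filterlim_iff by blast
    moreover have "\<forall>\<^sub>F z in whp unif_seq. 0 \<le> e (U z)" using e0 Ut(1) unfolding filterlim_iff by blast
    moreover have "\<forall>\<^sub>F z in whp unif_seq. 0 < U z" using lower_os_ln_ratio(2)[OF k_top k_less p0 np] by (simp add: U_def)
    ultimately show "\<forall>\<^sub>F z in whp unif_seq. norm (sqrt (k (fst z)) * e (U z)) \<le> c * exp 1 * (sqrt (real (k (fst z))) * exp (l (xn (fst z))))"
      using stoch
    proof eventually_elim
      case (elim z)
      have "e (U z) \<le> c * \<alpha> (- ln (U z))" using elim(1,3) by simp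
      also have "\<dots> \<le> c * (exp 1 * exp (l (xn (fst z))))" using elim(4) c by (intro mult_left_mono) auto
      finally have "sqrt (k (fst z)) * e (U z) \<le> sqrt (k (fst z)) * (c * (exp 1 * exp (l (xn (fst z)))))"
        by (intro mult_left_mono) auto
      then show ?case using elim(2) by (simp add: mult_ac)
    qed
  qed
  show "((\<lambda>z. sqrt (k (fst z)) * gap (U z)) \<longlongrightarrow> 0) (whp unif_seq)"
  proof (rule main[of _ 1])
    show "\<forall>\<^sub>F v in at_right 0. 0 \<le> gap v" using eventually_good
      by eventually_elim (use D_pos in \<open>auto simp: gap_def good_def intro!: divide_nonneg_pos less_imp_le\<close>)
  qed (use gap_bound in auto)
  show "((\<lambda>z. sqrt (k (fst z)) * ratio_error (U z)) \<longlongrightarrow> 0) (whp unif_seq)"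
    by (rule main[of _ "2 * C"]) (use re_bound C ratio_error_nonneg in auto)
qed

end

section \<open>Conditional quantiles\<close>

text \<open>G stands for F(.|x) and c for F_X(x), detached from the random vector.\<close>

locale conditional_cdf =
  fixes G :: "real \<Rightarrow> real" and c :: real
  assumes G_mono: "mono G" and G_le1: "\<And>y. G y \<le> 1" and G_neg: "\<And>y. y < 0 \<Longrightarrow> G y = 0"
    and G_nonneg: "\<And>y. 0 \<le> G y"
    and G_right: "\<And>y. 0 \<le> y \<Longrightarrow> (G \<longlongrightarrow> G y) (at_right y)"
    and G_fin: "frontier_finite G" and c: "0 < c" "c \<le> 1"
begin

text \<open>For c \<le> v < 1 the level 1 - v/c is at most 0 and the quantile is 0. This accounts
  for the mass 1 - c at 0 of the variable that vanishes outside X \<le> x.\<close>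

definition Q :: "real \<Rightarrow> real" where
  "Q v = (if 0 < v \<and> v < 1 then quantile_of G (1 - v / c) else 0)"

abbreviation \<phi> :: real where "\<phi> \<equiv> frontier_point G"

lemma G_one_above:
  obtains K where "0 \<le> K" "G K = 1"
proof -
  obtain b where b: "\<And>y. 0 \<le> y \<Longrightarrow> G y < 1 \<Longrightarrow> y \<le> b"
    using G_fin unfolding frontier_finite_def bdd_above_def by auto
  have "\<not> G (max 0 b + 1) < 1" using b[of "max 0 b + 1"] by auto
  then have "G (max 0 b + 1) = 1" using G_le1[of "max 0 b + 1"] by simp
  then show thesis by (intro that[of "max 0 b + 1"]) auto
qed

text \<open>The finite frontier makes the set nonempty, as G is 1 somewhere, and right continuity
  makes its infimum attained.\<close>

lemma quantile_le_iff:
  assumes "a \<le> 1" "0 \<le> y"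
  shows "quantile_of G a \<le> y \<longleftrightarrow> a \<le> G y"
proof -
  let ?S = "{y. 0 \<le> y \<and> a \<le> G y}"
  obtain K where "0 \<le> K" "G K = 1" by (rule G_one_above)
  then have ne: "?S \<noteq> {}" using assms(1) by auto
  have lb: "bdd_below ?S" by auto
  show ?thesis
  proof
    assume "a \<le> G y"
    then show "quantile_of G a \<le> y" unfolding quantile_of_def using assms lb by (intro cInf_lower) auto
  next
    assume le: "quantile_of G a \<le> y"
    have above: "a \<le> G y'" if "y < y'" for y'
    proof -
      have "Inf ?S < y'" using le that by (simp add: quantile_of_def)
      then obtain y'' where "y'' \<in> ?S" "y'' < y'" using cInf_lessD[OF ne] by blast
      then show ?thesis using monoD[OF G_mono, of y'' y'] by auto
    qed
    show "a \<le> G y"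
    proof (rule tendsto_lowerbound[OF G_right[OF assms(2)]])
      show "\<forall>\<^sub>F x in at_right y. a \<le> G x"
        using above by (auto simp: eventually_at_right_field intro: gt_ex)
    qed simp
  qed
qed

lemma quantile_nonneg: "a \<le> 1 \<Longrightarrow> 0 \<le> quantile_of G a"
proof -
  assume a: "a \<le> 1"
  obtain K where "0 \<le> K" "G K = 1" by (rule G_one_above)
  then have ne: "{y. 0 \<le> y \<and> a \<le> G y} \<noteq> {}" using a by auto
  show ?thesis unfolding quantile_of_def by (rule cInf_greatest[OF ne]) auto
qed

lemma level_le: "0 < v \<Longrightarrow> 1 - v / c \<le> 1" using c by simp

lemma Q_le_iff: "0 < v \<Longrightarrow> v < 1 \<Longrightarrow> 0 \<le> y \<Longrightarrow> Q v \<le> y \<longleftrightarrow> 1 - v / c \<le> G y"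
  unfolding Q_def using quantile_le_iff[OF level_le] by auto

lemma Q_nonneg: "0 \<le> Q v"
  unfolding Q_def using quantile_nonneg[OF level_le] by auto

lemma Q_anti: "antimono_on {0<..<1} Q"
proof (rule monotone_onI)
  fix v w :: real assume vw: "v \<in> {0<..<1}" "w \<in> {0<..<1}" "v \<le> w"
  have "1 - w / c \<le> 1 - v / c" using vw c by (simp add: divide_right_mono)
  also have "\<dots> \<le> G (Q v)" using Q_le_iff[of v "Q v"] Q_nonneg[of v] vw by simp
  finally show "Q w \<le> Q v" using Q_le_iff[of w "Q v"] Q_nonneg[of v] vw by simp
qed

lemma Q_meas[measurable]: "Q \<in> borel_measurable borel"
  unfolding borel_measurable_iff_le
proof
  fix a
  have "{v. Q v \<le> a} = (if 0 \<le> a then {v. (0 < v \<and> v < 1 \<longrightarrow> c * (1 - G a) \<le> v)} else {})"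
  proof (cases "0 \<le> a")
    case True
    have "Q v \<le> a \<longleftrightarrow> (0 < v \<and> v < 1 \<longrightarrow> c * (1 - G a) \<le> v)" for v
    proof (cases "0 < v \<and> v < 1")
      case v: True
      have "1 - v / c \<le> G a \<longleftrightarrow> c * (1 - G a) \<le> v" using c by (simp add: field_simps)
      then show ?thesis using Q_le_iff[of v a] v True by simp
    qed (use True in \<open>auto simp: Q_def\<close>)
    then show ?thesis using True by auto
  next
    case False
    then have "\<not> Q v \<le> a" for v using Q_nonneg[of v] by linarith
    then show ?thesis using False by auto
  qed
  also have "{v. 0 < v \<and> v < 1 \<longrightarrow> c * (1 - G a) \<le> v} = - ({0<..<1} \<inter> {..<c * (1 - G a)})" by auto
  also have "(if 0 \<le> a then - ({0<..<1} \<inter> {..<c * (1 - G a)}) else {}) \<in> sets borel" by simp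
  finally show "{w \<in> space borel. Q w \<le> a} \<in> sets borel" by simp
qed

section \<open>The quantile function at the frontier\<close>

lemma frontier_ge:
  assumes "0 \<le> y" "G y < 1" shows "y \<le> \<phi>"
  using assms G_fin unfolding frontier_point_def frontier_finite_def by (intro cSup_upper) auto

text \<open>\<open>G 0 < 1\<close> makes the set that defines the frontier nonempty. Beyond \<phi>
  no value of G is below 1, and right continuity extends this to \<phi> itself.\<close>

lemma G_ge_frontier:
  assumes ne: "G 0 < 1" and y: "\<phi> \<le> y"
  shows "G y = 1"
proof -
  have "0 \<le> \<phi>" by (rule frontier_ge[OF _ ne]) simp
  have "1 \<le> G \<phi>"
  proof (rule tendsto_lowerbound[OF G_right[OF \<open>0 \<le> \<phi>\<close>]])
    have "1 \<le> G x" if "\<phi> < x" for x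
      using frontier_ge[of x] that \<open>0 \<le> \<phi>\<close> by (cases "G x < 1") auto
    then show "\<forall>\<^sub>F x in at_right \<phi>. 1 \<le> G x" by (auto simp: eventually_at_right_field intro: gt_ex)
  qed simp
  also have "\<dots> \<le> G y" using y by (rule monoD[OF G_mono])
  finally show ?thesis using G_le1[of y] by simp
qed

lemma Q_le_frontier:
  assumes "G 0 < 1" "0 < v" "v < 1" shows "Q v \<le> \<phi>"
proof -
  have "0 \<le> \<phi>" by (rule frontier_ge[OF _ assms(1)]) simp
  then show ?thesis using Q_le_iff[OF assms(2,3), of \<phi>] G_ge_frontier[OF assms(1), of \<phi>] assms c by simp
qed

lemma Q_tendsto:
  assumes ne: "G 0 < 1"
  shows "(Q \<longlongrightarrow> \<phi>) (at_right 0)"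
proof (rule order_tendstoI)
  have Sne: "{y. 0 \<le> y \<and> G y < 1} \<noteq> {}" using ne by auto
  fix a assume a: "a < \<phi>"
  then obtain y where y: "0 \<le> y" "G y < 1" "a < y"
    using less_cSupE[OF a[unfolded frontier_point_def] Sne] by blast
  have "min 1 (c * (1 - G y)) > 0" using y c by simp
  moreover have "a < Q v" if "0 < v" "v < min 1 (c * (1 - G y))" for v
  proof -
    have "\<not> 1 - v / c \<le> G y" using that c by (simp add: field_simps)
    then have "\<not> Q v \<le> y" using Q_le_iff[of v y] that y by simp
    then show ?thesis using y by simp
  qed
  ultimately show "\<forall>\<^sub>F v in at_right 0. a < Q v" unfolding eventually_at_right_field by blast
next
  fix a assume "\<phi> < a"
  then show "\<forall>\<^sub>F v in at_right 0. Q v < a"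
    unfolding eventually_at_right_field using Q_le_frontier[OF ne] by (intro exI[of _ 1]) (auto intro: le_less_trans)
qed

text \<open>Regular variation excludes degenerate frontiers. At z = 1 it makes the quotient of the
  density by itself tend to 1, whereas 0/0 = 0; so the density cannot vanish close to the frontier,
  as it would for \<phi> \<le> 0, where G is 0 to the left. Then G(0) = 1 would make G constant on
  ]0,\<phi>[, against positivity.\<close>

lemma density_frontier_pos:
  assumes dens: "has_positive_density G"
    and RV: "regularly_varying (1 - \<rho>) (\<lambda>t. deriv G (\<phi> - 1 / t))"
  shows "0 < \<phi>" "G 0 < 1"
proof -
  have no: False if z: "\<forall>\<^sub>F t in at_top. deriv G (\<phi> - 1 / t) = 0"
  proof -
    have "((\<lambda>t. deriv G (\<phi> - 1 / (t * 1)) / deriv G (\<phi> - 1 / t)) \<longlongrightarrow> 1 powr (1 - \<rho>)) at_top"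
      using RV unfolding regularly_varying_def by (elim allE[of _ 1]) simp
    moreover have "\<forall>\<^sub>F t in at_top. deriv G (\<phi> - 1 / (t * 1)) / deriv G (\<phi> - 1 / t) = 0"
      using z by eventually_elim simp
    ultimately have "((\<lambda>t::real. 0::real) \<longlongrightarrow> 1) at_top" by (auto dest: Lim_transform_eventually)
    then show False by (simp add: tendsto_const_iff)
  qed
  show pos: "0 < \<phi>"
  proof (rule ccontr)
    assume "\<not> 0 < \<phi>"
    have d0: "deriv G y = 0" if "y < 0" for y
    proof -
      have "(G has_real_derivative 0) (at y)"
        by (rule has_field_derivative_transform_within_open[of "\<lambda>_. 0" 0 y "{..<0}"]) (use that G_neg in auto)
      then show ?thesis by (rule DERIV_imp_deriv)
    qed
    have "\<forall>\<^sub>F t in at_top. deriv G (\<phi> - 1 / t) = 0"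
      using eventually_gt_at_top[of "0::real"]
    proof eventually_elim
      case (elim t)
      have "0 < 1 / t" using elim by simp
      then have "\<phi> - 1 / t < 0" using \<open>\<not> 0 < \<phi>\<close> by linarith
      then show ?case by (rule d0)
    qed
    then show False by (rule no)
  qed
  show "G 0 < 1"
  proof (rule ccontr)
    assume "\<not> G 0 < 1"
    then have G1: "G y = 1" if "0 \<le> y" for y
      using monoD[OF G_mono that] G_le1[of y] by linarith
    have "(G has_real_derivative 0) (at (\<phi> / 2))"
      by (rule has_field_derivative_transform_within_open[of "\<lambda>_. 1" 0 _ "{0<..}"]) (use pos G1 in auto)
    then have "deriv G (\<phi> / 2) = 0" by (rule DERIV_imp_deriv)
    moreover have "0 < deriv G (\<phi> / 2)" using dens pos unfolding has_positive_density_def by auto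
    ultimately show False by simp
  qed
qed

text \<open>R(w) = 1 - G(\<phi> - w) has a regularly varying derivative, and \<phi> - Q inverts R
  near 0 up to the factor 1/c. The chord slopes of log(\<phi> - Q) follow, and its regular variation
  is the case of the two points sw and s.\<close>

lemma density_consequences:
  assumes rho: "\<rho> > 0" and dens: "has_positive_density G"
    and RV: "regularly_varying (1 - \<rho>) (\<lambda>t. deriv G (\<phi> - 1 / t))"
  shows "quantile_end Q \<phi> (1 / \<rho>)"
    and "\<And>w. 0 < w \<Longrightarrow> w < 1 \<Longrightarrow> ((\<lambda>s. (\<phi> - Q (s * w)) / (\<phi> - Q s)) \<longlongrightarrow> w powr (1 / \<rho>)) (at_right 0)"
    and "\<And>a a' F. filterlim a (at_right 0) F \<Longrightarrow> filterlim a' (at_right 0) F \<Longrightarrow>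
      ((\<lambda>z. if a z = a' z then 1 / \<rho> else (ln (\<phi> - Q (a z)) - ln (\<phi> - Q (a' z))) / (ln (a z) - ln (a' z))) \<longlongrightarrow> 1 / \<rho>) F"
proof -
  note pos = density_frontier_pos(1)[OF dens RV] and ne = density_frontier_pos(2)[OF dens RV]
  have Gm[measurable]: "G \<in> borel_measurable borel" by (rule borel_measurable_mono[OF G_mono])
  have Gd: "(G has_real_derivative deriv G y) (at y)" "0 < deriv G y" if "0 < y" "y < \<phi>" for y
    using dens that unfolding has_positive_density_def by (auto simp: DERIV_deriv_iff_real_differentiable)
  \<comment> \<open>The integral representation of G reaches up to \<phi>, hence continuity there:
    the frontier carries no atom and R vanishes at 0+.\<close>
  have cont: "continuous_on {\<phi> / 2..\<phi>} G"
  proof -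
    have hi: "(deriv G has_integral (G y - G (\<phi> / 2))) {\<phi> / 2..y}" if "\<phi> / 2 \<le> y" "y \<le> \<phi>" for y
      using dens that pos unfolding has_positive_density_def by auto
    have "continuous_on {\<phi> / 2..\<phi>} (\<lambda>y. integral {\<phi> / 2..y} (deriv G))"
      using hi[of \<phi>] pos by (intro indefinite_integral_continuous_1) auto
    then have "continuous_on {\<phi> / 2..\<phi>} (\<lambda>y. G (\<phi> / 2) + integral {\<phi> / 2..y} (deriv G))"
      by (intro continuous_intros)
    then show ?thesis
    proof (rule continuous_on_eq)
      fix y assume "y \<in> {\<phi> / 2..\<phi>}"
      then show "G (\<phi> / 2) + integral {\<phi> / 2..y} (deriv G) = G y"
        using integral_unique[OF hi[of y]] by simp
    qed
  qed
  define R where "R w = 1 - G (\<phi> - w)" for w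
  define f where "f w = deriv G (\<phi> - w)" for w
  have R0: "(R \<longlongrightarrow> 0) (at_right 0)"
  proof -
    have "(G \<longlongrightarrow> G \<phi>) (at \<phi> within {\<phi> / 2..\<phi>})" using cont pos unfolding continuous_on_def by auto
    then have "(G \<longlongrightarrow> 1) (at_left \<phi>)"
      using at_within_Icc_at_left[of "\<phi> / 2" \<phi>] pos G_ge_frontier[OF ne, of \<phi>] by simp
    then have "((\<lambda>w. G (\<phi> - w)) \<longlongrightarrow> 1) (at_right 0)"
      by (simp add: filterlim_at_left_to_right filterlim_at_right_to_0[of _ _ "- \<phi>"] algebra_simps)
    from tendsto_diff[OF tendsto_const[of 1] this] show ?thesis by (simp add: R_def[abs_def])
  qed
  interpret V: vanishing_RV_derivative R f \<phi> \<rho>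
  proof
    show "R \<in> borel_measurable borel" unfolding R_def[abs_def] by measurable
    show "(R has_real_derivative f w) (at w)" if "0 < w" "w < \<phi>" for w
    proof -
      have "(G has_real_derivative deriv G (\<phi> - w)) (at (\<phi> - w))" using that by (intro Gd) auto
      moreover have "((\<lambda>w. \<phi> - w) has_real_derivative - 1) (at w)" by (auto intro!: derivative_eq_intros)
      ultimately have "((\<lambda>w. G (\<phi> - w)) has_real_derivative deriv G (\<phi> - w) * (- 1)) (at w)"
        by (rule DERIV_chain2)
      from DERIV_diff[OF DERIV_const[of 1] this] show ?thesis by (simp add: R_def[abs_def] f_def)
    qed
    show "0 < f w" if "0 < w" "w < \<phi>" for w using that by (simp add: f_def Gd(2))
    show "((\<lambda>w. f (w * z) / f w) \<longlongrightarrow> z powr (\<rho> - 1)) (at_right 0)" if z: "z > 0" for z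
    proof -
      have "((\<lambda>t. deriv G (\<phi> - 1 / (t * (1 / z))) / deriv G (\<phi> - 1 / t)) \<longlongrightarrow> (1 / z) powr (1 - \<rho>)) at_top"
        using RV z unfolding regularly_varying_def by (elim allE[of _ "1 / z"]) simp
      moreover have "(1 / z) powr (1 - \<rho>) = z powr (\<rho> - 1)"
        using z by (simp add: powr_divide powr_minus_divide[symmetric])
      ultimately show ?thesis
        unfolding filterlim_at_right_to_top f_def by (simp add: inverse_eq_divide)
    qed
  qed (use pos rho R0 in auto)
  \<comment> \<open>Q v \<ge> \<phi> would keep G below 1 - v/c up to the frontier, so R would
    exceed v/c near 0.\<close>
  have Q_lt: "Q v < \<phi>" if v: "0 < v" "v < 1" for v
  proof (rule ccontr)
    assume "\<not> Q v < \<phi>"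
    then have lt: "G y < 1 - v / c" if "0 \<le> y" "y < \<phi>" for y
      using Q_le_iff[OF v that(1)] that by force
    have "0 < v / c" using v c by simp
    then have "\<forall>\<^sub>F w in at_right 0. R w < v / c" by (rule order_tendstoD(2)[OF R0])
    moreover have "\<forall>\<^sub>F w in at_right 0. 0 < w \<and> w < \<phi>" by (rule V.eventually_in[OF pos])
    ultimately have "\<forall>\<^sub>F w::real in at_right 0. False"
    proof eventually_elim
      case (elim w)
      then show ?case using lt[of "\<phi> - w"] by (simp add: R_def)
    qed
    then show False by simp
  qed
  show qe: "quantile_end Q \<phi> (1 / \<rho>)"
    by unfold_locales (use pos rho Q_anti Q_nonneg Q_lt Q_tendsto[OF ne] in auto)
  have Dlim: "filterlim (\<lambda>v. \<phi> - Q v) (at_right 0) (at_right 0)"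
  proof -
    have "((\<lambda>v. \<phi> - Q v) \<longlongrightarrow> 0) (at_right 0)"
      using tendsto_diff[OF tendsto_const[of \<phi>] Q_tendsto[OF ne]] by simp
    moreover have "\<forall>\<^sub>F v in at_right 0. 0 < \<phi> - Q v"
      using V.eventually_in[OF zero_less_one] by eventually_elim (use Q_lt in auto)
    ultimately show ?thesis by (auto simp: filterlim_at elim!: eventually_mono)
  qed
  \<comment> \<open>Near 0 the point Q v lies inside ]0,\<phi>[, where G is continuous, so G(Q v) =
    1 - v/c exactly; an atom at 0 does not interfere.\<close>
  have inv: "\<forall>\<^sub>F v in at_right 0. R (\<phi> - Q v) = (1 / c) * v"
  proof -
    have "\<forall>\<^sub>F v in at_right 0. 0 < Q v" by (rule order_tendstoD(1)[OF Q_tendsto[OF ne] pos])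
    then show ?thesis using V.eventually_in[OF zero_less_one]
    proof eventually_elim
      case (elim v)
      then have v: "0 < v" "v < 1" "0 < Q v" by auto
      have ge: "1 - v / c \<le> G (Q v)" using Q_le_iff[OF v(1,2), of "Q v"] v by simp
      have "isCont G (Q v)" using Gd(1)[OF v(3) Q_lt[OF v(1,2)]] by (rule DERIV_isCont)
      then have "(G \<longlongrightarrow> G (Q v)) (at_left (Q v))" unfolding isCont_def by (rule filterlim_mono[OF _ order_refl at_le]) simp
      then have "G (Q v) \<le> 1 - v / c"
      proof (rule tendsto_upperbound)
        have "G y \<le> 1 - v / c" if "0 < y" "y < Q v" for y
          using Q_le_iff[OF v(1,2), of y] that by force
        then show "\<forall>\<^sub>F y in at_left (Q v). G y \<le> 1 - v / c"
          using v(3) unfolding eventually_at_left_field by blast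
      qed simp
      with ge show ?case by (simp add: R_def)
    qed
  qed
  show slope: "((\<lambda>z. if a z = a' z then 1 / \<rho> else (ln (\<phi> - Q (a z)) - ln (\<phi> - Q (a' z))) / (ln (a z) - ln (a' z))) \<longlongrightarrow> 1 / \<rho>) F"
    if "filterlim a (at_right 0) F" "filterlim a' (at_right 0) F" for a a' F
    by (rule V.log_inverse_slope[OF Dlim inv _ that]) (use c in simp)
  show "((\<lambda>s. (\<phi> - Q (s * w)) / (\<phi> - Q s)) \<longlongrightarrow> w powr (1 / \<rho>)) (at_right 0)" if w: "0 < w" "w < 1" for w
  proof -
    have sl: "((\<lambda>s. if s * w = s then 1 / \<rho> else (ln (\<phi> - Q (s * w)) - ln (\<phi> - Q s)) / (ln (s * w) - ln s)) \<longlongrightarrow> 1 / \<rho>) (at_right 0)"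
      by (rule slope[OF V.scale_right[OF w(1)] filterlim_ident])
    have "((\<lambda>s. exp ((if s * w = s then 1 / \<rho> else (ln (\<phi> - Q (s * w)) - ln (\<phi> - Q s)) / (ln (s * w) - ln s)) * ln w)) \<longlongrightarrow> exp (1 / \<rho> * ln w)) (at_right 0)"
      by (intro tendsto_exp tendsto_mult sl tendsto_const)
    moreover have "\<forall>\<^sub>F s in at_right 0. exp ((if s * w = s then 1 / \<rho> else (ln (\<phi> - Q (s * w)) - ln (\<phi> - Q s)) / (ln (s * w) - ln s)) * ln w) = (\<phi> - Q (s * w)) / (\<phi> - Q s)"
      using V.eventually_in[OF zero_less_one]
    proof eventually_elim
      case (elim s)
      have lt: "s * w < s" using elim w by simp
      have sw: "0 < s * w" "s * w < 1" using elim w lt by (simp, linarith)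
      have D: "0 < \<phi> - Q (s * w)" "0 < \<phi> - Q s" using Q_lt[OF sw] Q_lt[of s] elim by auto
      have ls: "ln (s * w) - ln s = ln w" using elim w by (simp add: ln_mult)
      have "ln w \<noteq> 0" using w by simp
      moreover have ne: "(s * w = s) = False" using elim w by simp
      ultimately show ?case using D unfolding ne if_False ls by (simp add: exp_diff)
    qed
    ultimately show ?thesis using w by (auto simp: powr_def intro: Lim_transform_eventually)
  qed
qed

end

section \<open>The conditional sample\<close>

lemma Pi_varying_cong:
  assumes eq: "\<forall>\<^sub>F t in at_top. f t = g t" and P: "Pi_varying B f"
  shows "Pi_varying B g"
  unfolding Pi_varying_def
proof (intro allI impI)
  fix z :: real assume z: "z > 0"
  have "filterlim (\<lambda>t. t * z) at_top at_top"
    using z by (intro filterlim_at_top_mult_tendsto_pos[OF tendsto_const _ filterlim_ident])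
  then have "\<forall>\<^sub>F t in at_top. f (t * z) = g (t * z)" using eq unfolding filterlim_iff by blast
  then have "\<forall>\<^sub>F t in at_top. (f (t * z) - f t) / B t = (g (t * z) - g t) / B t"
    using eq by eventually_elim simp
  moreover have "((\<lambda>t. (f (t * z) - f t) / B t) \<longlongrightarrow> ln z) at_top" using P z unfolding Pi_varying_def by blast
  ultimately show "((\<lambda>t. (g (t * z) - g t) / B t) \<longlongrightarrow> ln z) at_top" by (blast intro: Lim_transform_eventually)
qed

text \<open>Membership in \<Pi> takes the place of a density. G(0) = 1 would give Q = 0 and H(x) =
  \<phi> e^{dx}, whose increment over 2 is 1 + e^d times the one over 1, against the limiting factor
  2. Hence H > 0 eventually, so Q < \<phi> near 0, and on all of ]0,1[ by monotonicity.\<close>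

lemma (in conditional_cdf) Pi_quantile_end:
  assumes rho: "\<rho> > 0" and s: "s = 1 \<or> s = - 1" and Bpos: "\<forall>\<^sub>F t in at_top. 0 < B t"
    and PI: "Pi_varying B (\<lambda>t. s * (t powr (1 / \<rho>) * (\<phi> - Q (1 / t))))"
  shows "quantile_end Q \<phi> (1 / \<rho>)"
proof -
  define d where "d = 1 / \<rho>"
  have d: "d > 0" using rho by (simp add: d_def)
  define H where "H x = exp x powr d * (\<phi> - Q (1 / exp x))" for x
  define b where "b x = B (exp x)" for x
  have Hm: "H \<in> borel_measurable borel" unfolding H_def[abs_def] by measurable
  have lim: "((\<lambda>x. s * (H (x + u) - H x) / b x) \<longlongrightarrow> u) at_top" for u
    using Pi_varying_exp[of B s "\<lambda>t. t powr d * (\<phi> - Q (1 / t))" u] PI by (simp add: H_def b_def d_def)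
  have ne: "G 0 < 1"
  proof (rule ccontr)
    assume "\<not> G 0 < 1"
    have Q0: "Q v = 0" if "0 < v" "v < 1" for v
    proof -
      have "0 \<le> v / c" using that c by simp
      then have "1 - v / c \<le> G 0" using \<open>\<not> G 0 < 1\<close> by linarith
      then show ?thesis using Q_le_iff[OF that order_refl] Q_nonneg[of v] by simp
    qed
    have "((\<lambda>x. (1 + exp d) * (s * (H (x + 1) - H x) / b x)) \<longlongrightarrow> (1 + exp d) * 1) at_top"
      by (intro tendsto_mult tendsto_const lim)
    moreover have "\<forall>\<^sub>F x in at_top. (1 + exp d) * (s * (H (x + 1) - H x) / b x) = s * (H (x + 2) - H x) / b x"
      using eventually_gt_at_top[of "0::real"]
    proof eventually_elim
      case (elim x)
      have H: "H y = exp (d * y) * \<phi>" if "y > 0" for y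
        using Q0[of "1 / exp y"] that by (simp add: H_def powr_def)
      have "exp (d * 2) = exp d * exp d" by (simp only: mult_2_right exp_add)
      then have "(1 + exp d) * (H (x + 1) - H x) = H (x + 2) - H x"
        using elim by (simp add: H exp_add distrib_left algebra_simps)
      then show ?case by (metis (no_types, opaque_lifting) mult.left_commute times_divide_eq_right)
    qed
    ultimately have "((\<lambda>x. s * (H (x + 2) - H x) / b x) \<longlongrightarrow> (1 + exp d) * 1) at_top"
      by (rule Lim_transform_eventually)
    then have "(1 + exp d) * 1 = (2::real)" using lim[of 2] by (intro tendsto_unique[OF _ _ lim[of 2]]) auto
    then show False using d by simp
  qed
  have "\<forall>\<^sub>F x in at_top. 0 \<le> H x"
    using eventually_gt_at_top[of 0]
  proof eventually_elim
    case (elim x)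
    then show ?case using Q_le_frontier[OF ne, of "1 / exp x"] by (simp add: H_def)
  qed
  moreover have "\<forall>\<^sub>F x in at_top. 0 < b x"
    using filterlim_iff[THEN iffD1, OF exp_at_top, rule_format, OF Bpos] by (simp add: b_def)
  ultimately have "\<forall>\<^sub>F x in at_top. 0 < H x" by (rule Pi_class_bounds(4)[OF s Hm _ _ lim])
  then obtain x0 where x0: "\<And>x. x \<ge> x0 \<Longrightarrow> 0 < H x" unfolding eventually_at_top_linorder by auto
  have Q_lt: "Q v < \<phi>" if v: "0 < v" "v < 1" for v
  proof -
    \<comment> \<open>Far enough for H y > 0 and for e^{-y} \<le> v, so that Q v \<le> Q(e^{-y}) <
      \<phi>.\<close>
    define y where "y = max (max x0 1) (- ln v)"
    have y: "y \<ge> x0" "y \<ge> 1" "- ln v \<le> y" by (auto simp: y_def)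
    have "1 / exp y \<le> v"
    proof -
      have "exp (- y) \<le> exp (ln v)" using y by simp
      then show ?thesis using v by (simp add: exp_minus inverse_eq_divide)
    qed
    then have "Q v \<le> Q (1 / exp y)"
      using monotone_onD[OF Q_anti, of "1 / exp y" v] v y by simp
    also have "\<dots> < \<phi>" using x0[OF y(1)] by (simp add: H_def zero_less_mult_iff)
    finally show ?thesis .
  qed
  have "0 < \<phi>" using Q_lt[of "1/2"] Q_nonneg[of "1/2"] by simp
  then show ?thesis
    by unfold_locales (use rho Q_anti Q_nonneg Q_lt Q_tendsto[OF ne] in auto)
qed

lemma (in prob_space) indep_vars_Suc:
  assumes "indep_vars (\<lambda>_. N) X {1..}"
  shows "indep_vars (\<lambda>_. N) (\<lambda>j. X (Suc j)) J"
  unfolding indep_vars_def2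
proof (intro conjI ballI)
  let ?F = "\<lambda>i. {X i -` A \<inter> space M |A. A \<in> sets N}"
  have I: "indep_sets ?F {1..}" and m: "\<And>i. i \<ge> 1 \<Longrightarrow> X i \<in> measurable M N"
    using assms unfolding indep_vars_def2 by auto
  show "X (Suc j) \<in> measurable M N" for j by (rule m) simp
  show "indep_sets (\<lambda>j. ?F (Suc j)) J"
  proof (rule indep_setsI)
    show "?F (Suc j) \<subseteq> events" for j using m[of "Suc j"] by (auto simp: measurable_sets)
  next
    fix A K assume K: "K \<noteq> {}" "K \<subseteq> J" "finite K" and A: "\<forall>j\<in>K. A j \<in> ?F (Suc j)"
    have "prob (\<Inter>i\<in>Suc ` K. A (i - 1)) = (\<Prod>i\<in>Suc ` K. prob (A (i - 1)))"
      by (rule indep_setsD[OF I]) (use K A in auto)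
    also have "(\<Inter>i\<in>Suc ` K. A (i - 1)) = (\<Inter>j\<in>K. A j)" by simp
    also have "(\<Prod>i\<in>Suc ` K. prob (A (i - 1))) = (\<Prod>j\<in>K. prob (A j))"
      by (subst prod.reindex) auto
    finally show "prob (\<Inter>j\<in>K. A j) = (\<Prod>j\<in>K. prob (A j))" .
  qed
qed

lemma real_distribution_normal_law: "0 < v \<Longrightarrow> real_distribution (normal_law m v)"
  unfolding normal_law_def
  by (intro real_distribution.intro prob_space_normal_density real_distribution_axioms.intro) auto

section \<open>From the sample to the uniform sequences\<close>

locale conditional_sample = prob_space M for M :: "'a measure" +
  fixes X :: "'a \<Rightarrow> real ^ 'p" and Y :: "'a \<Rightarrow> real"
    and Xs :: "nat \<Rightarrow> 'a \<Rightarrow> real ^ 'p" and Ys :: "nat \<Rightarrow> 'a \<Rightarrow> real" and x :: "real ^ 'p"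
  assumes X_meas[measurable]: "X \<in> borel_measurable M" and Y_meas[measurable]: "Y \<in> borel_measurable M"
    and Y_nonneg: "AE \<omega> in M. 0 \<le> Y \<omega>"
    and indep: "indep_vars (\<lambda>_. borel) (\<lambda>i \<omega>. (Xs i \<omega>, Ys i \<omega>)) {1..}"
    and copies: "\<And>i. 1 \<le> i \<Longrightarrow>
      distr M borel (\<lambda>\<omega>. (Xs i \<omega>, Ys i \<omega>)) = distr M borel (\<lambda>\<omega>. (X \<omega>, Y \<omega>))"
    and FX_pos: "0 < marginal_df M X x"
    and finite_frontier: "frontier_finite (cond_df M X Y x)"
begin

abbreviation G :: "real \<Rightarrow> real" where "G \<equiv> cond_df M X Y x"
abbreviation c :: real where "c \<equiv> marginal_df M X x"

text \<open>The conditional quantiles see only \<open>Y\<close> cut off to \<open>0\<close> outside \<open>{X \<le> x}\<close>, a real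
  variable.\<close>

definition cut :: "(real ^ 'p) \<times> real \<Rightarrow> real" where
  "cut p = of_bool (fst p \<le> x) * max 0 (snd p)"

text \<open>The sample is numbered from 1, the arguments of \<open>upper_os\<close> from 0.\<close>

definition Z :: "nat \<Rightarrow> 'a \<Rightarrow> real" where "Z j \<omega> = cut (Xs (Suc j) \<omega>, Ys (Suc j) \<omega>)"

lemma atMost_sets[measurable]: "Measurable.pred borel (\<lambda>a. a \<le> x)"
proof -
  have "{a. a \<le> x} \<in> sets borel" using closed_eucl_atMost[of x] by (simp add: atMost_def borel_closed)
  then show ?thesis unfolding pred_def by simp
qed

lemma cut_meas[measurable]: "cut \<in> borel_measurable borel"
  unfolding cut_def[abs_def] borel_prod[symmetric] by measurable

lemma pair_meas: "(\<lambda>\<omega>. (Xs (Suc j) \<omega>, Ys (Suc j) \<omega>)) \<in> borel_measurable M"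
  using indep unfolding indep_vars_def2 by auto

lemma X_meas_s[measurable]: "Xs (Suc j) \<in> borel_measurable M"
proof -
  have "(\<lambda>p. fst p) \<in> borel_measurable (borel :: ((real ^ 'p) \<times> real) measure)"
    unfolding borel_prod[symmetric] by measurable
  from measurable_compose[OF pair_meas this] show ?thesis by simp
qed

lemma Z_meas[measurable]: "Z j \<in> borel_measurable M"
  unfolding Z_def[abs_def] by (rule measurable_compose[OF pair_meas cut_meas])

text \<open>G inherits right continuity from the distribution function of a real variable: that of
  the cut-off variable is 1 - c(1 - G) on the nonnegative axis.\<close>

lemma conditional_cdf: "conditional_cdf G c"
  and cdf_cut: "\<And>y. cdf (distr M borel (\<lambda>\<omega>. cut (X \<omega>, Y \<omega>))) y = (if 0 \<le> y then 1 - c * (1 - G y) else 0)"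
proof -
  have [measurable]: "(\<lambda>\<omega>. cut (X \<omega>, Y \<omega>)) \<in> borel_measurable M" unfolding cut_def by simp measurable
  have J: "joint_df M X Y x y = c * G y" for y using FX_pos by (simp add: cond_df_def)
  have c1: "c \<le> 1" unfolding marginal_df_def by simp
  show cdf: "cdf (distr M borel (\<lambda>\<omega>. cut (X \<omega>, Y \<omega>))) y = (if 0 \<le> y then 1 - c * (1 - G y) else 0)" for y
  proof (cases "0 \<le> y")
    case True
    have "c = prob ({\<omega> \<in> space M. X \<omega> \<le> x \<and> Y \<omega> \<le> y} \<union> {\<omega> \<in> space M. X \<omega> \<le> x \<and> y < Y \<omega>})"
      unfolding marginal_df_def by (intro arg_cong[where f=prob]) auto
    also have "\<dots> = joint_df M X Y x y + prob {\<omega> \<in> space M. X \<omega> \<le> x \<and> y < Y \<omega>}"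
      unfolding joint_df_def by (rule finite_measure_Union) auto
    finally have p: "prob {\<omega> \<in> space M. X \<omega> \<le> x \<and> y < Y \<omega>} = c * (1 - G y)" by (simp add: J algebra_simps)
    have "cdf (distr M borel (\<lambda>\<omega>. cut (X \<omega>, Y \<omega>))) y = prob (space M - {\<omega> \<in> space M. X \<omega> \<le> x \<and> y < Y \<omega>})"
      unfolding cdf_def using True
      by (subst measure_distr) (auto simp: cut_def intro!: arg_cong[where f=prob])
    also have "\<dots> = 1 - c * (1 - G y)" by (subst prob_compl) (auto simp: p)
    finally show ?thesis using True by simp
  next
    case False
    then have "\<not> cut p \<le> y" for p by (simp add: cut_def)
    then show ?thesis unfolding cdf_def using False by (subst measure_distr) (auto simp: vimage_def)
  qed
  interpret Z: real_distribution "distr M borel (\<lambda>\<omega>. cut (X \<omega>, Y \<omega>))" by simp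
  show "conditional_cdf G c"
  proof
    show "mono G" unfolding mono_def cond_df_def joint_df_def using FX_pos
      by (auto intro!: divide_right_mono finite_measure_mono)
    show "G y \<le> 1" for y
      unfolding cond_df_def joint_df_def using FX_pos
      by (auto simp: pos_divide_le_eq) (auto simp: marginal_df_def intro!: finite_measure_mono)
    show "0 \<le> G y" for y unfolding cond_df_def joint_df_def using FX_pos by simp
    show "G y = 0" if "y < 0" for y
    proof -
      have "prob {\<omega> \<in> space M. X \<omega> \<le> x \<and> Y \<omega> \<le> y} = 0"
        using Y_nonneg that by (subst prob_eq_0) (auto elim!: eventually_mono)
      then show ?thesis by (simp add: cond_df_def joint_df_def)
    qed
    show "(G \<longlongrightarrow> G y) (at_right y)" if y: "0 \<le> y" for y
    proof -
      have Gy: "1 - (1 - cdf (distr M borel (\<lambda>\<omega>. cut (X \<omega>, Y \<omega>))) z) / c = G z" if "0 \<le> z" for z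
        using FX_pos that by (simp add: cdf)
      have "((\<lambda>z. 1 - (1 - cdf (distr M borel (\<lambda>\<omega>. cut (X \<omega>, Y \<omega>))) z) / c) \<longlongrightarrow> G y) (at_right y)"
        unfolding Gy[OF y, symmetric]
        using Z.cdf_is_right_cont[of y] FX_pos unfolding continuous_within by (intro tendsto_intros) auto
      moreover have "\<forall>\<^sub>F z in at_right y. 1 - (1 - cdf (distr M borel (\<lambda>\<omega>. cut (X \<omega>, Y \<omega>))) z) / c = G z"
        by (rule eventually_at_rightI[of _ "y + 1"]) (use y in \<open>auto intro!: Gy\<close>)
      ultimately show ?thesis by (rule Lim_transform_eventually)
    qed
    show "frontier_finite G" by (rule finite_frontier)
  qed (use FX_pos c1 in auto)
qed

sublocale conditional_cdf G c by (rule conditional_cdf)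

text \<open>Equal distribution functions: for 0 < v < 1 and y \<ge> 0, Q v > y means v < c(1 - G y),
  and c(1 - G y) is also the probability that the cut-off variable exceeds y.\<close>

lemma distr_Z: "distr M borel (Z j) = distr unif borel Q"
proof -
  have [measurable]: "(\<lambda>\<omega>. cut (X \<omega>, Y \<omega>)) \<in> borel_measurable M" unfolding cut_def by simp measurable
  have "distr M borel (Z j) = distr (distr M borel (\<lambda>\<omega>. (Xs (Suc j) \<omega>, Ys (Suc j) \<omega>))) borel cut"
    by (subst distr_distr[OF cut_meas pair_meas]) (simp add: comp_def Z_def[abs_def])
  also have "\<dots> = distr M borel (\<lambda>\<omega>. cut (X \<omega>, Y \<omega>))"
    unfolding copies[OF Suc_le_mono[THEN iffD2, OF le0, unfolded One_nat_def[symmetric]]]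
    by (subst distr_distr[OF cut_meas]) (simp_all add: comp_def)
  also have "\<dots> = distr unif borel Q"
  proof (rule cdf_unique)
    have [measurable]: "Q \<in> borel_measurable unif"
      using Q_meas by (subst measurable_cong_sets[OF sets_unif refl])
    show "real_distribution (distr M borel (\<lambda>\<omega>. cut (X \<omega>, Y \<omega>)))" by simp
    show "real_distribution (distr unif borel Q)" by (rule unif.real_distribution_distr) simp
    show "cdf (distr M borel (\<lambda>\<omega>. cut (X \<omega>, Y \<omega>))) = cdf (distr unif borel Q)"
    proof
      fix y
      have e: "cdf (distr unif borel Q) y = measure unif {v. Q v \<le> y}"
        unfolding cdf_def by (subst measure_distr) (auto simp: vimage_def)
      show "cdf (distr M borel (\<lambda>\<omega>. cut (X \<omega>, Y \<omega>))) y = cdf (distr unif borel Q) y"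
      proof (cases "0 \<le> y")
        case True
        define a where "a = c * (1 - G y)"
        have a: "0 \<le> a" "a \<le> 1" using c G_le1[of y] G_nonneg[of y] mult_le_one[of c "1 - G y"] by (auto simp: a_def)
        have iff: "y < Q v \<longleftrightarrow> v < a" if "0 < v" "v < 1" for v
        proof -
          have "1 - v / c \<le> G y \<longleftrightarrow> a \<le> v" using c by (simp add: a_def field_simps)
          then show ?thesis using Q_le_iff[OF that True] by auto
        qed
        have "{v. y < Q v} \<inter> {0<..<1} = {0<..<a}" using iff a by auto
        then have "emeasure unif {v. y < Q v} = ennreal a" using a by (subst emeasure_unif) auto
        then have m: "measure unif {v. y < Q v} = a" using a by (simp add: measure_def)
        have "measure unif {v. Q v \<le> y} = measure unif (space unif - {v. y < Q v})"
          by (intro arg_cong[where f="measure unif"]) auto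
        also have "\<dots> = 1 - a" by (subst unif.prob_compl) (auto simp: m)
        finally show ?thesis using True e by (simp add: cdf_cut a_def)
      next
        case False
        then have "\<not> Q v \<le> y" for v using Q_nonneg[of v] by linarith
        then show ?thesis using False e by (simp add: cdf_cut)
      qed
    qed
  qed
  finally show ?thesis .
qed

lemma indep_Z: "indep_vars (\<lambda>_. borel) Z J"
proof -
  have "indep_vars (\<lambda>_. borel) (\<lambda>i \<omega>. cut (Xs i \<omega>, Ys i \<omega>)) {1..}"
    using indep by (rule indep_vars_compose2) simp
  from indep_vars_Suc[OF this] show ?thesis by (simp add: Z_def[abs_def])
qed

lemma emp_marginal_nonneg: "0 \<le> emp_marginal_df Xs n \<omega> x"
  unfolding emp_marginal_df_def by (simp add: sum_nonneg)

lemma emp_marginal_meas[measurable]: "(\<lambda>\<omega>. emp_marginal_df Xs n \<omega> x) \<in> borel_measurable M"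
  unfolding emp_marginal_df_def One_nat_def sum.atLeast_Suc_atMost_Suc_shift sum.atLeast1_atMost_eq[unfolded One_nat_def]
  by measurable

text \<open>Let N count the X_j \<le> x and S(y) those among them with Y_j \<le> y. The level 1 -
  i/N is reached at y exactly when N - S(y) \<le> i, and N - S(y) counts the \<open>Z\<close> above
  y. If N = 0, division by 0 gives level 1 and empirical value 0, so the set is empty.\<close>

lemma upper_emp_quantile_eq:
  "upper_emp_quantile Xs Ys n \<omega> x i =
    (if 0 < emp_marginal_df Xs n \<omega> x then upper_os n (\<lambda>j. Z j \<omega>) i else Inf {})"
proof (cases "0 < emp_marginal_df Xs n \<omega> x")
  case True
  define N :: real where "N = (\<Sum>j<n. of_bool (Xs (Suc j) \<omega> \<le> x))"
  define S :: "real \<Rightarrow> real" where "S y = (\<Sum>j<n. of_bool (Xs (Suc j) \<omega> \<le> x \<and> Ys (Suc j) \<omega> \<le> y))" for y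
  have em: "emp_marginal_df Xs n \<omega> x = 1 / real n * N"
    unfolding emp_marginal_df_def N_def by (simp only: One_nat_def sum.atLeast1_atMost_eq)
  have ej: "emp_joint_df Xs Ys n \<omega> x y = 1 / real n * S y" for y
    unfolding emp_joint_df_def S_def by (simp only: One_nat_def sum.atLeast1_atMost_eq)
  have n: "0 < real n" using True by (cases n) (auto simp: emp_marginal_df_def)
  have N: "0 < N" using True n by (simp add: em zero_less_divide_iff)
  have "emp_level Xs n \<omega> x i \<le> emp_cond_df Xs Ys n \<omega> x y \<longleftrightarrow> card {j\<in>{..<n}. y < Z j \<omega>} \<le> i"
    if y: "0 \<le> y" for y
  proof -
    have "real (card {j\<in>{..<n}. y < Z j \<omega>}) = (\<Sum>j<n. of_bool (y < Z j \<omega>))"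
      by (simp add: sum_of_bool_eq Int_def)
    also have "\<dots> = (\<Sum>j<n. of_bool (Xs (Suc j) \<omega> \<le> x) - of_bool (Xs (Suc j) \<omega> \<le> x \<and> Ys (Suc j) \<omega> \<le> y))"
      using y by (intro sum.cong) (auto simp: Z_def cut_def)
    also have "\<dots> = N - S y" by (simp add: N_def S_def sum_subtractf)
    finally have "card {j\<in>{..<n}. y < Z j \<omega>} \<le> i \<longleftrightarrow> N - S y \<le> real i"
      by (metis of_nat_le_iff)
    moreover have "emp_cond_df Xs Ys n \<omega> x y = S y / N" using n by (simp add: emp_cond_df_def em ej)
    moreover have "emp_level Xs n \<omega> x i = 1 - real i / N" using n by (simp add: emp_level_def em)
    moreover have "1 - real i / N \<le> S y / N \<longleftrightarrow> N - S y \<le> real i"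
      using N by (simp add: diff_le_eq add_divide_distrib[symmetric] pos_le_divide_eq add.commute)
    ultimately show ?thesis by simp
  qed
  then show ?thesis using True
    unfolding upper_emp_quantile_def quantile_of_def upper_os_def
    by (auto intro!: arg_cong[where f=Inf])
next
  case False
  then have "emp_marginal_df Xs n \<omega> x = 0" using emp_marginal_nonneg[of n \<omega>] by simp
  then show ?thesis by (simp add: upper_emp_quantile_def quantile_of_def emp_cond_df_def emp_level_def)
qed

text \<open>Pair valued, so that both log-moments are components of one sum and their joint law is
  transported.\<close>

definition log_spacings :: "real \<times> real \<Rightarrow> real \<times> real" where
  "log_spacings p = (ln (snd p) - ln (fst p), (ln (snd p) - ln (fst p))\<^sup>2)"

lemma log_spacings_meas[measurable]: "log_spacings \<in> borel_measurable borel"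
  unfolding log_spacings_def[abs_def] borel_prod[symmetric] by measurable

lemma log_moment_spacings:
  "log_moment Xs Ys n k \<omega> x 1 = 1 / real k *
     fst (\<Sum>i<k. log_spacings (upper_emp_quantile Xs Ys n \<omega> x k, upper_emp_quantile Xs Ys n \<omega> x i))"
  "log_moment Xs Ys n k \<omega> x 2 = 1 / real k *
     snd (\<Sum>i<k. log_spacings (upper_emp_quantile Xs Ys n \<omega> x k, upper_emp_quantile Xs Ys n \<omega> x i))"
  by (simp_all add: log_moment_def log_spacings_def fst_sum snd_sum lessThan_atLeast0)

text \<open>For k n < n the statistic built on the order statistics of \<open>Z\<close> has exactly
  the law of its uniform counterpart, once that counterpart is the function \<open>\<tau> n\<close>
  of the representation. The sample statistic differs from it only when no X_j \<le> x, an event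
  whose probability tends to 0 by dominated convergence.\<close>

lemma converges_in_law_transfer:
  fixes \<tau> :: "nat \<Rightarrow> real \<times> real \<times> real \<Rightarrow> real"
  assumes L: "real_distribution L" and \<tau>[measurable]: "\<And>n. \<tau> n \<in> borel_measurable borel"
    and pos: "AE \<omega> in M. \<forall>\<^sub>F n in sequentially. 0 < emp_marginal_df Xs n \<omega> x"
    and k: "\<forall>\<^sub>F n in sequentially. k n < n"
    and W: "weak_conv_m (\<lambda>n. distr (unif_seq \<Otimes>\<^sub>M unif_seq) borel (\<sigma> n)) L"
    and eq: "\<forall>\<^sub>F n in sequentially. \<forall>z. \<sigma> n z = \<tau> n (Q (lower_os n (k n) (fst z)),
      \<Sum>j<k n. log_spacings (Q (lower_os n (k n) (fst z)), Q (lower_os n (k n) (fst z) * snd z j)))"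
  shows "converges_in_law M (\<lambda>n \<omega>. \<tau> n (upper_emp_quantile Xs Ys n \<omega> x (k n),
    \<Sum>i<k n. log_spacings (upper_emp_quantile Xs Ys n \<omega> x (k n), upper_emp_quantile Xs Ys n \<omega> x i))) L"
proof -
  define S where "S n \<omega> = \<tau> n (upper_os n (\<lambda>j. Z j \<omega>) (k n),
    \<Sum>i<k n. log_spacings (upper_os n (\<lambda>j. Z j \<omega>) (k n), upper_os n (\<lambda>j. Z j \<omega>) i))" for n \<omega>
  define T where "T n \<omega> = \<tau> n (upper_emp_quantile Xs Ys n \<omega> x (k n),
    \<Sum>i<k n. log_spacings (upper_emp_quantile Xs Ys n \<omega> x (k n), upper_emp_quantile Xs Ys n \<omega> x i))" for n \<omega>
  have Sm[measurable]: "S n \<in> borel_measurable M" for n unfolding S_def[abs_def] by measurable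
  have [measurable]: "(\<lambda>\<omega>. upper_emp_quantile Xs Ys n \<omega> x i) \<in> borel_measurable M" for n i
    unfolding upper_emp_quantile_eq by measurable
  have Tm[measurable]: "T n \<in> borel_measurable M" for n unfolding T_def[abs_def] by measurable
  have "\<forall>\<^sub>F n in sequentially. distr M borel (S n) = distr (unif_seq \<Otimes>\<^sub>M unif_seq) borel (\<sigma> n)"
    using k eq
  proof eventually_elim
    case (elim n)
    let ?A = "\<lambda>\<omega>. (upper_os n (\<lambda>j. Z j \<omega>) (k n),
      \<Sum>i<k n. log_spacings (upper_os n (\<lambda>j. Z j \<omega>) (k n), upper_os n (\<lambda>j. Z j \<omega>) i))"
    let ?B = "\<lambda>z. (Q (lower_os n (k n) (fst z)),
      \<Sum>j<k n. log_spacings (Q (lower_os n (k n) (fst z)), Q (lower_os n (k n) (fst z) * snd z j)))"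
    have A: "?A \<in> borel_measurable M" by measurable
    have B: "?B \<in> borel_measurable (unif_seq \<Otimes>\<^sub>M unif_seq)" by measurable
    have AB: "distr M borel ?A = distr (unif_seq \<Otimes>\<^sub>M unif_seq) borel ?B"
      using distr_upper_os_eq[OF prob_space_axioms elim(1) indep_Z distr_Z Q_anti Q_nonneg Q_meas log_spacings_meas]
      by (simp add: case_prod_beta' lower_os_def[symmetric])
    have "distr M borel (S n) = distr (distr M borel ?A) borel (\<tau> n)"
      by (subst distr_distr[OF \<tau> A]) (simp add: S_def[abs_def] comp_def)
    also have "\<dots> = distr (unif_seq \<Otimes>\<^sub>M unif_seq) borel (\<sigma> n)"
      unfolding AB by (subst distr_distr[OF \<tau> B]) (simp only: comp_def elim(2)[rule_format, symmetric])
    finally show ?case .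
  qed
  then have "\<forall>\<^sub>F n in sequentially. cdf (distr (unif_seq \<Otimes>\<^sub>M unif_seq) borel (\<sigma> n)) y = cdf (distr M borel (S n)) y" for y
    by eventually_elim simp
  then have S: "weak_conv_m (\<lambda>n. distr M borel (S n)) L"
    using W unfolding weak_conv_m_def weak_conv_def by (blast intro: Lim_transform_eventually)
  have ev: "\<forall>\<^sub>F z in whp M. 0 < emp_marginal_df Xs (fst z) (snd z) x"
  proof (rule eventually_whpI)
    show "{\<omega> \<in> space M. 0 < emp_marginal_df Xs (fst (n, \<omega>)) (snd (n, \<omega>)) x} \<in> events" for n by simp measurable
    have "(\<lambda>n. \<integral>\<omega>. indicator {\<omega> \<in> space M. \<not> 0 < emp_marginal_df Xs n \<omega> x} \<omega> \<partial>M) \<longlonglongrightarrow> (\<integral>\<omega>. (0::real) \<partial>M)"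
    proof (rule integral_dominated_convergence[where w="\<lambda>_. 1"])
      show "AE \<omega> in M. (\<lambda>n. indicator {\<omega> \<in> space M. \<not> 0 < emp_marginal_df Xs n \<omega> x} \<omega> :: real) \<longlonglongrightarrow> 0"
        using pos
      proof eventually_elim
        case (elim \<omega>)
        show ?case by (rule tendsto_eventually) (use elim in eventually_elim, simp)
      qed
    qed (auto simp: indicator_def)
    then show "(\<lambda>n. prob {\<omega> \<in> space M. \<not> 0 < emp_marginal_df Xs (fst (n, \<omega>)) (snd (n, \<omega>)) x}) \<longlonglongrightarrow> 0"
      by simp
  qed
  have "((\<lambda>z. T (fst z) (snd z) - S (fst z) (snd z)) \<longlongrightarrow> 0) (whp M)"
    by (rule tendsto_eventually, use ev in eventually_elim) (simp add: T_def S_def upper_emp_quantile_eq)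
  from weak_conv_Slutsky[OF L Sm Tm S this] show ?thesis unfolding converges_in_law_def T_def .
qed

end

theorem theorem2p7:
  fixes M :: "'a measure"
    and X :: "'a \<Rightarrow> real ^ 'p" and Y :: "'a \<Rightarrow> real"
    and Xs :: "nat \<Rightarrow> 'a \<Rightarrow> real ^ 'p" and Ys :: "nat \<Rightarrow> 'a \<Rightarrow> real"
    and x :: "real ^ 'p" and \<rho> :: real and k :: "nat \<Rightarrow> nat"
  assumes prob: "prob_space M"
    and meas_X: "X \<in> borel_measurable M" and meas_Y: "Y \<in> borel_measurable M"
    and nonneg: "AE \<omega> in M. 0 \<le> X \<omega> \<and> 0 \<le> Y \<omega>"
    and indep: "prob_space.indep_vars M (\<lambda>_. borel) (\<lambda>i \<omega>. (Xs i \<omega>, Ys i \<omega>)) {1..}"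
    and copies: "\<And>i. 1 \<le> i \<Longrightarrow>
      distr M borel (\<lambda>\<omega>. (Xs i \<omega>, Ys i \<omega>)) = distr M borel (\<lambda>\<omega>. (X \<omega>, Y \<omega>))"
    and x_nonneg: "0 \<le> x"
    and FX_pos: "0 < marginal_df M X x"
    and finite_frontier: "frontier_finite (cond_df M X Y x)"
    and rho_pos: "0 < \<rho>"
    and k_range: "\<forall>\<^sub>F n in sequentially. 0 < k n \<and> k n < n"
    and levels_pos: "AE \<omega> in M. \<forall>\<^sub>F n in sequentially.
      0 < emp_marginal_df Xs n \<omega> x \<and> 0 < emp_level Xs n \<omega> x (k n)"
  shows
    "(\<forall>p :: nat \<Rightarrow> real.
        has_positive_density (cond_df M X Y x) \<and>
        regularly_varying (1 - \<rho>)
          (\<lambda>t. deriv (cond_df M X Y x) (frontier_point (cond_df M X Y x) - 1 / t)) \<and>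
        p \<longlonglongrightarrow> 0 \<and>
        filterlim (\<lambda>n. real n * p n) at_top sequentially \<and>
        (\<forall>\<^sub>F n in sequentially. int (k n) = \<lfloor>real n * p n\<rfloor>)
        \<longrightarrow>
        converges_in_law M
          (\<lambda>n \<omega>. sqrt (real (k n)) *
            ((upper_emp_quantile Xs Ys n \<omega> x (k n)
                - quantile_of (cond_df M X Y x) (1 - p n / marginal_df M X x))
             / (log_moment Xs Ys n (k n) \<omega> x 1 * upper_emp_quantile Xs Ys n \<omega> x (k n))))
          (normal_law 0 (V4 \<rho>)))
     \<and>
     (\<forall>(B :: real \<Rightarrow> real) (s :: real) (t0 :: real).
        (s = 1 \<or> s = - 1) \<and>
        (\<forall>t > 1 / marginal_df M X x. 0 < B t) \<and>
        Pi_varying B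
          (\<lambda>t. s * (t powr (1 / \<rho>) *
             (frontier_point (cond_df M X Y x) - tail_quantile M X Y x t))) \<and>
        1 / marginal_df M X x < t0 \<and>
        (\<forall>T. bdd_above (bias_fun \<rho> (frontier_point (cond_df M X Y x)) (tail_quantile M X Y x) B ` {t0..T})) \<and>
        filterlim k at_top sequentially \<and>
        (\<lambda>n. real (k n)) \<in> o(\<lambda>n. real n /
           gen_inverse {t0..}
             (bias_fun \<rho> (frontier_point (cond_df M X Y x)) (tail_quantile M X Y x) B) (real n)) \<and>
        (\<forall>t > 1 / marginal_df M X x. tail_quantile M X Y x differentiable (at t)) \<and>
        regularly_varying (- 1 - 1 / \<rho>) (deriv (tail_quantile M X Y x))
        \<longrightarrow>
        converges_in_law M
          (\<lambda>n \<omega>. sqrt (real (k n)) *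
            ((moment_frontier Xs Ys n (k n) \<omega> x - frontier_point (cond_df M X Y x))
             / (log_moment Xs Ys n (k n) \<omega> x 1 * (1 + 1 / moment_rho Xs Ys n (k n) \<omega> x)
                  * upper_emp_quantile Xs Ys n \<omega> x (k n))))
          (normal_law 0 (V5 \<rho>)))"
proof -
  interpret prob_space M by (rule prob)
  interpret conditional_sample M X Y Xs Ys x
    by unfold_locales
      (use meas_X meas_Y nonneg indep copies FX_pos finite_frontier in \<open>auto elim: eventually_mono\<close>)
  have pos: "AE \<omega> in M. \<forall>\<^sub>F n in sequentially. 0 < emp_marginal_df Xs n \<omega> x"
    using levels_pos by eventually_elim (auto elim: eventually_mono)
  have kn: "\<forall>\<^sub>F n in sequentially. k n < n" using k_range by (auto elim: eventually_mono)
  have d: "0 < 1 / \<rho>" using rho_pos by simp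
  show ?thesis
  proof (intro conjI allI impI; (elim conjE)?)
    fix p :: "nat \<Rightarrow> real"
    assume dens: "has_positive_density G" and RV: "regularly_varying (1 - \<rho>) (\<lambda>t. deriv G (\<phi> - 1 / t))"
      and p0: "p \<longlonglongrightarrow> 0" and np: "filterlim (\<lambda>n. real n * p n) at_top sequentially"
      and kp: "\<forall>\<^sub>F n in sequentially. int (k n) = \<lfloor>real n * p n\<rfloor>"
    \<comment> \<open>An integer part lies within 1 of n p n, which is all the central limit theorem
      for u asks; it also gives that k tends to infinity.\<close>
    have near: "\<forall>\<^sub>F n in sequentially. \<bar>real n * p n - real (k n)\<bar> \<le> 1"
      using kp
    proof eventually_elim
      case (elim n)
      then have "real (k n) = real_of_int \<lfloor>real n * p n\<rfloor>" by (metis of_int_of_nat_eq)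
      then show ?case by linarith
    qed
    have "filterlim (\<lambda>n. - 1 + real n * p n) at_top sequentially"
      by (rule filterlim_tendsto_add_at_top[OF tendsto_const np])
    then have "filterlim (\<lambda>n. real (k n)) at_top sequentially"
      by (rule filterlim_at_top_mono) (use near in \<open>auto elim!: eventually_mono\<close>)
    then have k_top: "filterlim k at_top sequentially"
      unfolding filterlim_at_top
      by (intro allI) (auto dest!: spec[of _ "real _"] elim!: eventually_mono)
    note dc = density_consequences[OF rho_pos dens RV]
    interpret I: intermediate_quantile_end Q \<phi> "1 / \<rho>" k
      by (intro intermediate_quantile_end.intro intermediate_quantile_end_axioms.intro dc(1) k_top kn)
    have W: "weak_conv_m (\<lambda>n. distr (unif_seq \<Otimes>\<^sub>M unif_seq) borel
        (\<lambda>z. sqrt (k n) * ((Q (lower_os n (k n) (fst z)) - Q (p n)) / (I.L 1 n z * Q (lower_os n (k n) (fst z))))))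
      (normal_law 0 ((1 + 1 / \<rho>)\<^sup>2))"
      by (rule I.quantile_limit[OF p0 near]) (unfold I.D_def, (rule dc(2) dc(3); assumption)+)
    \<comment> \<open>\<open>Q\<close> agrees with the conditional quantile only on ]0,1[; elsewhere
      it has the default value 0.\<close>
    have p01: "\<forall>\<^sub>F n in sequentially. 0 < p n \<and> p n < 1"
    proof -
      have "\<forall>\<^sub>F n in sequentially. 0 < real n * p n" using np unfolding filterlim_at_top_dense by blast
      moreover have "\<forall>\<^sub>F n in sequentially. p n < 1" by (rule order_tendstoD(2)[OF p0]) simp
      ultimately show ?thesis by eventually_elim (auto simp: zero_less_mult_iff)
    qed
    have "converges_in_law M (\<lambda>n \<omega>. (\<lambda>y. sqrt (real (k n)) *
        ((fst y - quantile_of G (1 - p n / c)) / (1 / real (k n) * fst (snd y) * fst y)))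
        (upper_emp_quantile Xs Ys n \<omega> x (k n),
         \<Sum>i<k n. log_spacings (upper_emp_quantile Xs Ys n \<omega> x (k n), upper_emp_quantile Xs Ys n \<omega> x i)))
      (normal_law 0 ((1 + 1 / \<rho>)\<^sup>2))"
    proof (rule converges_in_law_transfer[OF _ _ pos kn W])
      show "real_distribution (normal_law 0 ((1 + 1 / \<rho>)\<^sup>2))"
        by (intro real_distribution_normal_law zero_less_power add_pos_pos zero_less_one d)
      show "(\<lambda>y :: real \<times> real \<times> real. sqrt (real (k n)) * ((fst y - quantile_of G (1 - p n / c)) /
          (1 / real (k n) * fst (snd y) * fst y))) \<in> borel_measurable borel" for n
        unfolding borel_prod[symmetric] by measurable
      show "\<forall>\<^sub>F n in sequentially. \<forall>z. sqrt (k n) * ((Q (lower_os n (k n) (fst z)) - Q (p n)) /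
            (I.L 1 n z * Q (lower_os n (k n) (fst z)))) =
          (\<lambda>y. sqrt (real (k n)) * ((fst y - quantile_of G (1 - p n / c)) / (1 / real (k n) * fst (snd y) * fst y)))
            (Q (lower_os n (k n) (fst z)),
             \<Sum>j<k n. log_spacings (Q (lower_os n (k n) (fst z)), Q (lower_os n (k n) (fst z) * snd z j)))"
        using p01
      proof eventually_elim
        case (elim n)
        then have "Q (p n) = quantile_of G (1 - p n / c)" by (simp add: Q_def)
        then show ?case by (intro allI) (simp only: I.L_def log_spacings_def fst_sum fst_conv snd_conv power_one_right)
      qed
    qed
    then show "converges_in_law M
          (\<lambda>n \<omega>. sqrt (real (k n)) *
            ((upper_emp_quantile Xs Ys n \<omega> x (k n) - quantile_of G (1 - p n / c))
             / (log_moment Xs Ys n (k n) \<omega> x 1 * upper_emp_quantile Xs Ys n \<omega> x (k n))))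
          (normal_law 0 (V4 \<rho>))"
      by (simp only: log_moment_spacings V4_def fst_conv snd_conv)
  next
    fix B :: "real \<Rightarrow> real" and s t0 :: real
    let ?U = "tail_quantile M X Y x"
    assume s: "s = 1 \<or> s = - 1" and B: "\<forall>t > 1 / c. 0 < B t"
      and PI: "Pi_varying B (\<lambda>t. s * (t powr (1 / \<rho>) * (\<phi> - ?U t)))"
      and t0: "1 / c < t0" and bdd: "\<forall>T. bdd_above (bias_fun \<rho> \<phi> ?U B ` {t0..T})"
      and k_top: "filterlim k at_top sequentially"
      and ko: "(\<lambda>n. real (k n)) \<in> o(\<lambda>n. real n / gen_inverse {t0..} (bias_fun \<rho> \<phi> ?U B) (real n))"
    have U: "?U t = Q (1 / t)" if "1 < t" for t
      using that by (simp add: tail_quantile_def Q_def)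
    \<comment> \<open>As c \<le> 1, the half-line beyond 1/c lies in t > 1, where U(t) =
      Q(1/t).\<close>
    have "1 \<le> 1 / c" using c by simp
    then have t1: "1 < t0" using t0 by linarith
    have PI': "Pi_varying B (\<lambda>t. s * (t powr (1 / \<rho>) * (\<phi> - Q (1 / t))))"
      by (rule Pi_varying_cong[OF _ PI]) (use eventually_gt_at_top[of 1] in eventually_elim, simp add: U)
    have Bpos: "\<forall>\<^sub>F t in at_top. 0 < B t"
      by (rule eventually_mono[OF eventually_gt_at_top[of "1 / c"]]) (use B in blast)
    \<comment> \<open>The double reciprocal is the \<rho> of \<open>quantile_end\<close> at \<delta>
      = 1/\<rho>.\<close>
    have bf: "bias_fun \<rho> \<phi> ?U B t = bias_fun (1 / (1 / \<rho>)) \<phi> (\<lambda>t. Q (1 / t)) B t" if "t0 \<le> t" for t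
      using that t1 by (simp add: bias_fun_def U)
    have bdd': "bdd_above (bias_fun (1 / (1 / \<rho>)) \<phi> (\<lambda>t. Q (1 / t)) B ` {t0..T})" for T
    proof -
      have "bias_fun \<rho> \<phi> ?U B ` {t0..T} = bias_fun (1 / (1 / \<rho>)) \<phi> (\<lambda>t. Q (1 / t)) B ` {t0..T}"
        by (rule image_cong[OF refl]) (rule bf, simp)
      then show ?thesis using bdd[rule_format, of T] by (simp only:)
    qed
    have gi: "gen_inverse {t0..} (bias_fun \<rho> \<phi> ?U B) y =
        gen_inverse {t0..} (bias_fun (1 / (1 / \<rho>)) \<phi> (\<lambda>t. Q (1 / t)) B) y" for y
      unfolding gen_inverse_def by (intro arg_cong[where f=Inf] Collect_cong) (auto simp only: bf atLeast_iff)
    interpret I: intermediate_quantile_end Q \<phi> "1 / \<rho>" k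
      by (intro intermediate_quantile_end.intro intermediate_quantile_end_axioms.intro
          Pi_quantile_end[OF rho_pos s Bpos PI'] k_top kn)
    note rates = I.Pi_rates[OF s Bpos PI' less_imp_le[OF t1] bdd' ko[unfolded gi]]
    note W = I.moment_limit[OF rates(4,2,3)]
    \<comment> \<open>\<open>?r\<close> is the moment estimator of \<rho> as a function of the first
      two log-moments; \<open>?\<tau>\<close> is the whole statistic as a function of the quantile
      and the pair of sums.\<close>
    let ?r = "\<lambda>a b. - inverse (a + 1 - (1/2) * inverse (1 - a\<^sup>2 / b)) :: real"
    let ?\<tau> = "\<lambda>n y. sqrt (real (k n)) *
      ((fst y * (1 + 1 / real (k n) * fst (snd y) * (1 + ?r (1 / real (k n) * fst (snd y)) (1 / real (k n) * snd (snd y)))) - \<phi>) /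
       (1 / real (k n) * fst (snd y) * (1 + 1 / ?r (1 / real (k n) * fst (snd y)) (1 / real (k n) * snd (snd y))) * fst y))"
    have "converges_in_law M (\<lambda>n \<omega>. ?\<tau> n
        (upper_emp_quantile Xs Ys n \<omega> x (k n),
         \<Sum>i<k n. log_spacings (upper_emp_quantile Xs Ys n \<omega> x (k n), upper_emp_quantile Xs Ys n \<omega> x i)))
      (normal_law 0 (V5 (1 / (1 / \<rho>))))"
    proof (rule converges_in_law_transfer[OF _ _ pos kn W])
      show "real_distribution (normal_law 0 (V5 (1 / (1 / \<rho>))))"
        by (rule real_distribution_normal_law) (use V5_pos[of \<rho>] rho_pos in simp)
      show "?\<tau> n \<in> borel_measurable borel" for n
        unfolding borel_prod[symmetric] by measurable
    qed (intro always_eventually allI, simp only: I.L_def log_spacings_def fst_sum snd_sum fst_conv snd_conv power_one_right)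
    then show "converges_in_law M
          (\<lambda>n \<omega>. sqrt (real (k n)) *
            ((moment_frontier Xs Ys n (k n) \<omega> x - \<phi>)
             / (log_moment Xs Ys n (k n) \<omega> x 1 * (1 + 1 / moment_rho Xs Ys n (k n) \<omega> x)
                  * upper_emp_quantile Xs Ys n \<omega> x (k n))))
          (normal_law 0 (V5 \<rho>))"
      by (simp only: moment_frontier_def moment_rho_def log_moment_spacings fst_conv snd_conv divide_divide_eq_right mult_1 div_by_1)
  qed
qed

end
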